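(* Let $S\subset\mathbb{R}^m$ be a $1$-dimensional semialgebraic set. Then the following assertions are equivalent: (i) $S$ is a regular image of $\mathbb{R}^n$ for some $n\geq 1$. (ii) $S$ is irreducible and $\operatorname{Cl}^{\mathrm{zar}}_{\mathbb{R}\mathbb{P}^m}(S)$ is a rational curve. In particular, if that is the case, then $\mathrm{r}(S)\leq 2$.
   Context: A map $f=(f_1,\dots,f_m):\mathbb{R}^n\to\mathbb{R}^m$ is regular if each $f_i=g_i/h_i$ is a quotient of polynomials $g_i,h_i\in\mathbb{R}[x_1,\dots,x_n]$ such that the zero set of $h_i$ in $\mathbb{R}^n$ is empty. A set $S\subset\mathbb{R}^m$ is a regular image of $\mathbb{R}^n$ if $S=f(\mathbb{R}^n)$ for some regular map $f:\mathbb{R}^n\to\mathbb{R}^m$. The invariant $\mathrm{r}(S)$ is the least $r\geq1$ such that $S$ is a regular image of $\mathbb{R}^r$, and $+\infty$ if there is no such $r$. Irreducibility of semialgebraic sets: a Nash function on an open semialgebraic set $U\subset\mathbb{R}^m$ is a (real) analytic function $f$ on $U$ satisfying a nontrivial polynomial equation, i.e. there is a nonzero polynomial $P\in\mathbb{R}[x_1,\dots,x_m,y]$ with $P(x,f(x))=0$ for all $x\in U$. The ring $\mathcal{N}(S)$ of Nash functions on a semialgebraic set $S\subset\mathbb{R}^m$ consists of all functions on $S$ admitting a Nash extension to some open semialgebraic neighborhood of $S$ in $\mathbb{R}^m$, with the usual sum and product. The semialgebraic set $S$ is irreducible if $\mathcal{N}(S)$ is an integral domain. Projective notation: $\mathbb{R}^m\subset\mathbb{R}\mathbb{P}^m$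 is identified with $\{x_0=1\}=\mathbb{R}\mathbb{P}^m\setminus\{x_0=0\}$, and $\operatorname{Cl}^{\mathrm{zar}}_{\mathbb{R}\mathbb{P}^m}(S)$ is the Zariski closure of $S$ in $\mathbb{R}\mathbb{P}^m$. A (real) rational curve is a real projective irreducible curve $C$ such that $C_{(1)}$ is the image of $\mathbb{R}\mathbb{P}^1$ under a birational (and hence regular) map, where $C_{(1)}$ denotes the set of points of $C$ at which $C$ has local dimension $1$. *)

theory Defs
  imports
    "HOL-Analysis.Analysis"
    "HOL-Library.Poly_Mapping"
    "HOL-Library.Extended_Nat"
    "HOL-Algebra.Ring"
begin

section \<open>Real polynomials in several variables\<close>

text \<open>
  Exponent vectors are finitely supported maps from the variables to the naturals, and
  polynomials are finitely supported maps from exponent vectors to coefficients; the ring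
  operations are those of the theory of finitely supported maps (convolution product).
\<close>

type_synonym 'v rpoly = "('v \<Rightarrow>\<^sub>0 nat) \<Rightarrow>\<^sub>0 real"

definition monom_eval :: "('v \<Rightarrow>\<^sub>0 nat) \<Rightarrow> ('v \<Rightarrow> real) \<Rightarrow> real" where
  "monom_eval \<alpha> x = (\<Prod>v\<in>Poly_Mapping.keys \<alpha>. x v ^ Poly_Mapping.lookup \<alpha> v)"

definition poly_eval :: "'v rpoly \<Rightarrow> ('v \<Rightarrow> real) \<Rightarrow> real" where
  "poly_eval p x = (\<Sum>\<alpha>\<in>Poly_Mapping.keys p. Poly_Mapping.lookup p \<alpha> * monom_eval \<alpha> x)"

definition poly_vars :: "'v rpoly \<Rightarrow> 'v set" where
  "poly_vars p = (\<Union>\<alpha>\<in>Poly_Mapping.keys p. Poly_Mapping.keys \<alpha>)"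

text \<open>The zero polynomial is homogeneous of every degree.\<close>

definition homogeneous :: "nat \<Rightarrow> 'v rpoly \<Rightarrow> bool" where
  "homogeneous d p \<longleftrightarrow>
     (\<forall>\<alpha>\<in>Poly_Mapping.keys p. (\<Sum>v\<in>Poly_Mapping.keys \<alpha>. Poly_Mapping.lookup \<alpha> v) = d)"


section \<open>Regular images of Euclidean spaces\<close>

text \<open>
  The dimension of the source is quantified over, so its points are sequences vanishing from
  index \<open>n\<close> on; the target is the type \<open>real ^ 'm\<close>.
\<close>

definition Rn :: "nat \<Rightarrow> (nat \<Rightarrow> real) set" where
  "Rn n = {x. \<forall>i\<ge>n. x i = 0}"

definition regular_map :: "nat \<Rightarrow> ((nat \<Rightarrow> real) \<Rightarrow> real ^ 'm) \<Rightarrow> bool" where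
  "regular_map n f \<longleftrightarrow>
     (\<forall>i. \<exists>g h. poly_vars g \<subseteq> {..<n} \<and> poly_vars h \<subseteq> {..<n} \<and>
        (\<forall>x\<in>Rn n. poly_eval h x \<noteq> 0) \<and>
        (\<forall>x\<in>Rn n. f x $ i = poly_eval g x / poly_eval h x))"

definition regular_image :: "nat \<Rightarrow> (real ^ 'm) set \<Rightarrow> bool" where
  "regular_image n S \<longleftrightarrow> (\<exists>f. regular_map n f \<and> S = f ` Rn n)"

text \<open>The infimum of the empty set of extended naturals is \<open>\<infinity>\<close>.\<close>

definition r_inv :: "(real ^ 'm) set \<Rightarrow> enat" where
  "r_inv S = Inf {enat r | r. 1 \<le> r \<and> regular_image r S}"


section \<open>Semialgebraic sets and Nash functions\<close>

inductive semialgebraic :: "(real ^ 'm) set \<Rightarrow> bool" where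
  eq: "semialgebraic {x. poly_eval p (($) x) = 0}"
| gt: "semialgebraic {x. poly_eval p (($) x) > 0}"
| compl: "semialgebraic A \<Longrightarrow> semialgebraic (- A)"
| union: "semialgebraic A \<Longrightarrow> semialgebraic B \<Longrightarrow> semialgebraic (A \<union> B)"

definition real_analytic_on :: "(real ^ 'm) set \<Rightarrow> (real ^ 'm \<Rightarrow> real) \<Rightarrow> bool" where
  "real_analytic_on U f \<longleftrightarrow>
     (\<forall>a\<in>U. \<exists>(c :: ('m \<Rightarrow>\<^sub>0 nat) \<Rightarrow> real) \<epsilon>. \<epsilon> > 0 \<and>
        (\<forall>x\<in>ball a \<epsilon>. ((\<lambda>\<alpha>. c \<alpha> * monom_eval \<alpha> (($) (x - a))) has_sum f x) UNIV))"

text \<open>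
  The index type \<open>'m option\<close> adds one variable to \<open>x\<^sub>i\<close> (\<open>i :: 'm\<close>): here \<open>None\<close> is the variable
  \<open>y\<close> of the polynomial equation; below it is the homogenizing variable \<open>x\<^sub>0\<close>.
\<close>

definition nash_on :: "(real ^ 'm) set \<Rightarrow> (real ^ 'm \<Rightarrow> real) \<Rightarrow> bool" where
  "nash_on U f \<longleftrightarrow> open U \<and> semialgebraic U \<and> real_analytic_on U f \<and>
     (\<exists>P :: 'm option rpoly. P \<noteq> 0 \<and> (\<forall>x\<in>U. poly_eval P (case_option (f x) (($) x)) = 0))"

definition nash_ring :: "(real ^ 'm) set \<Rightarrow> (real ^ 'm \<Rightarrow> real) ring" where
  "nash_ring S =
    \<lparr> carrier = {f \<in> extensional S. \<exists>U g. S \<subseteq> U \<and> nash_on U g \<and> (\<forall>x\<in>S. f x = g x)},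
      mult = (\<lambda>f g. restrict (\<lambda>x. f x * g x) S),
      one = restrict (\<lambda>x. 1) S,
      zero = restrict (\<lambda>x. 0) S,
      add = (\<lambda>f g. restrict (\<lambda>x. f x + g x) S) \<rparr>"

definition semialgebraic_irreducible :: "(real ^ 'm) set \<Rightarrow> bool" where
  "semialgebraic_irreducible S \<longleftrightarrow> domain (nash_ring S)"


section \<open>Dimension\<close>

text \<open>
  The definitions of this section are relative to a predicate \<open>Zcl\<close> singling out the Zariski closed
  subsets, so that they serve both for affine and for projective space; \<open>Zcl hull A\<close> is the
  Zariski closure of \<open>A\<close>.
\<close>

definition zariski_irreducible :: "('a set \<Rightarrow> bool) \<Rightarrow> 'a set \<Rightarrow> bool" where
  "zariski_irreducible Zcl Z \<longleftrightarrow> Zcl Z \<and> Z \<noteq> {} \<and>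
     (\<forall>A B. Zcl A \<and> Zcl B \<and> Z = A \<union> B \<longrightarrow> Z = A \<or> Z = B)"

text \<open>
  The supremum of the lengths of chains of irreducible Zariski closed subsets of the Zariski
  closure. The empty set gets dimension \<open>0\<close>; only the value \<open>1\<close> matters here.
\<close>

definition zariski_dim :: "('a set \<Rightarrow> bool) \<Rightarrow> 'a set \<Rightarrow> enat" where
  "zariski_dim Zcl A =
     Sup {enat n | n. \<exists>Z. (\<forall>i\<le>n. zariski_irreducible Zcl (Z i) \<and> Z i \<subseteq> Zcl hull A) \<and>
                         (\<forall>i<n. Z i \<subset> Z (Suc i))}"

definition affine_algebraic :: "(real ^ 'm) set \<Rightarrow> bool" where
  "affine_algebraic Z \<longleftrightarrow> (\<exists>P. Z = {x. \<forall>p\<in>P. poly_eval p (($) x) = 0})"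

definition dim_affine :: "(real ^ 'm) set \<Rightarrow> enat" where
  "dim_affine S = zariski_dim affine_algebraic S"


section \<open>Real projective space\<close>

definition proj_rel :: "real ^ 'k \<Rightarrow> real ^ 'k \<Rightarrow> bool" where
  "proj_rel v w \<longleftrightarrow> v \<noteq> 0 \<and> (\<exists>c. c \<noteq> 0 \<and> w = c *\<^sub>R v)"

text \<open>
  \<open>'k proj\<close> is the space of lines through the origin of \<open>real ^ 'k\<close>: so \<open>'m option proj\<close> is the
  projective space containing \<open>real ^ 'm\<close>, and \<open>2 proj\<close> is the projective line.
\<close>

quotient_type 'k proj = "real ^ ('k :: finite)" / partial: proj_rel
proof (rule part_equivpI)
  show "\<exists>v :: real ^ 'k. proj_rel v v"
    by (rule exI[of _ 1]) (auto simp: proj_rel_def vec_eq_iff intro!: exI[of _ 1])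
  show "symp (proj_rel :: real ^ 'k \<Rightarrow> _)"
  proof (rule sympI)
    fix v w :: "real ^ 'k"
    assume "proj_rel v w"
    then obtain c where "v \<noteq> 0" "c \<noteq> 0" "w = c *\<^sub>R v"
      by (auto simp: proj_rel_def)
    then show "proj_rel w v"
      by (auto simp: proj_rel_def intro!: exI[of _ "inverse c"])
  qed
  show "transp (proj_rel :: real ^ 'k \<Rightarrow> _)"
  proof (rule transpI)
    fix u v w :: "real ^ 'k"
    assume "proj_rel u v" "proj_rel v w"
    then obtain c d where "u \<noteq> 0" "c \<noteq> 0" "v = c *\<^sub>R u" "d \<noteq> 0" "w = d *\<^sub>R v"
      by (auto simp: proj_rel_def)
    then show "proj_rel u w"
      by (auto simp: proj_rel_def intro!: exI[of _ "d * c"])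
  qed
qed

text \<open>
  \<open>rep_proj\<close> selects some vector of homogeneous coordinates. It is only used to evaluate
  homogeneous polynomials, where the vanishing, and the ratios of values in a common degree,
  do not depend on the selection.
\<close>

definition hcoords :: "('k :: finite) proj \<Rightarrow> 'k \<Rightarrow> real" where
  "hcoords p = ($) (rep_proj p)"

definition proj_algebraic :: "('k :: finite) proj set \<Rightarrow> bool" where
  "proj_algebraic Z \<longleftrightarrow>
     (\<exists>P. (\<forall>p\<in>P. \<exists>d. homogeneous d p) \<and> Z = {x. \<forall>p\<in>P. poly_eval p (hcoords x) = 0})"

definition proj_open :: "('k :: finite) proj set \<Rightarrow> bool" where
  "proj_open W \<longleftrightarrow> open {v. v \<noteq> 0 \<and> abs_proj v \<in> W}"

definition affine_to_proj :: "real ^ 'm \<Rightarrow> 'm option proj" where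
  "affine_to_proj x = abs_proj (\<chi> k. case_option 1 (($) x) k)"

definition Cl_zar_proj :: "(real ^ 'm) set \<Rightarrow> 'm option proj set" where
  "Cl_zar_proj S = proj_algebraic hull (affine_to_proj ` S)"

text \<open>The dimension at \<open>x\<close> is that of the intersection with all small enough Euclidean
  neighbourhoods of \<open>x\<close>, that is, the least one.\<close>

definition proj_local_dim :: "('k :: finite) proj set \<Rightarrow> 'k proj \<Rightarrow> enat" where
  "proj_local_dim C x = (INF W\<in>{W. proj_open W \<and> x \<in> W}. zariski_dim proj_algebraic (C \<inter> W))"

definition one_dim_part :: "('k :: finite) proj set \<Rightarrow> 'k proj set" where
  "one_dim_part C = {x \<in> C. proj_local_dim C x = 1}"


section \<open>Rational curves\<close>

definition proj_regular_on :: "('j :: finite) proj set \<Rightarrow> ('j proj \<Rightarrow> ('k :: finite) proj) \<Rightarrow> bool" where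
  "proj_regular_on X f \<longleftrightarrow>
     (\<forall>x\<in>X. \<exists>W d F. proj_algebraic (- W) \<and> x \<in> W \<and> (\<forall>k. homogeneous d (F k)) \<and>
        (\<forall>z\<in>X \<inter> W. (\<exists>k. poly_eval (F k) (hcoords z) \<noteq> 0) \<and>
                     f z = abs_proj (\<chi> k. poly_eval (F k) (hcoords z))))"

text \<open>
  An everywhere defined regular map that is birational: it restricts to an isomorphism between
  nonempty Zariski open subsets. As every rational map from the projective line to a projective
  set extends to a regular one, this covers all birational maps from the projective line.
\<close>

definition birational_map ::
  "('j :: finite) proj set \<Rightarrow> ('k :: finite) proj set \<Rightarrow> ('j proj \<Rightarrow> 'k proj) \<Rightarrow> bool" where
  "birational_map X Y f \<longleftrightarrow> proj_regular_on X f \<and> f ` X \<subseteq> Y \<and>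
     (\<exists>U V g. proj_algebraic (- U) \<and> proj_algebraic (- V) \<and> X \<inter> U \<noteq> {} \<and> Y \<inter> V \<noteq> {} \<and>
        f ` (X \<inter> U) = Y \<inter> V \<and> proj_regular_on (Y \<inter> V) g \<and> (\<forall>x\<in>X \<inter> U. g (f x) = x))"

definition projective_irreducible_curve :: "('k :: finite) proj set \<Rightarrow> bool" where
  "projective_irreducible_curve C \<longleftrightarrow>
     zariski_irreducible proj_algebraic C \<and> zariski_dim proj_algebraic C = 1"

definition rational_curve :: "('k :: finite) proj set \<Rightarrow> bool" where
  "rational_curve C \<longleftrightarrow> projective_irreducible_curve C \<and>
     (\<exists>f :: 2 proj \<Rightarrow> 'k proj. birational_map UNIV C f \<and> f ` UNIV = one_dim_part C)"

end

theory Submission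
  imports
    Defs
    "HOL-Complex_Analysis.Complex_Analysis"
    "HOL-Computational_Algebra.Computational_Algebra"
    "HOL-Computational_Algebra.Field_as_Ring"
    "Jordan_Normal_Form.Determinant"
begin

text \<open>
  From a regular image to a rational curve: a line in \<open>\<real>\<^sup>n\<close> through two points with distinct images
  parametrizes the Zariski closure of \<open>S\<close> by polynomials of one variable, and Lueroth's theorem
  replaces this parametrization by a birational one. A Nash function pulled back to such lines is
  analytic on \<open>\<real>\<close>, so that it has isolated zeros: there are no zero divisors.

  Conversely, let \<open>\<Phi>\<close> be a birational parametrization of the curve by binary forms, and let \<open>T\<close> be the
  set of parameters of the points of \<open>S\<close>. An irreducible \<open>S\<close> has no isolated points, so the
  points outside the image of \<open>\<Phi>\<close> do not matter. If all parameters belong to \<open>T\<close>, then \<open>S\<close> is the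
  image of the circle. Otherwise we may assume that \<open>\<infinity>\<close> is missing; the point is
  that for any other missing parameter \<open>\<beta>\<close> (say \<open>\<beta> = 0\<close>) one side of \<open>\<beta>\<close> meets \<open>T\<close> in a finite set.
  The quotients of polynomials whose denominators are positive on \<open>S\<close> and which have a
  pole at a missing point show that \<open>t\<close> and \<open>1/t\<close> are integral over the ring of all quotients of
  polynomials with denominators positive on \<open>S\<close>. So this ring contains \<open>\<eta> \<real>[t]\<close> for some \<open>\<eta>\<close> with
  \<open>\<eta>(0) \<noteq> 0\<close>, hence the square of a polynomial \<open>\<psi>\<close> with the sign of \<open>t\<close>. As \<open>\<psi>\<close> is a quotient
  \<open>Q/E\<close> on \<open>S\<close> as well, \<open>(Q - E \<surd>\<psi>\<^sup>2) (Q + E \<surd>\<psi>\<^sup>2) = 0\<close> in the domain of Nash functions, and \<open>\<psi>\<close> has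
  constant sign up to finitely many points. Thus \<open>T\<close> is an interval up to finitely many points, and
  every interval is the image of the plane under a quotient of polynomials.
\<close>

no_notation Matrix.vec_index (infixl "$" 100)
no_notation fps_nth (infixl "$" 75)
hide_const (open) Module.smult
hide_fact (open) Matrix.vec_eq_iff

section \<open>Polynomial functions\<close>

text \<open>The obstacle is the singularities of the curve: there a polynomial in t need not be a
  quotient of ambient polynomials with denominator positive on S, and the rational inverse of the
  parametrization may degenerate to 0/0. So t itself cannot be used to test the sign of t; only
  multiples of \<open>\<eta>\<close> are known to descend. A polynomial with the sign of t and with
  square 1 modulo \<open>\<eta>\<close> is therefore sought in the form t (v^2 +
  \<open>\<eta>\<close>^2), whose second factor is a sum of squares. Its square is t^2 v^4 modulo
  \<open>\<eta>\<close>, so v has to be a fourth root of 1/t^2. The exponents matter: 1/t has no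
  real square root at a negative root of \<open>\<eta>\<close>, whereas 1/t^2 has a real fourth root
  at every real root except 0. Hence \<open>\<eta>\<close>(0) must not vanish, and this is where the
  integrality of 1/t enters: powers of 1/t cancel the zero at 0 which the denominator for t may
  have. The plane cannot be replaced by the line in general, since a quotient of polynomials without
  poles on the line never has an open half-line as image: being positive and unbounded, it tends to
  infinity at both ends and attains its minimum.\<close>

lemma monom_eval_superset:
  assumes "finite A" "Poly_Mapping.keys \<alpha> \<subseteq> A"
  shows "monom_eval \<alpha> x = (\<Prod>v\<in>A. x v ^ Poly_Mapping.lookup \<alpha> v)"
  unfolding monom_eval_def
  by (rule prod.mono_neutral_left) (use assms in \<open>auto simp: in_keys_iff\<close>)

lemma poly_eval_superset:
  assumes "finite A" "Poly_Mapping.keys p \<subseteq> A"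
  shows "poly_eval p x = (\<Sum>\<alpha>\<in>A. Poly_Mapping.lookup p \<alpha> * monom_eval \<alpha> x)"
  unfolding poly_eval_def
  by (rule sum.mono_neutral_left) (use assms in \<open>auto simp: in_keys_iff\<close>)

lemma monom_eval_0 [simp]: "monom_eval 0 x = 1"
  by (simp add: monom_eval_def)

lemma monom_eval_single [simp]: "monom_eval (Poly_Mapping.single v n) x = x v ^ n"
  by (cases "n = 0") (auto simp: monom_eval_def)

lemma monom_eval_add: "monom_eval (\<alpha> + \<beta>) x = monom_eval \<alpha> x * monom_eval \<beta> x"
proof -
  let ?A = "Poly_Mapping.keys \<alpha> \<union> Poly_Mapping.keys \<beta>"
  have "monom_eval (\<alpha> + \<beta>) x = (\<Prod>v\<in>?A. x v ^ Poly_Mapping.lookup (\<alpha> + \<beta>) v)"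
    by (rule monom_eval_superset) (auto simp: in_keys_iff lookup_add)
  also have "\<dots> = (\<Prod>v\<in>?A. x v ^ Poly_Mapping.lookup \<alpha> v) * (\<Prod>v\<in>?A. x v ^ Poly_Mapping.lookup \<beta> v)"
    by (simp add: lookup_add power_add prod.distrib)
  also have "\<dots> = monom_eval \<alpha> x * monom_eval \<beta> x"
    by (simp add: monom_eval_superset[of ?A])
  finally show ?thesis .
qed

lemma poly_eval_0 [simp]: "poly_eval 0 x = 0"
  by (simp add: poly_eval_def)

lemma poly_eval_single [simp]: "poly_eval (Poly_Mapping.single \<alpha> c) x = c * monom_eval \<alpha> x"
  by (cases "c = 0") (auto simp: poly_eval_def)

lemma poly_eval_add: "poly_eval (p + q) x = poly_eval p x + poly_eval q x"
proof -
  let ?A = "Poly_Mapping.keys p \<union> Poly_Mapping.keys q"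
  have "poly_eval (p + q) x = (\<Sum>\<alpha>\<in>?A. Poly_Mapping.lookup (p + q) \<alpha> * monom_eval \<alpha> x)"
    by (rule poly_eval_superset) (auto simp: in_keys_iff lookup_add)
  also have "\<dots> = poly_eval p x + poly_eval q x"
    by (simp add: lookup_add distrib_right sum.distrib poly_eval_superset[of ?A])
  finally show ?thesis .
qed

lemma poly_eval_sum: "poly_eval (sum f I) x = (\<Sum>i\<in>I. poly_eval (f i) x)"
  by (induction I rule: infinite_finite_induct) (auto simp: poly_eval_add)

lemma poly_mapping_sum_singles:
  "p = (\<Sum>\<alpha>\<in>Poly_Mapping.keys p. Poly_Mapping.single \<alpha> (Poly_Mapping.lookup p \<alpha>))"
proof (rule poly_mapping_eqI)
  fix k
  show "Poly_Mapping.lookup p k = Poly_Mapping.lookup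
    (\<Sum>\<alpha>\<in>Poly_Mapping.keys p. Poly_Mapping.single \<alpha> (Poly_Mapping.lookup p \<alpha>)) k"
    by (auto simp: lookup_sum lookup_single when_def in_keys_iff)
qed

text \<open>Expansion into single terms reduces both the evaluation and the norm of a product to the
  case of two monomials.\<close>

lemma mult_eq_sum_singles:
  fixes p q :: "'v rpoly"
  shows "p * q = (\<Sum>\<alpha>\<in>Poly_Mapping.keys p. \<Sum>\<beta>\<in>Poly_Mapping.keys q.
    Poly_Mapping.single (\<alpha> + \<beta>) (Poly_Mapping.lookup p \<alpha> * Poly_Mapping.lookup q \<beta>))"
proof -
  have "p * q = (\<Sum>\<alpha>\<in>Poly_Mapping.keys p. Poly_Mapping.single \<alpha> (Poly_Mapping.lookup p \<alpha>)) *
     (\<Sum>\<alpha>\<in>Poly_Mapping.keys q. Poly_Mapping.single \<alpha> (Poly_Mapping.lookup q \<alpha>))"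
    using poly_mapping_sum_singles[of p] poly_mapping_sum_singles[of q] by simp
  then show ?thesis
    by (simp add: sum_product mult_single)
qed

lemma poly_eval_mult: "poly_eval (p * q) x = poly_eval p x * poly_eval q x"
  by (simp add: mult_eq_sum_singles poly_eval_sum monom_eval_add poly_eval_def[of p] poly_eval_def[of q]
      sum_product algebra_simps)

text \<open>Working with functions instead of polynomials turns substitution into composition.\<close>

definition polyfun :: "'v set \<Rightarrow> (('v \<Rightarrow> real) \<Rightarrow> real) \<Rightarrow> bool" where
  "polyfun V f \<longleftrightarrow> (\<exists>p. poly_vars p \<subseteq> V \<and> (\<forall>x. f x = poly_eval p x))"

definition form :: "nat \<Rightarrow> (('v \<Rightarrow> real) \<Rightarrow> real) \<Rightarrow> bool" where
  "form d f \<longleftrightarrow> (\<exists>p. homogeneous d p \<and> (\<forall>x. f x = poly_eval p x))"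

lemma keys_nat_add:
  fixes \<alpha> \<beta> :: "'v \<Rightarrow>\<^sub>0 nat"
  shows "Poly_Mapping.keys (\<alpha> + \<beta>) = Poly_Mapping.keys \<alpha> \<union> Poly_Mapping.keys \<beta>"
  by (auto simp: in_keys_iff lookup_add)

lemma polyfun_UNIV_poly_eval: "polyfun UNIV (poly_eval p)"
  unfolding polyfun_def by blast

lemma polyfun_add: "polyfun V f \<Longrightarrow> polyfun V g \<Longrightarrow> polyfun V (\<lambda>x. f x + g x)"
  unfolding polyfun_def
proof safe
  fix p q assume *: "poly_vars p \<subseteq> V" "poly_vars q \<subseteq> V" "\<forall>x. f x = poly_eval p x" "\<forall>x. g x = poly_eval q x"
  have "poly_vars (p + q) \<subseteq> V"
    using *(1,2) Poly_Mapping.keys_add[of p q] unfolding poly_vars_def by blast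
  then show "\<exists>r. poly_vars r \<subseteq> V \<and> (\<forall>x. f x + g x = poly_eval r x)"
    using * by (intro exI[of _ "p + q"]) (simp add: poly_eval_add)
qed

lemma polyfun_mult: "polyfun V f \<Longrightarrow> polyfun V g \<Longrightarrow> polyfun V (\<lambda>x. f x * g x)"
  unfolding polyfun_def
proof safe
  fix p q assume *: "poly_vars p \<subseteq> V" "poly_vars q \<subseteq> V" "\<forall>x. f x = poly_eval p x" "\<forall>x. g x = poly_eval q x"
  have "poly_vars (p * q) \<subseteq> V"
    unfolding poly_vars_def
  proof (rule UN_least)
    fix \<gamma> assume "\<gamma> \<in> Poly_Mapping.keys (p * q)"
    then obtain \<alpha> \<beta> where "\<alpha> \<in> Poly_Mapping.keys p" "\<beta> \<in> Poly_Mapping.keys q" "\<gamma> = \<alpha> + \<beta>"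
      using Poly_Mapping.keys_mult[of p q] by blast
    then show "Poly_Mapping.keys \<gamma> \<subseteq> V"
      using *(1,2) unfolding poly_vars_def keys_nat_add by (auto simp: keys_nat_add)
  qed
  then show "\<exists>r. poly_vars r \<subseteq> V \<and> (\<forall>x. f x * g x = poly_eval r x)"
    using * by (intro exI[of _ "p * q"]) (auto simp: poly_eval_mult)
qed

lemma polyfun_const [simp]: "polyfun V (\<lambda>x. c)"
  unfolding polyfun_def
  by (rule exI[of _ "Poly_Mapping.single 0 c"]) (auto simp: poly_vars_def split: if_splits)

lemma polyfun_var: "v \<in> V \<Longrightarrow> polyfun V (\<lambda>x. x v)"
  unfolding polyfun_def
  by (rule exI[of _ "Poly_Mapping.single (Poly_Mapping.single v 1) 1"]) (auto simp: poly_vars_def)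

lemma polyfun_uminus: "polyfun V f \<Longrightarrow> polyfun V (\<lambda>x. - f x)"
  using polyfun_mult[OF polyfun_const[of V "-1"], of f] by simp

lemma polyfun_diff: "polyfun V f \<Longrightarrow> polyfun V g \<Longrightarrow> polyfun V (\<lambda>x. f x - g x)"
  using polyfun_add[OF _ polyfun_uminus, of V f g] by simp

lemma polyfun_power: "polyfun V f \<Longrightarrow> polyfun V (\<lambda>x. f x ^ n)"
  by (induction n) (auto intro: polyfun_mult)

lemma polyfun_sum: "(\<And>i. i \<in> I \<Longrightarrow> polyfun V (f i)) \<Longrightarrow> polyfun V (\<lambda>x. \<Sum>i\<in>I. f i x)"
  by (induction I rule: infinite_finite_induct) (auto intro: polyfun_add)

lemma polyfun_prod: "(\<And>i. i \<in> I \<Longrightarrow> polyfun V (f i)) \<Longrightarrow> polyfun V (\<lambda>x. \<Prod>i\<in>I. f i x)"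
  by (induction I rule: infinite_finite_induct) (auto intro: polyfun_mult)

lemmas polyfun_intros = polyfun_add polyfun_mult polyfun_const polyfun_uminus polyfun_diff
  polyfun_power polyfun_sum polyfun_prod

lemma polyfun_compose:
  assumes "polyfun V f" and "\<And>v. v \<in> V \<Longrightarrow> polyfun W (\<lambda>x. g x v)"
  shows "polyfun W (\<lambda>x. f (g x))"
proof -
  obtain p where p: "poly_vars p \<subseteq> V" "\<And>x. f x = poly_eval p x"
    using assms(1) unfolding polyfun_def by blast
  show ?thesis unfolding p(2) poly_eval_def monom_eval_def
    by (intro polyfun_intros assms(2)) (use p(1) in \<open>auto simp: poly_vars_def\<close>)
qed

section \<open>Homogeneous polynomial functions\<close>

lemma homogeneous_imp_degree:
  assumes "homogeneous d p" "\<alpha> \<in> Poly_Mapping.keys p"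
  shows "(\<Sum>v\<in>Poly_Mapping.keys \<alpha>. Poly_Mapping.lookup \<alpha> v) = d"
  using assms unfolding homogeneous_def by blast

lemma degree_add:
  fixes \<alpha> \<beta> :: "'v \<Rightarrow>\<^sub>0 nat"
  shows "(\<Sum>v\<in>Poly_Mapping.keys (\<alpha> + \<beta>). Poly_Mapping.lookup (\<alpha> + \<beta>) v) =
    (\<Sum>v\<in>Poly_Mapping.keys \<alpha>. Poly_Mapping.lookup \<alpha> v) + (\<Sum>v\<in>Poly_Mapping.keys \<beta>. Poly_Mapping.lookup \<beta> v)"
  by (rule setsum_keys_plus_distrib) auto

lemma form_poly_eval: "homogeneous d p \<Longrightarrow> form d (poly_eval p)"
  unfolding form_def by blast

lemma form_add: "form d f \<Longrightarrow> form d g \<Longrightarrow> form d (\<lambda>x. f x + g x)"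
  unfolding form_def
proof safe
  fix p q assume *: "homogeneous d p" "homogeneous d q" "\<forall>x. f x = poly_eval p x" "\<forall>x. g x = poly_eval q x"
  have "homogeneous d (p + q)"
    using *(1,2) Poly_Mapping.keys_add[of p q] unfolding homogeneous_def by blast
  then show "\<exists>r. homogeneous d r \<and> (\<forall>x. f x + g x = poly_eval r x)"
    using * by (intro exI[of _ "p + q"]) (simp add: poly_eval_add)
qed

lemma form_mult: "form d f \<Longrightarrow> form e g \<Longrightarrow> form (d + e) (\<lambda>x. f x * g x)"
  unfolding form_def
proof safe
  fix p q assume *: "homogeneous d p" "homogeneous e q" "\<forall>x. f x = poly_eval p x" "\<forall>x. g x = poly_eval q x"
  have "homogeneous (d + e) (p * q)"
    unfolding homogeneous_def
  proof
    fix \<gamma> assume "\<gamma> \<in> Poly_Mapping.keys (p * q)"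
    then obtain \<alpha> \<beta> where "\<alpha> \<in> Poly_Mapping.keys p" "\<beta> \<in> Poly_Mapping.keys q" "\<gamma> = \<alpha> + \<beta>"
      using Poly_Mapping.keys_mult[of p q] by blast
    then show "(\<Sum>v\<in>Poly_Mapping.keys \<gamma>. Poly_Mapping.lookup \<gamma> v) = d + e"
      using * by (simp add: degree_add homogeneous_imp_degree)
  qed
  then show "\<exists>r. homogeneous (d + e) r \<and> (\<forall>x. f x * g x = poly_eval r x)"
    using * by (intro exI[of _ "p * q"]) (auto simp: poly_eval_mult)
qed

lemma form_0 [simp]: "form d (\<lambda>x. 0)"
  unfolding form_def by (rule exI[of _ 0]) (auto simp: homogeneous_def)

lemma form_const [simp]: "form 0 (\<lambda>x. c)"
  unfolding form_def
  by (rule exI[of _ "Poly_Mapping.single 0 c"]) (auto simp: homogeneous_def)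

lemma form_var: "form 1 (\<lambda>x. x v)"
  unfolding form_def
  by (rule exI[of _ "Poly_Mapping.single (Poly_Mapping.single v 1) 1"]) (auto simp: homogeneous_def)

lemma form_cmult: "form d f \<Longrightarrow> form d (\<lambda>x. c * f x)"
  using form_mult[OF form_const[of c], of d f] by simp

lemma form_uminus: "form d f \<Longrightarrow> form d (\<lambda>x. - f x)"
  using form_cmult[of d f "-1"] by simp

lemma form_diff: "form d f \<Longrightarrow> form d g \<Longrightarrow> form d (\<lambda>x. f x - g x)"
  using form_add[OF _ form_uminus, of d f g] by simp

lemma form_power: "form d f \<Longrightarrow> form (n * d) (\<lambda>x. f x ^ n)"
  by (induction n) (auto intro: form_mult)

lemma form_sum: "(\<And>i. i \<in> I \<Longrightarrow> form d (f i)) \<Longrightarrow> form d (\<lambda>x. \<Sum>i\<in>I. f i x)"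
  by (induction I rule: infinite_finite_induct) (auto intro: form_add)

lemma form_imp_polyfun: "form d f \<Longrightarrow> polyfun UNIV f"
  unfolding form_def polyfun_def by blast

lemma form_scale:
  assumes "form d f"
  shows "f (\<lambda>v. c * x v) = c ^ d * f x"
proof -
  obtain p where p: "homogeneous d p" "\<And>x. f x = poly_eval p x"
    using assms unfolding form_def by blast
  have "monom_eval \<alpha> (\<lambda>v. c * x v) = c ^ d * monom_eval \<alpha> x" if "\<alpha> \<in> Poly_Mapping.keys p" for \<alpha>
    using homogeneous_imp_degree[OF p(1) that]
    by (simp add: monom_eval_def power_mult_distrib prod.distrib power_sum[symmetric])
  then show ?thesis
    by (simp add: p(2) poly_eval_def sum_distrib_left algebra_simps)
qed

section \<open>Substitution of polynomials in one variable\<close>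

lemma polyfun_poly_subst:
  fixes F :: "'v \<Rightarrow> real poly"
  assumes "polyfun V f"
  shows "\<exists>q. \<forall>t. poly q t = f (\<lambda>v. poly (F v) t)"
proof -
  obtain p where p: "\<And>x. f x = poly_eval p x"
    using assms unfolding polyfun_def by blast
  show ?thesis
    by (rule exI[of _ "\<Sum>\<alpha>\<in>Poly_Mapping.keys p. smult (Poly_Mapping.lookup p \<alpha>)
           (\<Prod>v\<in>Poly_Mapping.keys \<alpha>. F v ^ Poly_Mapping.lookup \<alpha> v)"])
       (simp add: p poly_eval_def poly_sum monom_eval_def poly_prod)
qed

text \<open>The degree bound is what homogenization needs: substituting 1 and t into a binary form
  of degree \<open>d\<close> gives a polynomial of degree at most \<open>d\<close>, from which the
  form can be recovered.\<close>

lemma form_poly_subst: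
  fixes F :: "'v \<Rightarrow> real poly"
  assumes "form d f" "\<And>v. degree (F v) \<le> D"
  shows "\<exists>q. degree q \<le> d * D \<and> (\<forall>t. poly q t = f (\<lambda>v. poly (F v) t))"
proof -
  obtain p where p: "homogeneous d p" "\<And>x. f x = poly_eval p x"
    using assms unfolding form_def by blast
  let ?q = "\<Sum>\<alpha>\<in>Poly_Mapping.keys p. smult (Poly_Mapping.lookup p \<alpha>)
           (\<Prod>v\<in>Poly_Mapping.keys \<alpha>. F v ^ Poly_Mapping.lookup \<alpha> v)"
  have "degree ?q \<le> d * D"
  proof (rule degree_sum_le)
    fix \<alpha> assume \<alpha>: "\<alpha> \<in> Poly_Mapping.keys p"
    have "degree (\<Prod>v\<in>Poly_Mapping.keys \<alpha>. F v ^ Poly_Mapping.lookup \<alpha> v) \<le>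
      (\<Sum>v\<in>Poly_Mapping.keys \<alpha>. degree (F v ^ Poly_Mapping.lookup \<alpha> v))"
      using degree_prod_sum_le[of "Poly_Mapping.keys \<alpha>" "\<lambda>v. F v ^ Poly_Mapping.lookup \<alpha> v"]
      by (simp add: o_def)
    also have "\<dots> \<le> (\<Sum>v\<in>Poly_Mapping.keys \<alpha>. Poly_Mapping.lookup \<alpha> v * D)"
    proof (rule sum_mono)
      fix v
      have "degree (F v ^ Poly_Mapping.lookup \<alpha> v) \<le> degree (F v) * Poly_Mapping.lookup \<alpha> v"
        by (rule degree_power_le)
      also have "\<dots> \<le> Poly_Mapping.lookup \<alpha> v * D"
        using assms(2)[of v] by simp
      finally show "degree (F v ^ Poly_Mapping.lookup \<alpha> v) \<le> Poly_Mapping.lookup \<alpha> v * D" .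
    qed
    also have "\<dots> = d * D"
      using homogeneous_imp_degree[OF p(1) \<alpha>] by (simp add: sum_distrib_right[symmetric])
    finally show "degree (smult (Poly_Mapping.lookup p \<alpha>)
           (\<Prod>v\<in>Poly_Mapping.keys \<alpha>. F v ^ Poly_Mapping.lookup \<alpha> v)) \<le> d * D"
      using degree_smult_le order_trans by blast
  qed auto
  then show ?thesis
    by (intro exI[of _ ?q]) (simp add: p poly_eval_def poly_sum monom_eval_def poly_prod)
qed

lemma continuous_on_polyfun:
  assumes "polyfun V f"
  shows "continuous_on A (\<lambda>x :: real ^ 'm. f (($) x))"
proof -
  obtain p where p: "\<And>x. f x = poly_eval p x"
    using assms unfolding polyfun_def by blast
  show ?thesis unfolding p poly_eval_def monom_eval_def
    by (intro continuous_intros)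
qed

text \<open>A formally nonzero polynomial is a nonzero function: split off the terms in which some
  variable \<open>v\<close> has a given exponent and induct on the number of terms.\<close>

lemma sum_monoms_nonzero:
  assumes "finite A" "A \<noteq> {}" "\<And>\<alpha>. \<alpha> \<in> A \<Longrightarrow> c \<alpha> \<noteq> (0::real)"
  shows "\<exists>x. (\<Sum>\<alpha>\<in>A. c \<alpha> * monom_eval \<alpha> x) \<noteq> 0"
  using assms
proof (induction A rule: finite_psubset_induct)
  case (psubset A)
  obtain \<alpha> where \<alpha>: "\<alpha> \<in> A" using psubset.prems by blast
  show ?case
  proof (cases "A = {\<alpha>}")
    case True
    then show ?thesis
      using psubset.prems by (intro exI[of _ "\<lambda>_. 1"]) (auto simp: monom_eval_def)
  next
    case False
    then obtain \<beta> where \<beta>: "\<beta> \<in> A" "\<beta> \<noteq> \<alpha>" using \<alpha> by blast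
    then obtain v where v: "Poly_Mapping.lookup \<alpha> v \<noteq> Poly_Mapping.lookup \<beta> v"
      by (metis poly_mapping_eqI)
    define i where "i = Poly_Mapping.lookup \<alpha> v"
    define B where "B = {\<gamma> \<in> A. Poly_Mapping.lookup \<gamma> v = i}"
    have "B \<subset> A" "B \<noteq> {}" using \<alpha> \<beta> v unfolding B_def i_def by force+
    then obtain x where x: "(\<Sum>\<alpha>\<in>B. c \<alpha> * monom_eval \<alpha> x) \<noteq> 0"
      using psubset.IH[of B] psubset.prems unfolding B_def by auto
    define rest where "rest \<gamma> = (\<Prod>w\<in>Poly_Mapping.keys \<gamma> - {v}. x w ^ Poly_Mapping.lookup \<gamma> w)" for \<gamma>
    have split: "monom_eval \<gamma> (x(v := T)) = T ^ Poly_Mapping.lookup \<gamma> v * rest \<gamma>" for \<gamma> T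
    proof -
      have "monom_eval \<gamma> (x(v := T)) = (\<Prod>w\<in>insert v (Poly_Mapping.keys \<gamma>). (x(v := T)) w ^ Poly_Mapping.lookup \<gamma> w)"
        by (rule monom_eval_superset) auto
      also have "\<dots> = T ^ Poly_Mapping.lookup \<gamma> v *
          (\<Prod>w\<in>Poly_Mapping.keys \<gamma> - {v}. (x(v := T)) w ^ Poly_Mapping.lookup \<gamma> w)"
        by (simp add: prod.insert_remove)
      also have "(\<Prod>w\<in>Poly_Mapping.keys \<gamma> - {v}. (x(v := T)) w ^ Poly_Mapping.lookup \<gamma> w) = rest \<gamma>"
        unfolding rest_def by (rule prod.cong) auto
      finally show ?thesis .
    qed
    define P where "P = (\<Sum>\<gamma>\<in>A. monom (c \<gamma> * rest \<gamma>) (Poly_Mapping.lookup \<gamma> v))"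
    have P: "poly P T = (\<Sum>\<gamma>\<in>A. c \<gamma> * monom_eval \<gamma> (x(v := T)))" for T
      by (simp add: P_def poly_sum poly_monom split algebra_simps)
    have "coeff P i = (\<Sum>\<gamma>\<in>A. if Poly_Mapping.lookup \<gamma> v = i then c \<gamma> * rest \<gamma> else 0)"
      by (simp add: P_def coeff_sum if_distrib cong: if_cong)
    also have "\<dots> = (\<Sum>\<gamma>\<in>B. c \<gamma> * rest \<gamma>)"
      unfolding B_def using psubset.hyps by (simp add: sum.If_cases Int_def)
    finally have "coeff P i = (\<Sum>\<gamma>\<in>B. c \<gamma> * rest \<gamma>)" .
    moreover have "(\<Sum>\<gamma>\<in>B. c \<gamma> * monom_eval \<gamma> x) = x v ^ i * (\<Sum>\<gamma>\<in>B. c \<gamma> * rest \<gamma>)"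
    proof -
      have "monom_eval \<gamma> x = x v ^ i * rest \<gamma>" if "\<gamma> \<in> B" for \<gamma>
        using split[of \<gamma> "x v"] that by (simp add: B_def)
      then show ?thesis by (simp add: sum_distrib_left algebra_simps)
    qed
    ultimately have "P \<noteq> 0" using x by auto
    then obtain T where "poly P T \<noteq> 0"
      using poly_all_0_iff_0 by blast
    then show ?thesis using P by auto
  qed
qed

lemma poly_eval_nonzero:
  assumes "p \<noteq> 0"
  shows "\<exists>x. poly_eval p x \<noteq> 0"
  unfolding poly_eval_def
  by (rule sum_monoms_nonzero) (use assms in \<open>auto simp: in_keys_iff\<close>)

lemma form_prod:
  "(\<And>i. i \<in> I \<Longrightarrow> form (d i) (f i)) \<Longrightarrow> form (sum d I) (\<lambda>x. \<Prod>i\<in>I. f i x)"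
  by (induction I rule: infinite_finite_induct) (auto intro: form_mult)

lemma form_compose:
  assumes "form e f" "\<And>v. form d (\<lambda>x. g x v)"
  shows "form (e * d) (\<lambda>x. f (g x))"
proof -
  obtain p where p: "homogeneous e p" "\<And>x. f x = poly_eval p x"
    using assms(1) unfolding form_def by blast
  have "form (e * d) (\<lambda>x. Poly_Mapping.lookup p \<alpha> * monom_eval \<alpha> (g x))" if "\<alpha> \<in> Poly_Mapping.keys p" for \<alpha>
  proof -
    have "form (\<Sum>v\<in>Poly_Mapping.keys \<alpha>. Poly_Mapping.lookup \<alpha> v * d)
            (\<lambda>x. \<Prod>v\<in>Poly_Mapping.keys \<alpha>. g x v ^ Poly_Mapping.lookup \<alpha> v)"
      by (intro form_prod form_power assms(2))
    moreover have "(\<Sum>v\<in>Poly_Mapping.keys \<alpha>. Poly_Mapping.lookup \<alpha> v * d) = e * d"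
      using homogeneous_imp_degree[OF p(1) that] by (simp add: sum_distrib_right[symmetric])
    ultimately show ?thesis
      by (simp add: monom_eval_def form_cmult)
  qed
  then show ?thesis
    unfolding p(2) poly_eval_def by (intro form_sum)
qed

subsection \<open>Binary forms\<close>

text \<open>Binary forms are curried functions of the two homogeneous coordinates. The parameter t
  is the point (1, t) of the projective line, and infinity is (0, 1).\<close>

definition bform :: "nat \<Rightarrow> (real \<Rightarrow> real \<Rightarrow> real) \<Rightarrow> bool" where
  "bform d q \<longleftrightarrow> form d (\<lambda>x::2 \<Rightarrow> real. q (x 1) (x 2))"

lemma bform_add: "bform d f \<Longrightarrow> bform d g \<Longrightarrow> bform d (\<lambda>a b. f a b + g a b)"
  unfolding bform_def by (rule form_add)

lemma bform_diff: "bform d f \<Longrightarrow> bform d g \<Longrightarrow> bform d (\<lambda>a b. f a b - g a b)"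
  unfolding bform_def by (rule form_diff)

lemma bform_mult: "bform d f \<Longrightarrow> bform e g \<Longrightarrow> bform (d + e) (\<lambda>a b. f a b * g a b)"
  unfolding bform_def by (rule form_mult)

lemma bform_cmult: "bform d f \<Longrightarrow> bform d (\<lambda>a b. c * f a b)"
  unfolding bform_def by (rule form_cmult)

lemma bform_power: "bform d f \<Longrightarrow> bform (n * d) (\<lambda>a b. f a b ^ n)"
  unfolding bform_def by (rule form_power)

lemma bform_sum: "(\<And>i. i \<in> I \<Longrightarrow> bform d (f i)) \<Longrightarrow> bform d (\<lambda>a b. \<Sum>i\<in>I. f i a b)"
  unfolding bform_def by (rule form_sum)

lemma bform_fst: "bform 1 (\<lambda>a b. a)"
  unfolding bform_def by (rule form_var)

lemma bform_snd: "bform 1 (\<lambda>a b. b)"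
  unfolding bform_def by (rule form_var)

lemma form_imp_bform:
  fixes f :: "(2 \<Rightarrow> real) \<Rightarrow> real"
  assumes "form d f"
  shows "bform d (\<lambda>a b. f (\<lambda>k. if k = 1 then a else b))"
proof -
  have "(\<lambda>k. if k = 1 then x 1 else x 2) = x" for x :: "2 \<Rightarrow> real"
    using exhaust_2 by fastforce
  then show ?thesis using assms by (simp add: bform_def)
qed

lemma bform_compose:
  assumes "form e P" "\<And>k. bform d (\<Phi> k)"
  shows "bform (e * d) (\<lambda>a b. P (\<lambda>k. \<Phi> k a b))"
  unfolding bform_def
  by (rule form_compose[OF assms(1)]) (use assms(2) in \<open>simp add: bform_def\<close>)

lemma bform_linear:
  assumes "bform d q"
  shows "bform d (\<lambda>a b. q (\<alpha> * a + \<beta> * b) (\<gamma> * a + \<epsilon> * b))"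
proof -
  have "bform (d * 1) (\<lambda>a b. (\<lambda>x::2 \<Rightarrow> real. q (x 1) (x 2))
     (\<lambda>k. (if k = 1 then (\<lambda>a b. \<alpha> * a + \<beta> * b) else (\<lambda>a b. \<gamma> * a + \<epsilon> * b)) a b))"
    using assms unfolding bform_def[of d q]
    by (rule bform_compose) (simp split del: if_split, auto intro!: bform_add bform_cmult bform_fst[simplified] bform_snd[simplified])
  then show ?thesis by simp
qed

lemma bform_scale:
  assumes "bform d q"
  shows "q (c * a) (c * b) = c ^ d * q a b"
  using form_scale[OF assms[unfolded bform_def], of c "\<lambda>k. if k = 1 then a else b"] by simp

lemma bform_poly:
  assumes "bform d q"
  shows "\<exists>p. degree p \<le> d \<and> (\<forall>t. poly p t = q 1 t)"
proof -
  have "\<exists>p. degree p \<le> d * 1 \<and> (\<forall>t. poly p t = q (poly (if (1::2) = 1 then 1 else [:0,1:]) t) (poly (if (2::2) = 1 then 1 else [:0,1:]) t))"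
    by (rule form_poly_subst[OF assms[unfolded bform_def], of "\<lambda>k. if k = 1 then 1 else [:0,1:]"]) auto
  then show ?thesis by simp
qed

lemma bform_poly_left:
  assumes "bform d q"
  shows "\<exists>p. \<forall>t. poly p t = q t b"
proof -
  have "\<exists>p. \<forall>t. poly p t = q (poly (if (1::2) = 1 then [:0,1:] else [:b:]) t) (poly (if (2::2) = 1 then [:0,1:] else [:b:]) t)"
    by (rule polyfun_poly_subst[OF form_imp_polyfun[OF assms[unfolded bform_def]], of "\<lambda>k. if k = 1 then [:0,1:] else [:b:]"])
  then show ?thesis by simp
qed

lemma poly_eq_if_infinite:
  fixes p q :: "'a :: idom poly"
  assumes "infinite {t. poly p t = poly q t}"
  shows "p = q"
  using assms poly_roots_finite[of "p - q"] by (auto simp: poly_diff)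

text \<open>Infinitely many zeros t kill the dehomogenized polynomial, and scaling kills the form
  wherever \<open>a\<close> is not 0. For fixed \<open>b\<close> the form is also a polynomial in
  \<open>a\<close>, which handles \<open>a\<close> = 0.\<close>

lemma bform_eq_0:
  assumes "bform d q" "infinite {t. q 1 t = 0}"
  shows "q a b = 0"
proof -
  obtain p where p: "\<And>t. poly p t = q 1 t" using bform_poly[OF assms(1)] by blast
  have "p = 0"
    using poly_eq_if_infinite[of p 0] assms(2) by (simp add: p)
  then have 1: "q 1 t = 0" for t using p[of t] by simp
  have 2: "q a b = 0" if "a \<noteq> 0" for a b
    using bform_scale[OF assms(1), of a 1 "b / a"] that 1 by simp
  obtain p' where p': "\<And>t. poly p' t = q t b" using bform_poly_left[OF assms(1)] by blast
  have "{t. t \<noteq> 0} \<subseteq> {t. poly p' t = poly 0 t}" using 2 p' by auto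
  moreover have "infinite {t::real. t \<noteq> 0}"
    using infinite_UNIV_char_0[where 'a=real] finite_insert[of 0 "{t::real. t \<noteq> 0}"]
    by (metis (mono_tags, lifting) UNIV_eq_I insertI1 insertI2 mem_Collect_eq)
  ultimately have "p' = 0"
    by (intro poly_eq_if_infinite) (meson finite_subset)
  then show ?thesis using p'[of a] by simp
qed

lemma bform_finite_zeros:
  assumes "bform d q" "q a b \<noteq> 0"
  shows "finite {t. q 1 t = 0}"
  using bform_eq_0[OF assms(1)] assms(2) by blast

lemma bform_of_poly: "bform d (\<lambda>a b. \<Sum>j\<le>d. coeff p j * a ^ (d - j) * b ^ j)"
proof (rule bform_sum)
  fix j assume "j \<in> {..d}"
  then have "bform d (\<lambda>a b. coeff p j * (a ^ (d - j) * b ^ j))"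
    using bform_cmult[OF bform_mult[OF bform_power[OF bform_fst, of "d - j"] bform_power[OF bform_snd, of j]], of "coeff p j"]
    by simp
  then show "bform d (\<lambda>a b. coeff p j * a ^ (d - j) * b ^ j)" by (simp add: mult.assoc)
qed

lemma bform_of_poly_1:
  fixes p :: "real poly"
  assumes "degree p \<le> d"
  shows "(\<Sum>j\<le>d. coeff p j * 1 ^ (d - j) * b ^ j) = poly p b"
proof -
  have "poly p b = (\<Sum>i\<le>degree p. coeff p i * b ^ i)" by (rule poly_altdef)
  also have "\<dots> = (\<Sum>i\<le>d. coeff p i * b ^ i)"
    by (rule sum.mono_neutral_left) (use assms in \<open>auto simp: coeff_eq_0\<close>)
  finally show ?thesis by simp
qed

text \<open>At infinity only the term of index \<open>d\<close> survives, so the value there is the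
  coefficient in the formal degree \<open>d\<close>. A zero at infinity thus becomes the vanishing
  of a top coefficient.\<close>

lemma bform_expand:
  assumes "bform d q"
  obtains p where "degree p \<le> d" "\<And>a b. q a b = (\<Sum>j\<le>d. coeff p j * a ^ (d - j) * b ^ j)"
    "\<And>t. q 1 t = poly p t" "q 0 1 = coeff p d"
proof -
  obtain p where p: "degree p \<le> d" "\<And>t. poly p t = q 1 t" using bform_poly[OF assms] by blast
  have "q a b - (\<Sum>j\<le>d. coeff p j * a ^ (d - j) * b ^ j) = 0" for a b
    by (rule bform_eq_0[OF bform_diff[OF assms bform_of_poly]])
       (simp only: bform_of_poly_1[OF p(1)] p(2), simp add: infinite_UNIV_char_0)
  then have *: "q a b = (\<Sum>j\<le>d. coeff p j * a ^ (d - j) * b ^ j)" for a b by simp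
  have "q 0 1 = (\<Sum>j\<le>d. if j = d then coeff p j else 0)"
    unfolding * by (rule sum.cong) auto
  then have "q 0 1 = coeff p d" by simp
  then show ?thesis using that p * by metis
qed

lemma continuous_on_bform:
  assumes "bform d q" "continuous_on A f" "continuous_on A g"
  shows "continuous_on A (\<lambda>z. q (f z) (g z))"
proof -
  obtain p where "\<And>a b. q a b = (\<Sum>j\<le>d. coeff p j * a ^ (d - j) * b ^ j)"
    using bform_expand[OF assms(1)] by metis
  then show ?thesis using assms(2,3) by (auto intro!: continuous_intros)
qed

subsection \<open>Homogeneous relations between polynomials in one variable\<close>

text \<open>Gaussian elimination on the top coefficient: the polynomials of degree below
  \<open>d\<close> form a space of dimension \<open>d\<close>, and the family has more than
  \<open>d\<close> members.\<close>

lemma poly_family_dependent: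
  fixes q :: "'i \<Rightarrow> 'a::field poly"
  assumes "finite J" "card J > d" "\<And>j i. j \<in> J \<Longrightarrow> i \<ge> d \<Longrightarrow> coeff (q j) i = 0"
  shows "\<exists>c. (\<exists>j\<in>J. c j \<noteq> 0) \<and> (\<Sum>j\<in>J. smult (c j) (q j)) = 0"
  using assms
proof (induction d arbitrary: J q)
  case 0
  then obtain j where "j \<in> J" by fastforce
  moreover have "q j = 0" if "j \<in> J" for j using 0(3)[OF that] by (auto simp: poly_eq_iff)
  ultimately show ?case by (intro exI[of _ "\<lambda>_. 1"]) auto
next
  case (Suc d)
  show ?case
  proof (cases "\<forall>j\<in>J. coeff (q j) d = 0")
    case True
    have "coeff (q j) i = 0" if "j \<in> J" "i \<ge> d" for i j
      using Suc.prems(3)[OF that(1), of i] True that by (cases "i = d") auto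
    then show ?thesis using Suc.IH[of J q] Suc.prems by auto
  next
    case False
    then obtain j0 where j0: "j0 \<in> J" "coeff (q j0) d \<noteq> 0" by blast
    define r where "r j = coeff (q j) d / coeff (q j0) d" for j
    define q' where "q' j = q j - smult (r j) (q j0)" for j
    have "coeff (q' j) i = 0" if "j \<in> J - {j0}" "i \<ge> d" for i j
      using Suc.prems(3)[of j i] Suc.prems(3)[of j0 i] that j0
      by (cases "i = d") (auto simp: q'_def r_def)
    moreover have "card (J - {j0}) > d" using Suc.prems j0 by simp
    ultimately obtain c where c: "\<exists>j\<in>J - {j0}. c j \<noteq> 0" "(\<Sum>j\<in>J - {j0}. smult (c j) (q' j)) = 0"
      using Suc.IH[of "J - {j0}" q'] Suc.prems(1) by auto
    \<comment> \<open>The coefficient of the pivot \<open>j0\<close> undoes the multiples of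
      \<open>q j0\<close> that were subtracted from the other members.\<close>
    define c' where "c' j = (if j = j0 then - (\<Sum>j\<in>J - {j0}. c j * r j) else c j)" for j
    have "(\<Sum>j\<in>J. smult (c' j) (q j)) = smult (c' j0) (q j0) + (\<Sum>j\<in>J - {j0}. smult (c' j) (q j))"
      using Suc.prems(1) j0 by (simp add: sum.remove)
    also have "(\<Sum>j\<in>J - {j0}. smult (c' j) (q j)) = (\<Sum>j\<in>J - {j0}. smult (c j) (q' j) + smult (c j * r j) (q j0))"
      by (rule sum.cong) (auto simp: c'_def q'_def smult_diff_right)
    also have "\<dots> = smult (\<Sum>j\<in>J - {j0}. c j * r j) (q j0)"
      using c(2) by (simp add: sum.distrib smult_sum)
    finally have "(\<Sum>j\<in>J. smult (c' j) (q j)) = 0" by (simp add: c'_def)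
    moreover have "\<exists>j\<in>J. c' j \<noteq> 0" using c(1) by (auto simp: c'_def)
    ultimately show ?thesis by blast
  qed
qed

text \<open>A dimension count: the homogeneous monomials in three polynomials of one variable
  outnumber the coefficients available for their values. The condition on \<open>c 0 j\<close> says
  that the relation remains nontrivial after the third variable is set to 0.\<close>

lemma three_polys_relation:
  fixes q1 q2 q3 :: "real poly"
  assumes "q3 \<noteq> 0"
  obtains N K J c where "K + J \<le> N" "\<exists>j\<le>J. c (0::nat) (j::nat) \<noteq> (0::real)"
    "(\<Sum>k\<le>K. \<Sum>j\<le>J. smult (c k j) (q3 ^ k * q2 ^ j * q1 ^ (N - k - j))) = 0"
proof -
  define D where "D = max (degree q1) (max (degree q2) (degree q3))"
  \<comment> \<open>With these choices the degrees are at most D M = (m - 1) m, so the number of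
    coefficients is smaller than (m + 1)^2, the number of exponent pairs.\<close>
  define m where "m = 2 * D + 1"
  define M where "M = 2 * m"
  define q where "q = (\<lambda>(k, j). q3 ^ k * q2 ^ j * q1 ^ (M - k - j))"
  have deg: "degree (q kj) \<le> D * M" if "kj \<in> {..m} \<times> {..m}" for kj
  proof -
    obtain k j where split: "kj = (k, j)" by (cases kj)
    with that have kj: "kj = (k, j)" "k \<le> m" "j \<le> m" by simp_all
    have "degree (q kj) \<le> degree (q3 ^ k) + degree (q2 ^ j) + degree (q1 ^ (M - k - j))"
      unfolding kj(1) q_def split_conv
      by (rule order.trans[OF degree_mult_le add_mono[OF degree_mult_le order.refl]])
    also have "\<dots> \<le> D * k + D * j + D * (M - k - j)"
      by (intro add_mono order.trans[OF degree_power_le] mult_right_mono) (auto simp: D_def)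
    also have "\<dots> = D * (k + j + (M - k - j))" by (simp add: algebra_simps)
    also have "k + j + (M - k - j) = M" using kj by (simp add: M_def)
    finally show ?thesis .
  qed
  have "card ({..m} \<times> {..m}) = Suc m * Suc m"
    by (simp add: card_cartesian_product)
  also have "Suc m * Suc m > D * M + 1"
    unfolding m_def M_def by (simp add: algebra_simps)
  finally have "card ({..m} \<times> {..m}) > D * M + 1" .
  moreover have "coeff (q kj) i = 0" if "kj \<in> {..m} \<times> {..m}" "i \<ge> D * M + 1" for kj i
    using deg[OF that(1)] that(2) by (intro coeff_eq_0) linarith
  ultimately obtain c where c: "\<exists>kj\<in>{..m} \<times> {..m}. c kj \<noteq> 0" "(\<Sum>kj\<in>{..m} \<times> {..m}. smult (c kj) (q kj)) = 0"
    using poly_family_dependent[of "{..m} \<times> {..m}" "D * M + 1" q] by blast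
  \<comment> \<open>The largest power of \<open>q3\<close> common to all terms with nonzero
    coefficients is divided out, so that terms free of \<open>q3\<close> remain.\<close>
  define k0 where "k0 = (LEAST k. \<exists>j\<le>m. c (k, j) \<noteq> 0)"
  have ex: "\<exists>k. \<exists>j\<le>m. c (k, j) \<noteq> 0" using c(1) by auto
  have k0: "\<exists>j\<le>m. c (k0, j) \<noteq> 0" unfolding k0_def by (rule LeastI_ex[OF ex])
  have k0_min: "c (k, j) = 0" if "k < k0" "j \<le> m" for k j
    using not_less_Least[of k "\<lambda>k. \<exists>j\<le>m. c (k, j) \<noteq> 0"] that unfolding k0_def by blast
  have "k0 \<le> m" unfolding k0_def using c(1) by (auto intro: order.trans[OF Least_le])
  define N where "N = M - k0"
  define c' where "c' k j = c (k + k0, j)" for k j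
  have "0 = (\<Sum>k\<le>m. \<Sum>j\<le>m. smult (c (k, j)) (q (k, j)))"
    using c(2) by (simp add: sum.cartesian_product)
  also have "\<dots> = (\<Sum>k\<in>{k0..m}. \<Sum>j\<le>m. smult (c (k, j)) (q (k, j)))"
    by (rule sum.mono_neutral_right) (auto simp: k0_min)
  also have "\<dots> = (\<Sum>k\<in>{0..m-k0}. \<Sum>j\<le>m. smult (c (k + k0, j)) (q (k + k0, j)))"
    using sum.shift_bounds_cl_nat_ivl[of "\<lambda>k. \<Sum>j\<le>m. smult (c (k, j)) (q (k, j))" 0 k0 "m - k0"] \<open>k0 \<le> m\<close> by simp
  also have "\<dots> = q3 ^ k0 * (\<Sum>k\<le>m-k0. \<Sum>j\<le>m. smult (c' k j) (q3 ^ k * q2 ^ j * q1 ^ (N - k - j)))"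
    unfolding sum_distrib_left atLeast0AtMost
  proof (intro sum.cong refl)
    fix k j
    have "M - (k + k0) - j = N - k - j" by (simp add: N_def)
    then show "smult (c (k + k0, j)) (q (k + k0, j)) =
        q3 ^ k0 * smult (c' k j) (q3 ^ k * q2 ^ j * q1 ^ (N - k - j))"
      by (simp add: c'_def q_def power_add mult.assoc mult.left_commute)
  qed
  finally have "(\<Sum>k\<le>m-k0. \<Sum>j\<le>m. smult (c' k j) (q3 ^ k * q2 ^ j * q1 ^ (N - k - j))) = 0"
    using assms by simp
  moreover have "(m - k0) + m \<le> N" using \<open>k0 \<le> m\<close> by (simp add: N_def M_def)
  moreover have "\<exists>j\<le>m. c' 0 j \<noteq> 0" using k0 by (simp add: c'_def)
  ultimately show ?thesis using that by blast
qed

text \<open>The homogeneous coordinates of the points of the Zariski closure of a curve \<open>t \<mapsto> [F(t)]\<close>.\<close>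

definition curve_cone :: "('k \<Rightarrow> real poly) \<Rightarrow> (real ^ 'k) set" where
  "curve_cone F = {v. v \<noteq> 0 \<and> (\<forall>d P. form d P \<and> (\<forall>t. P (\<lambda>k. poly (F k) t) = 0) \<longrightarrow> P (($) v) = 0)}"

text \<open>The forms \<open>p\<close>, x_b^e and x_a^e have the same degree and satisfy a
  homogeneous relation along the parametrization, hence on the whole cone. Where \<open>p\<close>
  vanishes and x_a = 1, this relation becomes a nonzero polynomial equation for x_b.\<close>

lemma curve_cone_coordinate_finite:
  fixes F :: "'k::finite \<Rightarrow> real poly"
  assumes p: "form e p" and nz: "p (\<lambda>k. poly (F k) t0) \<noteq> 0"
  shows "finite ((\<lambda>v. v $ b) ` {v \<in> curve_cone F. p (($) v) = 0 \<and> v $ a = 1})"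
proof (cases "e = 0")
  case True
  have const: "p x = p y" for x y
    using form_scale[OF p, of 0 x] form_scale[OF p, of 0 y] True by simp
  have "p (($) v) \<noteq> 0" for v :: "real ^ 'k"
    using nz const[of "($) v" "\<lambda>k. poly (F k) t0"] by simp
  then have "{v \<in> curve_cone F. p (($) v) = 0 \<and> v $ a = 1} = {}" by blast
  then show ?thesis by (simp only: image_empty finite.emptyI)
next
  case False
  obtain q3 where q3: "\<And>t. poly q3 t = p (\<lambda>k. poly (F k) t)"
    using polyfun_poly_subst[OF form_imp_polyfun[OF p], of F] by blast
  have "q3 \<noteq> 0" using nz q3[of t0] by auto
  then obtain N K J c where c: "K + J \<le> N" "\<exists>j\<le>J. c 0 j \<noteq> 0"
    "(\<Sum>k\<le>K. \<Sum>j\<le>J. smult (c k j) (q3 ^ k * (F b ^ e) ^ j * (F a ^ e) ^ (N - k - j))) = 0"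
    by (rule three_polys_relation)
  define P where "P x = (\<Sum>k\<le>K. \<Sum>j\<le>J. c k j * (p x ^ k * (x b ^ e) ^ j * (x a ^ e) ^ (N - k - j)))" for x
  have "form (N * e) P"
    unfolding P_def
  proof (intro form_sum form_cmult)
    fix k j assume "k \<in> {..K}" "j \<in> {..J}"
    then have "k + j + (N - k - j) = N" using c(1) by simp
    moreover have "k * e + j * (e * 1) + (N - k - j) * (e * 1) = (k + j + (N - k - j)) * e"
      by (simp only: distrib_right mult_1_right)
    ultimately have *: "k * e + j * (e * 1) + (N - k - j) * (e * 1) = N * e" by simp
    have "form (k * e + j * (e * 1) + (N - k - j) * (e * 1)) (\<lambda>x. p x ^ k * (x b ^ e) ^ j * (x a ^ e) ^ (N - k - j))"
      by (intro form_mult form_power p form_var)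
    then show "form (N * e) (\<lambda>x. p x ^ k * (x b ^ e) ^ j * (x a ^ e) ^ (N - k - j))"
      unfolding * .
  qed
  moreover have "P (\<lambda>k. poly (F k) t) = 0" for t
    using arg_cong[OF c(3), of "\<lambda>q. poly q t"] by (simp add: P_def poly_sum q3)
  ultimately have P0: "P (($) v) = 0" if "v \<in> curve_cone F" for v
    using that unfolding curve_cone_def by blast
  \<comment> \<open>Since \<open>e\<close> is positive here, the exponents e j are distinct and no
    coefficients \<open>c 0 j\<close> are merged.\<close>
  define R where "R = (\<Sum>j\<le>J. monom (c 0 j) (e * j))"
  have "coeff R (e * j) = c 0 j" if "j \<le> J" for j
  proof -
    have "coeff R (e * j) = (\<Sum>i\<le>J. if i = j then c 0 i else 0)"
      unfolding R_def coeff_sum coeff_monom by (rule sum.cong) (use False in auto)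
    then show ?thesis using that by simp
  qed
  then have "R \<noteq> 0" using c(2) by auto
  then have fin: "finite {y. poly R y = 0}" by (rule poly_roots_finite)
  have R0: "poly R (v $ b) = 0" if "v \<in> curve_cone F" "p (($) v) = 0" "v $ a = 1" for v
  proof -
    have "P (($) v) = (\<Sum>k\<le>K. if k = 0 then (\<Sum>j\<le>J. c k j * ((v $ b) ^ e) ^ j) else 0)"
      unfolding P_def by (rule sum.cong) (auto simp: that zero_power)
    then have "P (($) v) = (\<Sum>j\<le>J. c 0 j * ((v $ b) ^ e) ^ j)" by simp
    then show ?thesis using P0[OF that(1)]
      by (simp add: R_def poly_sum poly_monom power_mult)
  qed
  have "(\<lambda>v. v $ b) ` {v \<in> curve_cone F. p (($) v) = 0 \<and> v $ a = 1} \<subseteq> {y. poly R y = 0}"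
    using R0 by auto
  then show ?thesis by (rule finite_subset[OF _ fin])
qed

text \<open>Each coordinate takes finitely many values, so the vectors lie in a finite product. This
  replaces dimension theory: a form that does not vanish on the whole curve has finitely many zeros
  on its closure.\<close>

lemma curve_cone_finite:
  fixes F :: "'k::finite \<Rightarrow> real poly"
  assumes "form e p" and "p (\<lambda>k. poly (F k) t0) \<noteq> 0"
  shows "finite {v \<in> curve_cone F. p (($) v) = 0 \<and> v $ a = 1}"
proof -
  let ?V = "{v \<in> curve_cone F. p (($) v) = 0 \<and> v $ a = 1}"
  have "finite ((\<lambda>v. v $ b) ` ?V)" for b
    by (rule curve_cone_coordinate_finite[OF assms])
  then have "finite (PiE UNIV (\<lambda>b. (\<lambda>v. v $ b) ` ?V))"
    by (rule finite_PiE[OF finite])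
  moreover have "($) ` ?V \<subseteq> PiE UNIV (\<lambda>b. (\<lambda>v. v $ b) ` ?V)"
    unfolding PiE_UNIV_domain by blast
  ultimately have fin: "finite (($) ` ?V)" by (rule finite_subset[rotated])
  have inj: "inj_on ($) ?V"
  proof (rule inj_onI)
    fix v w :: "real ^ 'k" assume "($) v = ($) w"
    then show "v = w" by (simp add: vec_nth_inject)
  qed
  show ?thesis by (rule finite_imageD[OF fin inj])
qed

section \<open>Projective space\<close>

lemma proj_rel_refl: "v \<noteq> 0 \<Longrightarrow> proj_rel v v"
  by (auto simp: proj_rel_def intro: exI[of _ 1])

lemma abs_proj_eq_iff:
  assumes "v \<noteq> 0" "w \<noteq> 0"
  shows "abs_proj v = abs_proj w \<longleftrightarrow> (\<exists>c. c \<noteq> 0 \<and> w = c *\<^sub>R v)"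
proof -
  have "proj_rel v w \<longleftrightarrow> abs_proj v = abs_proj w"
    using Quotient3_rel[OF Quotient3_proj, of v w] assms proj_rel_refl by blast
  then show ?thesis using assms by (simp add: proj_rel_def)
qed

lemma rep_proj_nonzero: "rep_proj z \<noteq> 0"
  using Quotient3_rep_reflp[OF Quotient3_proj, of z] by (simp add: proj_rel_def)

lemma abs_rep_proj [simp]: "abs_proj (rep_proj z) = z"
  by (rule Quotient3_abs_rep[OF Quotient3_proj])

lemma proj_cases:
  obtains v where "v \<noteq> 0" "z = abs_proj v"
  using rep_proj_nonzero[of z] abs_rep_proj[of z] by metis

lemma abs_proj_scale: "c \<noteq> 0 \<Longrightarrow> v \<noteq> 0 \<Longrightarrow> abs_proj (c *\<^sub>R v) = abs_proj v"
  by (subst eq_commute) (auto simp: abs_proj_eq_iff)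

lemma hcoords_abs_proj:
  assumes "v \<noteq> 0"
  obtains c where "c \<noteq> 0" "hcoords (abs_proj v) = (\<lambda>k. c * v $ k)"
proof -
  have "abs_proj v = abs_proj (rep_proj (abs_proj v))" by simp
  then obtain c where c: "c \<noteq> 0" "rep_proj (abs_proj v) = c *\<^sub>R v"
    using abs_proj_eq_iff[OF assms rep_proj_nonzero[of "abs_proj v"]] by blast
  have "hcoords (abs_proj v) = (\<lambda>k. c * v $ k)"
    unfolding hcoords_def c(2) by (rule ext) simp
  then show ?thesis using that c(1) by blast
qed

lemma hcoords_nonzero: "\<exists>k. hcoords z k \<noteq> 0"
  using rep_proj_nonzero[of z] by (auto simp: hcoords_def vec_eq_iff)

text \<open>The vanishing of the 2x2 minors is polynomial in both vectors, so equality of points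
  becomes a condition that is closed for the Zariski and for the Euclidean topology.\<close>

lemma abs_proj_eq_iff_cross:
  assumes "v \<noteq> 0" "w \<noteq> 0"
  shows "abs_proj v = abs_proj w \<longleftrightarrow> (\<forall>i j. v $ i * w $ j = v $ j * w $ i)"
proof
  assume "abs_proj v = abs_proj w"
  then obtain c where "c \<noteq> 0" "w = c *\<^sub>R v" using abs_proj_eq_iff[OF assms] by blast
  then show "\<forall>i j. v $ i * w $ j = v $ j * w $ i" by simp
next
  assume *: "\<forall>i j. v $ i * w $ j = v $ j * w $ i"
  obtain i where i: "v $ i \<noteq> 0" using assms(1) by (auto simp: vec_eq_iff)
  have w: "w = (w $ i / v $ i) *\<^sub>R v"
    using * i by (auto simp: vec_eq_iff field_simps)
  moreover have "w $ i / v $ i \<noteq> 0"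
  proof
    assume "w $ i / v $ i = 0"
    then have "w = 0" by (subst w) simp
    then show False using assms(2) by simp
  qed
  ultimately show "abs_proj v = abs_proj w" using abs_proj_eq_iff[OF assms] by blast
qed

lemma form_hcoords:
  assumes "form d P" "v \<noteq> 0"
  shows "P (hcoords (abs_proj v)) = 0 \<longleftrightarrow> P (($) v) = 0"
proof -
  obtain c where c: "c \<noteq> 0" "hcoords (abs_proj v) = (\<lambda>k. c * v $ k)"
    using hcoords_abs_proj[OF assms(2)] by blast
  have "P (hcoords (abs_proj v)) = c ^ d * P (($) v)"
    unfolding c(2) by (rule form_scale[OF assms(1)])
  then show ?thesis using c(1) by simp
qed

lemma proj_algebraic_iff:
  "proj_algebraic Z \<longleftrightarrow> (\<exists>\<P>. (\<forall>P\<in>\<P>. \<exists>d. form d P) \<and> Z = {x. \<forall>P\<in>\<P>. P (hcoords x) = 0})"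
proof
  assume "proj_algebraic Z"
  then obtain A where A: "\<forall>p\<in>A. \<exists>d. homogeneous d p" "Z = {x. \<forall>p\<in>A. poly_eval p (hcoords x) = 0}"
    unfolding proj_algebraic_def by blast
  have "\<forall>P\<in>poly_eval ` A. \<exists>d. form d P" using A(1) form_poly_eval by blast
  moreover have "Z = {x. \<forall>P\<in>poly_eval ` A. P (hcoords x) = 0}" using A(2) by auto
  ultimately show "\<exists>\<P>. (\<forall>P\<in>\<P>. \<exists>d. form d P) \<and> Z = {x. \<forall>P\<in>\<P>. P (hcoords x) = 0}" by blast
next
  assume "\<exists>\<P>. (\<forall>P\<in>\<P>. \<exists>d. form d P) \<and> Z = {x. \<forall>P\<in>\<P>. P (hcoords x) = 0}"
  then obtain \<P> where *: "\<forall>P\<in>\<P>. \<exists>d. form d P" "Z = {x. \<forall>P\<in>\<P>. P (hcoords x) = 0}" by blast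
  let ?A = "{p. (\<exists>d. homogeneous d p) \<and> poly_eval p \<in> \<P>}"
  have "\<exists>p\<in>?A. P = poly_eval p" if P: "P \<in> \<P>" for P
  proof -
    obtain d p where p: "homogeneous d p" "\<forall>x. P x = poly_eval p x"
      using *(1) P unfolding form_def by blast
    have "P = poly_eval p" using p(2) by (rule_tac ext) simp
    then show ?thesis using p(1) P by (intro bexI[of _ p]) auto
  qed
  note ex = this
  have "(\<forall>P\<in>\<P>. P (hcoords x) = 0) \<longleftrightarrow> (\<forall>p\<in>?A. poly_eval p (hcoords x) = 0)" for x
  proof
    assume r: "\<forall>P\<in>\<P>. P (hcoords x) = 0"
    show "\<forall>p\<in>?A. poly_eval p (hcoords x) = 0"
    proof
      fix p assume "p \<in> ?A"
      then have "poly_eval p \<in> \<P>" unfolding mem_Collect_eq by (rule conjunct2)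
      then show "poly_eval p (hcoords x) = 0" by (rule bspec[OF r])
    qed
  next
    assume r: "\<forall>p\<in>?A. poly_eval p (hcoords x) = 0"
    show "\<forall>P\<in>\<P>. P (hcoords x) = 0"
    proof
      fix P assume "P \<in> \<P>"
      then obtain p where "p \<in> ?A" and P: "P = poly_eval p" by (rule bexE[OF ex])
      then show "P (hcoords x) = 0" unfolding P by (intro bspec[OF r])
    qed
  qed
  then have "Z = {x. \<forall>p\<in>?A. poly_eval p (hcoords x) = 0}"
    unfolding *(2) by simp
  then show "proj_algebraic Z" unfolding proj_algebraic_def by (intro exI[of _ ?A]) simp
qed

lemma proj_algebraic_zeros: "form d P \<Longrightarrow> proj_algebraic {x. P (hcoords x) = 0}"
  unfolding proj_algebraic_iff by (rule exI[of _ "{P}"]) auto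

lemma proj_algebraic_Inter:
  assumes "\<And>Z. Z \<in> \<Z> \<Longrightarrow> proj_algebraic Z"
  shows "proj_algebraic (\<Inter>\<Z>)"
proof -
  let ?P = "{P. (\<exists>d. form d P) \<and> (\<forall>x\<in>\<Inter>\<Z>. P (hcoords x) = 0)}"
  have "x \<in> \<Inter>\<Z>" if x: "\<forall>P\<in>?P. P (hcoords x) = 0" for x
  proof
    fix Z assume Z: "Z \<in> \<Z>"
    then obtain \<Q> where Q: "\<forall>P\<in>\<Q>. \<exists>d. form d P" "Z = {x. \<forall>P\<in>\<Q>. P (hcoords x) = 0}"
      using assms[OF Z] unfolding proj_algebraic_iff by (elim exE conjE)
    have "P (hcoords x) = 0" if P: "P \<in> \<Q>" for P
    proof -
      have "P (hcoords y) = 0" if "y \<in> Z" for y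
      proof -
        have "\<forall>P\<in>\<Q>. P (hcoords y) = 0" using that unfolding Q(2) by (rule CollectD)
        then show ?thesis by (rule bspec) (rule P)
      qed
      then have "P \<in> ?P" using bspec[OF Q(1) P] Z by auto
      then show ?thesis by (rule bspec[OF x])
    qed
    then show "x \<in> Z" unfolding Q(2) by simp
  qed
  then have "\<Inter>\<Z> = {x. \<forall>P\<in>?P. P (hcoords x) = 0}" by auto
  then show ?thesis unfolding proj_algebraic_iff by (intro exI[of _ ?P]) simp
qed

lemma proj_algebraic_Int: "proj_algebraic A \<Longrightarrow> proj_algebraic B \<Longrightarrow> proj_algebraic (A \<inter> B)"
  using proj_algebraic_Inter[of "{A, B}"] by auto

lemma proj_algebraic_hull: "proj_algebraic (proj_algebraic hull A)"
  by (rule hull_in) (auto intro: proj_algebraic_Inter)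

lemma proj_algebraic_Un:
  assumes "proj_algebraic A" "proj_algebraic B"
  shows "proj_algebraic (A \<union> B)"
proof -
  obtain \<P> where P: "\<forall>P\<in>\<P>. \<exists>d. form d P" "A = {x. \<forall>P\<in>\<P>. P (hcoords x) = 0}"
    using assms(1) unfolding proj_algebraic_iff by blast
  obtain \<Q> where Q: "\<forall>P\<in>\<Q>. \<exists>d. form d P" "B = {x. \<forall>P\<in>\<Q>. P (hcoords x) = 0}"
    using assms(2) unfolding proj_algebraic_iff by blast
  let ?R = "(\<lambda>(P, Q). (\<lambda>x. P x * Q x)) ` (\<P> \<times> \<Q>)"
  have "\<forall>P\<in>?R. \<exists>d. form d P" using P(1) Q(1) form_mult by fastforce
  moreover have "A \<union> B = {x. \<forall>P\<in>?R. P (hcoords x) = 0}"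
    unfolding P(2) Q(2) by auto
  ultimately show ?thesis unfolding proj_algebraic_iff by blast
qed

lemma proj_algebraic_empty [simp]: "proj_algebraic {}"
proof -
  have "form 0 (\<lambda>x. 1)" by (rule form_const)
  from proj_algebraic_zeros[OF this] show ?thesis by simp
qed

lemma proj_algebraic_singleton: "proj_algebraic {z}"
proof -
  let ?M = "\<lambda>(i, j). (\<lambda>x. hcoords z i * x j - hcoords z j * x i)"
  have "form 1 (?M ij)" for ij
    by (cases ij) (auto intro!: form_diff form_cmult form_var[simplified])
  then have "\<forall>P\<in>range ?M. \<exists>d. form d P" by blast
  moreover have "x = z \<longleftrightarrow> (\<forall>P\<in>range ?M. P (hcoords x) = 0)" for x
  proof -
    have "z = x \<longleftrightarrow> (\<forall>i j. rep_proj z $ i * rep_proj x $ j = rep_proj z $ j * rep_proj x $ i)"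
      using abs_proj_eq_iff_cross[OF rep_proj_nonzero[of z] rep_proj_nonzero[of x]] by simp
    then show ?thesis by (auto simp: hcoords_def)
  qed
  then have "{z} = {x. \<forall>P\<in>range ?M. P (hcoords x) = 0}" by blast
  ultimately show ?thesis unfolding proj_algebraic_iff by blast
qed

lemma proj_algebraic_finite: "finite A \<Longrightarrow> proj_algebraic A"
proof (induction A rule: finite_induct)
  case (insert x A)
  then show ?case using proj_algebraic_Un[OF proj_algebraic_singleton[of x]] by auto
qed simp

section \<open>Zariski dimension\<close>

lemma zariski_irreducible_singleton: "Zcl {x} \<Longrightarrow> zariski_irreducible Zcl {x}"
  unfolding zariski_irreducible_def by (auto simp: singleton_Un_iff)

lemma zariski_irreducible_finite:
  assumes "zariski_irreducible Zcl Z" "finite Z" "\<And>A. finite A \<Longrightarrow> Zcl A"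
  shows "\<exists>x. Z = {x}"
proof -
  obtain x where x: "x \<in> Z" using assms(1) unfolding zariski_irreducible_def by blast
  have "Z = {x} \<union> (Z - {x})" "Zcl {x}" "Zcl (Z - {x})" using x assms(2,3) by auto
  then have "Z = {x} \<or> Z = Z - {x}" using assms(1) unfolding zariski_irreducible_def by blast
  then show ?thesis using x by blast
qed

lemma zariski_dim_finite:
  assumes "finite A" "\<And>A. finite A \<Longrightarrow> Zcl A"
  shows "zariski_dim Zcl A = 0"
proof -
  have hull: "Zcl hull A = A" using assms by (intro hull_same) auto
  have "n = 0" if "\<And>i. i \<le> n \<Longrightarrow> zariski_irreducible Zcl (Z i) \<and> Z i \<subseteq> A" "\<And>i. i < n \<Longrightarrow> Z i \<subset> Z (Suc i)"
    for n :: nat and Z :: "nat \<Rightarrow> 'a set"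
  proof (rule ccontr)
    assume "n \<noteq> 0"
    then have "Z 0 \<subset> Z (Suc 0)" using that(2) by blast
    moreover have "\<exists>x. Z 0 = {x}"
      using that(1)[of 0] by (intro zariski_irreducible_finite[of Zcl] assms(2)) (auto intro: finite_subset assms(1))
    moreover have "\<exists>x. Z (Suc 0) = {x}"
      using that(1)[of "Suc 0"] \<open>n \<noteq> 0\<close>
      by (intro zariski_irreducible_finite[of Zcl] assms(2)) (auto intro: finite_subset assms(1))
    ultimately show False by auto
  qed
  then have "{enat n | n. \<exists>Z. (\<forall>i\<le>n. zariski_irreducible Zcl (Z i) \<and> Z i \<subseteq> Zcl hull A) \<and>
                         (\<forall>i<n. Z i \<subset> Z (Suc i))} \<subseteq> {0}"
    unfolding hull by (auto simp: zero_enat_def)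
  then have "zariski_dim Zcl A \<le> 0"
    unfolding zariski_dim_def by (intro Sup_least) auto
  then show ?thesis by simp
qed

text \<open>In a chain of three sets the middle one is a proper closed subset of \<open>C\<close>,
  hence finite, hence a single point, which leaves no room below it. Only the hull of
  \<open>A\<close> enters, so the result also applies to a small piece of a curve.\<close>

lemma zariski_dim_curve:
  assumes C: "zariski_irreducible Zcl C" "infinite C"
    and fin: "\<And>A. finite A \<Longrightarrow> Zcl A"
    and proper: "\<And>Z. Zcl Z \<Longrightarrow> Z \<subset> C \<Longrightarrow> finite Z"
    and hull: "Zcl hull A = C"
  shows "zariski_dim Zcl A = 1"
proof -
  let ?N = "{enat n | n. \<exists>Z. (\<forall>i\<le>n. zariski_irreducible Zcl (Z i) \<and> Z i \<subseteq> Zcl hull A) \<and>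
                         (\<forall>i<n. Z i \<subset> Z (Suc i))}"
  have "n \<le> 1" if Z: "\<forall>i\<le>n. zariski_irreducible Zcl (Z i) \<and> Z i \<subseteq> C" "\<forall>i<n. Z i \<subset> Z (Suc i)"
    for n :: nat and Z :: "nat \<Rightarrow> 'a set"
  proof (rule ccontr)
    assume "\<not> n \<le> 1"
    then have n: "0 < n" "1 < n" "2 \<le> n" by auto
    have sub: "Z 0 \<subset> Z 1" "Z 1 \<subset> Z 2" using Z(2) n by (auto simp: numeral_2_eq_2)
    have "Z 1 \<subset> C" using sub(2) Z(1) n(3) by blast
    have irr: "zariski_irreducible Zcl (Z 1)" "zariski_irreducible Zcl (Z 0)" using Z(1) n by auto
    have "Zcl (Z 1)" using irr(1) unfolding zariski_irreducible_def by (rule conjunct1)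
    then have fin1: "finite (Z 1)" using \<open>Z 1 \<subset> C\<close> by (rule proper)
    then have fin0: "finite (Z 0)" by (rule finite_subset[OF psubset_imp_subset[OF sub(1)]])
    have "\<exists>x. Z 1 = {x}" by (rule zariski_irreducible_finite[OF irr(1) fin1 fin])
    moreover have "\<exists>y. Z 0 = {y}" by (rule zariski_irreducible_finite[OF irr(2) fin0 fin])
    ultimately show False using sub(1) by auto
  qed
  then have "\<forall>k\<in>?N. k \<le> 1" unfolding hull by (auto simp: one_enat_def)
  moreover have "1 \<in> ?N"
  proof -
    obtain x where x: "x \<in> C" using C(2) by fastforce
    have "{x} \<subset> C" using x C(2) by (metis finite.emptyI finite_insert psubsetI empty_subsetI insert_subset)
    moreover have "zariski_irreducible Zcl {x}" by (rule zariski_irreducible_singleton) (simp add: fin)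
    ultimately show ?thesis
      unfolding hull using C(1)
      by (auto simp: one_enat_def split: if_splits intro!: exI[of _ "1::nat"] exI[of _ "\<lambda>i. if i = 0 then {x} else C"])
  qed
  ultimately show ?thesis
    unfolding zariski_dim_def by (intro antisym Sup_least Sup_upper) auto
qed

subsection \<open>Curves with a polynomial parametrization\<close>

definition curve_point :: "('k \<Rightarrow> real poly) \<Rightarrow> real \<Rightarrow> ('k::finite) proj" where
  "curve_point F t = abs_proj (\<chi> k. poly (F k) t)"

definition curve_closure :: "('k \<Rightarrow> real poly) \<Rightarrow> ('k::finite) proj set" where
  "curve_closure F = proj_algebraic hull (range (curve_point F))"

text \<open>Only real roots are excluded: this is what makes the point of real projective space well
  defined at each real parameter.\<close>

definition no_common_root :: "('k \<Rightarrow> real poly) \<Rightarrow> bool" where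
  "no_common_root F \<longleftrightarrow> (\<forall>t. \<exists>k. poly (F k) t \<noteq> 0)"

lemma curve_vec_nonzero: "no_common_root F \<Longrightarrow> (\<chi> k. poly (F k) t) \<noteq> 0"
  by (auto simp: no_common_root_def vec_eq_iff)

lemma form_curve_point:
  assumes "no_common_root F" "form d P"
  shows "P (hcoords (curve_point F t)) = 0 \<longleftrightarrow> P (\<lambda>k. poly (F k) t) = 0"
proof -
  have "($) (\<chi> k. poly (F k) t) = (\<lambda>k. poly (F k) t)" by (rule ext) simp
  then show ?thesis
    unfolding curve_point_def
    using form_hcoords[OF assms(2) curve_vec_nonzero[OF assms(1)], of t] by simp
qed

lemma curve_closure_form_zero:
  assumes "no_common_root F" "form d P" "\<And>t. P (\<lambda>k. poly (F k) t) = 0" "x \<in> curve_closure F"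
  shows "P (hcoords x) = 0"
proof -
  have "curve_closure F \<subseteq> {x. P (hcoords x) = 0}"
    unfolding curve_closure_def
    by (rule hull_minimal) (auto simp: proj_algebraic_zeros[OF assms(2)] form_curve_point[OF assms(1,2)] assms(3))
  then show ?thesis using assms(4) by blast
qed

lemma curve_closure_imp_cone:
  assumes "no_common_root F" "v \<noteq> 0" "abs_proj v \<in> curve_closure F"
  shows "v \<in> curve_cone F"
  unfolding curve_cone_def
  using curve_closure_form_zero[OF assms(1) _ _ assms(3)] form_hcoords[OF _ assms(2)] assms(2) by blast

text \<open>Each point has a representative with one coordinate equal to 1, and there are finitely
  many choices of that coordinate.\<close>

lemma finite_zeros_on_curve:
  assumes "no_common_root F" "form d P" "P (\<lambda>k. poly (F k) t0) \<noteq> 0"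
  shows "finite {x \<in> curve_closure F. P (hcoords x) = 0}"
proof -
  let ?V = "\<lambda>a. {v \<in> curve_cone F. P (($) v) = 0 \<and> v $ a = 1}"
  have "{x \<in> curve_closure F. P (hcoords x) = 0} \<subseteq> (\<Union>a. abs_proj ` ?V a)"
  proof
    fix x assume x: "x \<in> {x \<in> curve_closure F. P (hcoords x) = 0}"
    obtain w where w: "w \<noteq> 0" "x = abs_proj w" by (rule proj_cases)
    obtain a where a: "w $ a \<noteq> 0" using w(1) by (auto simp: vec_eq_iff)
    define v where "v = (1 / w $ a) *\<^sub>R w"
    have v: "v \<noteq> 0" "x = abs_proj v" "v $ a = 1"
      using w a by (auto simp: v_def abs_proj_scale)
    then have "v \<in> ?V a"
      using x curve_closure_imp_cone[OF assms(1) v(1)] form_hcoords[OF assms(2) v(1)] by simp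
    then show "x \<in> (\<Union>a. abs_proj ` ?V a)" using v(2) by blast
  qed
  moreover have "finite (\<Union>a. abs_proj ` ?V a)"
    by (intro finite_UN_I finite_imageI curve_cone_finite[OF assms(2,3)] finite)
  ultimately show ?thesis by (rule finite_subset)
qed

text \<open>Either all defining forms vanish along the parametrization, hence on its closure, or one
  of them does not and has finitely many zeros there. Irreducibility and dimension 1 of the closure
  both rest on this dichotomy.\<close>

lemma curve_closed_subset_cases:
  assumes "no_common_root F" "proj_algebraic Z"
  shows "curve_closure F \<subseteq> Z \<or> finite (curve_closure F \<inter> Z)"
proof -
  obtain \<P> where P: "\<forall>P\<in>\<P>. \<exists>d. form d P" "Z = {x. \<forall>P\<in>\<P>. P (hcoords x) = 0}"
    using assms(2) unfolding proj_algebraic_iff by blast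
  show ?thesis
  proof (cases "\<forall>P\<in>\<P>. \<forall>t. P (\<lambda>k. poly (F k) t) = 0")
    case True
    have "P (hcoords x) = 0" if "P \<in> \<P>" "x \<in> curve_closure F" for P x
      using P(1) True that curve_closure_form_zero[OF assms(1), of _ P x] by blast
    then show ?thesis unfolding P(2) by blast
  next
    case False
    then obtain P t0 d where *: "P \<in> \<P>" "P (\<lambda>k. poly (F k) t0) \<noteq> 0" "form d P" using P(1) by blast
    have "curve_closure F \<inter> Z \<subseteq> {x \<in> curve_closure F. P (hcoords x) = 0}"
      unfolding P(2) using *(1) by blast
    then show ?thesis using finite_zeros_on_curve[OF assms(1) *(3,2)] finite_subset by blast
  qed
qed

lemma curve_point_in_closure: "curve_point F t \<in> curve_closure F"
  unfolding curve_closure_def by (rule hull_inc) simp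

text \<open>The minors with a fixed vector are polynomials in t, so a point that is hit infinitely
  often is hit always.\<close>

lemma curve_fibre:
  assumes "no_common_root F" "infinite {t. curve_point F t = z}"
  shows "curve_point F t = z"
proof -
  obtain w where w: "w \<noteq> 0" "z = abs_proj w" by (rule proj_cases)
  have eq: "curve_point F t = z \<longleftrightarrow> (\<forall>i j. poly (F i) t * w $ j = poly (F j) t * w $ i)" for t
    unfolding curve_point_def w(2) abs_proj_eq_iff_cross[OF curve_vec_nonzero[OF assms(1)] w(1)] by simp
  have "smult (w $ j) (F i) = smult (w $ i) (F j)" for i j
  proof (rule poly_eq_if_infinite)
    have "{t. curve_point F t = z} \<subseteq> {t. poly (smult (w $ j) (F i)) t = poly (smult (w $ i) (F j)) t}"
      using eq by (auto simp: mult.commute)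
    then show "infinite {t. poly (smult (w $ j) (F i)) t = poly (smult (w $ i) (F j)) t}"
      using assms(2) finite_subset by blast
  qed
  then have "poly (smult (w $ j) (F i)) t = poly (smult (w $ i) (F j)) t" for i j by simp
  then show ?thesis using eq by (simp add: mult.commute)
qed

lemma infinite_curve_image:
  assumes "no_common_root F" "curve_point F s \<noteq> curve_point F t" "infinite A"
  shows "infinite (curve_point F ` A)"
proof
  assume "finite (curve_point F ` A)"
  then obtain a where "infinite {t \<in> A. curve_point F t = curve_point F a}"
    using pigeonhole_infinite[OF assms(3)] by blast
  then have "infinite {t. curve_point F t = curve_point F a}"
    by (rule contrapos_nn) (erule rev_finite_subset, blast)
  then show False using curve_fibre[OF assms(1)] assms(2) by metis
qed

lemma curve_proper_closed_finite:
  assumes "no_common_root F" "proj_algebraic Z" "Z \<subset> curve_closure F"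
  shows "finite Z"
  using curve_closed_subset_cases[OF assms(1,2)] assms(3)
  by (metis inf.absorb2 less_le_not_le psubset_imp_subset)

text \<open>An infinite set of points determines the curve; two parametrizations sharing infinitely
  many points therefore have the same closure.\<close>

lemma curve_hull_infinite:
  assumes "no_common_root F" "A \<subseteq> curve_closure F" "infinite A"
  shows "proj_algebraic hull A = curve_closure F"
proof
  show "proj_algebraic hull A \<subseteq> curve_closure F"
    using assms(2) unfolding curve_closure_def by (intro hull_minimal) (auto simp: proj_algebraic_hull)
  have "infinite (curve_closure F \<inter> proj_algebraic hull A)"
    using assms(2,3) hull_subset[of A proj_algebraic] by (meson finite_subset le_inf_iff)
  then show "curve_closure F \<subseteq> proj_algebraic hull A"
    using curve_closed_subset_cases[OF assms(1) proj_algebraic_hull[of A]] by blast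
qed

lemma curve_irreducible:
  assumes "no_common_root F" "infinite (curve_closure F)"
  shows "zariski_irreducible proj_algebraic (curve_closure F)"
  unfolding zariski_irreducible_def
proof (intro conjI allI impI)
  show "proj_algebraic (curve_closure F)" by (simp add: curve_closure_def proj_algebraic_hull)
  show "curve_closure F \<noteq> {}" using curve_point_in_closure by blast
  fix A B assume AB: "proj_algebraic A \<and> proj_algebraic B \<and> curve_closure F = A \<union> B"
  show "curve_closure F = A \<or> curve_closure F = B"
  proof (rule ccontr)
    assume "\<not> ?thesis"
    then have "A \<subset> curve_closure F" "B \<subset> curve_closure F" using AB by blast+
    then have "finite A" "finite B" using AB curve_proper_closed_finite[OF assms(1)] by blast+
    then show False using AB assms(2) by simp
  qed
qed

lemma zariski_dim_curve_subset:
  assumes "no_common_root F" "A \<subseteq> curve_closure F" "infinite A"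
  shows "zariski_dim proj_algebraic A = 1"
proof -
  have inf: "infinite (curve_closure F)" using assms(2,3) finite_subset by blast
  show ?thesis
    by (rule zariski_dim_curve[OF curve_irreducible[OF assms(1) inf] inf proj_algebraic_finite
        curve_proper_closed_finite[OF assms(1)] curve_hull_infinite[OF assms]])
qed

lemma curve_projective_irreducible:
  assumes "no_common_root F" "infinite (curve_closure F)"
  shows "projective_irreducible_curve (curve_closure F)"
  unfolding projective_irreducible_curve_def
  using curve_irreducible[OF assms] zariski_dim_curve_subset[OF assms(1) order.refl assms(2)] by blast

section \<open>Lueroth's theorem\<close>

text \<open>Closure under \<open>inverse\<close> is demanded without exception because
  \<open>inverse 0 = 0\<close>. The real constants are not included; where they matter, they are a
  separate hypothesis.\<close>

definition subfield_set :: "'a::field set \<Rightarrow> bool" where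
  "subfield_set S \<longleftrightarrow> 0 \<in> S \<and> 1 \<in> S \<and> (\<forall>x\<in>S. \<forall>y\<in>S. x + y \<in> S \<and> x * y \<in> S) \<and>
     (\<forall>x\<in>S. - x \<in> S \<and> inverse x \<in> S)"

lemma subfield_setD:
  assumes "subfield_set S"
  shows "0 \<in> S" "1 \<in> S" "x \<in> S \<Longrightarrow> y \<in> S \<Longrightarrow> x + y \<in> S" "x \<in> S \<Longrightarrow> y \<in> S \<Longrightarrow> x * y \<in> S"
    "x \<in> S \<Longrightarrow> - x \<in> S" "x \<in> S \<Longrightarrow> inverse x \<in> S" "x \<in> S \<Longrightarrow> y \<in> S \<Longrightarrow> x - y \<in> S"
    "x \<in> S \<Longrightarrow> y \<in> S \<Longrightarrow> x / y \<in> S"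
proof -
  show *: "0 \<in> S" "1 \<in> S" "x \<in> S \<Longrightarrow> y \<in> S \<Longrightarrow> x + y \<in> S" "x \<in> S \<Longrightarrow> y \<in> S \<Longrightarrow> x * y \<in> S"
    "x \<in> S \<Longrightarrow> - x \<in> S" "x \<in> S \<Longrightarrow> inverse x \<in> S" for x y
    using assms unfolding subfield_set_def by auto
  show "x \<in> S \<Longrightarrow> y \<in> S \<Longrightarrow> x - y \<in> S" using *(3)[of x "- y"] *(5) by simp
  show "x \<in> S \<Longrightarrow> y \<in> S \<Longrightarrow> x / y \<in> S" using *(4)[of x "inverse y"] *(6) by (simp add: divide_inverse)
qed

text \<open>Long division only ever divides by the leading coefficient of \<open>w\<close>, so it
  does not leave the subfield. The divisibility is over the large field, the coefficients of the
  remainder are in the small one.\<close>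

lemma subfield_division:
  fixes p w :: "'a::field poly"
  assumes S: "subfield_set S" and w: "\<And>i. coeff w i \<in> S" "w \<noteq> 0" and p: "\<And>i. coeff p i \<in> S"
  shows "\<exists>r. w dvd p - r \<and> (\<forall>i. coeff r i \<in> S) \<and> (r = 0 \<or> degree r < degree w)"
  using p
proof (induction "degree p" arbitrary: p rule: less_induct)
  case less
  show ?case
  proof (cases "p = 0 \<or> degree p < degree w")
    case True
    then show ?thesis using less.prems by (intro exI[of _ p]) simp
  next
    case False
    define c where "c = lead_coeff p / lead_coeff w"
    define q where "q = p - monom c (degree p - degree w) * w"
    have c: "c \<in> S" unfolding c_def by (intro subfield_setD[OF S] less.prems w)
    have q: "coeff q i \<in> S" for i
      unfolding q_def coeff_diff coeff_monom_mult
      using less.prems subfield_setD[OF S] c w(1) by auto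
    have deg: "degree q \<le> degree p"
    proof -
      have "degree (monom c (degree p - degree w) * w) \<le> degree (monom c (degree p - degree w)) + degree w"
        by (rule degree_mult_le)
      also have "\<dots> \<le> (degree p - degree w) + degree w"
        by (intro add_right_mono degree_monom_le)
      finally show ?thesis unfolding q_def using False by (intro degree_diff_le) auto
    qed
    have "coeff q (degree p) = 0"
      using False w(2) by (simp add: q_def coeff_monom_mult c_def)
    then have "q = 0 \<or> degree q < degree p"
      using deg by (metis eq_zero_or_degree_less)
    then have "\<exists>r. w dvd q - r \<and> (\<forall>i. coeff r i \<in> S) \<and> (r = 0 \<or> degree r < degree w)"
    proof
      assume "q = 0"
      then show ?thesis using subfield_setD(1)[OF S] by (intro exI[of _ 0]) simp
    next
      assume "degree q < degree p"
      then show ?thesis using less.hyps q by blast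
    qed
    then obtain r where r: "w dvd q - r" "\<forall>i. coeff r i \<in> S" "r = 0 \<or> degree r < degree w" by blast
    have "w dvd (q - r) + monom c (degree p - degree w) * w"
      by (intro dvd_add r(1)) simp
    then have "w dvd p - r" by (simp add: q_def)
    then show ?thesis using r by blast
  qed
qed

text \<open>The type \<open>real poly fract\<close> is the field of rational functions in t. The map
  \<open>hc\<close> embeds the constants, \<open>emb\<close> turns a real polynomial into one in a
  new variable Y over this field, and \<open>fX\<close> below is t, so that
  \<open>poly (emb p) fX\<close> is p(t).\<close>

definition hc :: "real \<Rightarrow> real poly fract" where "hc c = to_fract [:c:]"

definition emb :: "real poly \<Rightarrow> real poly fract poly" where "emb p = map_poly hc p"

lemma hc_0 [simp]: "hc 0 = 0" and hc_1 [simp]: "hc 1 = 1"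
  and hc_add: "hc (a + b) = hc a + hc b" and hc_mult: "hc (a * b) = hc a * hc b"
  and hc_uminus: "hc (- a) = - hc a" and hc_eq_0_iff [simp]: "hc a = 0 \<longleftrightarrow> a = 0"
proof -
  show "hc 0 = 0" "hc 1 = 1" by (simp_all add: hc_def flip: one_pCons)
  show "hc (a + b) = hc a + hc b" by (simp add: hc_def flip: to_fract_add)
  show "hc (a * b) = hc a * hc b" by (simp add: hc_def flip: to_fract_mult)
  show "hc (- a) = - hc a" by (simp add: hc_def flip: to_fract_uminus)
  show "hc a = 0 \<longleftrightarrow> a = 0" by (simp add: hc_def)
qed

lemma coeff_emb [simp]: "coeff (emb p) i = hc (coeff p i)"
  by (simp add: emb_def coeff_map_poly)

lemma emb_0 [simp]: "emb 0 = 0" by (simp add: emb_def)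

lemma emb_pCons: "emb (pCons a p) = pCons (hc a) (emb p)"
  by (rule poly_eqI) (simp add: coeff_pCons split: nat.split)

lemma emb_add: "emb (p + q) = emb p + emb q"
  by (simp add: poly_eq_iff hc_add)

lemma emb_smult: "emb (smult c p) = smult (hc c) (emb p)"
  by (simp add: poly_eq_iff hc_mult)

lemma emb_mult: "emb (p * q) = emb p * emb q"
  by (induction p) (simp_all add: emb_pCons emb_add emb_smult)

definition fX :: "real poly fract" where "fX = to_fract [:0, 1:]"

lemma poly_emb_fX: "poly (emb p) fX = to_fract p"
proof (induction p)
  case (pCons a p)
  have "pCons a p = [:a:] + [:0, 1:] * p" by simp
  then have "to_fract (pCons a p) = to_fract [:a:] + to_fract [:0, 1:] * to_fract p"
    by (simp only: to_fract_add to_fract_mult)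
  then show ?case using pCons by (simp add: emb_pCons hc_def fX_def)
qed simp

definition simple_ext :: "real poly fract \<Rightarrow> real poly fract set" where
  "simple_ext s = {poly (emb A) s / poly (emb B) s | A B. poly (emb B) s \<noteq> 0}"

lemma simple_extI: "poly (emb B) s \<noteq> 0 \<Longrightarrow> poly (emb A) s / poly (emb B) s \<in> simple_ext s"
  unfolding simple_ext_def by blast

lemma simple_ext_hc: "hc c \<in> simple_ext s"
  using simple_extI[of 1 s "[:c:]"] by (simp add: emb_pCons one_pCons)

lemma simple_ext_self: "s \<in> simple_ext s"
  using simple_extI[of 1 s "[:0,1:]"] by (simp add: emb_pCons one_pCons)

lemma subfield_simple_ext: "subfield_set (simple_ext s)"
  unfolding subfield_set_def
proof (intro conjI ballI)
  show "0 \<in> simple_ext s" using simple_ext_hc[of 0 s] by simp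
  show "1 \<in> simple_ext s" using simple_ext_hc[of 1 s] by simp
  fix x assume "x \<in> simple_ext s"
  then obtain A B where AB: "x = poly (emb A) s / poly (emb B) s" "poly (emb B) s \<noteq> 0"
    unfolding simple_ext_def by blast
  have "- x = poly (emb (smult (-1) A)) s / poly (emb B) s"
    unfolding AB(1) emb_smult hc_uminus by simp
  then show "- x \<in> simple_ext s" using simple_extI[OF AB(2)] by simp
  show "inverse x \<in> simple_ext s"
  proof (cases "poly (emb A) s = 0")
    case True
    then show ?thesis using \<open>0 \<in> simple_ext s\<close> by (simp add: AB(1))
  next
    case False
    then show ?thesis using simple_extI[OF False, of B] by (simp add: AB(1))
  qed
  fix y assume "y \<in> simple_ext s"
  then obtain A' B' where AB': "y = poly (emb A') s / poly (emb B') s" "poly (emb B') s \<noteq> 0"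
    unfolding simple_ext_def by blast
  have nz: "poly (emb (B * B')) s \<noteq> 0" using AB(2) AB'(2) by (simp add: emb_mult)
  have "x + y = poly (emb (A * B' + A' * B)) s / poly (emb (B * B')) s"
    using AB(2) AB'(2) by (simp add: AB(1) AB'(1) emb_mult emb_add add_frac_eq)
  then show "x + y \<in> simple_ext s" using simple_extI[OF nz] by simp
  have "x * y = poly (emb (A * A')) s / poly (emb (B * B')) s"
    by (simp add: AB(1) AB'(1) emb_mult)
  then show "x * y \<in> simple_ext s" using simple_extI[OF nz] by simp
qed

lemma poly_in_subfield:
  assumes "subfield_set K" "\<And>i. coeff p i \<in> K" "x \<in> K"
  shows "poly p x \<in> K"
  using assms(2)
proof (induction p)
  case 0
  then show ?case using subfield_setD(1)[OF assms(1)] by simp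
next
  case (pCons a p)
  have "a \<in> K" using pCons.prems[of 0] by simp
  moreover have "coeff p i \<in> K" for i using pCons.prems[of "Suc i"] by simp
  ultimately show ?case using pCons.IH subfield_setD(3,4)[OF assms(1)] assms(3) by simp
qed

lemma simple_ext_subset:
  assumes "subfield_set K" "\<And>c. hc c \<in> K" "s \<in> K"
  shows "simple_ext s \<subseteq> K"
  unfolding simple_ext_def using assms by (auto intro!: subfield_setD(8)[OF assms(1)] poly_in_subfield)

lemma coeff_eval_const:
  fixes P :: "real poly poly"
  shows "coeff (poly P [:y:]) m = poly (map_poly (\<lambda>c. coeff c m) P) y"
proof (induction P)
  case (pCons a P)
  then show ?case by (simp add: map_poly_pCons mult.commute[of "[:y:]"])
qed simp

text \<open>In a polynomial in Y over the polynomials in t, the coefficient of t^m after setting Y =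
  y is a polynomial in y. If it is not zero, all but finitely many y keep t^m.\<close>

lemma finite_bad_eval:
  fixes P :: "real poly poly"
  assumes "coeff (coeff P k) m \<noteq> 0"
  shows "finite {y. coeff (poly P [:y:]) m = 0}"
proof -
  have "coeff (map_poly (\<lambda>c. coeff c m) P) k \<noteq> 0" using assms by (simp add: coeff_map_poly)
  then have "map_poly (\<lambda>c. coeff c m) P \<noteq> 0" by auto
  then show ?thesis unfolding coeff_eval_const by (rule poly_roots_finite)
qed

lemma map_poly_coeff_mult_const:
  fixes P :: "real poly poly"
  shows "map_poly (\<lambda>c. coeff c m) (P * map_poly (\<lambda>c. [:c:]) e) = map_poly (\<lambda>c. coeff c m) P * e"
proof (rule poly_eqI)
  fix k
  have "coeff (p * [:c:]) m = coeff p m * c" for p :: "real poly" and c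
    by (simp add: mult.commute[of p])
  then show "coeff (map_poly (\<lambda>c. coeff c m) (P * map_poly (\<lambda>c. [:c:]) e)) k =
      coeff (map_poly (\<lambda>c. coeff c m) P * e) k"
    by (simp add: coeff_map_poly coeff_mult coeff_sum mult.commute[of "coeff e _"])
qed

text \<open>That \<open>u\<close> / \<open>v\<close> is not constant means that \<open>u\<close> and
  \<open>v\<close> are linearly independent over the reals.\<close>

lemma const_of_prop:
  fixes u v :: "real poly"
  assumes "v \<noteq> 0" "to_fract u / to_fract v \<notin> range hc" "smult \<alpha> v = smult \<beta> u"
  shows "\<alpha> = 0 \<and> \<beta> = 0"
proof (rule ccontr)
  assume *: "\<not> ?thesis"
  have "\<beta> \<noteq> 0" using * assms(1,3) by auto
  then have "u = smult (\<alpha> / \<beta>) v"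
    using assms(3) by (metis divide_self_if right_inverse_eq smult_1_left smult_smult times_divide_eq_left mult.commute)
  then have "to_fract u = hc (\<alpha> / \<beta>) * to_fract v"
    unfolding hc_def to_fract_mult[symmetric] by simp
  then have "to_fract u / to_fract v = hc (\<alpha> / \<beta>)" using assms(1) by simp
  then show False using assms(2) by blast
qed

definition theta :: "real poly \<Rightarrow> real poly \<Rightarrow> real poly poly" where
  "theta u v = map_poly (\<lambda>c. smult c v) u - map_poly (\<lambda>c. smult c u) v"

lemma coeff_theta: "coeff (theta u v) k = smult (coeff u k) v - smult (coeff v k) u"
  by (simp add: theta_def coeff_map_poly)

text \<open>The heart of Lueroth's theorem: comparing degrees in both variables, the polynomial
  \<open>u(Y) v(t) - u(t) v(Y)\<close> has no divisor of full degree in \<open>t\<close> other than itself.\<close>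

lemma theta_factor_degree:
  fixes u v :: "real poly" and D' E :: "real poly poly"
  assumes cop: "coprime u v" and v: "v \<noteq> 0" and nonconst: "to_fract u / to_fract v \<notin> range hc"
    and fact: "theta u v = D' * E"
    and big: "degree (coeff D' k1) \<ge> max (degree u) (degree v)" "coeff D' k1 \<noteq> 0"
  shows "degree D' = max (degree u) (degree v)"
proof -
  define n where "n = max (degree u) (degree v)"
  note np = const_of_prop[OF v nonconst]
  have n_pos: "coeff u n \<noteq> 0 \<or> coeff v n \<noteq> 0"
  proof (cases "degree u \<ge> degree v")
    case True
    have "u \<noteq> 0" using nonconst by (auto intro: rev_image_eqI[of 0])
    then show ?thesis using True by (simp add: n_def max_def)
  qed (use v in \<open>simp add: n_def max_def\<close>)
  have th_n: "coeff (theta u v) n \<noteq> 0"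
    using np[of "coeff u n" "coeff v n"] n_pos by (auto simp: coeff_theta)
  have deg_th: "degree (theta u v) = n"
  proof (rule antisym)
    show "degree (theta u v) \<le> n"
      by (rule degree_le) (auto simp: coeff_theta n_def coeff_eq_0)
    show "n \<le> degree (theta u v)" using th_n by (rule le_degree)
  qed
  have "theta u v \<noteq> 0" using th_n by auto
  then have nz: "D' \<noteq> 0" "E \<noteq> 0" using fact by auto
  have ev_th: "degree (poly (theta u v) [:y:]) \<le> n" for y
  proof -
    have "coeff (poly (theta u v) [:y:]) m = 0" if "m > n" for m
    proof -
      have "map_poly (\<lambda>c. coeff c m) (theta u v) = 0"
        using that by (simp add: poly_eq_iff coeff_map_poly coeff_theta n_def coeff_eq_0)
      then show ?thesis by (simp add: coeff_eval_const)
    qed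
    then show ?thesis by (rule degree_le[rule_format])
  qed
  \<comment> \<open>A generic value y of Y preserves the degrees in t of both chosen coefficients.
    Their sum would exceed n if \<open>E\<close> involved t, while the product has degree at most n
    in t.\<close>
  have E_const: "degree (coeff E k) = 0" for k
  proof (rule ccontr)
    assume k: "degree (coeff E k) \<noteq> 0"
    let ?M1 = "degree (coeff D' k1)" and ?M2 = "degree (coeff E k)"
    have "finite ({y. coeff (poly D' [:y:]) ?M1 = 0} \<union> {y. coeff (poly E [:y:]) ?M2 = 0})"
      using big(2) k by (intro finite_UnI finite_bad_eval[of _ k1] finite_bad_eval[of _ k]) auto
    then obtain y where y: "coeff (poly D' [:y:]) ?M1 \<noteq> 0" "coeff (poly E [:y:]) ?M2 \<noteq> 0"
      using ex_new_if_finite[OF infinite_UNIV_char_0[where 'a=real]] by blast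
    have "n + 1 \<le> ?M1 + ?M2" using big(1) k unfolding n_def by linarith
    also have "\<dots> \<le> degree (poly D' [:y:]) + degree (poly E [:y:])"
      using y by (intro add_mono le_degree)
    also have "\<dots> = degree (poly (theta u v) [:y:])"
      unfolding fact poly_mult using y by (intro degree_mult_eq[symmetric]) auto
    also have "\<dots> \<le> n" by (rule ev_th)
    finally show False by simp
  qed
  define e where "e = map_poly (\<lambda>c. coeff c 0) E"
  have E: "E = map_poly (\<lambda>c. [:c:]) e"
  proof (rule poly_eqI)
    fix k
    have "coeff E k = [:coeff (coeff E k) 0:]" using degree_0_id[OF E_const[of k]] by simp
    then show "coeff E k = coeff (map_poly (\<lambda>c. [:c:]) e) k"
      by (simp add: e_def coeff_map_poly)
  qed
  have "e dvd smult (coeff v m) u - smult (coeff u m) v" for m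
  proof -
    have "smult (coeff v m) u - smult (coeff u m) v = map_poly (\<lambda>c. coeff c m) (theta u v)"
      by (simp add: poly_eq_iff coeff_map_poly coeff_theta mult.commute)
    also have "\<dots> = map_poly (\<lambda>c. coeff c m) D' * e"
      unfolding fact E by (rule map_poly_coeff_mult_const)
    finally show ?thesis by simp
  qed note edvd = this
  \<comment> \<open>By independence some 2x2 minor of the coefficients of \<open>u\<close> and
    \<open>v\<close> is nonzero. Cramer's rule then recovers \<open>u\<close> and \<open>v\<close>
    from two combinations divisible by \<open>e\<close>, so \<open>e\<close> divides both and is a
    unit.\<close>
  have "smult (coeff u n) v \<noteq> smult (coeff v n) u"
    using np[of "coeff u n" "coeff v n"] n_pos by auto
  then obtain m where m: "coeff u n * coeff v m - coeff v n * coeff u m \<noteq> 0"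
    by (auto simp: poly_eq_iff)
  let ?\<Delta> = "coeff u n * coeff v m - coeff v n * coeff u m"
  let ?p = "\<lambda>m. smult (coeff v m) u - smult (coeff u m) v"
  have "smult ?\<Delta> u = smult (coeff u n) (?p m) - smult (coeff u m) (?p n)"
    by (simp add: smult_diff_right smult_diff_left algebra_simps)
  then have "e dvd smult ?\<Delta> u" using edvd by (simp add: dvd_smult)
  then have "e dvd u" using m dvd_smult_cancel by blast
  moreover have "smult ?\<Delta> v = smult (coeff v n) (?p m) - smult (coeff v m) (?p n)"
    by (simp add: smult_diff_right smult_diff_left algebra_simps)
  then have "e dvd smult ?\<Delta> v" using edvd by (simp add: dvd_smult)
  then have "e dvd v" using m dvd_smult_cancel by blast
  ultimately have "is_unit e" using cop by (rule coprime_common_divisor[rotated])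
  then have "degree e = 0" by (auto simp: is_unit_poly_iff)
  moreover have "degree E \<le> degree e" unfolding E by (rule degree_le) (simp add: coeff_map_poly coeff_eq_0)
  ultimately have "degree E = 0" by simp
  moreover have "degree (theta u v) = degree D' + degree E"
    unfolding fact using nz by (rule degree_mult_eq)
  ultimately show ?thesis using deg_th by (simp add: n_def)
qed

lemma degree_emb [simp]: "degree (emb p) = degree p"
proof (rule antisym)
  show "degree (emb p) \<le> degree p" by (rule degree_le) (simp add: coeff_eq_0)
  show "degree p \<le> degree (emb p)"
    by (cases "p = 0") (auto intro!: le_degree)
qed

lemma fract_eq_quot:
  fixes f :: "real poly fract"
  shows "f = to_fract (fst (quot_of_fract f)) / to_fract (snd (quot_of_fract f))"
proof -
  have "f = quot_to_fract (quot_of_fract f)" by simp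
  also have "\<dots> = to_fract (fst (quot_of_fract f)) / to_fract (snd (quot_of_fract f))"
    unfolding quot_to_fract_def by (simp only: split_beta Fract_conv_to_fract)
  finally show ?thesis .
qed

text \<open>This is the minimal polynomial of t over \<open>K\<close>. If \<open>f0\<close> = a/b,
  then t is a root of a(Y) - f0 b(Y), which has coefficients in \<open>K\<close> and is not zero
  because \<open>f0\<close> is not constant.\<close>

lemma luroth_minimal_polynomial:
  assumes K: "subfield_set K" "\<And>c. hc c \<in> K" and f0: "f0 \<in> K" "f0 \<notin> range hc"
  obtains D where "\<And>i. coeff D i \<in> K" "lead_coeff D = 1" "poly D fX = 0"
    "\<And>p. (\<And>i. coeff p i \<in> K) \<Longrightarrow> poly p fX = 0 \<Longrightarrow> p = 0 \<or> degree D \<le> degree p"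
proof -
  let ?Q = "\<lambda>p. p \<noteq> 0 \<and> (\<forall>i. coeff p i \<in> K) \<and> poly p fX = 0"
  obtain a b where ab: "f0 = to_fract a / to_fract b" "b \<noteq> 0"
    using fract_eq_quot[of f0] that snd_quot_of_fract_nonzero by blast
  define p0 where "p0 = emb a - smult f0 (emb b)"
  have "?Q p0"
  proof (intro conjI allI)
    show "p0 \<noteq> 0"
    proof
      assume "p0 = 0"
      then have eq: "hc (coeff a i) = f0 * hc (coeff b i)" for i
        unfolding p0_def poly_eq_iff by simp
      obtain i where i: "coeff b i \<noteq> 0" using ab(2) by (auto simp: poly_eq_iff)
      have "hc (coeff a i / coeff b i) * hc (coeff b i) = hc (coeff a i)"
        using i by (simp flip: hc_mult)
      then have "f0 = hc (coeff a i / coeff b i)" using eq[of i] i by simp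
      then show False using f0(2) by blast
    qed
    show "coeff p0 i \<in> K" for i
      unfolding p0_def by (auto intro!: subfield_setD[OF K(1)] K(2) f0)
    show "poly p0 fX = 0" using ab by (simp add: p0_def poly_emb_fX)
  qed
  then obtain D0 where D0: "?Q D0" "\<And>p. ?Q p \<Longrightarrow> degree D0 \<le> degree p"
    using ex_has_least_nat[of ?Q p0 degree] by blast
  define D where "D = smult (inverse (lead_coeff D0)) D0"
  have lc: "lead_coeff D0 \<noteq> 0" using D0(1) by simp
  show ?thesis
  proof (rule that[of D])
    show "coeff D i \<in> K" for i
      unfolding D_def using D0(1) by (auto intro!: subfield_setD[OF K(1)])
    show "lead_coeff D = 1" using lc by (simp add: D_def)
    show "poly D fX = 0" using D0(1) by (simp add: D_def)
    show "p = 0 \<or> degree D \<le> degree p" if "\<And>i. coeff p i \<in> K" "poly p fX = 0" for p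
      using D0(2)[of p] that lc by (auto simp: D_def)
  qed
qed

text \<open>The generator is a nonconstant coefficient s = u/v of the minimal polynomial
  \<open>D\<close> of t over \<open>K\<close>; one exists, for otherwise t would be algebraic over
  the reals. Now t is a root of u(Y) - s v(Y), of degree at most n = max (deg u) (deg v). Once
  \<open>D\<close> is known to have degree n, the degree of the rational function field over R(s) is
  not larger than over \<open>K\<close>, so both fields agree.\<close>

theorem luroth:
  assumes K: "subfield_set K" "\<And>c. hc c \<in> K" and f0: "f0 \<in> K" "f0 \<notin> range hc"
  obtains u v where "coprime u v" "v \<noteq> 0" "to_fract u / to_fract v \<in> K"
    "to_fract u / to_fract v \<notin> range hc" "K \<subseteq> simple_ext (to_fract u / to_fract v)"
proof -
  obtain D where D: "\<And>i. coeff D i \<in> K" "lead_coeff D = 1" "poly D fX = 0"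
    "\<And>p. (\<And>i. coeff p i \<in> K) \<Longrightarrow> poly p fX = 0 \<Longrightarrow> p = 0 \<or> degree D \<le> degree p"
    using luroth_minimal_polynomial[OF K f0] by blast
  have D0: "D \<noteq> 0" using D(2) by auto
  have "\<exists>i. coeff D i \<notin> range hc"
  proof (rule ccontr)
    assume "\<not> ?thesis"
    then have "\<forall>i. \<exists>c. coeff D i = hc c" by blast
    then obtain c where c: "\<And>i. coeff D i = hc (c i)" by metis
    have "c i = 0" if "i > degree D" for i using c[of i] that by (simp add: coeff_eq_0)
    then have "D = emb (\<Sum>i\<le>degree D. monom (c i) i)"
      by (intro poly_eqI) (auto simp: c coeff_sum coeff_monom)
    then have "to_fract (\<Sum>i\<le>degree D. monom (c i) i) = 0"
      using D(3) poly_emb_fX by metis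
    then have "D = 0" using \<open>D = emb _\<close> by (simp only: to_fract_eq_0_iff emb_0)
    then show False using D0 by blast
  qed
  then obtain i where i: "coeff D i \<notin> range hc" by blast
  define s where "s = coeff D i"
  define u where "u = fst (quot_of_fract s)"
  define v where "v = snd (quot_of_fract s)"
  have cop: "coprime u v" unfolding u_def v_def by (rule coprime_quot_of_fract)
  have v: "v \<noteq> 0" unfolding v_def by (rule snd_quot_of_fract_nonzero)
  have s: "s = to_fract u / to_fract v"
    unfolding u_def v_def by (rule fract_eq_quot)
  have nonconst: "to_fract u / to_fract v \<notin> range hc" using i unfolding s_def[symmetric] s .
  have sK: "s \<in> K" unfolding s_def by (rule D(1))
  define n where "n = max (degree u) (degree v)"
  define w where "w = emb u - smult s (emb v)"
  have wK: "coeff w k \<in> K" for k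
    unfolding w_def using sK by (auto intro!: subfield_setD[OF K(1)] K(2))
  have w_root: "poly w fX = 0" using v by (simp add: w_def poly_emb_fX s)
  have "D dvd w"
  proof -
    obtain r where r: "D dvd w - r" "\<forall>i. coeff r i \<in> K" "r = 0 \<or> degree r < degree D"
      using subfield_division[OF K(1) D(1) D0 wK] by blast
    have "poly (w - r) fX = 0" using r(1) D(3) by (metis dvdE mult_zero_left poly_mult)
    then have "poly r fX = 0" using w_root by simp
    then have "r = 0" using D(4)[of r] r(2,3) by auto
    then show ?thesis using r(1) by simp
  qed
  moreover have "fract_poly (theta u v) = smult (to_fract v) w"
    by (rule poly_eqI) (use v in \<open>simp add: coeff_map_poly coeff_theta w_def s hc_def field_simps
         flip: to_fract_mult to_fract_diff\<close>)
  ultimately have Dth: "D dvd fract_poly (theta u v)" by (simp add: dvd_smult)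
  \<comment> \<open>Gauss's lemma: the primitive part of \<open>D\<close> divides
    \<open>theta u v\<close> already over the polynomials in t.\<close>
  obtain c D' where D': "D = smult c (fract_poly D')" "content D' = 1"
    by (rule content_decompose_fract)
  have c: "c \<noteq> 0" using D0 D'(1) by auto
  have "fract_poly D' dvd fract_poly (theta u v)"
    using Dth c unfolding D'(1) by (simp add: smult_dvd_iff)
  then have "D' dvd theta u v" using D'(2) by (rule fract_poly_dvdD)
  then obtain E where E: "theta u v = D' * E" by blast
  define d where "d = degree D"
  have degD': "degree D' = d" using c by (simp add: d_def D'(1) degree_map_poly)
  have "c * to_fract (coeff D' d) = 1" using D(2) unfolding d_def[symmetric] by (simp add: D'(1) coeff_map_poly)
  moreover have "c * to_fract (coeff D' i) = s" unfolding s_def by (simp add: D'(1) coeff_map_poly)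
  ultimately have "to_fract (coeff D' i) = s * to_fract (coeff D' d)"
    by (metis mult.assoc mult.commute mult_1_right)
  then have "to_fract (coeff D' i * v) = to_fract (u * coeff D' d)"
    using v by (simp add: s field_simps)
  then have cross: "coeff D' i * v = u * coeff D' d" by (simp only: to_fract_eq_iff)
  have Dd: "coeff D' d \<noteq> 0" using \<open>c * to_fract (coeff D' d) = 1\<close> by auto
  have u0: "u \<noteq> 0" using nonconst by (auto intro: rev_image_eqI[of 0])
  have Di: "coeff D' i \<noteq> 0" using cross u0 Dd v by auto
  \<comment> \<open>As \<open>D\<close> is monic, the quotient of the coefficients of
    \<open>D'\<close> at i and d is u/v in lowest terms. So \<open>D'\<close> has degree at least n
    in t, as the degree comparison for \<open>theta\<close> requires.\<close>
  have "u dvd coeff D' i" using cross cop by (metis coprime_dvd_mult_left_iff dvd_triv_left)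
  then have du: "degree u \<le> degree (coeff D' i)" using Di by (rule dvd_imp_degree_le)
  have "v dvd coeff D' d" using cross cop by (metis coprime_dvd_mult_right_iff coprime_commute dvd_triv_right)
  then have dv: "degree v \<le> degree (coeff D' d)" using Dd by (rule dvd_imp_degree_le)
  have dn: "d = n"
  proof (cases "degree v \<le> degree u")
    case True
    then show ?thesis
      using theta_factor_degree[OF cop v nonconst E, of i] du Di degD' by (simp add: n_def max_def)
  next
    case False
    then show ?thesis
      using theta_factor_degree[OF cop v nonconst E, of d] dv Dd degD' by (simp add: n_def max_def)
  qed
  have "K \<subseteq> simple_ext s"
  proof
    fix f assume f: "f \<in> K"
    define a where "a = fst (quot_of_fract f)"
    define b where "b = snd (quot_of_fract f)"
    have b: "b \<noteq> 0" unfolding b_def by (rule snd_quot_of_fract_nonzero)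
    have fab: "f = to_fract a / to_fract b"
      unfolding a_def b_def by (rule fract_eq_quot)
    note S = subfield_simple_ext[of s]
    have wS: "coeff w k \<in> simple_ext s" for k
      unfolding w_def by (auto intro!: subfield_setD[OF S] simple_ext_hc simple_ext_self)
    have wn: "w \<noteq> 0"
    proof
      assume "w = 0"
      then have "D = 0 \<or> True" by simp
      have "theta u v = 0" using \<open>fract_poly (theta u v) = smult (to_fract v) w\<close> \<open>w = 0\<close> by simp
      then have "smult (coeff u k) v = smult (coeff v k) u" for k
        using coeff_theta[of u v k] by simp
      then have "coeff v k = 0" for k using const_of_prop[OF v nonconst] by blast
      then show False using v by (simp add: poly_eq_iff)
    qed
    have wdeg: "degree w \<le> n"
      by (rule degree_le) (simp add: w_def n_def coeff_eq_0)
    have red: "\<exists>r. (\<forall>i. coeff r i \<in> simple_ext s) \<and> (r = 0 \<or> degree r < n) \<and> poly r fX = to_fract p" for p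
    proof -
      obtain r where r: "w dvd emb p - r" "\<forall>i. coeff r i \<in> simple_ext s" "r = 0 \<or> degree r < degree w"
        using subfield_division[OF S wS wn, of "emb p"] by (auto simp: simple_ext_hc)
      have "poly (emb p - r) fX = 0" using r(1) w_root by (metis dvdE mult_zero_left poly_mult)
      then have "poly r fX = to_fract p" by (simp add: poly_emb_fX)
      then show ?thesis using r wdeg by (intro exI[of _ r]) auto
    qed
    obtain ra where ra: "\<forall>i. coeff ra i \<in> simple_ext s" "ra = 0 \<or> degree ra < n" "poly ra fX = to_fract a"
      using red by blast
    obtain rb where rb: "\<forall>i. coeff rb i \<in> simple_ext s" "rb = 0 \<or> degree rb < n" "poly rb fX = to_fract b"
      using red by blast
    have sub: "simple_ext s \<subseteq> K" by (rule simple_ext_subset[OF K sK])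
    \<comment> \<open>The numerator and denominator of \<open>f\<close> are reduced to polynomials
      of degree below n in Y over R(s), with the same values at t. Then \<open>g\<close> has
      coefficients in \<open>K\<close>, root t and degree below that of \<open>D\<close>, so it is
      0, and \<open>f\<close> is a quotient of coefficients lying in R(s).\<close>
    define g where "g = smult f rb - ra"
    have gK: "coeff g k \<in> K" for k
      unfolding g_def using ra(1) rb(1) sub f by (auto intro!: subfield_setD[OF K(1)])
    have "poly g fX = 0" using b by (simp add: g_def ra rb fab)
    then have "g = 0 \<or> d \<le> degree g" using D(4)[of g] gK by (simp add: d_def)
    moreover have "g = 0 \<or> degree g < n"
    proof -
      have "coeff g k = 0" if "k \<ge> n" for k
        using ra(2) rb(2) that by (auto simp: g_def coeff_eq_0)
      then show ?thesis by (metis leading_coeff_0_iff not_le)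
    qed
    ultimately have g0: "g = 0" using dn by auto
    have "rb \<noteq> 0" using rb(3) b by auto
    then obtain k where k: "coeff rb k \<noteq> 0" by (auto simp: poly_eq_iff)
    have "coeff g k = 0" using g0 by simp
    then have "f = coeff ra k / coeff rb k" using k by (simp add: g_def field_simps)
    then show "f \<in> simple_ext s" using ra(1) rb(1) subfield_setD(8)[OF S] by auto
  qed
  then show ?thesis using that[OF cop v _ nonconst] sK s by simp
qed

section \<open>Rational parametrizations\<close>

text \<open>One real linear factor is divided out at a time; the degree of the nonzero component
  \<open>F k0\<close> bounds the number of divisions.\<close>

lemma remove_common_roots:
  fixes F :: "'k \<Rightarrow> real poly"
  assumes "F k0 \<noteq> 0"
  shows "\<exists>c \<Phi>. c \<noteq> 0 \<and> (\<forall>k. F k = c * \<Phi> k) \<and> no_common_root \<Phi>"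
  using assms
proof (induction "degree (F k0)" arbitrary: F rule: less_induct)
  case less
  show ?case
  proof (cases "no_common_root F")
    case True
    then show ?thesis by (intro exI[of _ 1] exI[of _ F]) simp
  next
    case False
    then obtain r where r: "\<And>k. poly (F k) r = 0" unfolding no_common_root_def by blast
    define F' where "F' k = F k div [:- r, 1:]" for k
    have F': "F k = [:- r, 1:] * F' k" for k
    proof -
      have "[:- r, 1:] dvd F k" using r[of k] by (simp add: poly_eq_0_iff_dvd)
      then show ?thesis by (simp only: F'_def dvd_mult_div_cancel)
    qed
    have nz: "F' k0 \<noteq> 0" using less.prems F'[of k0] by auto
    have "degree (F k0) = degree [:- r, 1:] + degree (F' k0)"
      unfolding F'[of k0] using nz by (intro degree_mult_eq) auto
    then have "degree (F' k0) < degree (F k0)" by simp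
    then obtain c \<Phi> where c: "c \<noteq> 0" "\<forall>k. F' k = c * \<Phi> k" "no_common_root \<Phi>"
      using less.hyps[of F'] nz by blast
    have "F k = ([:- r, 1:] * c) * \<Phi> k" for k
      using F'[of k] c(2) by (simp only: mult.assoc)
    moreover have "[:- r, 1:] * c \<noteq> 0" using c(1) by (simp del: mult_pCons_left)
    ultimately show ?thesis using c(3) by blast
  qed
qed

definition hom_param :: "nat \<Rightarrow> ('k \<Rightarrow> real \<Rightarrow> real \<Rightarrow> real) \<Rightarrow> bool" where
  "hom_param d \<Phi> \<longleftrightarrow> (\<forall>k. bform d (\<Phi> k)) \<and> (\<forall>a b. (a, b) \<noteq> (0, 0) \<longrightarrow> (\<exists>k. \<Phi> k a b \<noteq> 0))"

text \<open>The forms \<open>G\<close> and \<open>H\<close> define a rational inverse of the parametrization.\<close>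

definition rat_param :: "nat \<Rightarrow> ('k \<Rightarrow> real \<Rightarrow> real \<Rightarrow> real) \<Rightarrow> nat \<Rightarrow> (('k \<Rightarrow> real) \<Rightarrow> real) \<Rightarrow> (('k \<Rightarrow> real) \<Rightarrow> real) \<Rightarrow> bool" where
  "rat_param d \<Phi> e G H \<longleftrightarrow> hom_param d \<Phi> \<and> form e G \<and> form e H \<and>
     (\<forall>a b. a * G (\<lambda>k. \<Phi> k a b) = b * H (\<lambda>k. \<Phi> k a b)) \<and> (\<exists>t. H (\<lambda>k. \<Phi> k 1 t) \<noteq> 0)"

text \<open>All components are homogenized to the largest of their degrees, so that one of them does
  not vanish at infinity.\<close>

lemma hom_param_of_polys:
  fixes F :: "'k::finite \<Rightarrow> real poly"
  assumes "no_common_root F"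
  shows "\<exists>d \<Phi>. hom_param d \<Phi> \<and> (\<forall>k. degree (F k) \<le> d) \<and>
    (\<forall>k a b. \<Phi> k a b = (\<Sum>j\<le>d. coeff (F k) j * a ^ (d - j) * b ^ j)) \<and> (\<forall>k t. \<Phi> k 1 t = poly (F k) t)"
proof -
  define d where "d = Max (range (\<lambda>k. degree (F k)))"
  define \<Phi> where "\<Phi> k a b = (\<Sum>j\<le>d. coeff (F k) j * a ^ (d - j) * b ^ j)" for k a b
  have deg: "degree (F k) \<le> d" for k unfolding d_def by (rule Max_ge) auto
  have bf: "bform d (\<Phi> k)" for k unfolding \<Phi>_def[abs_def] by (rule bform_of_poly)
  have one: "\<Phi> k 1 t = poly (F k) t" for k t unfolding \<Phi>_def by (rule bform_of_poly_1[OF deg])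
  have "\<exists>k. \<Phi> k a b \<noteq> 0" if "(a, b) \<noteq> (0, 0)" for a b
  proof (cases "a = 0")
    case False
    obtain k where "poly (F k) (b / a) \<noteq> 0" using assms unfolding no_common_root_def by blast
    then show ?thesis using bform_scale[OF bf[of k], of a 1 "b / a"] one[of k "b / a"] False by (auto intro!: exI[of _ k])
  next
    case True
    have "d \<in> range (\<lambda>k. degree (F k))" unfolding d_def by (rule Max_in) auto
    then obtain k where k: "degree (F k) = d" by auto
    have "\<exists>k. coeff (F k) d \<noteq> 0"
    \<comment> \<open>In degree 0 the component attaining the maximum may be the zero polynomial; a
      nonzero constant is then supplied by the absence of common roots.\<close>
    proof (cases "d = 0")
      case True
      obtain k' where k': "poly (F k') 0 \<noteq> 0" using assms unfolding no_common_root_def by blast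
      then show ?thesis using True by (intro exI[of _ k']) (simp add: poly_0_coeff_0)
    next
      case False
      then show ?thesis using k by (intro exI[of _ k]) auto
    qed
    then obtain k where "coeff (F k) d \<noteq> 0" by blast
    moreover have "\<Phi> k a b = (\<Sum>j\<le>d. if j = d then coeff (F k) j * b ^ j else 0)"
      unfolding \<Phi>_def by (rule sum.cong) (auto simp: True)
    ultimately show ?thesis using that True by (intro exI[of _ k]) auto
  qed
  then show ?thesis using bf deg one
    by (intro exI[of _ d] exI[of _ \<Phi>]) (simp add: hom_param_def \<Phi>_def)
qed

lemma polys_of_hom_param:
  assumes "hom_param d \<Phi>"
  obtains F where "\<And>k t. poly (F k) t = \<Phi> k 1 t" "no_common_root F"
proof -
  have "\<exists>p. \<forall>t. poly p t = \<Phi> k 1 t" for k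
    using bform_poly[of d "\<Phi> k"] assms unfolding hom_param_def by blast
  then obtain F where F: "\<And>k t. poly (F k) t = \<Phi> k 1 t" by metis
  have "no_common_root F" unfolding no_common_root_def F
    using assms unfolding hom_param_def by simp
  then show ?thesis using that F by blast
qed

section \<open>Points of the projective line and of a parametrized curve\<close>

definition v2 :: "real \<Rightarrow> real \<Rightarrow> real ^ 2" where "v2 a b = (\<chi> k. if k = 1 then a else b)"

lemma v2_nth [simp]: "v2 a b $ 1 = a" "v2 a b $ 2 = b" by (simp_all add: v2_def)

lemma v2_eta [simp]: "v2 (w $ 1) (w $ 2) = w"
  by (simp add: v2_def vec_eq_iff forall_2)

lemma v2_eq_0_iff [simp]: "v2 a b = 0 \<longleftrightarrow> a = 0 \<and> b = 0"
  by (auto simp: vec_eq_iff forall_2)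

lemma proj2_cases:
  fixes z :: "2 proj"
  obtains a b where "(a, b) \<noteq> (0, 0)" "z = abs_proj (v2 a b)"
proof -
  obtain w where w: "w \<noteq> 0" "z = abs_proj w" by (rule proj_cases)
  then show ?thesis using that[of "w $ 1" "w $ 2"] v2_eq_0_iff[of "w $ 1" "w $ 2"] by (metis prod.inject v2_eta)
qed

lemma abs_proj_v2_eq_iff:
  assumes "(a, b) \<noteq> (0, 0)" "(c, d) \<noteq> (0, 0)"
  shows "abs_proj (v2 a b) = abs_proj (v2 c d) \<longleftrightarrow> a * d = b * c"
proof -
  have "abs_proj (v2 a b) = abs_proj (v2 c d) \<longleftrightarrow> (\<forall>i j. v2 a b $ i * v2 c d $ j = v2 a b $ j * v2 c d $ i)"
    by (rule abs_proj_eq_iff_cross) (use assms in auto)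
  then show ?thesis by (auto simp: forall_2 mult.commute)
qed

definition param_point :: "('k \<Rightarrow> real \<Rightarrow> real \<Rightarrow> real) \<Rightarrow> real \<Rightarrow> real \<Rightarrow> ('k::finite) proj" where
  "param_point \<Phi> a b = abs_proj (\<chi> k. \<Phi> k a b)"

lemma hom_param_nonzero: "hom_param d \<Phi> \<Longrightarrow> (a, b) \<noteq> (0, 0) \<Longrightarrow> (\<chi> k. \<Phi> k a b) \<noteq> 0"
  unfolding hom_param_def vec_eq_iff by auto

lemma param_point_eq:
  assumes "hom_param d \<Phi>" "(a, b) \<noteq> (0, 0)" "abs_proj (v2 a b) = abs_proj (v2 a' b')" "(a', b') \<noteq> (0, 0)"
  shows "param_point \<Phi> a b = param_point \<Phi> a' b'"
proof -
  obtain c where c: "c \<noteq> 0" "v2 a' b' = c *\<^sub>R v2 a b"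
    using assms(2-4) abs_proj_eq_iff[of "v2 a b" "v2 a' b'"] by auto
  have "a' = c * a" "b' = c * b" using c(2) by (auto simp: vec_eq_iff forall_2)
  then have "(\<chi> k. \<Phi> k a' b') = c ^ d *\<^sub>R (\<chi> k. \<Phi> k a b)"
    using assms(1) by (simp add: vec_eq_iff hom_param_def bform_scale)
  then show ?thesis
    unfolding param_point_def using abs_proj_scale[OF _ hom_param_nonzero[OF assms(1,2)], of "c ^ d"] c(1) by simp
qed

definition param_map :: "('k \<Rightarrow> real \<Rightarrow> real \<Rightarrow> real) \<Rightarrow> 2 proj \<Rightarrow> ('k::finite) proj" where
  "param_map \<Phi> z = param_point \<Phi> (hcoords z 1) (hcoords z 2)"

lemma hcoords_pair_nonzero: "(hcoords z 1, hcoords z 2) \<noteq> (0, 0)" for z :: "2 proj"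
proof -
  obtain k where "hcoords z k \<noteq> 0" using hcoords_nonzero[of z] by blast
  then show ?thesis using exhaust_2[of k] by auto
qed

lemma param_map_abs_proj:
  assumes "hom_param d \<Phi>" "(a, b) \<noteq> (0, 0)"
  shows "param_map \<Phi> (abs_proj (v2 a b)) = param_point \<Phi> a b"
proof -
  let ?z = "abs_proj (v2 a b)"
  have "abs_proj (v2 (hcoords ?z 1) (hcoords ?z 2)) = abs_proj (v2 a b)"
    by (simp add: hcoords_def)
  then show ?thesis
    unfolding param_map_def using param_point_eq[OF assms(1) hcoords_pair_nonzero _ assms(2)] by blast
qed

lemma form_param_point:
  assumes "hom_param d \<Phi>" "(a, b) \<noteq> (0, 0)" "form e P"
  shows "P (hcoords (param_point \<Phi> a b)) = 0 \<longleftrightarrow> P (\<lambda>k. \<Phi> k a b) = 0"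
proof -
  have "($) (\<chi> k. \<Phi> k a b) = (\<lambda>k. \<Phi> k a b)" by (rule ext) simp
  then show ?thesis
    unfolding param_point_def
    using form_hcoords[OF assms(3) hom_param_nonzero[OF assms(1,2)]] by simp
qed

lemma hom_param_form: "hom_param d \<Phi> \<Longrightarrow> form e P \<Longrightarrow> bform (e * d) (\<lambda>a b. P (\<lambda>k. \<Phi> k a b))"
  by (rule bform_compose) (auto simp: hom_param_def)

lemma curve_closure_memI:
  assumes "no_common_root F"
    and "\<And>d P. form d P \<Longrightarrow> (\<And>t. P (\<lambda>k. poly (F k) t) = 0) \<Longrightarrow> P (hcoords x) = 0"
  shows "x \<in> curve_closure F"
  unfolding curve_closure_def hull_def
proof (rule InterI, elim CollectE conjE)
  fix Z assume Z: "proj_algebraic Z" "range (curve_point F) \<subseteq> Z"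
  obtain \<Q> where Q: "\<forall>P\<in>\<Q>. \<exists>d. form d P" "Z = {x. \<forall>P\<in>\<Q>. P (hcoords x) = 0}"
    using Z(1) unfolding proj_algebraic_iff by (elim exE conjE)
  have "P (hcoords x) = 0" if P: "P \<in> \<Q>" for P
  proof -
    obtain d where d: "form d P" using bspec[OF Q(1) P] by (elim exE)
    have "P (\<lambda>k. poly (F k) t) = 0" for t
    proof -
      have "curve_point F t \<in> Z" using Z(2) by (auto intro: subsetD)
      then have "\<forall>P\<in>\<Q>. P (hcoords (curve_point F t)) = 0" unfolding Q(2) by (rule CollectD)
      then have "P (hcoords (curve_point F t)) = 0" by (rule bspec) (rule P)
      then show ?thesis unfolding form_curve_point[OF assms(1) d] .
    qed
    then show ?thesis by (rule assms(2)[OF d])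
  qed
  then show "x \<in> Z" unfolding Q(2) by simp
qed

lemma param_point_in_closure:
  assumes "hom_param d \<Phi>" "(a, b) \<noteq> (0, 0)" "no_common_root F" "\<And>k t. poly (F k) t = \<Phi> k 1 t"
  shows "param_point \<Phi> a b \<in> curve_closure F"
proof (rule curve_closure_memI[OF assms(3)])
  fix e P assume P: "form e P" "\<And>t. P (\<lambda>k. poly (F k) t) = 0"
  have "P (\<lambda>k. \<Phi> k a b) = 0"
    using bform_eq_0[OF hom_param_form[OF assms(1) P(1)], of a b] P(2)
    by (simp add: assms(4) infinite_UNIV_char_0)
  then show "P (hcoords (param_point \<Phi> a b)) = 0"
    unfolding form_param_point[OF assms(1,2) P(1)] .
qed

text \<open>The proportionality of x and \<open>\<Phi>\<close>(H(x), G(x)) is the vanishing of the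
  forms \<open>P i j\<close>. At a parameter t one has G = t H, so \<open>\<Phi>\<close>(H, G) is
  H^d times \<open>\<Phi>\<close>(1, t) and the forms vanish; from the parametrized points this
  passes to the closure.\<close>

lemma rat_param_inverse:
  assumes "rat_param d \<Phi> e G H" "no_common_root F" "\<And>k t. poly (F k) t = \<Phi> k 1 t"
    and x: "x \<in> curve_closure F" "(H (hcoords x), G (hcoords x)) \<noteq> (0, 0)"
  shows "param_point \<Phi> (H (hcoords x)) (G (hcoords x)) = x"
proof -
  have par: "hom_param d \<Phi>" and GH: "form e G" "form e H"
    and inv: "\<And>a b. a * G (\<lambda>k. \<Phi> k a b) = b * H (\<lambda>k. \<Phi> k a b)"
    using assms(1) unfolding rat_param_def by blast+
  define P where "P i j y = y i * \<Phi> j (H y) (G y) - y j * \<Phi> i (H y) (G y)" for i j y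
  have "form (d * e) (\<lambda>y. \<Phi> j (H y) (G y))" for j
  proof -
    have b: "form d (\<lambda>w::2 \<Rightarrow> real. \<Phi> j (w 1) (w 2))"
      using par unfolding hom_param_def bform_def by blast
    have "form (d * e) (\<lambda>y. (\<lambda>w::2 \<Rightarrow> real. \<Phi> j (w 1) (w 2)) (\<lambda>v. if v = 1 then H y else G y))"
    proof (rule form_compose[OF b])
      show "form e (\<lambda>y. if v = 1 then H y else G y)" for v :: 2
        by (cases "v = 1") (simp_all add: GH)
    qed
    then show ?thesis by simp
  qed
  then have P: "form (1 + d * e) (P i j)" for i j
    unfolding P_def[abs_def] by (intro form_diff form_mult form_var)
  have "P i j (\<lambda>k. poly (F k) t) = 0" for i j t
  proof -
    let ?H = "H (\<lambda>k. \<Phi> k 1 t)"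
    have "G (\<lambda>k. \<Phi> k 1 t) = t * ?H" using inv[of 1 t] by simp
    moreover have "\<Phi> k (?H * 1) (?H * t) = ?H ^ d * \<Phi> k 1 t" for k
      using par by (intro bform_scale) (simp add: hom_param_def)
    ultimately have "\<Phi> k ?H (G (\<lambda>k. \<Phi> k 1 t)) = ?H ^ d * \<Phi> k 1 t" for k
      by (simp add: mult.commute)
    then show ?thesis by (simp add: P_def assms(3))
  qed
  then have "P i j (hcoords x) = 0" for i j
    by (rule curve_closure_form_zero[OF assms(2) P _ x(1)])
  then have "rep_proj x $ i * (\<chi> k. \<Phi> k (H (hcoords x)) (G (hcoords x))) $ j =
      rep_proj x $ j * (\<chi> k. \<Phi> k (H (hcoords x)) (G (hcoords x))) $ i" for i j
    unfolding P_def by (simp add: hcoords_def)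
  then have "abs_proj (rep_proj x) = abs_proj (\<chi> k. \<Phi> k (H (hcoords x)) (G (hcoords x)))"
    using abs_proj_eq_iff_cross[OF rep_proj_nonzero hom_param_nonzero[OF par x(2)]] by blast
  then show ?thesis by (simp add: param_point_def)
qed

lemma rat_param_exceptional_finite:
  assumes "rat_param d \<Phi> e G H" "no_common_root F" "\<And>k t. poly (F k) t = \<Phi> k 1 t"
  shows "finite {x \<in> curve_closure F. H (hcoords x) = 0}"
proof -
  obtain t where t: "H (\<lambda>k. \<Phi> k 1 t) \<noteq> 0" "form e H" using assms(1) unfolding rat_param_def by blast
  then show ?thesis using finite_zeros_on_curve[OF assms(2) t(2), of t] by (simp add: assms(3))
qed

section \<open>Euclidean topology and local dimension\<close>

lemma continuous_param:
  assumes "hom_param d \<Phi>"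
  shows "continuous_on A (\<lambda>w::real^2. (\<chi> k. \<Phi> k (w $ 1) (w $ 2)) :: real ^ 'k)"
proof (rule continuous_on_vec_lambda)
  fix k
  have "bform d (\<Phi> k)" using assms unfolding hom_param_def by blast
  then show "continuous_on A (\<lambda>w::real^2. \<Phi> k (w $ 1) (w $ 2))"
    by (rule continuous_on_bform[where f = "\<lambda>w. w $ 1" and g = "\<lambda>w. w $ 2"])
      (intro continuous_intros)+
qed

lemma norm_one_rep:
  fixes z :: "'k::finite proj"
  obtains w where "norm w = 1" "z = abs_proj w"
proof -
  obtain v where v: "v \<noteq> 0" "z = abs_proj v" by (rule proj_cases)
  show ?thesis
    by (rule that[of "(1 / norm v) *\<^sub>R v"]) (use v in \<open>auto simp: abs_proj_scale\<close>)
qed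

definition circle :: "(real ^ 2) set" where "circle = sphere 0 1"

lemma circle_nonzero: "norm w = 1 \<Longrightarrow> (w $ 1, w $ 2) \<noteq> (0, 0)" for w :: "real ^ 2"
  using v2_eq_0_iff[of "w $ 1" "w $ 2"] by auto

text \<open>The minors define a closed set of pairs, and projection along a compact factor preserves
  closedness. The vector 0 always belongs to the result; it is discarded where the set is
  used.\<close>

lemma closed_param_image:
  fixes A :: "(real ^ 2) set"
  assumes "hom_param d \<Phi>" "compact A" "0 \<notin> A"
  shows "closed {v :: real ^ 'k. \<exists>w\<in>A. \<forall>i j. v $ i * \<Phi> j (w $ 1) (w $ 2) = v $ j * \<Phi> i (w $ 1) (w $ 2)}"
proof -
  have cont: "continuous_on UNIV (\<lambda>p::(real^2) \<times> (real^'k). \<Phi> j (fst p $ 1) (fst p $ 2))" for j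
  proof -
    have "bform d (\<Phi> j)" using assms(1) unfolding hom_param_def by blast
    then show ?thesis
      by (rule continuous_on_bform[where f = "\<lambda>p. fst p $ 1" and g = "\<lambda>p. fst p $ 2"])
        (intro continuous_intros)+
  qed
  have "closed {p :: (real^2) \<times> (real^'k). \<forall>i j. snd p $ i * \<Phi> j (fst p $ 1) (fst p $ 2) = snd p $ j * \<Phi> i (fst p $ 1) (fst p $ 2)}"
    by (intro closed_Collect_all closed_Collect_eq continuous_intros cont)
  then have "closed {v :: real ^ 'k. \<exists>w. w \<in> A \<and> (w, v) \<in> {p :: (real^2) \<times> (real^'k).
      \<forall>i j. snd p $ i * \<Phi> j (fst p $ 1) (fst p $ 2) = snd p $ j * \<Phi> i (fst p $ 1) (fst p $ 2)}}"
    by (rule closed_compact_projection[OF assms(2)])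
  then show ?thesis by (simp add: Bex_def)
qed

lemma proj_open_Int: "proj_open A \<Longrightarrow> proj_open B \<Longrightarrow> proj_open (A \<inter> B)"
  unfolding proj_open_def by (drule (1) open_Int) (simp add: Int_def conj_commute conj_left_commute)

lemma open_compl_zero: "open {v :: 'a::euclidean_space. v \<noteq> 0}"
proof -
  have "{v :: 'a. v \<noteq> 0} = UNIV - {0}" by auto
  then show ?thesis using open_delete[of UNIV "0::'a"] by simp
qed

lemma proj_open_compl_singleton: "proj_open (- {y})" for y :: "'k::finite proj"
proof -
  have "{v :: real ^ 'k. v \<noteq> 0 \<and> abs_proj v \<in> - {y}} =
     - {v :: real ^ 'k. \<forall>i j. v $ i * rep_proj y $ j = v $ j * rep_proj y $ i}" (is "?A = - ?B")
  proof (rule Set.set_eqI)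
    fix v :: "real ^ 'k"
    show "v \<in> ?A \<longleftrightarrow> v \<in> - ?B"
      using abs_proj_eq_iff_cross[of v "rep_proj y"] rep_proj_nonzero[of y]
      by (cases "v = 0") auto
  qed
  moreover have "closed ?B" by (intro closed_Collect_all closed_Collect_eq continuous_intros)
  ultimately show ?thesis unfolding proj_open_def by (simp add: open_Compl)
qed

lemma proj_open_UNIV: "proj_open (UNIV :: 'k::finite proj set)"
  unfolding proj_open_def using open_compl_zero by simp

lemma proj_open_compl_finite: "finite A \<Longrightarrow> proj_open (- A)" for A :: "'k::finite proj set"
proof (induction A rule: finite_induct)
  case empty
  then show ?case using proj_open_UNIV by simp
next
  case (insert x A)
  have "- insert x A = - {x} \<inter> - A" by auto
  then show ?case using insert proj_open_Int[OF proj_open_compl_singleton] by simp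
qed

text \<open>The unit circle already covers the projective line, so the image of the parametrization
  is the projection of a closed set along a compact one.\<close>

lemma proj_open_compl_param:
  fixes \<Phi> :: "'k::finite \<Rightarrow> real \<Rightarrow> real \<Rightarrow> real"
  assumes "hom_param d \<Phi>"
  shows "proj_open (- range (param_map \<Phi>))"
proof -
  have iff: "abs_proj v \<in> range (param_map \<Phi>) \<longleftrightarrow>
     (\<exists>w\<in>circle. \<forall>i j. v $ i * \<Phi> j (w $ 1) (w $ 2) = v $ j * \<Phi> i (w $ 1) (w $ 2))" if "v \<noteq> 0" for v
  proof
    assume "abs_proj v \<in> range (param_map \<Phi>)"
    then obtain z where z: "abs_proj v = param_map \<Phi> z" by blast
    obtain w where w: "norm w = 1" "z = abs_proj w" by (rule norm_one_rep)
    then have nz: "(w $ 1, w $ 2) \<noteq> (0, 0)" by (intro circle_nonzero)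
    have "param_map \<Phi> z = param_point \<Phi> (w $ 1) (w $ 2)"
      using param_map_abs_proj[OF assms nz] w(2) by simp
    then have "\<forall>i j. v $ i * \<Phi> j (w $ 1) (w $ 2) = v $ j * \<Phi> i (w $ 1) (w $ 2)"
      using abs_proj_eq_iff_cross[OF that hom_param_nonzero[OF assms nz]] z by (simp add: param_point_def)
    then show "\<exists>w\<in>circle. \<forall>i j. v $ i * \<Phi> j (w $ 1) (w $ 2) = v $ j * \<Phi> i (w $ 1) (w $ 2)"
      using w(1) by (intro bexI[of _ w]) (auto simp: circle_def)
  next
    assume "\<exists>w\<in>circle. \<forall>i j. v $ i * \<Phi> j (w $ 1) (w $ 2) = v $ j * \<Phi> i (w $ 1) (w $ 2)"
    then obtain w :: "real ^ 2" where w: "norm w = 1" "\<forall>i j. v $ i * \<Phi> j (w $ 1) (w $ 2) = v $ j * \<Phi> i (w $ 1) (w $ 2)"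
      by (auto simp: circle_def)
    then have nz: "(w $ 1, w $ 2) \<noteq> (0, 0)" by (intro circle_nonzero)
    have "abs_proj v = param_map \<Phi> (abs_proj (v2 (w $ 1) (w $ 2)))"
      unfolding param_map_abs_proj[OF assms nz] param_point_def
      using abs_proj_eq_iff_cross[OF that hom_param_nonzero[OF assms nz]] w(2) by simp
    then show "abs_proj v \<in> range (param_map \<Phi>)" by blast
  qed
  let ?B = "{v :: real ^ 'k. \<exists>w\<in>circle. \<forall>i j. v $ i * \<Phi> j (w $ 1) (w $ 2) = v $ j * \<Phi> i (w $ 1) (w $ 2)}"
  have "{v :: real ^ 'k. v \<noteq> 0 \<and> abs_proj v \<in> - range (param_map \<Phi>)} = {v :: real ^ 'k. v \<noteq> 0} \<inter> - ?B"
    using iff by auto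
  moreover have "closed ?B" by (rule closed_param_image[OF assms]) (auto simp: circle_def)
  ultimately show ?thesis
    unfolding proj_open_def by (simp add: open_Int open_compl_zero open_Compl)
qed

text \<open>The pair is a + i b multiplied by 1 + i s, so its squared norm is (1 + s^2) (a^2 +
  b^2).\<close>

lemma rotated_nonzero:
  fixes a b s :: real
  assumes "(a, b) \<noteq> (0, 0)"
  shows "(a - s * b, b + s * a) \<noteq> (0, 0)"
proof
  assume *: "(a - s * b, b + s * a) = (0, 0)"
  have "(1 + s\<^sup>2) * (a\<^sup>2 + b\<^sup>2) = (a - s * b)\<^sup>2 + (b + s * a)\<^sup>2"
    by (simp add: power2_eq_square algebra_simps)
  moreover have "a - s * b = 0" "b + s * a = 0" using * by auto
  ultimately have "(1 + s\<^sup>2) * (a\<^sup>2 + b\<^sup>2) = 0" by (simp only: power_zero_numeral add_0)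
  moreover have "1 + s\<^sup>2 > 0" by (simp add: add_pos_nonneg)
  ultimately have "a\<^sup>2 + b\<^sup>2 = 0" by auto
  then show False using assms by (simp add: sum_power2_eq_zero_iff)
qed

text \<open>The determinant of the vectors belonging to s and s' is (s' - s) (a^2 + b^2), so
  distinct s give distinct points, arbitrarily close to the given one.\<close>

lemma infinite_proj_line_ball:
  fixes a b :: real
  assumes "(a, b) \<noteq> (0, 0)" "\<epsilon> > 0"
  shows "infinite ((\<lambda>s. abs_proj (v2 (a - s * b) (b + s * a))) ` {s. \<bar>s\<bar> < \<epsilon>})"
proof -
  note nz = rotated_nonzero[OF assms(1)]
  have "inj_on (\<lambda>s. abs_proj (v2 (a - s * b) (b + s * a))) {s. \<bar>s\<bar> < \<epsilon>}"
  proof (rule inj_onI)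
    fix s s' assume "abs_proj (v2 (a - s * b) (b + s * a)) = abs_proj (v2 (a - s' * b) (b + s' * a))"
    then have "(a - s * b) * (b + s' * a) = (b + s * a) * (a - s' * b)"
      using abs_proj_v2_eq_iff[OF nz nz] by simp
    then have "(s' - s) * (a\<^sup>2 + b\<^sup>2) = 0" by (simp add: power2_eq_square algebra_simps)
    moreover have "a\<^sup>2 + b\<^sup>2 \<noteq> 0" using assms(1) by (simp add: sum_power2_eq_zero_iff)
    ultimately have "s' - s = 0" unfolding mult_eq_0_iff by blast
    then show "s = s'" by simp
  qed
  moreover have "infinite {s. \<bar>s\<bar> < \<epsilon>}"
  proof -
    have "{0<..<\<epsilon>} \<subseteq> {s. \<bar>s\<bar> < \<epsilon>}" by auto
    moreover have "infinite {0<..<\<epsilon>}" using assms(2) by simp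
    ultimately show ?thesis using finite_subset by blast
  qed
  ultimately show ?thesis using finite_imageD by blast
qed

lemma infinite_proj_line: "infinite (UNIV :: 2 proj set)"
proof -
  have "infinite ((\<lambda>s. abs_proj (v2 (1 - s * 0) (0 + s * 1))) ` {s. \<bar>s\<bar> < (1::real)})"
    by (rule infinite_proj_line_ball) auto
  then show ?thesis by (rule contrapos_nn) (rule finite_subset[OF subset_UNIV])
qed

lemma finite_proj_line_zeros:
  assumes "bform m q" "q a0 b0 \<noteq> 0"
  shows "finite {z :: 2 proj. q (hcoords z 1) (hcoords z 2) = 0}"
proof -
  have "{z :: 2 proj. q (hcoords z 1) (hcoords z 2) = 0} \<subseteq>
     insert (abs_proj (v2 0 1)) ((\<lambda>t. abs_proj (v2 1 t)) ` {t. q 1 t = 0})"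
  proof
    fix z :: "2 proj" assume "z \<in> {z. q (hcoords z 1) (hcoords z 2) = 0}"
    then have q: "q (hcoords z 1) (hcoords z 2) = 0" by simp
    define a where "a = hcoords z 1"
    define b where "b = hcoords z 2"
    have nz: "(a, b) \<noteq> (0, 0)" unfolding a_def b_def by (rule hcoords_pair_nonzero)
    have z: "z = abs_proj (v2 a b)" by (simp add: a_def b_def hcoords_def)
    show "z \<in> insert (abs_proj (v2 0 1)) ((\<lambda>t. abs_proj (v2 1 t)) ` {t. q 1 t = 0})"
    proof (cases "a = 0")
      case True
      then have "z = abs_proj (v2 0 1)" unfolding z using nz by (subst abs_proj_v2_eq_iff) auto
      then show ?thesis by simp
    next
      case False
      then have "z = abs_proj (v2 1 (b / a))" unfolding z using nz by (subst abs_proj_v2_eq_iff) auto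
      moreover have "q 1 (b / a) = 0"
        using bform_scale[OF assms(1), of a 1 "b / a"] q False by (simp add: a_def b_def)
      ultimately show ?thesis by blast
    qed
  qed
  moreover have "finite {t. q 1 t = 0}" by (rule bform_finite_zeros[OF assms])
  ultimately show ?thesis by (meson finite.insertI finite_imageI finite_subset)
qed

text \<open>The forms H and G give the inverse on the open set \<open>V\<close>. The image is the
  part of dimension 1 for two reasons: moving the parameter slightly produces infinitely many points
  in each neighbourhood of an image point; and the points outside the image are finitely many, at
  which H and G both vanish, and are isolated because the image is closed.\<close>

lemma rat_param_imp_rational_curve:
  fixes \<Phi> :: "'k::finite \<Rightarrow> real \<Rightarrow> real \<Rightarrow> real"
  assumes rp: "rat_param d \<Phi> e G H" and F: "no_common_root F" "\<And>k t. poly (F k) t = \<Phi> k 1 t"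
  shows "rational_curve (curve_closure F)"
proof -
  have par: "hom_param d \<Phi>" and GH: "form e G" "form e H"
    and inv: "\<And>a b. a * G (\<lambda>k. \<Phi> k a b) = b * H (\<lambda>k. \<Phi> k a b)"
    using rp unfolding rat_param_def by blast+
  obtain t0 where t0: "H (\<lambda>k. \<Phi> k 1 t0) \<noteq> 0" using rp unfolding rat_param_def by blast
  define C where "C = curve_closure F"
  define f where "f = param_map \<Phi>"
  define V where "V = {x :: 'k proj. \<not> (G (hcoords x) = 0 \<and> H (hcoords x) = 0)}"
  define U where "U = {z :: 2 proj. f z \<in> V}"
  define g where "g x = abs_proj (v2 (H (hcoords x)) (G (hcoords x)))" for x :: "'k proj"
  have f_point: "f (abs_proj (v2 a b)) = param_point \<Phi> a b" if "(a, b) \<noteq> (0, 0)" for a b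
    unfolding f_def by (rule param_map_abs_proj[OF par that])
  have fC: "f z \<in> C" for z
    unfolding f_def C_def param_map_def
    by (rule param_point_in_closure[OF par hcoords_pair_nonzero F])
  have fV: "f z \<in> V \<longleftrightarrow> \<not> (G (\<lambda>k. \<Phi> k (hcoords z 1) (hcoords z 2)) = 0 \<and> H (\<lambda>k. \<Phi> k (hcoords z 1) (hcoords z 2)) = 0)" for z
    unfolding V_def f_def param_map_def mem_Collect_eq
      form_param_point[OF par hcoords_pair_nonzero GH(1)] form_param_point[OF par hcoords_pair_nonzero GH(2)] ..
  have fg: "f (g x) = x" if "x \<in> C" "x \<in> V" for x
    using that rat_param_inverse[OF rp F, of x] f_point[of "H (hcoords x)" "G (hcoords x)"]
    by (auto simp: C_def V_def g_def)
  have gf: "g (f z) = z" if "z \<in> U" for z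
  proof -
    define a where "a = hcoords z 1"
    define b where "b = hcoords z 2"
    have nz: "(a, b) \<noteq> (0, 0)" unfolding a_def b_def by (rule hcoords_pair_nonzero)
    have z: "z = abs_proj (v2 a b)" by (simp add: a_def b_def hcoords_def)
    have fz: "f z = abs_proj (\<chi> k. \<Phi> k a b)"
      unfolding z f_point[OF nz] param_point_def ..
    obtain c where c: "c \<noteq> 0" "hcoords (f z) = (\<lambda>k. c * \<Phi> k a b)"
      using hcoords_abs_proj[OF hom_param_nonzero[OF par nz]] unfolding fz by auto
    have "a * G (hcoords (f z)) = b * H (hcoords (f z))"
      unfolding c(2) form_scale[OF GH(1)] form_scale[OF GH(2)] using inv[of a b] by simp
    moreover have "(H (hcoords (f z)), G (hcoords (f z))) \<noteq> (0, 0)"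
      using that unfolding U_def V_def by auto
    ultimately show ?thesis
      unfolding g_def by (subst z, subst abs_proj_v2_eq_iff) (use nz in \<open>auto simp: mult.commute\<close>)
  qed
  have bH: "bform (e * d) (\<lambda>a b. H (\<lambda>k. \<Phi> k a b))" and bG: "bform (e * d) (\<lambda>a b. G (\<lambda>k. \<Phi> k a b))"
    using hom_param_form[OF par] GH by blast+
  have finU: "finite (- U)"
  proof -
    have "- U \<subseteq> {z. H (\<lambda>k. \<Phi> k (hcoords z 1) (hcoords z 2)) = 0}"
      using fV by (auto simp: U_def)
    then show ?thesis using finite_proj_line_zeros[OF bH t0] by (rule finite_subset)
  qed
  have injU: "inj_on f U" by (rule inj_on_inverseI[of _ g]) (rule gf)
  have inf_image: "infinite (f ` A)" if "infinite A" for A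
  proof -
    have "infinite (A \<inter> U)" using that finU by (metis Diff_eq double_compl finite_Diff2 inf_commute)
    then have "infinite (f ` (A \<inter> U))" using finite_imageD[OF _ inj_on_subset[OF injU]] by blast
    then show ?thesis by (meson finite_subset image_mono inf_le1)
  qed
  have infC: "infinite C"
  proof -
    have "infinite (range f)"
      by (rule inf_image[OF infinite_proj_line])
    then show ?thesis using fC by (meson finite_subset image_subsetI)
  qed
  have birat: "birational_map UNIV C f"
    unfolding birational_map_def
  proof (intro conjI exI[of _ U] exI[of _ V] exI[of _ g])
    have "\<exists>p. homogeneous d p \<and> (\<forall>x::2 \<Rightarrow> real. \<Phi> k (x 1) (x 2) = poly_eval p x)" for k
      using par unfolding hom_param_def bform_def form_def by blast
    then obtain p where p: "\<And>k. homogeneous d (p k)" "\<And>k (x :: 2 \<Rightarrow> real). \<Phi> k (x 1) (x 2) = poly_eval (p k) x"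
      by metis
    have fp: "f z = abs_proj (\<chi> k. poly_eval (p k) (hcoords z))" for z
      unfolding f_def param_map_def param_point_def p(2) ..
    have "\<exists>k. poly_eval (p k) (hcoords z) \<noteq> 0" for z
      unfolding p(2)[symmetric] using par hcoords_pair_nonzero[of z] unfolding hom_param_def by blast
    then show "proj_regular_on UNIV f"
      unfolding proj_regular_on_def
      by (intro ballI exI[of _ UNIV] exI[of _ d] exI[of _ p]) (simp add: p(1) fp)
    show "f ` UNIV \<subseteq> C" using fC by blast
    have "- V = {x. G (hcoords x) = 0} \<inter> {x. H (hcoords x) = 0}" unfolding V_def by auto
    then show V_open: "proj_algebraic (- V)"
      using proj_algebraic_Int[OF proj_algebraic_zeros[OF GH(1)] proj_algebraic_zeros[OF GH(2)]] by simp
    have "form (e * d) (\<lambda>x::2\<Rightarrow>real. G (\<lambda>k. \<Phi> k (x 1) (x 2)))" "form (e * d) (\<lambda>x::2\<Rightarrow>real. H (\<lambda>k. \<Phi> k (x 1) (x 2)))"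
      using bG bH unfolding bform_def by blast+
    then have "proj_algebraic ({z::2 proj. G (\<lambda>k. \<Phi> k (hcoords z 1) (hcoords z 2)) = 0} \<inter>
       {z. H (\<lambda>k. \<Phi> k (hcoords z 1) (hcoords z 2)) = 0})"
      by (intro proj_algebraic_Int) (rule proj_algebraic_zeros[of "e*d" "\<lambda>x::2\<Rightarrow>real. G (\<lambda>k. \<Phi> k (x 1) (x 2))"]
        proj_algebraic_zeros[of "e*d" "\<lambda>x::2\<Rightarrow>real. H (\<lambda>k. \<Phi> k (x 1) (x 2))"], assumption)+
    moreover have "- U = {z::2 proj. G (\<lambda>k. \<Phi> k (hcoords z 1) (hcoords z 2)) = 0} \<inter>
       {z. H (\<lambda>k. \<Phi> k (hcoords z 1) (hcoords z 2)) = 0}"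
      unfolding U_def using fV by auto
    ultimately show "proj_algebraic (- U)" by simp
    have "U \<noteq> {}" using finU infinite_proj_line by auto
    then show "UNIV \<inter> U \<noteq> {}" by simp
    show im: "f ` (UNIV \<inter> U) = C \<inter> V"
    proof
      show "f ` (UNIV \<inter> U) \<subseteq> C \<inter> V" using fC by (auto simp: U_def)
      show "C \<inter> V \<subseteq> f ` (UNIV \<inter> U)"
      proof
        fix x assume x: "x \<in> C \<inter> V"
        then have "f (g x) = x" using fg by blast
        then show "x \<in> f ` (UNIV \<inter> U)" using x by (intro image_eqI[of _ _ "g x"]) (auto simp: U_def)
      qed
    qed
    show "C \<inter> V \<noteq> {}" using im \<open>UNIV \<inter> U \<noteq> {}\<close> by blast
    obtain pG pH where pGH: "homogeneous e pG" "\<And>x. G x = poly_eval pG x" "homogeneous e pH" "\<And>x. H x = poly_eval pH x"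
      using GH unfolding form_def by blast
    define q where "q k = (if k = (1::2) then pH else pG)" for k
    have gq: "g x = abs_proj (\<chi> k. poly_eval (q k) (hcoords x))" for x
      unfolding g_def v2_def q_def pGH(2,4) by (simp add: if_distrib if_distribR cong: if_cong)
    have "\<exists>k. poly_eval (q k) (hcoords x) \<noteq> 0" if "x \<in> V" for x
    proof (cases "H (hcoords x) = 0")
      case True
      then show ?thesis using that by (intro exI[of _ 2]) (simp add: V_def q_def pGH(2,4))
    next
      case False
      then show ?thesis using that by (intro exI[of _ 1]) (simp add: V_def q_def pGH(2,4))
    qed
    then show "proj_regular_on (C \<inter> V) g"
      unfolding proj_regular_on_def
      by (intro ballI exI[of _ V] exI[of _ e] exI[of _ q]) (simp add: V_open gq q_def pGH(1,3))
    show "\<forall>x\<in>UNIV \<inter> U. g (f x) = x" using gf by simp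
  qed
  have CV_range: "C \<inter> V \<subseteq> range f" using fg by (metis IntE rangeI subsetI)
  have exc: "finite (C - V)"
  proof -
    have "C - V \<subseteq> {x \<in> curve_closure F. H (hcoords x) = 0}" by (auto simp: V_def C_def)
    then show ?thesis using rat_param_exceptional_finite[OF rp F] by (rule finite_subset)
  qed
  have image: "range f = one_dim_part C"
  proof (intro equalityI subsetI)
    fix x assume "x \<in> range f"
    then obtain z where z: "x = f z" by blast
    obtain a b where ab: "(a, b) \<noteq> (0, 0)" "z = abs_proj (v2 a b)" by (rule proj2_cases)
    have dim: "zariski_dim proj_algebraic (C \<inter> W) = 1" if W: "proj_open W" "x \<in> W" for W
    proof -
      let ?\<Phi> = "\<lambda>w::real^2. (\<chi> k. \<Phi> k (w $ 1) (w $ 2)) :: real ^ 'k"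
      define O' where "O' = {v. v \<noteq> 0 \<and> abs_proj v \<in> W}"
      have "open (?\<Phi> -` O')"
        using W(1) unfolding proj_open_def O'_def[symmetric]
        by (intro open_vimage) (simp_all add: continuous_param[OF par])
      moreover have "v2 a b \<in> ?\<Phi> -` O'"
        using W(2) hom_param_nonzero[OF par ab(1)] f_point[OF ab(1)]
        by (simp add: O'_def z ab(2) param_point_def)
      ultimately obtain \<epsilon> where \<epsilon>: "\<epsilon> > 0" "ball (v2 a b) \<epsilon> \<subseteq> ?\<Phi> -` O'"
        unfolding open_contains_ball by blast
      define \<delta> where "\<delta> = \<epsilon> / (norm (v2 (- b) a) + 1)"
      have \<delta>: "\<delta> > 0" unfolding \<delta>_def using \<epsilon>(1) by (intro divide_pos_pos) (auto intro: add_nonneg_pos)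
      let ?A = "(\<lambda>s. abs_proj (v2 (a - s * b) (b + s * a))) ` {s. \<bar>s\<bar> < \<delta>}"
      have "f ` ?A \<subseteq> C \<inter> W"
      proof
        fix y assume "y \<in> f ` ?A"
        then obtain s where s: "\<bar>s\<bar> < \<delta>" "y = f (abs_proj (v2 (a - s * b) (b + s * a)))" by blast
        let ?w = "v2 (a - s * b) (b + s * a)"
        have "?w = v2 a b + s *\<^sub>R v2 (- b) a" by (simp add: vec_eq_iff forall_2)
        then have "dist (v2 a b) ?w = \<bar>s\<bar> * norm (v2 (- b) a)" by (simp add: dist_norm)
        also have "\<dots> \<le> \<bar>s\<bar> * (norm (v2 (- b) a) + 1)" by (intro mult_left_mono) auto
        also have "\<dots> < \<delta> * (norm (v2 (- b) a) + 1)"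
          using s(1) by (intro mult_strict_right_mono) (auto intro: add_nonneg_pos)
        also have "\<dots> = \<epsilon>" unfolding \<delta>_def by (simp add: add_nonneg_eq_0_iff)
        finally have "?w \<in> ball (v2 a b) \<epsilon>" by simp
        then have "?w \<in> ?\<Phi> -` O'" using \<epsilon>(2) by blast
        then have w: "?\<Phi> ?w \<noteq> 0" "abs_proj (?\<Phi> ?w) \<in> W" by (auto simp: O'_def)
        have "y = abs_proj (?\<Phi> ?w)"
          unfolding s(2) f_point[OF rotated_nonzero[OF ab(1)]] param_point_def by simp
        then have "y \<in> W" using w(2) by simp
        moreover have "y \<in> C" unfolding s(2) by (rule fC)
        ultimately show "y \<in> C \<inter> W" by blast
      qed
      moreover have "infinite (f ` ?A)" by (rule inf_image[OF infinite_proj_line_ball[OF ab(1) \<delta>]])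
      ultimately have "infinite (C \<inter> W)" using finite_subset by blast
      then show ?thesis using zariski_dim_curve_subset[OF F(1), of "C \<inter> W"] by (simp add: C_def)
    qed
    have "proj_local_dim C x = (INF W\<in>{W. proj_open W \<and> x \<in> W}. 1)"
      unfolding proj_local_dim_def by (rule INF_cong) (auto simp: dim)
    also have "\<dots> = 1" using proj_open_UNIV by (intro INF_const) auto
    finally show "x \<in> one_dim_part C" unfolding one_dim_part_def using fC z by simp
  next
    fix x assume "x \<in> one_dim_part C"
    then have x: "x \<in> C" "proj_local_dim C x = 1" by (auto simp: one_dim_part_def)
    show "x \<in> range f"
    proof (rule ccontr)
      assume nx: "x \<notin> range f"
      \<comment> \<open>This neighbourhood of x avoids the image and all other points with undefined
        inverse, so it meets the curve in x only.\<close>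
      define W where "W = - range f \<inter> - ((C - V) - {x})"
      have "proj_open W" unfolding W_def f_def
        by (intro proj_open_Int proj_open_compl_param[OF par] proj_open_compl_finite) (simp add: exc)
      moreover have "x \<in> W" using nx by (simp add: W_def)
      moreover have "C \<inter> W \<subseteq> {x}" using CV_range by (auto simp: W_def)
      ultimately have "proj_local_dim C x \<le> zariski_dim proj_algebraic (C \<inter> W)" "finite (C \<inter> W)"
        unfolding proj_local_dim_def by (auto intro: INF_lower finite_subset)
      then have "proj_local_dim C x \<le> 0"
        using zariski_dim_finite[where Zcl = proj_algebraic and A = "C \<inter> W", OF _ proj_algebraic_finite] by simp
      then show False using x(2) by simp
    qed
  qed
  have "projective_irreducible_curve C"
    unfolding C_def by (rule curve_projective_irreducible[OF F(1) infC[unfolded C_def]])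
  then show ?thesis
    unfolding rational_curve_def C_def[symmetric] using birat image by blast
qed

text \<open>The function field of the curve inside R(t). Numerator and denominator are forms of the
  same degree, so that only the ratios of the components of \<open>F\<close> matter.\<close>

definition form_field :: "('k \<Rightarrow> real poly) \<Rightarrow> real poly fract set" where
  "form_field F = {to_fract a / to_fract b | a b. \<exists>e P Q. form e P \<and> form e Q \<and> b \<noteq> 0 \<and>
     (\<forall>t. poly a t = P (\<lambda>k. poly (F k) t)) \<and> (\<forall>t. poly b t = Q (\<lambda>k. poly (F k) t))}"

lemma form_fieldI:
  assumes "form e P" "form e Q" "b \<noteq> 0" "\<And>t. poly a t = P (\<lambda>k. poly (F k) t)"
    "\<And>t. poly b t = Q (\<lambda>k. poly (F k) t)"
  shows "to_fract a / to_fract b \<in> form_field F"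
  unfolding form_field_def using assms by blast

lemma form_fieldE:
  assumes "x \<in> form_field F"
  obtains a b e P Q where "x = to_fract a / to_fract b" "form e P" "form e Q" "b \<noteq> 0"
    "\<forall>t. poly a t = P (\<lambda>k. poly (F k) t)" "\<forall>t. poly b t = Q (\<lambda>k. poly (F k) t)"
  using assms unfolding form_field_def by blast

lemma form_field_hc: "hc c \<in> form_field F"
  using form_fieldI[of 0 "\<lambda>_. c" "\<lambda>_. 1" 1 "[:c:]" F] by (simp add: hc_def)

lemma subfield_form_field: "subfield_set (form_field F)"
  unfolding subfield_set_def
proof (intro conjI ballI)
  show zero: "0 \<in> form_field F" using form_field_hc[of 0 F] by simp
  show "1 \<in> form_field F" using form_field_hc[of 1 F] by simp
  fix x assume "x \<in> form_field F"
  then obtain a b e P Q where x: "x = to_fract a / to_fract b" "form e P" "form e Q" "b \<noteq> 0"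
    "\<forall>t. poly a t = P (\<lambda>k. poly (F k) t)" "\<forall>t. poly b t = Q (\<lambda>k. poly (F k) t)"
    by (rule form_fieldE)
  have "to_fract (- a) / to_fract b \<in> form_field F"
    by (rule form_fieldI[OF form_uminus[OF x(2)] x(3,4)]) (simp_all add: x(5,6))
  then show "- x \<in> form_field F" by (simp add: x(1))
  show "inverse x \<in> form_field F"
  proof (cases "a = 0")
    case True
    then show ?thesis using zero by (simp add: x(1))
  next
    case False
    have "to_fract b / to_fract a \<in> form_field F"
      by (rule form_fieldI[OF x(3,2) False]) (simp_all add: x(5,6))
    then show ?thesis by (simp add: x(1))
  qed
  fix y assume "y \<in> form_field F"
  then obtain c d n R S where y: "y = to_fract c / to_fract d" "form n R" "form n S" "d \<noteq> 0"
    "\<forall>t. poly c t = R (\<lambda>k. poly (F k) t)" "\<forall>t. poly d t = S (\<lambda>k. poly (F k) t)"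
    by (rule form_fieldE)
  have "to_fract (a * d + b * c) / to_fract (b * d) \<in> form_field F"
    by (rule form_fieldI[of "e + n" "\<lambda>x. P x * S x + Q x * R x" "\<lambda>x. Q x * S x"])
      (use x y in \<open>auto intro!: form_add form_mult\<close>)
  moreover have "x + y = to_fract (a * d + b * c) / to_fract (b * d)"
    using x(4) y(4) by (simp add: x(1) y(1) field_simps)
  ultimately show "x + y \<in> form_field F" by simp
  have "to_fract (a * c) / to_fract (b * d) \<in> form_field F"
    by (rule form_fieldI[of "e + n" "\<lambda>x. P x * R x" "\<lambda>x. Q x * S x"])
      (use x y in \<open>auto intro!: form_add form_mult\<close>)
  then show "x * y \<in> form_field F" by (simp add: x(1) y(1))
qed

lemma to_fract_hom_poly:
  assumes "v \<noteq> 0" "degree p \<le> d"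
  shows "to_fract (\<Sum>j\<le>d. smult (coeff p j) (v ^ (d - j) * u ^ j)) =
    to_fract v ^ d * poly (emb p) (to_fract u / to_fract v)"
proof -
  have pow: "to_fract (x ^ n) = to_fract x ^ n" for x :: "real poly" and n
    by (induction n) auto
  have "poly (emb p) (to_fract u / to_fract v) = (\<Sum>j\<le>d. hc (coeff p j) * (to_fract u / to_fract v) ^ j)"
    unfolding poly_altdef degree_emb coeff_emb
    by (rule sum.mono_neutral_left) (use assms(2) in \<open>auto simp: coeff_eq_0\<close>)
  moreover have "to_fract (smult (coeff p j) (v ^ (d - j) * u ^ j)) =
      to_fract v ^ d * (hc (coeff p j) * (to_fract u / to_fract v) ^ j)" if "j \<le> d" for j
  proof -
    have "to_fract (smult (coeff p j) (v ^ (d - j) * u ^ j)) = to_fract ([:coeff p j:] * (v ^ (d - j) * u ^ j))"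
      by simp
    also have "\<dots> = hc (coeff p j) * (to_fract v ^ (d - j) * to_fract u ^ j)"
      by (simp only: to_fract_mult pow hc_def)
    also have "to_fract v ^ (d - j) * to_fract u ^ j = to_fract v ^ d * (to_fract u / to_fract v) ^ j"
    proof -
      have "to_fract v ^ d = to_fract v ^ (d - j) * to_fract v ^ j"
        using that by (simp flip: power_add)
      then show ?thesis using assms(1) by (simp add: power_divide)
    qed
    finally show ?thesis by (simp only: mult.left_commute)
  qed
  ultimately show ?thesis by (simp add: to_fract_sum sum_distrib_left)
qed

text \<open>Let s = u/v generate the function field. The ratios of the components of
  \<open>F\<close> are rational functions of s; clearing denominators, removing common roots and
  homogenizing gives \<open>\<Phi>\<close> with F(t) proportional to \<open>\<Phi>\<close>(v(t),
  u(t)). Since s belongs to the function field, it is a quotient of forms in \<open>F\<close>, and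
  these forms are the rational inverse.\<close>

lemma luroth_curve:
  fixes F :: "'k::finite \<Rightarrow> real poly"
  assumes F: "no_common_root F" "curve_point F s0 \<noteq> curve_point F s1"
  obtains d \<Phi> e G H u v where "rat_param d \<Phi> e G H" "v \<noteq> 0"
    "\<forall>t. (poly v t, poly u t) \<noteq> (0, 0)"
    "\<forall>t i j. poly (F i) t * \<Phi> j (poly v t) (poly u t) = poly (F j) t * \<Phi> i (poly v t) (poly u t)"
    "infinite {t. poly v t \<noteq> 0}"
proof -
  define K where "K = form_field F"
  have K: "subfield_set K" "\<And>c. hc c \<in> K" unfolding K_def by (rule subfield_form_field form_field_hc)+
  obtain i0 j0 where ij: "poly (F i0) s0 * poly (F j0) s1 \<noteq> poly (F j0) s0 * poly (F i0) s1"
    using F(2) abs_proj_eq_iff_cross[OF curve_vec_nonzero[OF F(1)] curve_vec_nonzero[OF F(1)]]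
    unfolding curve_point_def by auto
  have Fj0: "F j0 \<noteq> 0" using ij by auto
  have ratio: "to_fract (F k) / to_fract (F j0) \<in> K" for k
    unfolding K_def by (rule form_fieldI[OF form_var form_var Fj0]) auto
  have nonconst: "to_fract (F i0) / to_fract (F j0) \<notin> range hc"
  proof
    assume "to_fract (F i0) / to_fract (F j0) \<in> range hc"
    then obtain c where "to_fract (F i0) / to_fract (F j0) = hc c" by blast
    then have "to_fract (F i0) = to_fract ([:c:] * F j0)"
      using Fj0 unfolding to_fract_mult hc_def[symmetric] by (simp add: field_simps)
    then have "F i0 = [:c:] * F j0" by (simp only: to_fract_eq_iff)
    then show False using ij by simp
  qed
  obtain u v where uv: "coprime u v" "v \<noteq> 0" "to_fract u / to_fract v \<in> K"
    "to_fract u / to_fract v \<notin> range hc" "K \<subseteq> simple_ext (to_fract u / to_fract v)"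
    by (rule luroth[OF K ratio nonconst])
  define \<sigma> where "\<sigma> p = poly (emb p) (to_fract u / to_fract v)" for p
  have \<sigma>_mult: "\<sigma> (p * q) = \<sigma> p * \<sigma> q" for p q by (simp add: \<sigma>_def emb_mult)
  have \<sigma>_prod: "\<sigma> (prod p A) = (\<Prod>a\<in>A. \<sigma> (p a))" for p and A :: "'k set"
    by (induction A rule: infinite_finite_induct) (simp_all add: \<sigma>_mult, simp_all add: \<sigma>_def one_pCons emb_pCons)
  have "\<exists>A B. \<sigma> B \<noteq> 0 \<and> to_fract (F k) / to_fract (F j0) = \<sigma> A / \<sigma> B" for k
    using subsetD[OF uv(5) ratio[of k]] unfolding simple_ext_def \<sigma>_def by blast
  then obtain A B where AB: "\<And>k. \<sigma> (B k) \<noteq> 0" "\<And>k. to_fract (F k) / to_fract (F j0) = \<sigma> (A k) / \<sigma> (B k)"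
    by metis
  define \<Psi> where "\<Psi> k = A k * (\<Prod>l\<in>UNIV - {k}. B l)" for k
  define BB where "BB = (\<Prod>l\<in>UNIV. B l)"
  have BB: "\<sigma> BB \<noteq> 0" using AB(1) by (simp add: BB_def \<sigma>_prod)
  have \<Psi>: "to_fract (F k) * \<sigma> BB = to_fract (F j0) * \<sigma> (\<Psi> k)" for k
  proof -
    have "\<sigma> BB = \<sigma> (B k) * \<sigma> (\<Prod>l\<in>UNIV - {k}. B l)"
      unfolding BB_def \<sigma>_mult[symmetric] by (simp add: prod.remove)
    then show ?thesis using AB(2)[of k] AB(1)[of k] Fj0 by (simp add: \<Psi>_def \<sigma>_mult field_simps)
  qed
  have \<Psi>j0: "\<sigma> (\<Psi> j0) = \<sigma> BB" using \<Psi>[of j0] Fj0 by simp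
  have "\<Psi> j0 \<noteq> 0" using \<Psi>j0 BB by (auto simp: \<sigma>_def)
  then obtain c \<Psi>' where c: "c \<noteq> 0" "\<forall>k. \<Psi> k = c * \<Psi>' k" "no_common_root \<Psi>'"
    using remove_common_roots[of \<Psi> j0] by blast
  have \<sigma>c: "\<sigma> c \<noteq> 0" "\<sigma> (\<Psi>' j0) \<noteq> 0" using \<Psi>j0 BB c(2) by (auto simp: \<sigma>_mult)
  have rel: "to_fract (F k) * \<sigma> (\<Psi>' j0) = to_fract (F j0) * \<sigma> (\<Psi>' k)" for k
  proof -
    have "\<sigma> c * (to_fract (F k) * \<sigma> (\<Psi>' j0)) = to_fract (F k) * \<sigma> BB"
      using \<Psi>j0 c(2) by (simp add: \<sigma>_mult mult.left_commute)
    also have "\<dots> = \<sigma> c * (to_fract (F j0) * \<sigma> (\<Psi>' k))"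
      using \<Psi>[of k] c(2) by (simp add: \<sigma>_mult mult.left_commute)
    finally show ?thesis using \<sigma>c(1) by simp
  qed
  obtain d \<Phi> where \<Phi>: "hom_param d \<Phi>" "\<And>k. degree (\<Psi>' k) \<le> d"
    "\<And>k a b. \<Phi> k a b = (\<Sum>j\<le>d. coeff (\<Psi>' k) j * a ^ (d - j) * b ^ j)" "\<And>k t. \<Phi> k 1 t = poly (\<Psi>' k) t"
    using hom_param_of_polys[OF c(3)] by blast
  define h where "h k = (\<Sum>j\<le>d. smult (coeff (\<Psi>' k) j) (v ^ (d - j) * u ^ j))" for k
  have h: "poly (h k) t = \<Phi> k (poly v t) (poly u t)" for k t
    by (simp add: h_def \<Phi>(3) poly_sum mult.assoc)
  have h_fract: "to_fract (h k) = to_fract v ^ d * \<sigma> (\<Psi>' k)" for k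
    unfolding h_def \<sigma>_def by (rule to_fract_hom_poly[OF uv(2) \<Phi>(2)])
  have "to_fract (F k * h j0) = to_fract (F j0 * h k)" for k
    using rel[of k] by (simp add: h_fract mult.left_commute)
  then have rel_poly: "F k * h j0 = F j0 * h k" for k by (simp only: to_fract_eq_iff)
  have rel_all: "F i * h j = F j * h i" for i j
  proof -
    have "F j0 * (F i * h j) = F i * (F j0 * h j)" by (simp only: mult.left_commute)
    also have "\<dots> = F i * (F j * h j0)" by (simp only: rel_poly)
    also have "\<dots> = F j * (F i * h j0)" by (simp only: mult.left_commute)
    also have "\<dots> = F j * (F j0 * h i)" by (simp only: rel_poly)
    also have "\<dots> = F j0 * (F j * h i)" by (simp only: mult.left_commute)
    finally show ?thesis using Fj0 by simp
  qed
  have eq: "poly (F i) t * \<Phi> j (poly v t) (poly u t) = poly (F j) t * \<Phi> i (poly v t) (poly u t)" for i j t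
    using arg_cong[OF rel_all[of i j], of "\<lambda>p. poly p t"] by (simp add: h)
  have nz: "(poly v t, poly u t) \<noteq> (0, 0)" for t
  proof
    assume "(poly v t, poly u t) = (0, 0)"
    then have "[:- t, 1:] dvd u" "[:- t, 1:] dvd v" by (simp_all add: poly_eq_0_iff_dvd)
    then have "is_unit [:- t, 1:]" using uv(1) by (rule coprime_common_divisor[rotated])
    then show False by (simp add: is_unit_iff_degree)
  qed
  have finv: "finite {t. poly v t = 0}" using uv(2) by (rule poly_roots_finite)
  have infv: "infinite {t. poly v t \<noteq> 0}"
  proof -
    have "{t. poly v t \<noteq> 0} = - {t. poly v t = 0}" by auto
    then show ?thesis using finv by (metis finite_compl infinite_UNIV_char_0)
  qed
  obtain a b e P Q where PQ: "to_fract u / to_fract v = to_fract a / to_fract b" "form e P" "form e Q" "b \<noteq> 0"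
    and PQ': "\<forall>t. poly a t = P (\<lambda>k. poly (F k) t)" "\<forall>t. poly b t = Q (\<lambda>k. poly (F k) t)"
    using uv(3) unfolding K_def by (rule form_fieldE)
  note PQ = PQ PQ'[rule_format]
  have "to_fract (v * a) = to_fract (u * b)"
    using PQ(1,4) uv(2) by (simp add: field_simps)
  then have vaub: "v * a = u * b" by (simp only: to_fract_eq_iff)
  have scale: "\<exists>c. c \<noteq> 0 \<and> (\<forall>k. \<Phi> k (poly v t) (poly u t) = c * poly (F k) t)" for t
  proof -
    have "abs_proj (\<chi> k. poly (F k) t) = abs_proj (\<chi> k. \<Phi> k (poly v t) (poly u t))"
      using abs_proj_eq_iff_cross[OF curve_vec_nonzero[OF F(1)] hom_param_nonzero[OF \<Phi>(1) nz]] eq by simp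
    then obtain c where "c \<noteq> 0" "(\<chi> k. \<Phi> k (poly v t) (poly u t)) = c *\<^sub>R (\<chi> k. poly (F k) t)"
      using abs_proj_eq_iff[OF curve_vec_nonzero[OF F(1)] hom_param_nonzero[OF \<Phi>(1) nz]] by blast
    then show ?thesis by (auto simp: vec_eq_iff)
  qed
  \<comment> \<open>The relation required of a rational inverse. It holds at the pairs (v(t), u(t)),
    whose ratios take infinitely many values because s is not constant, so this binary form vanishes
    identically.\<close>
  define q where "q x y = x * P (\<lambda>k. \<Phi> k x y) - y * Q (\<lambda>k. \<Phi> k x y)" for x y
  have bq: "bform (1 + e * d) q"
    unfolding q_def[abs_def]
    by (intro bform_diff bform_mult bform_fst bform_snd hom_param_form[OF \<Phi>(1)] PQ(2,3))
  have q0: "q (poly v t) (poly u t) = 0" for t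
  proof -
    obtain c where c: "\<And>k. \<Phi> k (poly v t) (poly u t) = c * poly (F k) t" using scale[of t] by blast
    have "q (poly v t) (poly u t) = c ^ e * (poly v t * poly a t - poly u t * poly b t)"
      unfolding q_def c form_scale[OF PQ(2)] form_scale[OF PQ(3)] PQ(5,6) by (simp add: algebra_simps)
    also have "poly v t * poly a t = poly u t * poly b t"
      using arg_cong[OF vaub, of "\<lambda>p. poly p t"] by simp
    finally show ?thesis by simp
  qed
  have inf_s: "infinite ((\<lambda>t. poly u t / poly v t) ` {t. poly v t \<noteq> 0})"
  proof
    assume "finite ((\<lambda>t. poly u t / poly v t) ` {t. poly v t \<noteq> 0})"
    then obtain t0 where t0: "infinite {t \<in> {t. poly v t \<noteq> 0}. poly u t / poly v t = poly u t0 / poly v t0}"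
      using pigeonhole_infinite[OF infv] by blast
    let ?c = "poly u t0 / poly v t0"
    have "{t \<in> {t. poly v t \<noteq> 0}. poly u t / poly v t = ?c} \<subseteq> {t. poly u t = poly (smult ?c v) t}"
      by (auto simp: field_simps)
    then have "infinite {t. poly u t = poly (smult ?c v) t}" using t0 finite_subset by blast
    then have "u = smult ?c v" by (rule poly_eq_if_infinite)
    then have "smult ?c v = smult 1 u" by simp
    then have "?c = 0 \<and> (1::real) = 0" by (rule const_of_prop[OF uv(2,4)])
    then show False by simp
  qed
  have q1: "q 1 (poly u t / poly v t) = 0" if "poly v t \<noteq> 0" for t
    using bform_scale[OF bq, of "poly v t" 1 "poly u t / poly v t"] q0[of t] that by simp
  have "infinite {s. q 1 s = 0}"
    using inf_s by (rule contrapos_nn) (rule finite_subset[rotated], auto simp: q1)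
  then have q_zero: "q x y = 0" for x y by (rule bform_eq_0[OF bq])
  have "finite ({t. poly v t = 0} \<union> {t. poly b t = 0})"
    using finv poly_roots_finite[OF PQ(4)] by simp
  then obtain t where t: "poly v t \<noteq> 0" "poly b t \<noteq> 0"
    using ex_new_if_finite[OF infinite_UNIV_char_0[where 'a=real]] by blast
  have "Q (\<lambda>k. \<Phi> k 1 (poly u t / poly v t)) \<noteq> 0"
  proof
    assume *: "Q (\<lambda>k. \<Phi> k 1 (poly u t / poly v t)) = 0"
    have "Q (\<lambda>k. \<Phi> k (poly v t) (poly u t)) = 0"
      using bform_scale[OF hom_param_form[OF \<Phi>(1) PQ(3)], of "poly v t" 1 "poly u t / poly v t"] t(1) * by simp
    moreover obtain c where "c \<noteq> 0" "\<And>k. \<Phi> k (poly v t) (poly u t) = c * poly (F k) t" using scale[of t] by blast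
    ultimately show False using t(2) by (simp add: form_scale[OF PQ(3)] PQ(6))
  qed
  then have "rat_param d \<Phi> e P Q"
    unfolding rat_param_def using \<Phi>(1) PQ(2,3) q_zero unfolding q_def
    by (intro conjI allI exI[of _ "poly u t / poly v t"]) simp_all
  then show ?thesis by (rule that[OF _ uv(2) allI[OF nz] _ infv]) (simp add: eq)
qed

text \<open>The points of \<open>F\<close> are among those of the birational parametrization found
  by Lueroth's theorem; being infinitely many, they have the same closure.\<close>

theorem rational_curve_closure:
  fixes F :: "'k::finite \<Rightarrow> real poly"
  assumes F: "no_common_root F" "curve_point F s0 \<noteq> curve_point F s1"
  shows "rational_curve (curve_closure F)"
proof -
  obtain d \<Phi> e G H u v where L: "rat_param d \<Phi> e G H" "v \<noteq> 0"
    "\<forall>t. (poly v t, poly u t) \<noteq> (0, 0)"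
    "\<forall>t i j. poly (F i) t * \<Phi> j (poly v t) (poly u t) = poly (F j) t * \<Phi> i (poly v t) (poly u t)"
    "infinite {t. poly v t \<noteq> 0}"
    by (rule luroth_curve[OF F])
  note L = L(1,2) L(3,4)[rule_format] L(5)
  have par: "hom_param d \<Phi>" using L(1) unfolding rat_param_def by blast
  obtain F' where F': "\<And>k t. poly (F' k) t = \<Phi> k 1 t" "no_common_root F'"
    using polys_of_hom_param[OF par] by blast
  have "curve_point F t = param_point \<Phi> (poly v t) (poly u t)" for t
    unfolding curve_point_def param_point_def
    using abs_proj_eq_iff_cross[OF curve_vec_nonzero[OF F(1)] hom_param_nonzero[OF par L(3)]] L(4) by simp
  then have sub: "range (curve_point F) \<subseteq> curve_closure F'"
    using param_point_in_closure[OF par L(3) F'(2,1)] by auto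
  have inf: "infinite (range (curve_point F))"
    by (rule infinite_curve_image[OF F infinite_UNIV_char_0])
  have "curve_closure F = curve_closure F'"
    unfolding curve_closure_def[of F] by (rule curve_hull_infinite[OF F'(2) sub inf])
  then show ?thesis using rat_param_imp_rational_curve[OF L(1) F'(2,1)] by simp
qed

section \<open>Analytic functions\<close>

definition analytic_at_pt :: "real ^ 'm \<Rightarrow> (real ^ 'm \<Rightarrow> real) \<Rightarrow> bool" where
  "analytic_at_pt a f \<longleftrightarrow> (\<exists>(c :: ('m \<Rightarrow>\<^sub>0 nat) \<Rightarrow> real) \<epsilon>. \<epsilon> > 0 \<and>
        (\<forall>x\<in>ball a \<epsilon>. ((\<lambda>\<alpha>. c \<alpha> * monom_eval \<alpha> (($) (x - a))) has_sum f x) UNIV))"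

lemma real_analytic_on_iff: "real_analytic_on U f \<longleftrightarrow> (\<forall>a\<in>U. analytic_at_pt a f)"
  unfolding real_analytic_on_def analytic_at_pt_def ..

lemma has_sum_poly_eval:
  "((\<lambda>\<alpha>. Poly_Mapping.lookup q \<alpha> * monom_eval \<alpha> y) has_sum poly_eval q y) UNIV"
proof -
  have "((\<lambda>\<alpha>. Poly_Mapping.lookup q \<alpha> * monom_eval \<alpha> y) has_sum poly_eval q y) (Poly_Mapping.keys q)"
    unfolding poly_eval_def by (rule has_sum_finite) simp
  then show ?thesis
    by (rule has_sum_cong_neutral[THEN iffD1, rotated -1]) (auto simp: in_keys_iff)
qed

lemma polyfun_shift:
  assumes "polyfun UNIV f"
  shows "\<exists>q. \<forall>y. f (\<lambda>v. y v + a v) = poly_eval q y"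
proof -
  have "polyfun UNIV (\<lambda>y. f (\<lambda>v. y v + a v))"
    by (rule polyfun_compose[OF assms]) (auto intro!: polyfun_add polyfun_var)
  then show ?thesis unfolding polyfun_def by blast
qed

lemma analytic_at_polyfun:
  fixes a :: "real ^ 'm"
  assumes "polyfun UNIV f"
  shows "analytic_at_pt a (\<lambda>x. f (($) x))"
proof -
  obtain q where q: "\<forall>y. f (\<lambda>v. y v + a $ v) = poly_eval q y"
    using polyfun_shift[OF assms, of "($) a"] by blast
  have "f (($) x) = poly_eval q (($) (x - a))" for x
  proof -
    have "($) x = (\<lambda>v. ($) (x - a) v + a $ v)" by (rule ext) simp
    then show ?thesis using q by metis
  qed
  then show ?thesis
    unfolding analytic_at_pt_def
    by (intro exI[of _ "Poly_Mapping.lookup q"] exI[of _ 1]) (simp add: has_sum_poly_eval)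
qed

lemma analytic_at_add:
  assumes "analytic_at_pt a f" "analytic_at_pt a g"
  shows "analytic_at_pt a (\<lambda>x. f x + g x)"
proof -
  obtain c \<epsilon> where c: "\<epsilon> > 0" "\<forall>x\<in>ball a \<epsilon>. ((\<lambda>\<alpha>. c \<alpha> * monom_eval \<alpha> (($) (x - a))) has_sum f x) UNIV"
    using assms(1) unfolding analytic_at_pt_def by blast
  obtain d \<delta> where d: "\<delta> > 0" "\<forall>x\<in>ball a \<delta>. ((\<lambda>\<alpha>. d \<alpha> * monom_eval \<alpha> (($) (x - a))) has_sum g x) UNIV"
    using assms(2) unfolding analytic_at_pt_def by blast
  have "((\<lambda>\<alpha>. (c \<alpha> + d \<alpha>) * monom_eval \<alpha> (($) (x - a))) has_sum f x + g x) UNIV"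
    if "x \<in> ball a (min \<epsilon> \<delta>)" for x
    unfolding distrib_right using that c(2) d(2) by (intro has_sum_add) auto
  then show ?thesis unfolding analytic_at_pt_def
    using c(1) d(1) by (intro exI[of _ "\<lambda>\<alpha>. c \<alpha> + d \<alpha>"] exI[of _ "min \<epsilon> \<delta>"]) auto
qed

text \<open>Unconditional summation allows terms with the same monomial to be collected. The
  collected coefficient does not depend on y, as a power series requires. Where the monomial
  vanishes at y, the coefficients need not be summable, but the product is 0 all the same.\<close>

lemma has_sum_regroup:
  fixes e :: "'i \<Rightarrow> real" and g :: "'i \<Rightarrow> ('v \<Rightarrow>\<^sub>0 nat)"
  assumes "((\<lambda>i. e i * monom_eval (g i) y) has_sum S) I"
  shows "((\<lambda>\<alpha>. (\<Sum>\<^sub>\<infinity>i\<in>{i\<in>I. g i = \<alpha>}. e i) * monom_eval \<alpha> y) has_sum S) UNIV"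
proof -
  let ?B = "\<lambda>\<alpha>. {i \<in> I. g i = \<alpha>}"
  have bij: "bij_betw snd (Sigma UNIV ?B) I"
    by (rule bij_betwI[of _ _ _ "\<lambda>i. (g i, i)"]) auto
  have 1: "((\<lambda>p. e (snd p) * monom_eval (g (snd p)) y) has_sum S) (Sigma UNIV ?B)"
    using has_sum_reindex_bij_betw[OF bij, of "\<lambda>i. e i * monom_eval (g i) y" S] assms by simp
  have 2: "((\<lambda>i. e (snd (\<alpha>, i)) * monom_eval (g (snd (\<alpha>, i))) y) has_sum
      (\<Sum>\<^sub>\<infinity>i\<in>?B \<alpha>. e i) * monom_eval \<alpha> y) (?B \<alpha>)" for \<alpha>
  proof -
    have "(\<lambda>i. e i * monom_eval (g i) y) summable_on ?B \<alpha>"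
      using assms by (intro summable_on_subset[of _ I "?B \<alpha>"]) (auto simp: summable_on_def)
    moreover have "(\<lambda>i. e i * monom_eval (g i) y) summable_on ?B \<alpha> \<longleftrightarrow> (\<lambda>i. e i * monom_eval \<alpha> y) summable_on ?B \<alpha>"
      by (rule summable_on_cong) auto
    ultimately have "((\<lambda>i. e i * monom_eval \<alpha> y) has_sum (\<Sum>\<^sub>\<infinity>i\<in>?B \<alpha>. e i * monom_eval \<alpha> y)) (?B \<alpha>)"
      by simp
    also have "(\<Sum>\<^sub>\<infinity>i\<in>?B \<alpha>. e i * monom_eval \<alpha> y) = (\<Sum>\<^sub>\<infinity>i\<in>?B \<alpha>. e i) * monom_eval \<alpha> y"
      by (rule infsum_cmult_left')
    finally show ?thesis
      by (rule has_sum_cong[THEN iffD1, rotated]) auto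
  qed
  show ?thesis by (rule has_sum_SigmaD[OF 1 2])
qed

text \<open>The Cauchy product: both series converge absolutely, so the products of their terms are
  summable over pairs of exponents and can be regrouped by the sum of the exponents.\<close>

lemma analytic_at_mult:
  assumes "analytic_at_pt a f" "analytic_at_pt a g"
  shows "analytic_at_pt a (\<lambda>x. f x * g x)"
proof -
  obtain c \<epsilon> where c: "\<epsilon> > 0" "\<forall>x\<in>ball a \<epsilon>. ((\<lambda>\<alpha>. c \<alpha> * monom_eval \<alpha> (($) (x - a))) has_sum f x) UNIV"
    using assms(1) unfolding analytic_at_pt_def by blast
  obtain d \<delta> where d: "\<delta> > 0" "\<forall>x\<in>ball a \<delta>. ((\<lambda>\<alpha>. d \<alpha> * monom_eval \<alpha> (($) (x - a))) has_sum g x) UNIV"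
    using assms(2) unfolding analytic_at_pt_def by blast
  define e where "e p = c (fst p) * d (snd p)" for p
  define h :: "('a \<Rightarrow>\<^sub>0 nat) \<times> ('a \<Rightarrow>\<^sub>0 nat) \<Rightarrow> 'a \<Rightarrow>\<^sub>0 nat" where "h p = fst p + snd p" for p
  have "((\<lambda>p. e p * monom_eval (h p) (($) (x - a))) has_sum f x * g x) UNIV"
    if x: "x \<in> ball a (min \<epsilon> \<delta>)" for x
  proof -
    let ?y = "($) (x - a)"
    let ?F = "\<lambda>\<alpha>. c \<alpha> * monom_eval \<alpha> ?y" and ?G = "\<lambda>\<alpha>. d \<alpha> * monom_eval \<alpha> ?y"
    have F: "(?F has_sum f x) UNIV" and G: "(?G has_sum g x) UNIV" using x c(2) d(2) by auto
    have absF: "(\<lambda>\<alpha>. norm (?F \<alpha>)) summable_on UNIV" and absG: "(\<lambda>\<alpha>. norm (?G \<alpha>)) summable_on UNIV"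
      by (rule summable_on_iff_abs_summable_on_real[THEN iffD1, OF has_sum_imp_summable[OF F]]
          summable_on_iff_abs_summable_on_real[THEN iffD1, OF has_sum_imp_summable[OF G]])+
    have "(\<lambda>p. norm ((\<lambda>(p, q). ?F p * ?G q) p)) summable_on UNIV \<times> UNIV"
    proof (rule summable_on_SigmaI)
      show "((\<lambda>q. norm ((\<lambda>(p, q). ?F p * ?G q) (p, q))) has_sum norm (?F p) * (\<Sum>\<^sub>\<infinity>q. norm (?G q))) UNIV" for p
        using has_sum_cmult_right[OF has_sum_infsum[OF absG], of "norm (?F p)"] by (simp add: abs_mult)
      show "(\<lambda>p. norm (?F p) * (\<Sum>\<^sub>\<infinity>q. norm (?G q))) summable_on UNIV"
        using absF by (rule summable_on_cmult_left)
    qed simp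
    then have sm: "(\<lambda>(p, q). ?F p * ?G q) summable_on UNIV \<times> UNIV"
      by (rule abs_summable_summable)
    have "((\<lambda>(p, q). ?F p * ?G q) has_sum f x * g x) (UNIV \<times> UNIV)"
      using sm
      by (intro has_sum_SigmaI[where g = "\<lambda>p. ?F p * g x"])
        (auto intro: has_sum_cmult_right[OF G] has_sum_cmult_left[OF F])
    moreover have "(\<lambda>(p, q). ?F p * ?G q) = (\<lambda>p. e p * monom_eval (h p) ?y)"
      by (auto simp: e_def h_def monom_eval_add fun_eq_iff)
    ultimately show ?thesis by simp
  qed
  note sums = this
  have "((\<lambda>\<alpha>. (\<Sum>\<^sub>\<infinity>p\<in>{p\<in>UNIV. h p = \<alpha>}. e p) * monom_eval \<alpha> (($) (x - a))) has_sum f x * g x) UNIV"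
    if "x \<in> ball a (min \<epsilon> \<delta>)" for x
    by (rule has_sum_regroup) (rule sums[OF that])
  then show ?thesis unfolding analytic_at_pt_def
    using c(1) d(1) by (intro exI[of _ "\<lambda>\<alpha>. (\<Sum>\<^sub>\<infinity>p\<in>{p\<in>UNIV. h p = \<alpha>}. e p)"] exI[of _ "min \<epsilon> \<delta>"]) auto
qed

text \<open>A submultiplicative majorant of the value at \<open>y\<close>; it bounds the sum of the
  absolute values of all terms, not just their sum.\<close>

definition poly_norm :: "('v \<Rightarrow> real) \<Rightarrow> 'v rpoly \<Rightarrow> real" where
  "poly_norm y p = (\<Sum>\<alpha>\<in>Poly_Mapping.keys p. \<bar>Poly_Mapping.lookup p \<alpha>\<bar> * \<bar>monom_eval \<alpha> y\<bar>)"

lemma poly_norm_superset: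
  assumes "finite A" "Poly_Mapping.keys p \<subseteq> A"
  shows "poly_norm y p = (\<Sum>\<alpha>\<in>A. \<bar>Poly_Mapping.lookup p \<alpha>\<bar> * \<bar>monom_eval \<alpha> y\<bar>)"
  unfolding poly_norm_def
  by (rule sum.mono_neutral_left) (use assms in \<open>auto simp: in_keys_iff\<close>)

lemma poly_norm_add: "poly_norm y (p + q) \<le> poly_norm y p + poly_norm y q"
proof -
  let ?A = "Poly_Mapping.keys p \<union> Poly_Mapping.keys q"
  have "poly_norm y (p + q) = (\<Sum>\<alpha>\<in>?A. \<bar>Poly_Mapping.lookup (p + q) \<alpha>\<bar> * \<bar>monom_eval \<alpha> y\<bar>)"
    by (rule poly_norm_superset) (auto simp: in_keys_iff lookup_add)
  also have "\<dots> \<le> (\<Sum>\<alpha>\<in>?A. \<bar>Poly_Mapping.lookup p \<alpha>\<bar> * \<bar>monom_eval \<alpha> y\<bar> + \<bar>Poly_Mapping.lookup q \<alpha>\<bar> * \<bar>monom_eval \<alpha> y\<bar>)"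
    unfolding distrib_right[symmetric] lookup_add by (intro sum_mono mult_right_mono abs_triangle_ineq) simp
  also have "\<dots> = poly_norm y p + poly_norm y q"
    by (simp add: sum.distrib poly_norm_superset[of ?A])
  finally show ?thesis .
qed

lemma poly_norm_sum: "poly_norm y (sum f I) \<le> (\<Sum>i\<in>I. poly_norm y (f i))"
proof (induction I rule: infinite_finite_induct)
  case (insert x F)
  then show ?case using poly_norm_add[of y "f x" "sum f F"] by simp
qed (simp_all add: poly_norm_def)

lemma poly_norm_single: "poly_norm y (Poly_Mapping.single \<alpha> c) = \<bar>c\<bar> * \<bar>monom_eval \<alpha> y\<bar>"
  by (cases "c = 0") (simp_all add: poly_norm_def)

lemma poly_norm_mult: "poly_norm y (p * q) \<le> poly_norm y p * poly_norm y q"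
proof -
  have "poly_norm y (p * q) \<le> (\<Sum>\<alpha>\<in>Poly_Mapping.keys p. \<Sum>\<beta>\<in>Poly_Mapping.keys q.
    poly_norm y (Poly_Mapping.single (\<alpha> + \<beta>) (Poly_Mapping.lookup p \<alpha> * Poly_Mapping.lookup q \<beta>)))"
    unfolding mult_eq_sum_singles by (intro order.trans[OF poly_norm_sum] sum_mono poly_norm_sum)
  also have "\<dots> = poly_norm y p * poly_norm y q"
    unfolding poly_norm_single poly_norm_def sum_product
    by (intro sum.cong refl) (simp add: monom_eval_add abs_mult)
  finally show ?thesis .
qed

lemma poly_norm_nonneg: "poly_norm y p \<ge> 0"
  unfolding poly_norm_def by (intro sum_nonneg) simp

lemma poly_norm_power: "poly_norm y (p ^ n) \<le> poly_norm y p ^ n"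
proof (induction n)
  case 0
  show ?case using poly_norm_single[of y 0 1] by (simp add: single_one[symmetric] del: single_one)
next
  case (Suc n)
  have "poly_norm y (p * p ^ n) \<le> poly_norm y p * poly_norm y (p ^ n)" by (rule poly_norm_mult)
  also have "\<dots> \<le> poly_norm y p * poly_norm y p ^ n"
    by (intro mult_left_mono Suc poly_norm_nonneg)
  finally show ?case by simp
qed

lemma abs_poly_eval_le: "\<bar>poly_eval p y\<bar> \<le> poly_norm y p"
  unfolding poly_eval_def poly_norm_def by (rule order.trans[OF sum_abs]) (simp add: abs_mult)

lemma poly_eval_1 [simp]: "poly_eval 1 y = 1"
  using poly_eval_single[of 0 1 y] by (simp add: single_one[symmetric] del: single_one poly_eval_single)

lemma poly_eval_power: "poly_eval (p ^ n) y = poly_eval p y ^ n"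
  by (induction n) (simp_all add: poly_eval_mult)

lemma has_sum_poly_norm:
  "((\<lambda>\<alpha>. \<bar>Poly_Mapping.lookup p \<alpha> * monom_eval \<alpha> y\<bar>) has_sum poly_norm y p) UNIV"
proof -
  have "((\<lambda>\<alpha>. \<bar>Poly_Mapping.lookup p \<alpha> * monom_eval \<alpha> y\<bar>) has_sum poly_norm y p) (Poly_Mapping.keys p)"
    unfolding poly_norm_def abs_mult[symmetric] by (rule has_sum_finite) simp
  then show ?thesis
    by (rule has_sum_cong_neutral[THEN iffD1, rotated -1]) (auto simp: in_keys_iff)
qed

lemma monom_eval_at_0: "\<alpha> \<noteq> 0 \<Longrightarrow> monom_eval \<alpha> (\<lambda>v. 0) = 0"
  unfolding monom_eval_def by (auto simp: in_keys_iff poly_mapping_eq_iff fun_eq_iff power_0_left intro!: prod_zero)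

text \<open>The terms of all powers k^n are summed at once. Their absolute values are dominated by
  the binomial series at \<open>poly_norm y k\<close>, which is less than 1.\<close>

lemma binomial_series_has_sum:
  fixes k :: "'v rpoly" and s :: real
  assumes "poly_norm y k < 1"
  shows "((\<lambda>p. ((s gchoose fst p) * Poly_Mapping.lookup (k ^ fst p) (snd p)) * monom_eval (snd p) y)
           has_sum (1 + poly_eval k y) powr s) (UNIV \<times> UNIV)"
proof -
  define b where "b n = s gchoose n" for n
  define N where "N = poly_norm y k"
  have N: "0 \<le> N" "N < 1" unfolding N_def using assms poly_norm_nonneg by auto
  have absN: "summable (\<lambda>n. norm (b n * N ^ n))"
  proof (rule powser_insidea)
    \<comment> \<open>An intermediate point between N and 1: convergence there yields absolute
      convergence at N.\<close>
    show "summable (\<lambda>n. b n * ((N + 1) / 2) ^ n)"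
      unfolding b_def using N by (intro sums_summable[OF gen_binomial_real]) auto
    show "norm N < norm ((N + 1) / 2)" using N by simp
  qed
  have z: "\<bar>poly_eval k y\<bar> \<le> N" unfolding N_def by (rule abs_poly_eval_le)
  have "summable (\<lambda>n. norm (b n * poly_eval k y ^ n))"
  proof (rule summable_comparison_test'[OF absN, of 0])
    fix n
    have "\<bar>poly_eval k y\<bar> ^ n \<le> N ^ n" using z by (intro power_mono) auto
    then show "norm (norm (b n * poly_eval k y ^ n)) \<le> norm (b n * N ^ n)"
      using N by (simp add: abs_mult power_abs mult_left_mono)
  qed
  moreover have "(\<lambda>n. b n * poly_eval k y ^ n) sums (1 + poly_eval k y) powr s"
    unfolding b_def using z N by (intro gen_binomial_real) auto
  ultimately have outer: "((\<lambda>n. b n * poly_eval k y ^ n) has_sum (1 + poly_eval k y) powr s) UNIV"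
    by (rule norm_summable_imp_has_sum)
  let ?t = "\<lambda>p. (b (fst p) * Poly_Mapping.lookup (k ^ fst p) (snd p)) * monom_eval (snd p) y"
  have inner: "((\<lambda>\<alpha>. ?t (n, \<alpha>)) has_sum b n * poly_eval k y ^ n) UNIV" for n
    using has_sum_cmult_right[OF has_sum_poly_eval[of "k ^ n" y], of "b n"]
    by (simp add: poly_eval_power mult.assoc)
  have "(\<lambda>p. norm (?t p)) summable_on Sigma UNIV (\<lambda>_. UNIV)"
  proof (rule summable_on_SigmaI)
    show "((\<lambda>\<alpha>. norm (?t (n, \<alpha>))) has_sum \<bar>b n\<bar> * poly_norm y (k ^ n)) UNIV" for n
      using has_sum_cmult_right[OF has_sum_poly_norm[of "k ^ n" y], of "\<bar>b n\<bar>"]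
      by (simp add: abs_mult mult.assoc)
    have "summable (\<lambda>n. norm (\<bar>b n\<bar> * poly_norm y (k ^ n)))"
    proof (rule summable_comparison_test'[OF absN, of 0])
      fix n
      show "norm (norm (\<bar>b n\<bar> * poly_norm y (k ^ n))) \<le> norm (b n * N ^ n)"
        using poly_norm_power[of y k n] poly_norm_nonneg[of y "k ^ n"] N
        by (simp add: abs_mult N_def mult_left_mono)
    qed
    then show "(\<lambda>n. \<bar>b n\<bar> * poly_norm y (k ^ n)) summable_on UNIV"
      by (rule norm_summable_imp_summable_on)
  qed simp
  then have "?t summable_on Sigma UNIV (\<lambda>_. UNIV)" by (rule abs_summable_summable)
  then have "(?t has_sum (1 + poly_eval k y) powr s) (Sigma UNIV (\<lambda>_. UNIV))"
    by (intro has_sum_SigmaI[OF inner outer])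
  then show ?thesis by (simp add: b_def)
qed

text \<open>Near \<open>a\<close> one has f = f(a) (1 + k) with a polynomial k in x - a without
  constant term. Its majorant is 0 at \<open>a\<close>, hence less than 1 in a neighbourhood, where
  the binomial series can be rearranged into powers of x - a.\<close>

lemma analytic_at_powr:
  fixes a :: "real ^ 'm"
  assumes f: "polyfun UNIV f" and pos: "f (($) a) > 0"
  shows "analytic_at_pt a (\<lambda>x. f (($) x) powr s)"
proof -
  let ?fa = "f (($) a)"
  have "polyfun UNIV (\<lambda>x. f x * (1 / ?fa) - 1)"
    by (intro polyfun_intros f)
  then obtain k where k: "\<forall>y. f (\<lambda>v. y v + a $ v) * (1 / ?fa) - 1 = poly_eval k y"
    using polyfun_shift[of "\<lambda>x. f x * (1 / ?fa) - 1" "($) a"] by blast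
  have fx: "f (($) x) = ?fa * (1 + poly_eval k (($) (x - a)))" for x
  proof -
    have "(\<lambda>v. ($) (x - a) v + a $ v) = ($) x" by (rule ext) simp
    then show ?thesis using k[rule_format, of "($) (x - a)"] pos by (simp add: field_simps)
  qed
  have "poly_eval k (\<lambda>v. 0) = 0" using k[rule_format, of "\<lambda>v. 0"] pos by simp
  moreover have "poly_eval k (\<lambda>v. 0) = Poly_Mapping.lookup k 0"
  proof -
    have "poly_eval k (\<lambda>v. 0) = (\<Sum>\<alpha>\<in>insert 0 (Poly_Mapping.keys k). Poly_Mapping.lookup k \<alpha> * monom_eval \<alpha> (\<lambda>v. 0))"
      by (rule poly_eval_superset) auto
    also have "\<dots> = (\<Sum>\<alpha>\<in>insert 0 (Poly_Mapping.keys k). if \<alpha> = 0 then Poly_Mapping.lookup k \<alpha> else 0)"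
      by (intro sum.cong refl) (simp add: monom_eval_at_0)
    also have "\<dots> = Poly_Mapping.lookup k 0" by (simp add: sum.delta)
    finally show ?thesis .
  qed
  ultimately have k0: "Poly_Mapping.lookup k 0 = 0" by simp
  have "poly_norm (($) (a - a)) k = (\<Sum>\<alpha>\<in>Poly_Mapping.keys k. 0)"
    unfolding poly_norm_def
  proof (intro sum.cong refl)
    fix \<alpha> assume "\<alpha> \<in> Poly_Mapping.keys k"
    then have "\<alpha> \<noteq> 0" using k0 by (auto simp: in_keys_iff)
    moreover have "($) (a - a) = (\<lambda>v. 0)" by (rule ext) simp
    ultimately show "\<bar>Poly_Mapping.lookup k \<alpha>\<bar> * \<bar>monom_eval \<alpha> (($) (a - a))\<bar> = 0"
      by (simp add: monom_eval_at_0)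
  qed
  then have norm0: "poly_norm (($) (a - a)) k < 1" by simp
  have "continuous_on UNIV (\<lambda>x. poly_norm (($) (x - a)) k)"
    unfolding poly_norm_def monom_eval_def by (intro continuous_intros)
  then have "open {x. poly_norm (($) (x - a)) k < 1}"
    by (intro open_Collect_less continuous_intros)
  then obtain \<epsilon> where \<epsilon>: "\<epsilon> > 0" "ball a \<epsilon> \<subseteq> {x. poly_norm (($) (x - a)) k < 1}"
    using norm0 unfolding open_contains_ball by blast
  define e where "e p = (s gchoose fst p) * Poly_Mapping.lookup (k ^ fst p) (snd p)" for p :: "nat \<times> ('m \<Rightarrow>\<^sub>0 nat)"
  define c where "c \<alpha> = ?fa powr s * (\<Sum>\<^sub>\<infinity>p\<in>{p\<in>UNIV \<times> UNIV. snd p = \<alpha>}. e p)" for \<alpha>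
  have "((\<lambda>\<alpha>. c \<alpha> * monom_eval \<alpha> (($) (x - a))) has_sum f (($) x) powr s) UNIV" if x: "x \<in> ball a \<epsilon>" for x
  proof -
    have n1: "poly_norm (($) (x - a)) k < 1" using \<epsilon>(2) x by blast
    have "((\<lambda>\<alpha>. (\<Sum>\<^sub>\<infinity>p\<in>{p\<in>UNIV \<times> UNIV. snd p = \<alpha>}. e p) * monom_eval \<alpha> (($) (x - a)))
        has_sum (1 + poly_eval k (($) (x - a))) powr s) UNIV"
      by (rule has_sum_regroup) (use binomial_series_has_sum[OF n1, of s] in \<open>simp add: e_def\<close>)
    then have "((\<lambda>\<alpha>. ?fa powr s * ((\<Sum>\<^sub>\<infinity>p\<in>{p\<in>UNIV \<times> UNIV. snd p = \<alpha>}. e p) * monom_eval \<alpha> (($) (x - a))))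
        has_sum ?fa powr s * (1 + poly_eval k (($) (x - a))) powr s) UNIV"
      by (rule has_sum_cmult_right)
    moreover have "?fa powr s * (1 + poly_eval k (($) (x - a))) powr s = f (($) x) powr s"
    proof -
      have "\<bar>poly_eval k (($) (x - a))\<bar> < 1" using abs_poly_eval_le[of k "($) (x - a)"] n1 by linarith
      then show ?thesis unfolding fx[of x] using pos by (subst powr_mult) auto
    qed
    ultimately show ?thesis by (simp add: c_def mult.assoc)
  qed
  then show ?thesis unfolding analytic_at_pt_def using \<epsilon>(1) by blast
qed

section \<open>Nash functions on an irreducible set\<close>

lemma polyfun_at_Some: "polyfun UNIV f \<Longrightarrow> polyfun UNIV (\<lambda>z. f (\<lambda>v. z (Some v)))"
  by (rule polyfun_compose) (auto intro: polyfun_var)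

text \<open>The function y = Q L^(-1/2) + E satisfies (y - E)^2 L = Q^2. A point with L positive is
  needed to see that this polynomial relation is not the trivial one.\<close>

lemma nash_on_polyfun_sqrt:
  fixes Q E L :: "('m::finite \<Rightarrow> real) \<Rightarrow> real"
  assumes Q: "polyfun UNIV Q" and E: "polyfun UNIV E" and L: "polyfun UNIV L"
    and ne: "L (($) x0) > 0"
  shows "nash_on {x :: real ^ 'm. L (($) x) > 0} (\<lambda>x. Q (($) x) * L (($) x) powr (- 1 / 2) + E (($) x))"
  unfolding nash_on_def
proof (intro conjI)
  let ?U = "{x :: real ^ 'm. L (($) x) > 0}"
  show "open ?U"
    by (intro open_Collect_less continuous_intros continuous_on_polyfun[OF L])
  obtain p where "\<forall>x. L x = poly_eval p x" using L unfolding polyfun_def by blast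
  then show "semialgebraic ?U" using semialgebraic.gt[of p] by simp
  show "real_analytic_on ?U (\<lambda>x. Q (($) x) * L (($) x) powr (- 1 / 2) + E (($) x))"
    unfolding real_analytic_on_iff
    by (intro ballI analytic_at_add analytic_at_mult analytic_at_polyfun Q E analytic_at_powr L) simp
  let ?R = "\<lambda>z. (z None - E (\<lambda>v. z (Some v)))\<^sup>2 * L (\<lambda>v. z (Some v)) - (Q (\<lambda>v. z (Some v)))\<^sup>2"
  have "polyfun UNIV ?R"
    by (intro polyfun_diff polyfun_mult polyfun_power polyfun_at_Some Q E L polyfun_var) simp
  then obtain P where P: "\<forall>z. ?R z = poly_eval P z" unfolding polyfun_def by blast
  have "P \<noteq> 0"
  proof
    assume "P = 0"
    let ?Q = "Q (($) x0)" and ?E = "E (($) x0)" and ?L = "L (($) x0)"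
    \<comment> \<open>A value of y for which (y - E)^2 L is (|Q| + 1)^2, which differs from
      Q^2.\<close>
    have "poly_eval P (case_option (?E + (\<bar>?Q\<bar> + 1) / sqrt ?L) (($) x0)) = 0" using \<open>P = 0\<close> by simp
    then have "((\<bar>?Q\<bar> + 1) / sqrt ?L)\<^sup>2 * ?L = ?Q\<^sup>2" unfolding P[rule_format, symmetric] by simp
    then have "(\<bar>?Q\<bar> + 1)\<^sup>2 = ?Q\<^sup>2" using ne by (simp add: power_divide)
    then have "2 * \<bar>?Q\<bar> + 1 = 0" by (simp add: power2_eq_square algebra_simps)
    then show False by linarith
  qed
  moreover have "poly_eval P (case_option (Q (($) x) * L (($) x) powr (- 1 / 2) + E (($) x)) (($) x)) = 0"
    if "x \<in> ?U" for x
  proof -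
    have "(L (($) x) powr (- 1 / 2))\<^sup>2 * L (($) x) = L (($) x) powr (- 1) * L (($) x)"
      by (simp add: power2_eq_square flip: powr_add)
    also have "\<dots> = 1" using that by (simp add: powr_minus)
    finally show ?thesis unfolding P[rule_format, symmetric] by (simp add: power_mult_distrib algebra_simps)
  qed
  ultimately show "\<exists>P :: 'm option rpoly. P \<noteq> 0 \<and>
     (\<forall>x\<in>?U. poly_eval P (case_option (Q (($) x) * L (($) x) powr (- 1 / 2) + E (($) x)) (($) x)) = 0)"
    by blast
qed

text \<open>The source of zero divisors: \<open>Q / \<surd>L\<close> is a Nash function which equals \<open>E\<close> or \<open>-E\<close> at each point.\<close>

theorem irreducible_sign:
  fixes S :: "(real ^ 'm) set"
  assumes irr: "semialgebraic_irreducible S"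
    and Q: "polyfun UNIV Q" and E: "polyfun UNIV E" and L: "polyfun UNIV L"
    and pos: "\<And>x. x \<in> S \<Longrightarrow> L (($) x) > 0"
    and eq: "\<And>x. x \<in> S \<Longrightarrow> (Q (($) x))\<^sup>2 = (E (($) x))\<^sup>2 * L (($) x)"
  shows "(\<forall>x\<in>S. Q (($) x) * E (($) x) \<ge> 0) \<or> (\<forall>x\<in>S. Q (($) x) * E (($) x) \<le> 0)"
proof (cases "S = {}")
  case False
  then obtain x0 where x0: "x0 \<in> S" by blast
  interpret domain "nash_ring S" using irr unfolding semialgebraic_irreducible_def .
  define h where "h x = Q (($) x) * L (($) x) powr (- 1 / 2)" for x :: "real ^ 'm"
  define f where "f = restrict (\<lambda>x. h x + - E (($) x)) S"
  define g where "g = restrict (\<lambda>x. h x + E (($) x)) S"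
  have carrier: "restrict (\<lambda>x. h x + E' (($) x)) S \<in> carrier (nash_ring S)" if E': "polyfun UNIV E'" for E'
  proof -
    have "S \<subseteq> {x. L (($) x) > 0}" using pos by blast
    moreover have "nash_on {x. L (($) x) > 0} (\<lambda>x. h x + E' (($) x))"
      unfolding h_def by (rule nash_on_polyfun_sqrt[OF Q E' L pos[OF x0]])
    ultimately show ?thesis unfolding nash_ring_def by auto
  qed
  have fc: "f \<in> carrier (nash_ring S)" and gc: "g \<in> carrier (nash_ring S)"
    unfolding f_def g_def by (intro carrier polyfun_uminus E)+
  have h2: "h x * h x = E (($) x) * E (($) x)" if x: "x \<in> S" for x
  proof -
    have "(L (($) x) powr (- 1 / 2))\<^sup>2 * L (($) x) = L (($) x) powr (- 1) * L (($) x)"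
      by (simp add: power2_eq_square flip: powr_add)
    also have "\<dots> = 1" using pos[OF x] by (simp add: powr_minus)
    finally have "(L (($) x) powr (- 1 / 2))\<^sup>2 * L (($) x) = 1" .
    moreover have "h x * h x = (Q (($) x))\<^sup>2 * (L (($) x) powr (- 1 / 2))\<^sup>2"
      by (simp add: h_def power2_eq_square)
    ultimately show ?thesis unfolding eq[OF x]
      by (simp add: power2_eq_square mult.assoc mult.commute[of "L _"])
  qed
  have "f \<otimes>\<^bsub>nash_ring S\<^esub> g = \<zero>\<^bsub>nash_ring S\<^esub>"
    unfolding nash_ring_def f_def g_def using h2 by (auto simp: algebra_simps restrict_def)
  then have "f = \<zero>\<^bsub>nash_ring S\<^esub> \<or> g = \<zero>\<^bsub>nash_ring S\<^esub>" using fc gc by (rule integral)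
  then show ?thesis
  proof
    assume "f = \<zero>\<^bsub>nash_ring S\<^esub>"
    then have "h x = E (($) x)" if "x \<in> S" for x
    proof -
      have "f x = 0" using \<open>f = \<zero>\<^bsub>nash_ring S\<^esub>\<close> that by (simp add: nash_ring_def)
      then show ?thesis using that by (simp add: f_def)
    qed
    then have "Q (($) x) * E (($) x) \<ge> 0" if "x \<in> S" for x
      using that h_def[of x] by (metis mult.assoc mult.commute powr_ge_zero mult_nonneg_nonneg zero_le_square)
    then show ?thesis by blast
  next
    assume "g = \<zero>\<^bsub>nash_ring S\<^esub>"
    then have "h x = - E (($) x)" if "x \<in> S" for x
    proof -
      have "g x = 0" using \<open>g = \<zero>\<^bsub>nash_ring S\<^esub>\<close> that by (simp add: nash_ring_def)
      then show ?thesis using that by (simp add: g_def)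
    qed
    then have "Q (($) x) * E (($) x) \<le> 0" if "x \<in> S" for x
    proof -
      have "E (($) x) = - (Q (($) x) * L (($) x) powr (- 1 / 2))"
        using \<open>\<And>x. x \<in> S \<Longrightarrow> h x = - E (($) x)\<close>[OF that] by (simp add: h_def)
      then have "Q (($) x) * E (($) x) = - (Q (($) x) * Q (($) x) * L (($) x) powr (- 1 / 2))" by simp
      then show ?thesis by simp
    qed
    then show ?thesis by blast
  qed
qed simp

lemma polyfun_sqdist: "polyfun UNIV (\<lambda>x. \<Sum>i\<in>UNIV. (x i - (a :: real ^ 'm) $ i)\<^sup>2)"
  by (intro polyfun_intros polyfun_var) simp

lemma sqdist_eq: "(\<Sum>i\<in>UNIV. (x $ i - a $ i)\<^sup>2) = (dist x a)\<^sup>2" for x a :: "real ^ 'm"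
  by (simp add: dist_norm norm_vec_def L2_set_def sum_nonneg)

text \<open>On S the function |x - x0|^2 - \<open>\<epsilon>\<close>^2/4 vanishes nowhere and is
  negative at \<open>x0\<close> only. Divided by the root of its own square it takes the values -1
  and 1, and a Nash function on an irreducible set cannot take both.\<close>

lemma irreducible_no_isolated:
  fixes S :: "(real ^ 'm) set"
  assumes irr: "semialgebraic_irreducible S" and x0: "x0 \<in> S" and \<epsilon>: "\<epsilon> > 0"
    and iso: "\<And>x. x \<in> S \<Longrightarrow> x \<noteq> x0 \<Longrightarrow> dist x x0 \<ge> \<epsilon>"
  shows "S = {x0}"
proof (rule ccontr)
  assume "S \<noteq> {x0}"
  then obtain x1 where x1: "x1 \<in> S" "x1 \<noteq> x0" using x0 by blast
  define Q where "Q x = (\<Sum>i\<in>UNIV. (x i - x0 $ i)\<^sup>2) - \<epsilon>\<^sup>2 / 4" for x :: "'m \<Rightarrow> real"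
  have Q: "polyfun UNIV Q" unfolding Q_def[abs_def] by (intro polyfun_diff polyfun_sqdist polyfun_const)
  have Qx: "Q (($) x) = (dist x x0)\<^sup>2 - \<epsilon>\<^sup>2 / 4" for x unfolding Q_def sqdist_eq ..
  have far: "Q (($) x) > 0" if "x \<in> S" "x \<noteq> x0" for x
  proof -
    have "\<epsilon>\<^sup>2 \<le> (dist x x0)\<^sup>2" using iso[OF that] \<epsilon> by (intro power_mono) auto
    moreover have "\<epsilon>\<^sup>2 > 0" using \<epsilon> by simp
    ultimately show ?thesis unfolding Qx by linarith
  qed
  have near: "Q (($) x0) < 0" unfolding Qx using \<epsilon> by simp
  have "(\<forall>x\<in>S. Q (($) x) * 1 \<ge> 0) \<or> (\<forall>x\<in>S. Q (($) x) * 1 \<le> 0)"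
  proof (rule irreducible_sign[OF irr Q polyfun_const polyfun_power[OF Q]])
    show "0 < (Q (($) x))\<^sup>2" if "x \<in> S" for x
      using far[OF that] near by (cases "x = x0") auto
  qed simp
  then show False using far[OF x1] near x0 x1 by fastforce
qed

section \<open>The ring of Nash functions\<close>

definition algebraic_on :: "(real ^ 'm) set \<Rightarrow> (real ^ 'm \<Rightarrow> real) \<Rightarrow> bool" where
  "algebraic_on U f \<longleftrightarrow> (\<exists>P :: 'm option rpoly. P \<noteq> 0 \<and> (\<forall>x\<in>U. poly_eval P (case_option (f x) (($) x)) = 0))"

lemma polyfun_split_None:
  fixes P :: "'v option rpoly"
  obtains D q where "\<forall>i. polyfun UNIV (q i)"
    "\<forall>y x. poly_eval P (case_option y x) = (\<Sum>i\<le>D. q i x * y ^ i)"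
proof -
  define D where "D = Max (insert 0 ((\<lambda>\<alpha>. Poly_Mapping.lookup \<alpha> None) ` Poly_Mapping.keys P))"
  define r where "r \<alpha> x = Poly_Mapping.lookup P \<alpha> * (\<Prod>v\<in>Poly_Mapping.keys \<alpha> - {None}. x (the v) ^ Poly_Mapping.lookup \<alpha> v)"
    for \<alpha> and x :: "'v \<Rightarrow> real"
  define q where "q i x = (\<Sum>\<alpha>\<in>{\<alpha>\<in>Poly_Mapping.keys P. Poly_Mapping.lookup \<alpha> None = i}. r \<alpha> x)" for i x
  have bound: "Poly_Mapping.lookup \<alpha> None \<le> D" if "\<alpha> \<in> Poly_Mapping.keys P" for \<alpha>
    unfolding D_def using that by (intro Max_ge) auto
  have split: "monom_eval \<alpha> (case_option y x) = y ^ Poly_Mapping.lookup \<alpha> None *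
      (\<Prod>v\<in>Poly_Mapping.keys \<alpha> - {None}. x (the v) ^ Poly_Mapping.lookup \<alpha> v)" for \<alpha> y and x :: "'v \<Rightarrow> real"
  proof -
    have "monom_eval \<alpha> (case_option y x) = (\<Prod>v\<in>insert None (Poly_Mapping.keys \<alpha>). case_option y x v ^ Poly_Mapping.lookup \<alpha> v)"
      by (rule monom_eval_superset) auto
    also have "\<dots> = y ^ Poly_Mapping.lookup \<alpha> None * (\<Prod>v\<in>Poly_Mapping.keys \<alpha> - {None}. case_option y x v ^ Poly_Mapping.lookup \<alpha> v)"
      by (simp add: prod.insert_remove)
    also have "(\<Prod>v\<in>Poly_Mapping.keys \<alpha> - {None}. case_option y x v ^ Poly_Mapping.lookup \<alpha> v) =
        (\<Prod>v\<in>Poly_Mapping.keys \<alpha> - {None}. x (the v) ^ Poly_Mapping.lookup \<alpha> v)"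
      by (rule prod.cong) auto
    finally show ?thesis .
  qed
  have "poly_eval P (case_option y x) = (\<Sum>i\<le>D. q i x * y ^ i)" for y x
  proof -
    have "poly_eval P (case_option y x) = (\<Sum>\<alpha>\<in>Poly_Mapping.keys P. r \<alpha> x * y ^ Poly_Mapping.lookup \<alpha> None)"
      unfolding poly_eval_def split r_def by (simp add: mult_ac)
    also have "\<dots> = (\<Sum>i\<in>{..D}. \<Sum>\<alpha>\<in>{\<alpha>\<in>Poly_Mapping.keys P. Poly_Mapping.lookup \<alpha> None = i}. r \<alpha> x * y ^ Poly_Mapping.lookup \<alpha> None)"
      by (rule sum.group[symmetric]) (auto simp: bound)
    also have "\<dots> = (\<Sum>i\<le>D. q i x * y ^ i)"
      unfolding q_def sum_distrib_right by (intro sum.cong refl) auto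
    finally show ?thesis .
  qed
  moreover have "polyfun UNIV (q i)" for i
    unfolding q_def[abs_def] r_def by (intro polyfun_intros polyfun_var) auto
  ultimately show ?thesis using that[of q D] by blast
qed

text \<open>The relation is multiplied by the unknown, so that its degree is positive.\<close>

lemma algebraic_on_coeffs:
  fixes f :: "real ^ 'm \<Rightarrow> real"
  assumes "algebraic_on U f"
  obtains d p where "d > 0" "\<forall>i. polyfun UNIV (p i)" "\<exists>x. p d x \<noteq> 0"
    "\<forall>x\<in>U. (\<Sum>i\<le>d. p i (($) x) * f x ^ i) = 0"
proof -
  obtain P :: "'m option rpoly" where P: "P \<noteq> 0" "\<forall>x\<in>U. poly_eval P (case_option (f x) (($) x)) = 0"
    using assms unfolding algebraic_on_def by blast
  obtain D q where q: "\<forall>i. polyfun UNIV (q i)" "\<forall>y x. poly_eval P (case_option y x) = (\<Sum>i\<le>D. q i x * y ^ i)"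
    by (rule polyfun_split_None)
  obtain z where z: "poly_eval P z \<noteq> 0" using poly_eval_nonzero[OF P(1)] by blast
  have "z = case_option (z None) (\<lambda>v. z (Some v))" by (rule ext) (simp split: option.split)
  then have "(\<Sum>i\<le>D. q i (\<lambda>v. z (Some v)) * z None ^ i) \<noteq> 0" using z q(2) by metis
  then obtain i where i: "i \<le> D" "q i (\<lambda>v. z (Some v)) \<noteq> 0" by (metis (no_types, lifting) atMost_iff mult_eq_0_iff sum.neutral)
  define A where "A = {i. i \<le> D \<and> (\<exists>x. q i x \<noteq> 0)}"
  have A: "finite A" "A \<noteq> {}" using i unfolding A_def by auto
  define d where "d = Max A"
  have d: "d \<le> D" "\<exists>x. q d x \<noteq> 0" using Max_in[OF A] unfolding d_def A_def by blast+
  have above: "q i x = 0" if "i \<le> D" "d < i" for i x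
  proof (rule ccontr)
    assume "q i x \<noteq> 0"
    then have "i \<in> A" using that(1) unfolding A_def by blast
    then have "i \<le> d" unfolding d_def using A(1) by (intro Max_ge)
    then show False using that(2) by simp
  qed
  define p where "p i x = (case i of 0 \<Rightarrow> 0 | Suc j \<Rightarrow> q j x)" for i x
  have "polyfun UNIV (p i)" for i
    using q(1) by (cases i) (simp_all add: p_def[abs_def])
  moreover have "(\<Sum>i\<le>Suc d. p i (($) x) * f x ^ i) = 0" if "x \<in> U" for x
  proof -
    have "(\<Sum>i\<le>Suc d. p i (($) x) * f x ^ i) = f x * (\<Sum>i\<le>d. q i (($) x) * f x ^ i)"
      by (simp add: sum.atMost_Suc_shift p_def sum_distrib_left mult_ac del: sum.atMost_Suc)
    also have "(\<Sum>i\<le>d. q i (($) x) * f x ^ i) = (\<Sum>i\<le>D. q i (($) x) * f x ^ i)"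
      by (rule sum.mono_neutral_left) (use d above in auto)
    also have "\<dots> = 0" using P(2) q(2) that by metis
    finally show ?thesis by simp
  qed
  moreover have "\<exists>x. p (Suc d) x \<noteq> 0" using d(2) by (simp add: p_def)
  ultimately show ?thesis using that[of "Suc d" p] by blast
qed

lemma polyfun_line:
  assumes "polyfun V f"
  shows "\<exists>q. \<forall>t. poly q t = f (\<lambda>v. x v + t * (y v - x v))"
  using polyfun_poly_subst[OF assms, of "\<lambda>v. [:x v, y v - x v:]"] by simp

text \<open>On the line through the two points both functions are nonzero polynomials of one
  variable.\<close>

lemma polyfun_mult_nonzero:
  assumes "polyfun V f" "polyfun V g" "f x \<noteq> 0" "g y \<noteq> 0"
  shows "\<exists>z. f z * g z \<noteq> 0"
proof -
  obtain p where p: "\<And>t. poly p t = f (\<lambda>v. x v + t * (y v - x v))" using polyfun_line[OF assms(1)] by blast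
  obtain q where q: "\<And>t. poly q t = g (\<lambda>v. x v + t * (y v - x v))" using polyfun_line[OF assms(2)] by blast
  have "p \<noteq> 0" using p[of 0] assms(3) by auto
  moreover have "q \<noteq> 0" using q[of 1] assms(4) by auto
  ultimately have "p * q \<noteq> 0" by simp
  then obtain t where "poly (p * q) t \<noteq> 0" using poly_all_0_iff_0 by blast
  then show ?thesis using p q by auto
qed

lemma polyfun_det:
  assumes "\<And>i j. polyfun V (\<lambda>z. a z i j)"
  shows "polyfun V (\<lambda>z. Determinant.det (Matrix.mat n n (\<lambda>(i, j). a z i j)))"
proof -
  have eq: "Determinant.det (Matrix.mat n n (\<lambda>(i, j). a z i j)) =
     (\<Sum>p\<in>{p. p permutes {0..<n}}. signof p * (\<Prod>i = 0..<n. a z i (p i)))" for z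
    unfolding Determinant.det_def
    by (auto intro!: sum.cong prod.cong simp: permutes_in_image)
  show ?thesis unfolding eq by (intro polyfun_intros assms)
qed

text \<open>Determinant trick: if multiplication by \<open>c u\<close> acts on the span of the \<open>v k\<close> by a polynomial
  matrix, then \<open>u\<close> is a root of a characteristic polynomial.\<close>

lemma algebraic_on_by_matrix:
  fixes u :: "real ^ 'm \<Rightarrow> real" and v :: "nat \<Rightarrow> real ^ 'm \<Rightarrow> real"
  assumes c: "polyfun UNIV c" "c x0 \<noteq> 0" and M: "\<And>k l. polyfun UNIV (M k l)"
    and n: "0 < n"
    and rel: "\<And>x k. x \<in> U \<Longrightarrow> k < n \<Longrightarrow> c (($) x) * u x * v k x = (\<Sum>l<n. M k l (($) x) * v l x)"
    and v: "\<And>x. x \<in> U \<Longrightarrow> \<exists>k<n. v k x \<noteq> 0"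
  shows "algebraic_on U u"
proof -
  define a where "a z k l = (if k = l then c (\<lambda>v. z (Some v)) * z None else 0) - M k l (\<lambda>v. z (Some v))"
    for z :: "'m option \<Rightarrow> real" and k l :: nat
  define A where "A z = Matrix.mat n n (\<lambda>(k, l). a z k l)" for z
  have A: "A z \<in> carrier_mat n n" for z by (simp add: A_def)
  have mult: "(A z *\<^sub>v Matrix.vec n w = 0\<^sub>v n) \<longleftrightarrow>
      (\<forall>k<n. c (\<lambda>v. z (Some v)) * z None * w k = (\<Sum>l<n. M k l (\<lambda>v. z (Some v)) * w l))" for z w
  proof -
    have row: "(\<Sum>l<n. a z k l * w l) = c (\<lambda>v. z (Some v)) * z None * w k - (\<Sum>l<n. M k l (\<lambda>v. z (Some v)) * w l)"
      if "k < n" for k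
    proof -
      have "(\<Sum>l<n. a z k l * w l) = (\<Sum>l<n. if l = k then c (\<lambda>v. z (Some v)) * z None * w l else 0) -
          (\<Sum>l<n. M k l (\<lambda>v. z (Some v)) * w l)"
        unfolding sum_subtractf[symmetric] by (intro sum.cong refl) (auto simp: a_def algebra_simps)
      then show ?thesis using that by simp
    qed
    have "(A z *\<^sub>v Matrix.vec n w = 0\<^sub>v n) \<longleftrightarrow> (\<forall>k<n. (\<Sum>l<n. a z k l * w l) = 0)"
      by (auto simp: Matrix.vec_eq_iff A_def scalar_prod_def lessThan_atLeast0)
    then show ?thesis using row by auto
  qed
  have "polyfun UNIV (\<lambda>z. a z k l)" for k l
    unfolding a_def
    by (cases "k = l") (auto intro!: polyfun_intros polyfun_at_Some c(1) M polyfun_var polyfun_uminus)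
  then have "polyfun UNIV (\<lambda>z. Determinant.det (A z))" unfolding A_def by (rule polyfun_det)
  then obtain P where P: "\<forall>z. Determinant.det (A z) = poly_eval P z" unfolding polyfun_def by blast
  have "poly_eval P (case_option (u x) (($) x)) = 0" if x: "x \<in> U" for x
  proof -
    let ?w = "Matrix.vec n (\<lambda>l. v l x)"
    have "?w \<noteq> 0\<^sub>v n" using v[OF x] by (auto simp: Matrix.vec_eq_iff)
    moreover have "A (case_option (u x) (($) x)) *\<^sub>v ?w = 0\<^sub>v n"
      unfolding mult using rel[OF x] by simp
    moreover have "?w \<in> carrier_vec n" by simp
    ultimately have "Determinant.det (A (case_option (u x) (($) x))) = 0"
      using det_0_iff_vec_prod_zero[OF A] by blast
    then show ?thesis using P by simp
  qed
  moreover have "P \<noteq> 0"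
  proof
    assume "P = 0"
    \<comment> \<open>If the determinant were identically 0, it would vanish for a y with |c y|
      larger than the sum of all entries of \<open>M\<close>. An entry of largest absolute value in
      a kernel vector contradicts this, by diagonal dominance.\<close>
    define B where "B = (\<Sum>k<n. \<Sum>l<n. \<bar>M k l x0\<bar>)"
    define y where "y = (B + 1) / \<bar>c x0\<bar>"
    have "Determinant.det (A (case_option y x0)) = 0" using P \<open>P = 0\<close> by simp
    then obtain w where w: "w \<in> carrier_vec n" "w \<noteq> 0\<^sub>v n" "A (case_option y x0) *\<^sub>v w = 0\<^sub>v n"
      using det_0_iff_vec_prod_zero[OF A] by blast
    define w' where "w' k = vec_index w k" for k
    have ww: "w = Matrix.vec n w'" using w(1) by (auto simp: Matrix.vec_eq_iff w'_def)
    have eq: "c x0 * y * w' k = (\<Sum>l<n. M k l x0 * w' l)" if "k < n" for k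
      using w(3) that unfolding ww mult by simp
    define m where "m = Max ((\<lambda>k. \<bar>w' k\<bar>) ` {..<n})"
    have "m \<in> (\<lambda>k. \<bar>w' k\<bar>) ` {..<n}" unfolding m_def using n by (intro Max_in) auto
    then obtain k where k: "k < n" "\<bar>w' k\<bar> = m" by auto
    have le: "\<bar>w' l\<bar> \<le> m" if "l < n" for l unfolding m_def using that by (intro Max_ge) auto
    have "m \<noteq> 0"
    proof
      assume "m = 0"
      then have "w' l = 0" if "l < n" for l using le[OF that] by simp
      then have "w = 0\<^sub>v n" unfolding ww by (auto simp: Matrix.vec_eq_iff)
      then show False using w(2) by blast
    qed
    then have m: "m > 0" using k by (metis abs_ge_zero less_le)
    have "\<bar>c x0 * y * w' k\<bar> \<le> (\<Sum>l<n. \<bar>M k l x0 * w' l\<bar>)" unfolding eq[OF k(1)] by (rule sum_abs)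
    also have "\<dots> \<le> (\<Sum>l<n. \<bar>M k l x0\<bar> * m)" by (intro sum_mono) (auto simp: abs_mult intro!: mult_left_mono le)
    also have "\<dots> \<le> B * m"
    proof -
      have "(\<Sum>l<n. \<bar>M k l x0\<bar>) \<le> B"
        unfolding B_def using k(1) member_le_sum[of k "{..<n}" "\<lambda>k. \<Sum>l<n. \<bar>M k l x0\<bar>"] by (auto intro: sum_nonneg)
      then show ?thesis using m by (simp flip: sum_distrib_right)
    qed
    finally have "\<bar>c x0 * y\<bar> \<le> B" using m k(2) by (simp add: abs_mult)
    moreover have "B \<ge> 0" unfolding B_def by (intro sum_nonneg) auto
    then have "\<bar>c x0 * y\<bar> = B + 1" unfolding y_def using c(2) by (simp add: abs_mult)
    ultimately show False by simp
  qed
  ultimately show ?thesis unfolding algebraic_on_def by blast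
qed

text \<open>Membership in the module generated by the \<open>v l\<close> over the ambient
  polynomials, with equality tested on \<open>U\<close> only. The coefficients have to be
  polynomials, since they become entries of the matrix.\<close>

definition polyspan :: "(real ^ 'm) set \<Rightarrow> nat \<Rightarrow> (nat \<Rightarrow> real ^ 'm \<Rightarrow> real) \<Rightarrow> (real ^ 'm \<Rightarrow> real) \<Rightarrow> bool" where
  "polyspan U n v w \<longleftrightarrow> (\<exists>m. (\<forall>l. polyfun UNIV (m l)) \<and> (\<forall>x\<in>U. w x = (\<Sum>l<n. m l (($) x) * v l x)))"

lemma polyspan_add:
  assumes "polyspan U n v w" "polyspan U n v w'"
  shows "polyspan U n v (\<lambda>x. w x + w' x)"
proof -
  obtain m where m: "\<forall>l. polyfun UNIV (m l)" "\<forall>x\<in>U. w x = (\<Sum>l<n. m l (($) x) * v l x)"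
    using assms(1) unfolding polyspan_def by blast
  obtain m' where m': "\<forall>l. polyfun UNIV (m' l)" "\<forall>x\<in>U. w' x = (\<Sum>l<n. m' l (($) x) * v l x)"
    using assms(2) unfolding polyspan_def by blast
  show ?thesis unfolding polyspan_def
    using m m' by (intro exI[of _ "\<lambda>l x. m l x + m' l x"]) (auto intro!: polyfun_add simp: distrib_right sum.distrib)
qed

lemma polyspan_mult:
  assumes "polyspan U n v w" "polyfun UNIV c"
  shows "polyspan U n v (\<lambda>x. c (($) x) * w x)"
proof -
  obtain m where m: "\<forall>l. polyfun UNIV (m l)" "\<forall>x\<in>U. w x = (\<Sum>l<n. m l (($) x) * v l x)"
    using assms(1) unfolding polyspan_def by blast
  show ?thesis unfolding polyspan_def
    using m by (intro exI[of _ "\<lambda>l x. c x * m l x"]) (auto intro!: polyfun_mult assms(2) simp: sum_distrib_left mult.assoc)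
qed

lemma polyspan_0: "polyspan U n v (\<lambda>x. 0)"
  unfolding polyspan_def by (intro exI[of _ "\<lambda>l x. 0"]) simp

lemma polyspan_sum: "(\<And>i. i \<in> I \<Longrightarrow> polyspan U n v (w i)) \<Longrightarrow> polyspan U n v (\<lambda>x. \<Sum>i\<in>I. w i x)"
  by (induction I rule: infinite_finite_induct) (auto intro: polyspan_0 polyspan_add)

lemma polyspan_cong: "polyspan U n v w \<Longrightarrow> (\<And>x. x \<in> U \<Longrightarrow> w x = w' x) \<Longrightarrow> polyspan U n v w'"
  unfolding polyspan_def by auto

lemma polyspan_basis: "k < n \<Longrightarrow> polyspan U n v (v k)"
  unfolding polyspan_def
proof (intro exI[of _ "\<lambda>l x. if l = k then 1 else 0"] conjI allI ballI)
  fix x assume "k < n"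
  have "(\<Sum>l<n. (if l = k then 1 else 0) * v l x) = (\<Sum>l<n. if l = k then v l x else 0)"
    by (rule sum.cong) auto
  then show "v k x = (\<Sum>l<n. (if l = k then 1 else 0) * v l x)" using \<open>k < n\<close> by simp
qed (simp split: if_splits)

lemma algebraic_on_by_polyspan:
  fixes u :: "real ^ 'm \<Rightarrow> real"
  assumes c: "polyfun UNIV c" "c x0 \<noteq> 0" and n: "0 < n"
    and rel: "\<And>k. k < n \<Longrightarrow> polyspan U n v (\<lambda>x. c (($) x) * (u x * v k x))"
    and v: "\<And>x. x \<in> U \<Longrightarrow> \<exists>k<n. v k x \<noteq> 0"
  shows "algebraic_on U u"
proof -
  have "\<forall>k\<in>{..<n}. \<exists>m. (\<forall>l. polyfun UNIV (m l)) \<and> (\<forall>x\<in>U. c (($) x) * (u x * v k x) = (\<Sum>l<n. m l (($) x) * v l x))"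
    using rel unfolding polyspan_def by blast
  then obtain M where M: "\<forall>k\<in>{..<n}. (\<forall>l. polyfun UNIV (M k l)) \<and> (\<forall>x\<in>U. c (($) x) * (u x * v k x) = (\<Sum>l<n. M k l (($) x) * v l x))"
    unfolding bchoice_iff by blast
  show ?thesis
  proof (rule algebraic_on_by_matrix[OF c _ n _ v, of "\<lambda>k l. if k < n then M k l else (\<lambda>_. 0)"])
    show "polyfun UNIV (if k < n then M k l else (\<lambda>_. 0))" for k l using M by auto
    show "c (($) x) * u x * v k x = (\<Sum>l<n. (if k < n then M k l else (\<lambda>_. 0)) (($) x) * v l x)"
      if "x \<in> U" "k < n" for x k
      using M that by (simp add: mult.assoc)
  qed
qed

text \<open>The products \<open>f\<^sup>i g\<^sup>j\<close> with \<open>i < d\<close>, \<open>j < e\<close> span a module stable under \<open>f\<close> and \<open>g\<close>,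
  up to the leading coefficients of the equations.\<close>

lemma
  fixes f g :: "real ^ 'm \<Rightarrow> real"
  assumes "algebraic_on U f" "algebraic_on U g"
  shows algebraic_on_add: "algebraic_on U (\<lambda>x. f x + g x)"
    and algebraic_on_mult: "algebraic_on U (\<lambda>x. f x * g x)"
proof -
  obtain d p where p: "d > 0" "\<forall>i. polyfun UNIV (p i)" "\<exists>x. p d x \<noteq> 0" "\<forall>x\<in>U. (\<Sum>i\<le>d. p i (($) x) * f x ^ i) = 0"
    by (rule algebraic_on_coeffs[OF assms(1)])
  obtain e q where q: "e > 0" "\<forall>i. polyfun UNIV (q i)" "\<exists>x. q e x \<noteq> 0" "\<forall>x\<in>U. (\<Sum>i\<le>e. q i (($) x) * g x ^ i) = 0"
    by (rule algebraic_on_coeffs[OF assms(2)])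
  define n where "n = d * e"
  \<comment> \<open>The single index k encodes the pair of exponents (k div e, k mod e).\<close>
  define v where "v k x = f x ^ (k div e) * g x ^ (k mod e)" for k x
  let ?W = "polyspan U n v"
  have n: "0 < n" using p(1) q(1) by (simp add: n_def)
  have basis: "?W (\<lambda>x. f x ^ i * g x ^ j)" if "i < d" "j < e" for i j
  proof -
    have "i * e + j < Suc i * e" using that by simp
    also have "\<dots> \<le> n" unfolding n_def using that by (intro mult_right_mono) auto
    finally have "?W (v (i * e + j))" by (rule polyspan_basis)
    then show ?thesis using that by (simp add: v_def[abs_def])
  qed
  have pf: "?W (\<lambda>x. p d (($) x) * (f x ^ i * g x ^ j))" if "i \<le> d" "j < e" for i j
  proof (cases "i < d")
    case True
    then show ?thesis using that p(2) by (intro polyspan_mult basis) auto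
  next
    case False
    have "?W (\<lambda>x. \<Sum>i<d. - p i (($) x) * (f x ^ i * g x ^ j))"
      using that p(2) by (intro polyspan_sum polyspan_mult[where c = "\<lambda>x. - p _ x"] basis polyfun_uminus) auto
    then show ?thesis
    proof (rule polyspan_cong)
      fix x assume "x \<in> U"
      then have "(\<Sum>i<d. p i (($) x) * f x ^ i) + p d (($) x) * f x ^ d = 0"
        using p(4) by (simp add: lessThan_Suc_atMost[symmetric])
      then have "p d (($) x) * f x ^ d = - (\<Sum>i<d. p i (($) x) * f x ^ i)" by linarith
      moreover have "i = d" using False that by simp
      ultimately have "p d (($) x) * (f x ^ i * g x ^ j) = - (\<Sum>i<d. p i (($) x) * f x ^ i) * g x ^ j"
        by (simp flip: mult.assoc)
      then show "(\<Sum>i<d. - p i (($) x) * (f x ^ i * g x ^ j)) = p d (($) x) * (f x ^ i * g x ^ j)"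
        by (simp add: sum_distrib_right sum_negf mult.assoc)
    qed
  qed
  have qg: "?W (\<lambda>x. q e (($) x) * (p d (($) x) * (f x ^ i * g x ^ j)))" if "i \<le> d" "j \<le> e" for i j
  proof (cases "j < e")
    case True
    then show ?thesis using that q(2) by (intro polyspan_mult pf) auto
  next
    case False
    have "?W (\<lambda>x. \<Sum>j<e. - q j (($) x) * (p d (($) x) * (f x ^ i * g x ^ j)))"
      using that q(2) by (intro polyspan_sum polyspan_mult[where c = "\<lambda>x. - q _ x"] pf polyfun_uminus) auto
    then show ?thesis
    proof (rule polyspan_cong)
      fix x assume "x \<in> U"
      then have "(\<Sum>j<e. q j (($) x) * g x ^ j) + q e (($) x) * g x ^ e = 0"
        using q(4) by (simp add: lessThan_Suc_atMost[symmetric])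
      then have lead: "q e (($) x) * g x ^ e = - (\<Sum>j<e. q j (($) x) * g x ^ j)" by linarith
      have "j = e" using False that by simp
      have "(\<Sum>j<e. - q j (($) x) * (p d (($) x) * (f x ^ i * g x ^ j))) =
          (\<Sum>j<e. - (q j (($) x) * g x ^ j) * (p d (($) x) * f x ^ i))"
        by (intro sum.cong refl) (simp add: mult_ac)
      also have "\<dots> = q e (($) x) * g x ^ e * (p d (($) x) * f x ^ i)"
        by (simp only: lead sum_distrib_right[symmetric] sum_negf)
      also have "\<dots> = q e (($) x) * (p d (($) x) * (f x ^ i * g x ^ j))"
        unfolding \<open>j = e\<close> by (simp add: mult_ac)
      finally show "(\<Sum>j<e. - q j (($) x) * (p d (($) x) * (f x ^ i * g x ^ j))) = q e (($) x) * (p d (($) x) * (f x ^ i * g x ^ j))" .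
    qed
  qed
  define c where "c x = q e x * p d x" for x
  have c: "polyfun UNIV c" unfolding c_def[abs_def] using p(2) q(2) by (intro polyfun_mult) auto
  obtain x0 where x0: "c x0 \<noteq> 0"
    using polyfun_mult_nonzero[of UNIV "q e" "p d"] p(2,3) q(2,3) unfolding c_def by blast
  have one: "\<exists>k<n. v k x \<noteq> 0" for x using n by (intro exI[of _ 0]) (simp add: v_def)
  have k: "k div e < d" "k mod e < e" if "k < n" for k
    using that q(1) by (simp_all add: n_def less_mult_imp_div_less)
  show "algebraic_on U (\<lambda>x. f x + g x)"
  proof (rule algebraic_on_by_polyspan[OF c x0 n _ one])
    fix l assume l: "l < n"
    have "?W (\<lambda>x. q e (($) x) * (p d (($) x) * (f x ^ Suc (l div e) * g x ^ (l mod e))) +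
        q e (($) x) * (p d (($) x) * (f x ^ (l div e) * g x ^ Suc (l mod e))))"
      using k[OF l] by (intro polyspan_add qg) auto
    then show "?W (\<lambda>x. c (($) x) * ((f x + g x) * v l x))"
      by (rule polyspan_cong) (simp add: c_def v_def algebra_simps)
  qed
  show "algebraic_on U (\<lambda>x. f x * g x)"
  proof (rule algebraic_on_by_polyspan[OF c x0 n _ one])
    fix l assume l: "l < n"
    have "?W (\<lambda>x. q e (($) x) * (p d (($) x) * (f x ^ Suc (l div e) * g x ^ Suc (l mod e))))"
      using k[OF l] by (intro qg) auto
    then show "?W (\<lambda>x. c (($) x) * ((f x * g x) * v l x))"
      by (rule polyspan_cong) (simp add: c_def v_def mult_ac)
  qed
qed

section \<open>Ring structure on the Nash functions\<close>

lemma semialgebraic_Int: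
  assumes "semialgebraic A" "semialgebraic B"
  shows "semialgebraic (A \<inter> B)"
proof -
  have "A \<inter> B = - (- A \<union> - B)" by blast
  then show ?thesis by (simp only:) (intro semialgebraic.compl semialgebraic.union assms)
qed

lemma nash_on_iff:
  "nash_on U f \<longleftrightarrow> open U \<and> semialgebraic U \<and> (\<forall>a\<in>U. analytic_at_pt a f) \<and> algebraic_on U f"
  unfolding nash_on_def real_analytic_on_iff algebraic_on_def by blast

lemma algebraic_on_subset: "algebraic_on U f \<Longrightarrow> V \<subseteq> U \<Longrightarrow> algebraic_on V f"
  unfolding algebraic_on_def by blast

lemma nash_on_add:
  assumes "nash_on U f" "nash_on V g"
  shows "nash_on (U \<inter> V) (\<lambda>x. f x + g x)"
  using assms unfolding nash_on_iff
  by (auto intro!: semialgebraic_Int analytic_at_add algebraic_on_add intro: algebraic_on_subset[OF _ Int_lower1] algebraic_on_subset[OF _ Int_lower2])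

lemma nash_on_mult:
  assumes "nash_on U f" "nash_on V g"
  shows "nash_on (U \<inter> V) (\<lambda>x. f x * g x)"
  using assms unfolding nash_on_iff
  by (auto intro!: semialgebraic_Int analytic_at_mult algebraic_on_mult intro: algebraic_on_subset[OF _ Int_lower1] algebraic_on_subset[OF _ Int_lower2])

lemma nash_on_const: "nash_on UNIV (\<lambda>x :: real ^ 'm::finite. c)"
proof -
  have "nash_on {x :: real ^ 'm. (\<lambda>_. 1::real) (($) x) > 0} (\<lambda>x. (\<lambda>_. 0) (($) x) * (\<lambda>_. 1) (($) x) powr (- 1 / 2) + (\<lambda>_. c) (($) x))"
    by (rule nash_on_polyfun_sqrt[where L = "\<lambda>_. 1"]) simp_all
  then show ?thesis by simp
qed

lemma carrier_nash_ring:
  "f \<in> carrier (nash_ring S) \<longleftrightarrow> f \<in> extensional S \<and> (\<exists>U g. S \<subseteq> U \<and> nash_on U g \<and> (\<forall>x\<in>S. f x = g x))"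
  unfolding nash_ring_def by simp

lemma nash_ring_closed:
  assumes "f \<in> carrier (nash_ring S)" "g \<in> carrier (nash_ring S)"
  shows "restrict (\<lambda>x. f x + g x) S \<in> carrier (nash_ring S)"
    and "restrict (\<lambda>x. f x * g x) S \<in> carrier (nash_ring S)"
proof -
  obtain U f' where U: "S \<subseteq> U" "nash_on U f'" "\<forall>x\<in>S. f x = f' x" using assms(1) unfolding carrier_nash_ring by blast
  obtain V g' where V: "S \<subseteq> V" "nash_on V g'" "\<forall>x\<in>S. g x = g' x" using assms(2) unfolding carrier_nash_ring by blast
  show "restrict (\<lambda>x. f x + g x) S \<in> carrier (nash_ring S)"
    unfolding carrier_nash_ring
    using U V nash_on_add[OF U(2) V(2)] by (intro conjI exI[of _ "U \<inter> V"] exI[of _ "\<lambda>x. f' x + g' x"]) auto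
  show "restrict (\<lambda>x. f x * g x) S \<in> carrier (nash_ring S)"
    unfolding carrier_nash_ring
    using U V nash_on_mult[OF U(2) V(2)] by (intro conjI exI[of _ "U \<inter> V"] exI[of _ "\<lambda>x. f' x * g' x"]) auto
qed

lemma nash_ring_const: "restrict (\<lambda>x. c) S \<in> carrier (nash_ring (S :: (real ^ 'm::finite) set))"
  unfolding carrier_nash_ring using nash_on_const[of c]
  by (intro conjI exI[of _ UNIV] exI[of _ "\<lambda>x. c"]) auto

lemma nash_ring_simps:
  "f \<oplus>\<^bsub>nash_ring S\<^esub> g = restrict (\<lambda>x. f x + g x) S"
  "f \<otimes>\<^bsub>nash_ring S\<^esub> g = restrict (\<lambda>x. f x * g x) S"
  "\<zero>\<^bsub>nash_ring S\<^esub> = restrict (\<lambda>x. 0) S" "\<one>\<^bsub>nash_ring S\<^esub> = restrict (\<lambda>x. 1) S"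
  by (simp_all add: nash_ring_def)

lemma restrict_eqI: "f \<in> extensional S \<Longrightarrow> (\<And>x. x \<in> S \<Longrightarrow> g x = f x) \<Longrightarrow> restrict g S = f"
  by (auto simp: restrict_def extensional_def fun_eq_iff)

lemma cring_nash_ring: "cring (nash_ring (S :: (real ^ 'm::finite) set))"
proof (rule cringI)
  have ext: "f \<in> extensional S" if "f \<in> carrier (nash_ring S)" for f
    using that unfolding carrier_nash_ring by blast
  show "abelian_group (nash_ring S)"
  proof (rule abelian_groupI)
    fix f assume f: "f \<in> carrier (nash_ring S)"
    show "\<zero>\<^bsub>nash_ring S\<^esub> \<oplus>\<^bsub>nash_ring S\<^esub> f = f"
      unfolding nash_ring_simps by (rule restrict_eqI[OF ext[OF f]]) simp
    have "restrict (\<lambda>x. restrict (\<lambda>x. -1) S x * f x) S \<in> carrier (nash_ring S)"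
      by (rule nash_ring_closed(2)[OF nash_ring_const f])
    moreover have "restrict (\<lambda>x. restrict (\<lambda>x. restrict (\<lambda>x. -1) S x * f x) S x + f x) S = restrict (\<lambda>x. 0) S"
      by (rule restrict_ext) simp
    ultimately show "\<exists>g\<in>carrier (nash_ring S). g \<oplus>\<^bsub>nash_ring S\<^esub> f = \<zero>\<^bsub>nash_ring S\<^esub>"
      unfolding nash_ring_simps by blast
  next
    fix f g h assume "f \<in> carrier (nash_ring S)" "g \<in> carrier (nash_ring S)" "h \<in> carrier (nash_ring S)"
    show "f \<oplus>\<^bsub>nash_ring S\<^esub> g \<oplus>\<^bsub>nash_ring S\<^esub> h = f \<oplus>\<^bsub>nash_ring S\<^esub> (g \<oplus>\<^bsub>nash_ring S\<^esub> h)"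
      unfolding nash_ring_simps by (rule restrict_ext) simp
  next
    fix f g assume "f \<in> carrier (nash_ring S)" "g \<in> carrier (nash_ring S)"
    show "f \<oplus>\<^bsub>nash_ring S\<^esub> g = g \<oplus>\<^bsub>nash_ring S\<^esub> f"
      unfolding nash_ring_simps by (rule restrict_ext) simp
  qed (simp_all add: nash_ring_simps nash_ring_closed nash_ring_const)
  show "Group.comm_monoid (nash_ring S)"
  proof (rule comm_monoidI)
    fix f assume f: "f \<in> carrier (nash_ring S)"
    show "\<one>\<^bsub>nash_ring S\<^esub> \<otimes>\<^bsub>nash_ring S\<^esub> f = f"
      unfolding nash_ring_simps by (rule restrict_eqI[OF ext[OF f]]) simp
  next
    fix f g h assume "f \<in> carrier (nash_ring S)" "g \<in> carrier (nash_ring S)" "h \<in> carrier (nash_ring S)"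
    show "f \<otimes>\<^bsub>nash_ring S\<^esub> g \<otimes>\<^bsub>nash_ring S\<^esub> h = f \<otimes>\<^bsub>nash_ring S\<^esub> (g \<otimes>\<^bsub>nash_ring S\<^esub> h)"
      unfolding nash_ring_simps by (rule restrict_ext) simp
  next
    fix f g assume "f \<in> carrier (nash_ring S)" "g \<in> carrier (nash_ring S)"
    show "f \<otimes>\<^bsub>nash_ring S\<^esub> g = g \<otimes>\<^bsub>nash_ring S\<^esub> f"
      unfolding nash_ring_simps by (rule restrict_ext) simp
  qed (simp_all add: nash_ring_simps nash_ring_closed nash_ring_const)
  fix f g h assume "f \<in> carrier (nash_ring S)" "g \<in> carrier (nash_ring S)" "h \<in> carrier (nash_ring S)"
  show "(f \<oplus>\<^bsub>nash_ring S\<^esub> g) \<otimes>\<^bsub>nash_ring S\<^esub> h = f \<otimes>\<^bsub>nash_ring S\<^esub> h \<oplus>\<^bsub>nash_ring S\<^esub> g \<otimes>\<^bsub>nash_ring S\<^esub> h"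
    unfolding nash_ring_simps by (rule restrict_ext) (simp add: distrib_right)
qed

subsection \<open>Restriction of an analytic function to a rational curve\<close>

lemma norm_le_sum_components: "norm (x :: real ^ 'm) \<le> (\<Sum>i\<in>UNIV. \<bar>x $ i\<bar>)"
  by (rule norm_le_l1_cart)

text \<open>The components of the curve are quotients of polynomials and accept complex arguments.
  Inserted into the power series they give holomorphic terms that converge uniformly near
  \<open>t0\<close>, so the sum is holomorphic and extends the real function.\<close>

lemma analytic_holomorphic_extension:
  fixes \<gamma> :: "real \<Rightarrow> real ^ 'm"
  assumes F: "analytic_at_pt (\<gamma> t0) F"
    and \<gamma>: "\<And>i t. \<gamma> t $ i = poly (num i) t / poly (den i) t" and den: "\<And>i. poly (den i) t0 \<noteq> 0"
  shows "\<exists>r>0. \<exists>h. h holomorphic_on ball (of_real t0) r \<and>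
    (\<forall>t. \<bar>t - t0\<bar> < r \<longrightarrow> h (of_real t) = of_real (F (\<gamma> t)))"
proof -
  obtain c \<epsilon> where c: "\<epsilon> > 0"
    "\<forall>x\<in>ball (\<gamma> t0) \<epsilon>. ((\<lambda>\<alpha>. c \<alpha> * monom_eval \<alpha> (($) (x - \<gamma> t0))) has_sum F x) UNIV"
    using F unfolding analytic_at_pt_def by blast
  \<comment> \<open>The sum of the coordinates bounds the norm, so the cube of half-side
    \<open>\<rho>\<close> has radius at most \<open>\<epsilon>\<close>/2 and fits into the ball of
    convergence.\<close>
  define \<rho> where "\<rho> = \<epsilon> / (2 * real CARD('m))"
  have \<rho>: "\<rho> > 0" using c(1) by (simp add: \<rho>_def)
  have small: "x \<in> ball (\<gamma> t0) \<epsilon>" if "\<And>i. \<bar>(x - \<gamma> t0) $ i\<bar> \<le> \<rho>" for x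
  proof -
    have "norm (x - \<gamma> t0) \<le> (\<Sum>i\<in>(UNIV :: 'm set). \<rho>)"
      by (rule order.trans[OF norm_le_sum_components sum_mono]) (rule that)
    also have "\<dots> = \<epsilon> / 2" by (simp add: \<rho>_def)
    finally show ?thesis using c(1) by (simp add: dist_norm norm_minus_commute)
  qed
  define N where "N i = map_poly (of_real :: real \<Rightarrow> complex) (num i)" for i
  define E where "E i = map_poly (of_real :: real \<Rightarrow> complex) (den i)" for i
  have of_real_poly: "poly (map_poly of_real p) (of_real t) = (of_real (poly p t) :: complex)" for p :: "real poly" and t
    by (induction p) (simp_all add: map_poly_pCons)
  define g where "g i z = poly (N i) z / poly (E i) z - of_real (\<gamma> t0 $ i)" for i z
  have Et0: "poly (E i) (of_real t0) \<noteq> 0" for i using den by (simp add: E_def of_real_poly)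
  have g_real: "g i (of_real t) = of_real ((\<gamma> t - \<gamma> t0) $ i)" for i t
    by (simp add: g_def N_def E_def of_real_poly \<gamma>)
  have "\<exists>r>0. \<forall>z\<in>ball (of_real t0) r. poly (E i) z \<noteq> 0 \<and> norm (g i z) < \<rho>" for i
  proof -
    have "isCont (\<lambda>z. poly (E i) z) (of_real t0)" by (intro continuous_intros)
    then have "\<forall>\<^sub>F z in nhds (of_real t0). poly (E i) z \<noteq> 0"
      using Et0[of i] unfolding isCont_def tendsto_at_iff_tendsto_nhds by (intro tendsto_imp_eventually_ne)
    moreover have "isCont (g i) (of_real t0)" unfolding g_def[abs_def] using Et0 by (intro continuous_intros)
    then have "(g i \<longlongrightarrow> g i (of_real t0)) (nhds (of_real t0))"
      unfolding isCont_def tendsto_at_iff_tendsto_nhds .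
    then have "\<forall>\<^sub>F z in nhds (of_real t0). dist (g i z) (g i (of_real t0)) < \<rho>"
      using \<rho> by (rule tendstoD)
    ultimately have "\<forall>\<^sub>F z in nhds (of_real t0). poly (E i) z \<noteq> 0 \<and> norm (g i z) < \<rho>"
      by eventually_elim (simp add: g_real)
    then show ?thesis unfolding eventually_nhds_metric by (auto simp: dist_commute)
  qed
  then obtain R where R: "\<And>i. R i > 0" "\<And>i z. z \<in> ball (of_real t0) (R i) \<Longrightarrow> poly (E i) z \<noteq> 0 \<and> norm (g i z) < \<rho>"
    by metis
  define r where "r = Min (range R) / 2"
  have "Min (range R) > 0" using R(1) by (subst Min_gr_iff) auto
  then have r: "r > 0" "\<And>i. r < R i"
    using Min_le[of "range R"] by (auto simp: r_def intro: le_less_trans[of _ "Min (range R) / 2 * 1"] dest: spec) (smt (verit, best) Min_le finite_UNIV_fun finite_imageI finite rangeI field_sum_of_halves)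
  have inb: "z \<in> ball (of_real t0) (R i)" if "z \<in> cball (of_real t0) r" for z i
    using that r(2)[of i] by simp
  define T where "T \<alpha> z = of_real (c \<alpha>) * (\<Prod>v\<in>Poly_Mapping.keys \<alpha>. g v z ^ Poly_Mapping.lookup \<alpha> v)"
    for \<alpha> :: "'m \<Rightarrow>\<^sub>0 nat" and z
  have T_real: "T \<alpha> (of_real t) = of_real (c \<alpha> * monom_eval \<alpha> (($) (\<gamma> t - \<gamma> t0)))" for \<alpha> t
    unfolding T_def g_real monom_eval_def by simp
  \<comment> \<open>The value at the corner of the cube, all of whose coordinates are
    \<open>\<rho>\<close>, dominates the term at every complex point of the polydisc. Absolute
    convergence at this one real point provides the Weierstrass majorant.\<close>
  define M where "M \<alpha> = \<bar>c \<alpha> * monom_eval \<alpha> (\<lambda>_. \<rho>)\<bar>" for \<alpha> :: "'m \<Rightarrow>\<^sub>0 nat"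
  have M: "M summable_on UNIV"
  proof -
    let ?x = "\<gamma> t0 + (\<chi> i. \<rho>)"
    have "?x \<in> ball (\<gamma> t0) \<epsilon>" by (rule small) (use \<rho> in simp)
    moreover have "($) (?x - \<gamma> t0) = (\<lambda>_. \<rho>)" by (rule ext) simp
    ultimately have "((\<lambda>\<alpha>. c \<alpha> * monom_eval \<alpha> (\<lambda>_. \<rho>)) has_sum F ?x) UNIV" using c(2) by metis
    from summable_on_iff_abs_summable_on_real[THEN iffD1, OF has_sum_imp_summable[OF this]]
    show ?thesis by (simp add: M_def[abs_def])
  qed
  have T_le: "norm (T \<alpha> z) \<le> M \<alpha>" if "z \<in> cball (of_real t0) r" for \<alpha> z
  proof -
    have "(\<Prod>v\<in>Poly_Mapping.keys \<alpha>. norm (g v z) ^ Poly_Mapping.lookup \<alpha> v) \<le> (\<Prod>v\<in>Poly_Mapping.keys \<alpha>. \<rho> ^ Poly_Mapping.lookup \<alpha> v)"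
      by (intro prod_mono conjI zero_le_power norm_ge_zero power_mono less_imp_le)
        (use R(2)[OF inb[OF that]] in blast)
    moreover have "(\<Prod>v\<in>Poly_Mapping.keys \<alpha>. \<rho> ^ Poly_Mapping.lookup \<alpha> v) = \<bar>monom_eval \<alpha> (\<lambda>_. \<rho>)\<bar>"
      unfolding monom_eval_def using \<rho> by (simp add: prod_nonneg)
    ultimately show ?thesis
      unfolding T_def M_def by (simp add: norm_mult abs_mult prod_norm[symmetric] norm_power mult_left_mono)
  qed
  define h where "h z = (\<Sum>\<^sub>\<infinity>\<alpha>. T \<alpha> z)" for z
  have lim: "uniform_limit (cball (of_real t0) r) (\<lambda>X z. \<Sum>\<alpha>\<in>X. T \<alpha> z) h (finite_subsets_at_top UNIV)"
    unfolding h_def by (rule Weierstrass_m_test_general[OF T_le M])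
  have T_holo: "T \<alpha> holomorphic_on ball (of_real t0) r" for \<alpha>
    unfolding T_def[abs_def] g_def using R(2)[OF inb] by (intro holomorphic_intros) auto
  have T_cont: "continuous_on (cball (of_real t0) r) (T \<alpha>)" for \<alpha>
    unfolding T_def[abs_def] g_def using R(2)[OF inb] by (intro continuous_intros) auto
  have ev: "\<forall>\<^sub>F X in finite_subsets_at_top UNIV. continuous_on (cball (of_real t0) r) (\<lambda>z. \<Sum>\<alpha>\<in>X. T \<alpha> z) \<and>
      (\<lambda>z. \<Sum>\<alpha>\<in>X. T \<alpha> z) holomorphic_on ball (of_real t0) r"
    by (intro always_eventually allI conjI continuous_on_sum holomorphic_on_sum T_cont T_holo)
  have "h holomorphic_on ball (of_real t0) r"
    by (rule holomorphic_uniform_limit[OF ev lim]) simp_all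
  moreover have "h (of_real t) = of_real (F (\<gamma> t))" if t: "\<bar>t - t0\<bar> < r" for t
  proof -
    have "of_real t \<in> cball (of_real t0 :: complex) r" using t by (simp add: dist_norm norm_minus_commute flip: of_real_diff)
    then have "norm (g i (of_real t)) < \<rho>" for i using R(2)[OF inb] by blast
    then have "\<bar>(\<gamma> t - \<gamma> t0) $ i\<bar> \<le> \<rho>" for i unfolding g_real norm_of_real by (rule less_imp_le)
    then have "\<gamma> t \<in> ball (\<gamma> t0) \<epsilon>" by (rule small)
    then have "((\<lambda>\<alpha>. c \<alpha> * monom_eval \<alpha> (($) (\<gamma> t - \<gamma> t0))) has_sum F (\<gamma> t)) UNIV" using c(2) by blast
    then have "((\<lambda>\<alpha>. T \<alpha> (of_real t)) has_sum of_real (F (\<gamma> t))) UNIV"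
      unfolding T_real by (rule has_sum_of_real)
    then show ?thesis unfolding h_def by (rule infsumI)
  qed
  ultimately show ?thesis using r(1) by blast
qed

text \<open>This is the isolation of zeros of the holomorphic extension, restricted to the real
  line.\<close>

lemma analytic_curve_dichotomy:
  fixes \<gamma> :: "real \<Rightarrow> real ^ 'm"
  assumes F: "analytic_at_pt (\<gamma> t0) F"
    and \<gamma>: "\<And>i t. \<gamma> t $ i = poly (num i) t / poly (den i) t" and den: "\<And>i. poly (den i) t0 \<noteq> 0"
  shows "(\<exists>r>0. \<forall>t. \<bar>t - t0\<bar> < r \<longrightarrow> F (\<gamma> t) = 0) \<or>
         (\<exists>r>0. \<forall>t. \<bar>t - t0\<bar> < r \<longrightarrow> t \<noteq> t0 \<longrightarrow> F (\<gamma> t) \<noteq> 0)"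
proof -
  obtain r h where r: "r > 0" "h holomorphic_on ball (of_real t0) r"
    "\<forall>t. \<bar>t - t0\<bar> < r \<longrightarrow> h (of_real t) = of_real (F (\<gamma> t))"
    using analytic_holomorphic_extension[OF assms] by blast
  have inb: "of_real t \<in> ball (of_real t0 :: complex) s \<longleftrightarrow> \<bar>t - t0\<bar> < s" for t s
    by (simp add: dist_norm flip: of_real_diff) (simp add: abs_minus_commute)
  consider "\<forall>z\<in>ball (of_real t0) r. h z = 0" | "h (of_real t0) \<noteq> 0"
    | \<beta> where "h (of_real t0) = 0" "\<beta> \<in> ball (of_real t0) r" "h \<beta> \<noteq> 0" by blast
  then show ?thesis
  proof cases
    case 1
    have "F (\<gamma> t) = 0" if "\<bar>t - t0\<bar> < r" for t
      using 1 r(3) that inb[of t r] by (metis of_real_eq_0_iff)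
    then show ?thesis using r(1) by blast
  next
    case 2
    have "\<forall>x\<in>ball (of_real t0) r. isCont h x"
      using continuous_on_eq_continuous_at[OF open_ball, of "of_real t0" r h]
        holomorphic_on_imp_continuous_on[OF r(2)] by simp
    then have "isCont h (of_real t0)" by (rule bspec) (use r(1) in simp)
    from continuous_at_avoid[OF this 2] obtain s
      where s: "s > 0" "\<forall>z. dist (of_real t0) z < s \<longrightarrow> h z \<noteq> 0" by (elim exE conjE)
    have "F (\<gamma> t) \<noteq> 0" if "\<bar>t - t0\<bar> < min r s" for t
    proof -
      have "of_real t \<in> ball (of_real t0 :: complex) s" unfolding inb using that by simp
      then have "h (of_real t) \<noteq> 0" using s(2) by simp
      moreover have "h (of_real t) = of_real (F (\<gamma> t))" using r(3) that by simp
      ultimately show ?thesis by simp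
    qed
    then show ?thesis using r(1) s(1) by (intro disjI2 exI[of _ "min r s"]) auto
  next
    case 3
    have "\<exists>s>0. ball (of_real t0 :: complex) s \<subseteq> ball (of_real t0) r \<and> (\<forall>z\<in>ball (of_real t0) s - {of_real t0}. h z \<noteq> 0)"
    proof (rule isolated_zeros[OF r(2) open_ball connected_ball _ 3])
      show "of_real t0 \<in> ball (of_real t0 :: complex) r" using r(1) by simp
      fix s assume "0 < s" "ball (of_real t0 :: complex) s \<subseteq> ball (of_real t0) r"
        "\<And>z. z \<in> ball (of_real t0) s - {of_real t0} \<Longrightarrow> h z \<noteq> 0"
      then show ?thesis by (intro exI[of _ s]) simp
    qed
    then obtain s where s: "0 < s" "ball (of_real t0 :: complex) s \<subseteq> ball (of_real t0) r"
      "\<forall>z\<in>ball (of_real t0) s - {of_real t0}. h z \<noteq> 0" by (elim exE conjE)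
    have "F (\<gamma> t) \<noteq> 0" if "\<bar>t - t0\<bar> < s" "t \<noteq> t0" for t
    proof -
      have t: "of_real t \<in> ball (of_real t0 :: complex) s" unfolding inb by (rule that(1))
      then have "h (of_real t) \<noteq> 0" using that(2) by (intro bspec[OF s(3)]) simp
      moreover have "\<bar>t - t0\<bar> < r" using subsetD[OF s(2) t] unfolding inb .
      then have "h (of_real t) = of_real (F (\<gamma> t))" using r(3) by simp
      ultimately show ?thesis by simp
    qed
    then show ?thesis using s(1) by blast
  qed
qed

text \<open>The set \<open>Z\<close> of parameters near which the function vanishes identically is
  open by definition, and its complement is open by the local dichotomy. The line is connected, and
  \<open>t1\<close> is not in \<open>Z\<close>.\<close>

lemma analytic_curve_isolated_zeros:
  fixes \<gamma> :: "real \<Rightarrow> real ^ 'm"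
  assumes F: "\<And>t. analytic_at_pt (\<gamma> t) F"
    and \<gamma>: "\<And>i t. \<gamma> t $ i = poly (num i) t / poly (den i) t" and den: "\<And>i t. poly (den i) t \<noteq> 0"
    and nz: "F (\<gamma> t1) \<noteq> 0"
  shows "\<exists>r>0. \<forall>t. \<bar>t - t0\<bar> < r \<longrightarrow> t \<noteq> t0 \<longrightarrow> F (\<gamma> t) \<noteq> 0"
proof -
  define Z where "Z = {t0. \<exists>r>0. \<forall>t. \<bar>t - t0\<bar> < r \<longrightarrow> F (\<gamma> t) = 0}"
  note dich = analytic_curve_dichotomy[OF F \<gamma> den]
  have Z_zero: "F (\<gamma> t) = 0" if "t \<in> Z" for t
    using that unfolding Z_def by (elim CollectE exE conjE) simp
  have "open Z"
    unfolding open_dist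
  proof
    fix t0 assume "t0 \<in> Z"
    then obtain r where r: "r > 0" "\<forall>t. \<bar>t - t0\<bar> < r \<longrightarrow> F (\<gamma> t) = 0" unfolding Z_def by blast
    have "y \<in> Z" if "dist y t0 < r / 2" for y
      unfolding Z_def
    proof (intro CollectI exI[of _ "r / 2"] conjI allI impI)
      fix t assume "\<bar>t - y\<bar> < r / 2"
      then have "\<bar>t - t0\<bar> < r" using that unfolding dist_real_def by linarith
      then show "F (\<gamma> t) = 0" using r(2) by blast
    qed (use r(1) in simp)
    then show "\<exists>e>0. \<forall>y. dist y t0 < e \<longrightarrow> y \<in> Z" using r(1) by (intro exI[of _ "r / 2"]) auto
  qed
  moreover have "open (- Z)"
    unfolding open_dist
  proof
    fix t0 assume "t0 \<in> - Z"
    then obtain r where r: "r > 0" "\<forall>t. \<bar>t - t0\<bar> < r \<longrightarrow> t \<noteq> t0 \<longrightarrow> F (\<gamma> t) \<noteq> 0"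
      using dich[of t0] unfolding Z_def by blast
    have "y \<in> - Z" if "dist y t0 < r" for y
    proof (cases "y = t0")
      case True
      then show ?thesis using \<open>t0 \<in> - Z\<close> by simp
    next
      case False
      then have "F (\<gamma> y) \<noteq> 0" using r(2) that by (simp add: dist_real_def)
      then show ?thesis using Z_zero by blast
    qed
    then show "\<exists>e>0. \<forall>y. dist y t0 < e \<longrightarrow> y \<in> - Z" using r(1) by blast
  qed
  ultimately have "Z = {} \<or> Z = UNIV"
    using clopen[of Z] by (simp add: closed_def)
  moreover have "t1 \<notin> Z" using nz Z_zero by blast
  ultimately have "t0 \<notin> Z" by blast
  then show ?thesis using dich[of t0] unfolding Z_def by blast
qed

section \<open>Regular images\<close>

lemma Rn_line: "x \<in> Rn n \<Longrightarrow> y \<in> Rn n \<Longrightarrow> (\<lambda>v. x v + t * (y v - x v)) \<in> Rn n"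
  by (simp add: Rn_def)

lemma regular_map_line:
  fixes f :: "(nat \<Rightarrow> real) \<Rightarrow> real ^ 'm"
  assumes "regular_map n f" "x \<in> Rn n" "y \<in> Rn n"
  obtains num den where "\<forall>i t. poly (den i) t \<noteq> 0"
    "\<forall>i t. f (\<lambda>v. x v + t * (y v - x v)) $ i = poly (num i) t / poly (den i) t"
proof -
  have "\<exists>a b. (\<forall>t. poly b t \<noteq> 0) \<and> (\<forall>t. f (\<lambda>v. x v + t * (y v - x v)) $ i = poly a t / poly b t)" for i
  proof -
    obtain g h where gh: "\<forall>x\<in>Rn n. poly_eval h x \<noteq> 0" "\<forall>x\<in>Rn n. f x $ i = poly_eval g x / poly_eval h x"
      using assms(1) unfolding regular_map_def by blast
    obtain a where a: "\<And>t. poly a t = poly_eval g (\<lambda>v. x v + t * (y v - x v))"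
      using polyfun_line[OF polyfun_UNIV_poly_eval] by blast
    obtain b where b: "\<And>t. poly b t = poly_eval h (\<lambda>v. x v + t * (y v - x v))"
      using polyfun_line[OF polyfun_UNIV_poly_eval] by blast
    show ?thesis
      using gh Rn_line[OF assms(2,3)] by (intro exI[of _ a] exI[of _ b]) (simp add: a b)
  qed
  then obtain num den where "\<And>i. (\<forall>t. poly (den i) t \<noteq> 0) \<and> (\<forall>t. f (\<lambda>v. x v + t * (y v - x v)) $ i = poly (num i) t / poly (den i) t)"
    by metis
  then show ?thesis using that[of den num] by blast
qed

text \<open>A line through a point where \<open>a\<close> is nonzero and one where \<open>b\<close>
  is nonzero serves both functions: along it each has isolated zeros, so near the parameter 0 there
  is a t where neither vanishes.\<close>

theorem regular_image_irreducible:
  fixes S :: "(real ^ 'm) set"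
  assumes "regular_image n S"
  shows "semialgebraic_irreducible S"
  unfolding semialgebraic_irreducible_def
proof (intro domain.intro domain_axioms.intro cring_nash_ring)
  obtain f where f: "regular_map n f" "S = f ` Rn n" using assms unfolding regular_image_def by blast
  have "(\<lambda>_. 0) \<in> Rn n" by (simp add: Rn_def)
  then obtain s where s: "s \<in> S" using f(2) by blast
  show "\<one>\<^bsub>nash_ring S\<^esub> \<noteq> \<zero>\<^bsub>nash_ring S\<^esub>"
  proof
    assume "\<one>\<^bsub>nash_ring S\<^esub> = \<zero>\<^bsub>nash_ring S\<^esub>"
    then have "restrict (\<lambda>x. 1::real) S s = restrict (\<lambda>x. 0) S s" unfolding nash_ring_simps by simp
    then show False using s by simp
  qed
  fix a b assume ab: "a \<otimes>\<^bsub>nash_ring S\<^esub> b = \<zero>\<^bsub>nash_ring S\<^esub>"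
    and a: "a \<in> carrier (nash_ring S)" and b: "b \<in> carrier (nash_ring S)"
  have zero: "a z * b z = 0" if "z \<in> S" for z
  proof -
    have "restrict (\<lambda>x. a x * b x) S z = restrict (\<lambda>x. 0) S z" using ab unfolding nash_ring_simps by simp
    then show ?thesis using that by simp
  qed
  show "a = \<zero>\<^bsub>nash_ring S\<^esub> \<or> b = \<zero>\<^bsub>nash_ring S\<^esub>"
  proof (rule ccontr)
    assume nonz: "\<not> ?thesis"
    have nz: "\<exists>z\<in>S. g z \<noteq> 0" if "g \<in> carrier (nash_ring S)" "g \<noteq> \<zero>\<^bsub>nash_ring S\<^esub>" for g
    proof (rule ccontr)
      assume "\<not> ?thesis"
      moreover have "g \<in> extensional S" using that(1) unfolding carrier_nash_ring by blast
      ultimately have "restrict (\<lambda>x. 0) S = g" by (intro restrict_eqI) auto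
      then show False using that(2) unfolding nash_ring_simps by simp
    qed
    obtain x where x: "x \<in> Rn n" "a (f x) \<noteq> 0" using nz[OF a] nonz f(2) by blast
    obtain y where y: "y \<in> Rn n" "b (f y) \<noteq> 0" using nz[OF b] nonz f(2) by blast
    define \<gamma> where "\<gamma> t = f (\<lambda>v. x v + t * (y v - x v))" for t
    obtain num den where nd: "\<forall>i t. poly (den i) t \<noteq> 0" "\<forall>i t. \<gamma> t $ i = poly (num i) t / poly (den i) t"
      unfolding \<gamma>_def by (rule regular_map_line[OF f(1) x(1) y(1)])
    have \<gamma>S: "\<gamma> t \<in> S" for t unfolding \<gamma>_def f(2) using Rn_line[OF x(1) y(1)] by blast
    have iso: "\<exists>r>0. \<forall>t. \<bar>t - 0\<bar> < r \<longrightarrow> t \<noteq> 0 \<longrightarrow> g (\<gamma> t) \<noteq> 0"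
      if g: "g \<in> carrier (nash_ring S)" "g (\<gamma> t1) \<noteq> 0" for g t1
    proof -
      obtain U g' where U: "S \<subseteq> U" "nash_on U g'" "\<forall>x\<in>S. g x = g' x"
        using g(1) unfolding carrier_nash_ring by blast
      have an: "analytic_at_pt (\<gamma> t) g'" for t using U(1,2) \<gamma>S[of t] unfolding nash_on_iff by blast
      have eq: "g (\<gamma> t) = g' (\<gamma> t)" for t using U(3) \<gamma>S by blast
      show ?thesis unfolding eq
        by (rule analytic_curve_isolated_zeros[OF an nd(2)[rule_format] nd(1)[rule_format]]) (use g(2) eq in simp)
    qed
    have "\<gamma> 0 = f x" "\<gamma> 1 = f y" by (simp_all add: \<gamma>_def)
    then obtain r where r: "r > 0" "\<forall>t. \<bar>t - 0\<bar> < r \<longrightarrow> t \<noteq> 0 \<longrightarrow> a (\<gamma> t) \<noteq> 0"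
      using iso[OF a, of 0] x(2) by auto
    obtain r' where r': "r' > 0" "\<forall>t. \<bar>t - 0\<bar> < r' \<longrightarrow> t \<noteq> 0 \<longrightarrow> b (\<gamma> t) \<noteq> 0"
      using iso[OF b, of 1] y(2) \<open>\<gamma> 1 = f y\<close> by auto
    define t where "t = min r r' / 2"
    have "t \<noteq> 0" "\<bar>t - 0\<bar> < r" "\<bar>t - 0\<bar> < r'" using r(1) r'(1) by (auto simp: t_def min_def)
    then have "a (\<gamma> t) * b (\<gamma> t) \<noteq> 0" using r(2) r'(2) by simp
    then show False using zero[OF \<gamma>S] by simp
  qed
qed

subsection \<open>Affine Zariski closures\<close>

lemma affine_algebraic_Inter:
  assumes "\<And>Z. Z \<in> \<Z> \<Longrightarrow> affine_algebraic Z"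
  shows "affine_algebraic (\<Inter>\<Z>)"
proof -
  let ?P = "{p. \<forall>x\<in>\<Inter>\<Z>. poly_eval p (($) x) = 0}"
  have "x \<in> \<Inter>\<Z>" if x: "\<forall>p\<in>?P. poly_eval p (($) x) = 0" for x
  proof
    fix Z assume Z: "Z \<in> \<Z>"
    then obtain A where A: "Z = {x. \<forall>p\<in>A. poly_eval p (($) x) = 0}" using assms unfolding affine_algebraic_def by blast
    have "A \<subseteq> ?P" using Z A by blast
    then show "x \<in> Z" using x A by blast
  qed
  then have "\<Inter>\<Z> = {x. \<forall>p\<in>?P. poly_eval p (($) x) = 0}" by blast
  then show ?thesis unfolding affine_algebraic_def by blast
qed

lemma affine_algebraic_hull: "affine_algebraic (affine_algebraic hull A)"
  by (rule hull_in) (auto intro: affine_algebraic_Inter)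

lemma affine_algebraic_zeros: "polyfun UNIV P \<Longrightarrow> affine_algebraic {x :: real ^ 'm. P (($) x) = 0}"
proof -
  assume "polyfun UNIV P"
  then obtain p where p: "\<forall>x. P x = poly_eval p x" unfolding polyfun_def by blast
  show ?thesis unfolding affine_algebraic_def by (rule exI[of _ "{p}"]) (simp add: p)
qed

text \<open>Over the reals one polynomial suffices, the product of the squared distances to the
  points.\<close>

lemma affine_algebraic_finite: "finite A \<Longrightarrow> affine_algebraic (A :: (real ^ 'm) set)"
proof -
  assume A: "finite A"
  have "polyfun UNIV (\<lambda>x. \<Prod>a\<in>A. \<Sum>i\<in>UNIV. (x i - a $ i)\<^sup>2)"
    by (intro polyfun_prod polyfun_sqdist)
  from affine_algebraic_zeros[OF this]
  have "affine_algebraic {x. (\<Prod>a\<in>A. (dist x a)\<^sup>2) = 0}" unfolding sqdist_eq .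
  moreover have "{x. (\<Prod>a\<in>A. (dist x a)\<^sup>2) = 0} = A"
    using A by (auto simp: prod_zero_iff)
  ultimately show ?thesis by simp
qed

text \<open>The hypothesis on pairs of polynomials says that the ideal of polynomials vanishing on
  \<open>A\<close> is prime.\<close>

lemma affine_irreducible_hull:
  fixes A :: "(real ^ 'm) set"
  assumes "A \<noteq> {}"
    and prod: "\<And>p q x y. x \<in> A \<Longrightarrow> y \<in> A \<Longrightarrow> poly_eval p (($) x) \<noteq> 0 \<Longrightarrow> poly_eval q (($) y) \<noteq> 0 \<Longrightarrow>
      \<exists>z\<in>A. poly_eval p (($) z) \<noteq> 0 \<and> poly_eval q (($) z) \<noteq> 0"
  shows "zariski_irreducible affine_algebraic (affine_algebraic hull A)"
  unfolding zariski_irreducible_def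
proof (intro conjI allI impI affine_algebraic_hull)
  show "affine_algebraic hull A \<noteq> {}" using assms(1) hull_subset[of A] by blast
  fix B C assume BC: "affine_algebraic B \<and> affine_algebraic C \<and> affine_algebraic hull A = B \<union> C"
  then have sub: "A \<subseteq> B \<union> C" using hull_subset[of A affine_algebraic] by simp
  obtain P Q where PQ: "B = {x. \<forall>p\<in>P. poly_eval p (($) x) = 0}" "C = {x. \<forall>p\<in>Q. poly_eval p (($) x) = 0}"
    using BC unfolding affine_algebraic_def by blast
  have "A \<subseteq> B \<or> A \<subseteq> C"
  proof (rule ccontr)
    assume "\<not> ?thesis"
    then obtain x y where xy: "x \<in> A" "x \<notin> B" "y \<in> A" "y \<notin> C" by blast
    obtain p where p: "p \<in> P" "poly_eval p (($) x) \<noteq> 0" using xy(2) PQ(1) by blast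
    obtain q where q: "q \<in> Q" "poly_eval q (($) y) \<noteq> 0" using xy(4) PQ(2) by blast
    obtain z where "z \<in> A" "poly_eval p (($) z) \<noteq> 0" "poly_eval q (($) z) \<noteq> 0"
      using prod[OF xy(1,3) p(2) q(2)] by blast
    then show False using sub p(1) q(1) PQ by blast
  qed
  then show "affine_algebraic hull A = B \<or> affine_algebraic hull A = C"
    using hull_minimal[of A B affine_algebraic] hull_minimal[of A C affine_algebraic] BC by blast
qed

section \<open>Quotients of polynomials on the line\<close>

definition rational_function :: "(real \<Rightarrow> real) \<Rightarrow> bool" where
  "rational_function r \<longleftrightarrow> (\<exists>a b. (\<forall>t. poly b t \<noteq> 0) \<and> (\<forall>t. r t = poly a t / poly b t))"

lemma rational_function_const: "rational_function (\<lambda>t. c)"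
  unfolding rational_function_def by (intro exI[of _ "[:c:]"] exI[of _ 1]) simp

lemma rational_function_add:
  assumes "rational_function r" "rational_function s"
  shows "rational_function (\<lambda>t. r t + s t)"
proof -
  obtain a b where ab: "\<forall>t. poly b t \<noteq> 0" "\<forall>t. r t = poly a t / poly b t" using assms(1) unfolding rational_function_def by blast
  obtain c d where cd: "\<forall>t. poly d t \<noteq> 0" "\<forall>t. s t = poly c t / poly d t" using assms(2) unfolding rational_function_def by blast
  show ?thesis unfolding rational_function_def
    using ab cd by (intro exI[of _ "a * d + c * b"] exI[of _ "b * d"]) (simp add: add_frac_eq)
qed

lemma rational_function_mult:
  assumes "rational_function r" "rational_function s"
  shows "rational_function (\<lambda>t. r t * s t)"
proof -
  obtain a b where ab: "\<forall>t. poly b t \<noteq> 0" "\<forall>t. r t = poly a t / poly b t" using assms(1) unfolding rational_function_def by blast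
  obtain c d where cd: "\<forall>t. poly d t \<noteq> 0" "\<forall>t. s t = poly c t / poly d t" using assms(2) unfolding rational_function_def by blast
  show ?thesis unfolding rational_function_def
    using ab cd by (intro exI[of _ "a * c"] exI[of _ "b * d"]) simp
qed

lemma rational_function_sum: "(\<And>i. i \<in> I \<Longrightarrow> rational_function (r i)) \<Longrightarrow> rational_function (\<lambda>t. \<Sum>i\<in>I. r i t)"
  by (induction I rule: infinite_finite_induct) (auto intro: rational_function_const rational_function_add)

lemma rational_function_prod: "(\<And>i. i \<in> I \<Longrightarrow> rational_function (r i)) \<Longrightarrow> rational_function (\<lambda>t. \<Prod>i\<in>I. r i t)"
  by (induction I rule: infinite_finite_induct) (auto intro: rational_function_const rational_function_mult)

lemma rational_function_power: "rational_function r \<Longrightarrow> rational_function (\<lambda>t. r t ^ n)"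
  by (induction n) (auto intro: rational_function_const rational_function_mult)

lemma rational_function_poly_eval:
  assumes "\<And>v. rational_function (\<lambda>t. \<gamma> t v)"
  shows "rational_function (\<lambda>t. poly_eval p (\<gamma> t))"
  unfolding poly_eval_def monom_eval_def
  by (intro rational_function_sum rational_function_mult rational_function_const rational_function_prod
      rational_function_power assms)

lemma rational_function_common_nonzero:
  assumes "rational_function r" "rational_function s" "r t0 \<noteq> 0" "s t1 \<noteq> 0"
  shows "\<exists>t. r t \<noteq> 0 \<and> s t \<noteq> 0"
proof -
  obtain a b where ab: "\<forall>t. poly b t \<noteq> 0" "\<forall>t. r t = poly a t / poly b t" using assms(1) unfolding rational_function_def by blast
  obtain c d where cd: "\<forall>t. poly d t \<noteq> 0" "\<forall>t. s t = poly c t / poly d t" using assms(2) unfolding rational_function_def by blast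
  have "a \<noteq> 0" "c \<noteq> 0" using ab(2) cd(2) assms(3,4) by auto
  then have "a * c \<noteq> 0" by simp
  then obtain t where "poly (a * c) t \<noteq> 0" using poly_all_0_iff_0 by blast
  then show ?thesis using ab cd by (intro exI[of _ t]) simp
qed

section \<open>The affine chart of projective space\<close>

definition affine_vec :: "real ^ 'm \<Rightarrow> real ^ 'm option" where
  "affine_vec x = (\<chi> k. case_option 1 (($) x) k)"

lemma affine_to_proj_eq: "affine_to_proj x = abs_proj (affine_vec x)"
  unfolding affine_to_proj_def affine_vec_def ..

lemma affine_vec_nth [simp]: "affine_vec x $ None = 1" "affine_vec x $ Some i = x $ i"
  by (simp_all add: affine_vec_def)

lemma affine_vec_nonzero [simp]: "affine_vec x \<noteq> 0"
  using affine_vec_nth(1)[of x] by (metis zero_index zero_neq_one)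

lemma affine_vec_fun: "($) (affine_vec x) = case_option 1 (($) x)"
  by (rule ext) (simp add: affine_vec_def)

lemma affine_to_proj_inj: "affine_to_proj x = affine_to_proj y \<longleftrightarrow> x = y"
proof
  assume "affine_to_proj x = affine_to_proj y"
  then have "affine_vec x $ None * affine_vec y $ Some i = affine_vec x $ Some i * affine_vec y $ None" for i
    unfolding affine_to_proj_eq using abs_proj_eq_iff_cross[OF affine_vec_nonzero affine_vec_nonzero] by blast
  then show "x = y" by (simp add: vec_eq_iff)
qed simp

lemma form_dehomogenize:
  assumes "form d P"
  shows "polyfun UNIV (\<lambda>x. P (case_option 1 x))"
proof -
  have "polyfun UNIV (\<lambda>x :: 'b \<Rightarrow> real. case_option 1 x v)" for v
    by (cases v) (auto intro: polyfun_var)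
  then show ?thesis
    by (rule polyfun_compose[OF form_imp_polyfun[OF assms], where g = "case_option 1"])
qed

lemma dim_affine_not_small:
  assumes "dim_affine S = 1"
  obtains p q where "p \<in> S" "q \<in> S" "p \<noteq> q"
proof -
  have "\<not> finite S"
  proof
    assume "finite S"
    then have "dim_affine S = 0" unfolding dim_affine_def
      by (rule zariski_dim_finite) (rule affine_algebraic_finite)
    then show False using assms by simp
  qed
  then obtain p where "p \<in> S" by fastforce
  moreover have "infinite (S - {p})" using \<open>\<not> finite S\<close> by simp
  then have "S - {p} \<noteq> {}" by (metis finite.emptyI)
  then obtain q where "q \<in> S - {p}" by blast
  ultimately show ?thesis using that by blast
qed

lemma dim_affine_infinite: "dim_affine S = 1 \<Longrightarrow> infinite S"
  using zariski_dim_finite[where Zcl = affine_algebraic and A = S, OF _ affine_algebraic_finite] by (auto simp: dim_affine_def)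

text \<open>The dimension enters once: the closure of the image of one nonconstant line is
  irreducible and contained in the irreducible closure of S. Were it smaller, a point, this closure
  and the closure of S would form a chain of length 2.\<close>

theorem regular_image_rational_curve:
  fixes S :: "(real ^ 'm) set"
  assumes "regular_image n S" and dim: "dim_affine S = 1"
  shows "rational_curve (Cl_zar_proj S)"
proof -
  obtain f where f: "regular_map n f" "S = f ` Rn n" using assms(1) unfolding regular_image_def by blast
  obtain p q where "p \<in> S" "q \<in> S" "p \<noteq> q" by (rule dim_affine_not_small[OF dim])
  then obtain x y where xy: "x \<in> Rn n" "y \<in> Rn n" "f x \<noteq> f y" using f(2) by blast
  define \<gamma> where "\<gamma> t = f (\<lambda>v. x v + t * (y v - x v))" for t
  obtain num den where nd: "\<forall>i t. poly (den i) t \<noteq> 0" "\<forall>i t. \<gamma> t $ i = poly (num i) t / poly (den i) t"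
    unfolding \<gamma>_def by (rule regular_map_line[OF f(1) xy(1,2)])
  have \<gamma>S: "\<gamma> t \<in> S" for t unfolding \<gamma>_def f(2) using Rn_line[OF xy(1,2)] by blast
  have \<gamma>01: "\<gamma> 0 \<noteq> \<gamma> 1" using xy(3) by (simp add: \<gamma>_def)
  have \<gamma>_rat: "rational_function (\<lambda>t. poly_eval p (($) (\<gamma> t)))" for p
  proof (rule rational_function_poly_eval)
    fix v
    show "rational_function (\<lambda>t. \<gamma> t $ v)"
      unfolding rational_function_def using nd by (intro exI[of _ "num v"] exI[of _ "den v"]) simp
  qed
  let ?D = "affine_algebraic hull (range \<gamma>)" and ?Z = "affine_algebraic hull S"
  have irrD: "zariski_irreducible affine_algebraic ?D"
  proof (rule affine_irreducible_hull)
    fix p q a b assume "a \<in> range \<gamma>" "b \<in> range \<gamma>" and nz: "poly_eval p (($) a) \<noteq> 0" "poly_eval q (($) b) \<noteq> 0"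
    then obtain s t where st: "a = \<gamma> s" "b = \<gamma> t" by blast
    show "\<exists>z\<in>range \<gamma>. poly_eval p (($) z) \<noteq> 0 \<and> poly_eval q (($) z) \<noteq> 0"
      using rational_function_common_nonzero[OF \<gamma>_rat \<gamma>_rat, of p s q t] nz unfolding st by blast
  qed simp
  have irrZ: "zariski_irreducible affine_algebraic ?Z"
  proof (rule affine_irreducible_hull)
    show "S \<noteq> {}" using \<gamma>S by blast
    fix p q a b assume "a \<in> S" "b \<in> S" and nz: "poly_eval p (($) a) \<noteq> 0" "poly_eval q (($) b) \<noteq> 0"
    then obtain u w where uw: "u \<in> Rn n" "w \<in> Rn n" "a = f u" "b = f w" using f(2) by blast
    define \<delta> where "\<delta> t = f (\<lambda>v. u v + t * (w v - u v))" for t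
    obtain num' den' where nd': "\<forall>i t. poly (den' i) t \<noteq> 0" "\<forall>i t. \<delta> t $ i = poly (num' i) t / poly (den' i) t"
      unfolding \<delta>_def by (rule regular_map_line[OF f(1) uw(1,2)])
    have \<delta>_rat: "rational_function (\<lambda>t. poly_eval p (($) (\<delta> t)))" for p
    proof (rule rational_function_poly_eval)
      fix v
      show "rational_function (\<lambda>t. \<delta> t $ v)"
        unfolding rational_function_def using nd' by (intro exI[of _ "num' v"] exI[of _ "den' v"]) simp
    qed
    have "\<delta> 0 = a" "\<delta> 1 = b" by (simp_all add: \<delta>_def uw)
    then obtain t where "poly_eval p (($) (\<delta> t)) \<noteq> 0 \<and> poly_eval q (($) (\<delta> t)) \<noteq> 0"
      using rational_function_common_nonzero[OF \<delta>_rat \<delta>_rat, of p 0 q 1] nz by auto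
    moreover have "\<delta> t \<in> S" unfolding \<delta>_def f(2) using Rn_line[OF uw(1,2)] by blast
    ultimately show "\<exists>z\<in>S. poly_eval p (($) z) \<noteq> 0 \<and> poly_eval q (($) z) \<noteq> 0" by blast
  qed
  have sub: "?D \<subseteq> ?Z" using \<gamma>S by (intro hull_mono) blast
  have DZ: "?D = ?Z"
  proof (rule ccontr)
    assume "?D \<noteq> ?Z"
    then have "?D \<subset> ?Z" using sub by blast
    moreover have "{\<gamma> 0} \<subset> ?D"
    proof -
      have "\<gamma> 0 \<in> ?D" "\<gamma> 1 \<in> ?D" by (auto intro: hull_inc)
      then show ?thesis using \<gamma>01 by (intro psubsetI) (simp, metis singletonD)
    qed
    moreover have "zariski_irreducible affine_algebraic {\<gamma> 0}"
      by (rule zariski_irreducible_singleton) (simp add: affine_algebraic_finite)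
    ultimately have "enat 2 \<in> {enat n | n. \<exists>Z. (\<forall>i\<le>n. zariski_irreducible affine_algebraic (Z i) \<and> Z i \<subseteq> ?Z) \<and>
                         (\<forall>i<n. Z i \<subset> Z (Suc i))}"
      using irrD irrZ sub
      by (intro CollectI exI[of _ 2] conjI exI[of _ "\<lambda>i. if i = 0 then {\<gamma> 0} else if i = 1 then ?D else ?Z"])
        (auto simp: less_Suc_eq numeral_2_eq_2 split: if_splits)
    then have "enat 2 \<le> dim_affine S" unfolding dim_affine_def zariski_dim_def by (rule Sup_upper)
    then show False unfolding dim by (simp add: one_enat_def)
  qed
  \<comment> \<open>A common denominator as the homogenizing coordinate. It has no real zeros, so
    every parameter gives a point in the affine chart.\<close>
  define F where "F k = (case k of None \<Rightarrow> (\<Prod>j\<in>UNIV. den j) | Some i \<Rightarrow> num i * (\<Prod>j\<in>UNIV - {i}. den j))" for k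
  have FN: "poly (F None) t \<noteq> 0" for t using nd(1) by (simp add: F_def poly_prod)
  have FS: "poly (F (Some i)) t = poly (F None) t * \<gamma> t $ i" for i t
  proof -
    have "poly (F None) t = poly (den i) t * (\<Prod>j\<in>UNIV - {i}. poly (den j) t)"
      by (simp add: F_def poly_prod prod.remove[of UNIV i])
    then show ?thesis using nd by (simp add: F_def poly_prod)
  qed
  have F: "no_common_root F" unfolding no_common_root_def using FN by blast
  have "(\<chi> k. poly (F k) t) = poly (F None) t *\<^sub>R affine_vec (\<gamma> t)" for t
  proof -
    have "poly (F k) t = poly (F None) t * affine_vec (\<gamma> t) $ k" for k
      by (cases k) (simp_all add: FS)
    then show ?thesis
      unfolding vec_eq_iff vec_lambda_beta vector_scaleR_component real_scaleR_def by blast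
  qed
  then have point: "curve_point F t = affine_to_proj (\<gamma> t)" for t
    unfolding curve_point_def affine_to_proj_eq by (simp add: abs_proj_scale FN)
  have "curve_closure F = Cl_zar_proj S"
    unfolding curve_closure_def Cl_zar_proj_def
  proof (rule antisym)
    show "proj_algebraic hull range (curve_point F) \<subseteq> proj_algebraic hull (affine_to_proj ` S)"
      using \<gamma>S point by (intro hull_mono) auto
    have "affine_to_proj z \<in> curve_closure F" if z: "z \<in> S" for z
    proof (rule curve_closure_memI[OF F])
      fix d P assume P: "form d P" "\<And>t. P (\<lambda>k. poly (F k) t) = 0"
      have "P (($) (affine_vec (\<gamma> t))) = 0" for t
        using form_curve_point[OF F P(1), of t] P(2) form_hcoords[OF P(1) affine_vec_nonzero]
        unfolding point affine_to_proj_eq by blast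
      then have "range \<gamma> \<subseteq> {x. P (case_option 1 (($) x)) = 0}" unfolding affine_vec_fun by blast
      then have "?D \<subseteq> {x. P (case_option 1 (($) x)) = 0}"
        by (rule hull_minimal) (rule affine_algebraic_zeros[OF form_dehomogenize[OF P(1)]])
      moreover have "z \<in> ?D" unfolding DZ using z by (rule hull_inc)
      ultimately have "P (($) (affine_vec z)) = 0" unfolding affine_vec_fun by blast
      then show "P (hcoords (affine_to_proj z)) = 0"
        unfolding affine_to_proj_eq form_hcoords[OF P(1) affine_vec_nonzero] .
    qed
    then show "proj_algebraic hull (affine_to_proj ` S) \<subseteq> proj_algebraic hull range (curve_point F)"
      unfolding curve_closure_def by (intro hull_minimal) (auto simp: proj_algebraic_hull)
  qed
  moreover have "curve_point F 0 \<noteq> curve_point F 1"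
    unfolding point affine_to_proj_inj by (rule \<gamma>01)
  ultimately show ?thesis using rational_curve_closure[OF F] by metis
qed

section \<open>From a rational curve to a parametrization\<close>

lemma proj_algebraic_separate:
  assumes "proj_algebraic Z" "z \<notin> Z"
  shows "\<exists>d P. form d P \<and> P (hcoords z) \<noteq> 0 \<and> Z \<subseteq> {x. P (hcoords x) = 0}"
proof (rule ccontr)
  assume no: "\<not> ?thesis"
  obtain \<Q> where Q: "\<forall>P\<in>\<Q>. \<exists>d. form d P" "Z = {x. \<forall>P\<in>\<Q>. P (hcoords x) = 0}"
    using assms(1) unfolding proj_algebraic_iff by (elim exE conjE)
  have "\<forall>P\<in>\<Q>. P (hcoords z) = 0"
  proof (rule ballI, rule ccontr)
    fix P assume P: "P \<in> \<Q>" "P (hcoords z) \<noteq> 0"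
    obtain d where d: "form d P" using bspec[OF Q(1) P(1)] by (elim exE)
    have "Z \<subseteq> {x. P (hcoords x) = 0}"
    proof
      fix x assume "x \<in> Z"
      then have "\<forall>P\<in>\<Q>. P (hcoords x) = 0" unfolding Q(2) by (rule CollectD)
      then have "P (hcoords x) = 0" by (rule bspec) (rule P(1))
      then show "x \<in> {x. P (hcoords x) = 0}" by simp
    qed
    then show False using d P(2) no by blast
  qed
  then have "z \<in> Z" unfolding Q(2) by (rule CollectI)
  then show False using assms(2) by blast
qed

lemma proj_line_closed_finite:
  assumes "proj_algebraic Z" "Z \<noteq> (UNIV :: 2 proj set)"
  shows "finite Z"
proof -
  obtain z where "z \<notin> Z" using assms(2) by blast
  from proj_algebraic_separate[OF assms(1) this]
  obtain d P where d: "form d P" and P: "P (hcoords z) \<noteq> 0" and Z: "Z \<subseteq> {x. P (hcoords x) = 0}"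
    by (elim exE conjE)
  have eta: "(\<lambda>k. if k = 1 then x 1 else x 2) = x" for x :: "2 \<Rightarrow> real"
    using exhaust_2 by fastforce
  have "finite {z :: 2 proj. (\<lambda>a b. P (\<lambda>k. if k = 1 then a else b)) (hcoords z 1) (hcoords z 2) = 0}"
    by (rule finite_proj_line_zeros[OF form_imp_bform[OF d], of "hcoords z 1" "hcoords z 2"]) (simp add: eta P)
  then have "finite {z :: 2 proj. P (hcoords z) = 0}" by (simp add: eta)
  then show ?thesis using Z by (rule finite_subset[rotated])
qed

lemma finite_affine_line_preimage:
  assumes "finite A"
  shows "finite {t. abs_proj (v2 1 t) \<in> A}"
proof -
  have "inj (\<lambda>t. abs_proj (v2 1 t))"
    by (rule injI) (simp add: abs_proj_v2_eq_iff)
  then have "finite ((\<lambda>t. abs_proj (v2 1 t)) -` A)" using assms by (rule finite_vimageI[rotated])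
  then show ?thesis by (simp add: vimage_def)
qed

lemma cofinite_affine_line:
  assumes "finite (- W)"
  shows "finite {t. abs_proj (v2 1 t) \<notin> W}"
  using finite_affine_line_preimage[OF assms] by simp

lemma infinite_reals_cofinite: "finite {t :: real. \<not> P t} \<Longrightarrow> infinite {t. P t}"
proof
  assume "finite {t :: real. \<not> P t}" "finite {t. P t}"
  then have "finite ({t. P t} \<union> {t. \<not> P t})" by simp
  moreover have "{t. P t} \<union> {t. \<not> P t} = UNIV" by auto
  ultimately show False using infinite_UNIV_char_0[where 'a = real] by simp
qed

text \<open>A regular map is given through the selected coordinates of a point. Homogeneity changes
  the values by a common nonzero factor only, so arbitrary coordinates (a, b) may be
  inserted.\<close>

lemma regular_local_bforms:
  fixes f :: "2 proj \<Rightarrow> ('k::finite) proj"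
  assumes "proj_regular_on UNIV f"
  shows "\<exists>W m q. proj_algebraic (- W) \<and> z0 \<in> W \<and> (\<forall>k. bform m (q k)) \<and>
    (\<forall>a b. (a, b) \<noteq> (0, 0) \<longrightarrow> abs_proj (v2 a b) \<in> W \<longrightarrow>
      (\<exists>k. q k a b \<noteq> 0) \<and> f (abs_proj (v2 a b)) = abs_proj (\<chi> k. q k a b))"
proof -
  obtain W m F where W: "proj_algebraic (- W)" "z0 \<in> W" "\<forall>k. homogeneous m (F k)"
    "\<forall>z\<in>UNIV \<inter> W. (\<exists>k. poly_eval (F k) (hcoords z) \<noteq> 0) \<and> f z = abs_proj (\<chi> k. poly_eval (F k) (hcoords z))"
    using bspec[OF assms[unfolded proj_regular_on_def] UNIV_I, of z0] by (elim exE conjE)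
  define q where "q k a b = poly_eval (F k) (\<lambda>i. if i = 1 then a else b)" for k a b
  have bf: "bform m (q k)" for k
    unfolding q_def[abs_def] by (rule form_imp_bform[OF form_poly_eval]) (use W(3) in blast)
  have "(\<exists>k. q k a b \<noteq> 0) \<and> f (abs_proj (v2 a b)) = abs_proj (\<chi> k. q k a b)"
    if ab: "(a, b) \<noteq> (0, 0)" and mem: "abs_proj (v2 a b) \<in> W" for a b
  proof -
    have "v2 a b \<noteq> 0" using ab by auto
    then obtain c where c: "c \<noteq> 0" "hcoords (abs_proj (v2 a b)) = (\<lambda>k. c * v2 a b $ k)"
      by (rule hcoords_abs_proj)
    have arg: "(\<lambda>i. if i = 1 then a else b) = (\<lambda>k. v2 a b $ k)" by (simp add: v2_def)
    have val: "poly_eval (F k) (hcoords (abs_proj (v2 a b))) = c ^ m * q k a b" for k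
      unfolding c(2) q_def arg by (rule form_scale[OF form_poly_eval]) (use W(3) in blast)
    have loc: "(\<exists>k. c ^ m * q k a b \<noteq> 0) \<and> f (abs_proj (v2 a b)) = abs_proj (\<chi> k. c ^ m * q k a b)"
      using W(4) mem unfolding val[symmetric] by blast
    then have ne: "\<exists>k. q k a b \<noteq> 0" by auto
    then have "(\<chi> k. q k a b) \<noteq> 0" by (auto simp: vec_eq_iff)
    moreover have "(\<chi> k. c ^ m * q k a b) = c ^ m *\<^sub>R (\<chi> k. q k a b)" by (simp add: vec_eq_iff)
    ultimately show ?thesis using loc ne abs_proj_scale[of "c ^ m" "\<chi> k. q k a b"] c(1) by simp
  qed
  then show ?thesis using W(1,2) bf by blast
qed

text \<open>The local forms at one point, freed of common roots and homogenized, have no common zero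
  at all. They represent the map everywhere: their minors with any other local representation are
  binary forms with infinitely many zeros.\<close>

lemma regular_global_param:
  fixes f :: "2 proj \<Rightarrow> ('k::finite) proj"
  assumes reg: "proj_regular_on UNIV f"
  obtains d \<Phi> where "hom_param d \<Phi>" "f = param_map \<Phi>"
proof -
  have fin: "finite (- W)" if "proj_algebraic (- W)" "z \<in> W" for W :: "2 proj set" and z
    using that by (intro proj_line_closed_finite) auto
  obtain W0 m0 q0 where W0: "proj_algebraic (- W0)" "abs_proj (v2 1 0) \<in> W0" "\<forall>k. bform m0 (q0 k)"
    "\<forall>a b. (a, b) \<noteq> (0, 0) \<longrightarrow> abs_proj (v2 a b) \<in> W0 \<longrightarrow>
      (\<exists>k. q0 k a b \<noteq> 0) \<and> f (abs_proj (v2 a b)) = abs_proj (\<chi> k. q0 k a b)"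
    using regular_local_bforms[OF reg, of "abs_proj (v2 1 0)"] by (elim exE conjE)
  have "\<exists>p. \<forall>t. poly p t = q0 k 1 t" for k using bform_poly[of m0 "q0 k"] W0(3) by blast
  then obtain p where p: "\<And>k t. poly (p k) t = q0 k 1 t" by metis
  have "\<exists>k. q0 k 1 0 \<noteq> 0" using W0(2,4) by simp
  then obtain k0 where "p k0 \<noteq> 0" using p[of _ 0] by (metis poly_0)
  then obtain c \<Psi> where c: "c \<noteq> 0" "\<forall>k. p k = c * \<Psi> k" "no_common_root \<Psi>"
    using remove_common_roots[of p k0] by blast
  obtain d \<Phi> where \<Phi>: "hom_param d \<Phi>" "\<And>k t. \<Phi> k 1 t = poly (\<Psi> k) t"
    using hom_param_of_polys[OF c(3)] by blast
  have gen: "f (abs_proj (v2 1 t)) = param_point \<Phi> 1 t" if t: "abs_proj (v2 1 t) \<in> W0" for t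
  proof -
    have 1: "(\<exists>k. q0 k 1 t \<noteq> 0)" "f (abs_proj (v2 1 t)) = abs_proj (\<chi> k. q0 k 1 t)" using W0(4) t by auto
    have q: "q0 k 1 t = poly c t * \<Phi> k 1 t" for k using p[of k t] c(2) \<Phi>(2) by simp
    then have "poly c t \<noteq> 0" using 1(1) by auto
    moreover have "(\<chi> k. q0 k 1 t) = poly c t *\<^sub>R (\<chi> k. \<Phi> k 1 t)" by (simp add: vec_eq_iff q)
    ultimately show ?thesis unfolding 1(2) param_point_def
      using abs_proj_scale[OF _ hom_param_nonzero[OF \<Phi>(1), of 1 t]] by simp
  qed
  have all: "f (abs_proj (v2 a b)) = param_point \<Phi> a b" if ab: "(a, b) \<noteq> (0, 0)" for a b
  proof -
    obtain W m q where W: "proj_algebraic (- W)" "abs_proj (v2 a b) \<in> W" "\<forall>k. bform m (q k)"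
      "\<forall>a b. (a, b) \<noteq> (0, 0) \<longrightarrow> abs_proj (v2 a b) \<in> W \<longrightarrow>
        (\<exists>k. q k a b \<noteq> 0) \<and> f (abs_proj (v2 a b)) = abs_proj (\<chi> k. q k a b)"
      using regular_local_bforms[OF reg, of "abs_proj (v2 a b)"] by (elim exE conjE)
    have "finite ({t. abs_proj (v2 1 t) \<notin> W} \<union> {t. abs_proj (v2 1 t) \<notin> W0})"
      by (intro finite_UnI cofinite_affine_line fin[OF W(1,2)] fin[OF W0(1,2)])
    then have "finite {t. \<not> (abs_proj (v2 1 t) \<in> W \<and> abs_proj (v2 1 t) \<in> W0)}"
      by (rule finite_subset[rotated]) auto
    then have inf: "infinite {t. abs_proj (v2 1 t) \<in> W \<and> abs_proj (v2 1 t) \<in> W0}"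
      by (rule infinite_reals_cofinite)
    have nzq: "(\<chi> k. q k x y) \<noteq> 0" if "(x, y) \<noteq> (0, 0)" "abs_proj (v2 x y) \<in> W" for x y
    proof -
      have "\<exists>k. q k x y \<noteq> 0" using W(4) that by blast
      then show ?thesis by (auto simp: vec_eq_iff)
    qed
    have cross: "q i a b * \<Phi> j a b - q j a b * \<Phi> i a b = 0" for i j
    proof (rule bform_eq_0[of "m + d" "\<lambda>a b. q i a b * \<Phi> j a b - q j a b * \<Phi> i a b"])
      show "bform (m + d) (\<lambda>a b. q i a b * \<Phi> j a b - q j a b * \<Phi> i a b)"
        using W(3) \<Phi>(1) unfolding hom_param_def by (intro bform_diff bform_mult) blast+
      have "q i 1 t * \<Phi> j 1 t - q j 1 t * \<Phi> i 1 t = 0"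
        if t: "abs_proj (v2 1 t) \<in> W" "abs_proj (v2 1 t) \<in> W0" for t
      proof -
        have "abs_proj (\<chi> k. q k 1 t) = abs_proj (\<chi> k. \<Phi> k 1 t)"
          using W(4) t(1) gen[OF t(2)] unfolding param_point_def by simp
        then have "\<forall>i j. (\<chi> k. q k 1 t) $ i * (\<chi> k. \<Phi> k 1 t) $ j = (\<chi> k. q k 1 t) $ j * (\<chi> k. \<Phi> k 1 t) $ i"
          using abs_proj_eq_iff_cross[OF nzq hom_param_nonzero[OF \<Phi>(1)], of 1 t 1 t] t(1) by simp
        then show ?thesis by simp
      qed
      then have "{t. abs_proj (v2 1 t) \<in> W \<and> abs_proj (v2 1 t) \<in> W0} \<subseteq> {t. q i 1 t * \<Phi> j 1 t - q j 1 t * \<Phi> i 1 t = 0}"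
        by auto
      then show "infinite {t. q i 1 t * \<Phi> j 1 t - q j 1 t * \<Phi> i 1 t = 0}"
        using inf finite_subset by blast
    qed
    have "f (abs_proj (v2 a b)) = abs_proj (\<chi> k. q k a b)" using W(2,4) ab by blast
    also have "\<dots> = param_point \<Phi> a b"
      unfolding param_point_def
      using abs_proj_eq_iff_cross[OF nzq[OF ab W(2)] hom_param_nonzero[OF \<Phi>(1) ab]] cross by simp
    finally show ?thesis .
  qed
  have "f z = param_map \<Phi> z" for z
  proof -
    obtain a b where "(a, b) \<noteq> (0, 0)" "z = abs_proj (v2 a b)" by (rule proj2_cases)
    then show ?thesis using all param_map_abs_proj[OF \<Phi>(1)] by simp
  qed
  then show ?thesis using that \<Phi>(1) by blast
qed

text \<open>The inverse is given by forms near one point \<open>y0\<close> only. The relation a G =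
  b H, which holds at the cofinitely many parameters mapped near \<open>y0\<close>, is an identity
  of binary forms and thus holds everywhere.\<close>

theorem rational_curve_param:
  fixes C :: "('k::finite) proj set"
  assumes "rational_curve C"
  obtains d \<Phi> e G H where "rat_param d \<Phi> e G H" "finite (C - range (param_map \<Phi>))"
proof -
  obtain f :: "2 proj \<Rightarrow> 'k proj" where f: "projective_irreducible_curve C" "birational_map UNIV C f"
    using assms unfolding rational_curve_def by (elim exE conjE)
  obtain U V g where UV: "proj_algebraic (- U)" "proj_algebraic (- V)" "UNIV \<inter> U \<noteq> {}" "C \<inter> V \<noteq> {}"
    "f ` (UNIV \<inter> U) = C \<inter> V" "proj_regular_on (C \<inter> V) g" "\<forall>x\<in>UNIV \<inter> U. g (f x) = x"
    and reg: "proj_regular_on UNIV f" and sub: "f ` UNIV \<subseteq> C"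
    using f(2) unfolding birational_map_def by (elim exE conjE)
  obtain d \<Phi> where \<Phi>: "hom_param d \<Phi>" "f = param_map \<Phi>" by (rule regular_global_param[OF reg])
  have f_pt: "f (abs_proj (v2 a b)) = param_point \<Phi> a b" if "(a, b) \<noteq> (0, 0)" for a b
    unfolding \<Phi>(2) by (rule param_map_abs_proj[OF \<Phi>(1) that])
  obtain y0 where y0: "y0 \<in> C \<inter> V" using UV(4) by blast
  then have "y0 \<in> f ` (UNIV \<inter> U)" using UV(5) by simp
  then obtain z0 where "y0 = f z0" "z0 \<in> UNIV \<inter> U" by (rule imageE)
  then have z0: "z0 \<in> U" "f z0 = y0" by simp_all
  obtain W e F where W: "proj_algebraic (- W)" "y0 \<in> W" "\<forall>k. homogeneous e (F k)"
    "\<forall>z\<in>C \<inter> V \<inter> W. (\<exists>k. poly_eval (F k) (hcoords z) \<noteq> 0) \<and> g z = abs_proj (\<chi> k. poly_eval (F k) (hcoords z))"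
    using bspec[OF UV(6)[unfolded proj_regular_on_def] y0] by (elim exE conjE)
  define G where "G = poly_eval (F 2)"
  define H where "H = poly_eval (F 1)"
  have GH: "form e G" "form e H" unfolding G_def H_def using W(3) by (auto intro: form_poly_eval)
  have inv: "a * G (\<lambda>k. \<Phi> k a b) = b * H (\<lambda>k. \<Phi> k a b) \<and> (H (\<lambda>k. \<Phi> k a b), G (\<lambda>k. \<Phi> k a b)) \<noteq> (0, 0)"
    if ab: "(a, b) \<noteq> (0, 0)" and U: "abs_proj (v2 a b) \<in> U" and fW: "f (abs_proj (v2 a b)) \<in> W" for a b
  proof -
    let ?y = "f (abs_proj (v2 a b))"
    have "?y \<in> C \<inter> V \<inter> W" using UV(5) U fW by blast
    then have 1: "\<exists>k. poly_eval (F k) (hcoords ?y) \<noteq> 0" "g ?y = abs_proj (\<chi> k. poly_eval (F k) (hcoords ?y))"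
      using W(4) by auto
    have "(\<chi> k. poly_eval (F k) (hcoords ?y)) = v2 (H (hcoords ?y)) (G (hcoords ?y))"
      by (simp add: vec_eq_iff forall_2 G_def H_def)
    then have 2: "abs_proj (v2 (H (hcoords ?y)) (G (hcoords ?y))) = abs_proj (v2 a b)"
      using 1(2) UV(7) U by simp
    obtain k where "poly_eval (F k) (hcoords ?y) \<noteq> 0" using 1(1) by blast
    then have 3: "(H (hcoords ?y), G (hcoords ?y)) \<noteq> (0, 0)"
      using exhaust_2[of k] by (auto simp: G_def H_def)
    have 4: "H (hcoords ?y) * b = G (hcoords ?y) * a"
      using 2 abs_proj_v2_eq_iff[OF 3 ab] by simp
    obtain c where c: "c \<noteq> 0" "hcoords (abs_proj (\<chi> k. \<Phi> k a b)) = (\<lambda>k. c * (\<chi> k. \<Phi> k a b) $ k)"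
      by (rule hcoords_abs_proj[OF hom_param_nonzero[OF \<Phi>(1) ab]])
    then have hy: "hcoords ?y = (\<lambda>k. c * \<Phi> k a b)"
      unfolding f_pt[OF ab] param_point_def by simp
    show ?thesis using 3 4 c(1) unfolding hy form_scale[OF GH(1)] form_scale[OF GH(2)] by (auto simp: mult.commute)
  qed
  have finU: "finite (- U)" using UV(1,3) by (intro proj_line_closed_finite) auto
  have finW: "finite {z. f z \<notin> W}"
  proof -
    have "y0 \<notin> - W" using W(2) by simp
    from proj_algebraic_separate[OF W(1) this]
    obtain m P where m: "form m P" and P: "P (hcoords y0) \<noteq> 0" and sub: "- W \<subseteq> {x. P (hcoords x) = 0}"
      by (elim exE conjE)
    have iff: "P (hcoords (f z)) = 0 \<longleftrightarrow> P (\<lambda>k. \<Phi> k (hcoords z 1) (hcoords z 2)) = 0" for z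
      unfolding \<Phi>(2) param_map_def by (rule form_param_point[OF \<Phi>(1) hcoords_pair_nonzero m])
    have "P (\<lambda>k. \<Phi> k (hcoords z0 1) (hcoords z0 2)) \<noteq> 0" using P iff[of z0] z0(2) by simp
    then have "finite {z :: 2 proj. P (\<lambda>k. \<Phi> k (hcoords z 1) (hcoords z 2)) = 0}"
      by (rule finite_proj_line_zeros[OF hom_param_form[OF \<Phi>(1) m]])
    moreover have "{z. f z \<notin> W} \<subseteq> {z. P (\<lambda>k. \<Phi> k (hcoords z 1) (hcoords z 2)) = 0}"
    proof
      fix z assume "z \<in> {z. f z \<notin> W}"
      then have "f z \<in> - W" by simp
      then have "P (hcoords (f z)) = 0" using sub by blast
      then show "z \<in> {z. P (\<lambda>k. \<Phi> k (hcoords z 1) (hcoords z 2)) = 0}" using iff by simp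
    qed
    ultimately show ?thesis by (rule finite_subset[rotated])
  qed
  have "finite {t. abs_proj (v2 1 t) \<in> - U \<union> {z. f z \<notin> W}}"
    using finU finW by (intro finite_affine_line_preimage) simp
  then have "finite {t. \<not> (abs_proj (v2 1 t) \<in> U \<and> f (abs_proj (v2 1 t)) \<in> W)}"
    by (rule finite_subset[rotated]) auto
  then have inf: "infinite {t. abs_proj (v2 1 t) \<in> U \<and> f (abs_proj (v2 1 t)) \<in> W}"
    by (rule infinite_reals_cofinite)
  have bG: "bform (e * d) (\<lambda>a b. G (\<lambda>k. \<Phi> k a b))" and bH: "bform (e * d) (\<lambda>a b. H (\<lambda>k. \<Phi> k a b))"
    using hom_param_form[OF \<Phi>(1)] GH by blast+
  have eq: "a * G (\<lambda>k. \<Phi> k a b) - b * H (\<lambda>k. \<Phi> k a b) = 0" for a b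
  proof (rule bform_eq_0[of "1 + e * d" "\<lambda>a b. a * G (\<lambda>k. \<Phi> k a b) - b * H (\<lambda>k. \<Phi> k a b)"])
    show "bform (1 + e * d) (\<lambda>a b. a * G (\<lambda>k. \<Phi> k a b) - b * H (\<lambda>k. \<Phi> k a b))"
      by (intro bform_diff bform_mult bform_fst bform_snd bG bH)
    have "{t. abs_proj (v2 1 t) \<in> U \<and> f (abs_proj (v2 1 t)) \<in> W} \<subseteq> {t. 1 * G (\<lambda>k. \<Phi> k 1 t) - t * H (\<lambda>k. \<Phi> k 1 t) = 0}"
      using inv[of 1] by auto
    then show "infinite {t. 1 * G (\<lambda>k. \<Phi> k 1 t) - t * H (\<lambda>k. \<Phi> k 1 t) = 0}" using inf finite_subset by blast
  qed
  obtain t where t: "abs_proj (v2 1 t) \<in> U" "f (abs_proj (v2 1 t)) \<in> W"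
    using inf by (metis (mono_tags, lifting) Collect_empty_eq finite.emptyI)
  have "H (\<lambda>k. \<Phi> k 1 t) \<noteq> 0" using inv[of 1 t] t by auto
  then have rp: "rat_param d \<Phi> e G H"
    unfolding rat_param_def using \<Phi>(1) GH eq by (intro conjI allI exI[of _ t]) simp_all
  obtain F' where F': "\<And>k t. poly (F' k) t = \<Phi> k 1 t" "no_common_root F'"
    using polys_of_hom_param[OF \<Phi>(1)] by blast
  have rangeC: "range f \<subseteq> curve_closure F'"
    unfolding \<Phi>(2) param_map_def using param_point_in_closure[OF \<Phi>(1) hcoords_pair_nonzero F'(2,1)] by blast
  have C_irr: "zariski_irreducible proj_algebraic C" using f(1) unfolding projective_irreducible_curve_def by blast
  then have Ccl: "proj_algebraic C" unfolding zariski_irreducible_def by blast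
  \<comment> \<open>The open set \<open>V\<close> meets \<open>C\<close>, so irreducibility puts
    \<open>C\<close> inside the closure of the parametrization; there the complement of
    \<open>V\<close> is finite.\<close>
  have "C = (C \<inter> - V) \<union> (C \<inter> curve_closure F')"
    using UV(5) rangeC by blast
  moreover have "proj_algebraic (C \<inter> - V)" "proj_algebraic (C \<inter> curve_closure F')"
    unfolding curve_closure_def by (intro proj_algebraic_Int Ccl UV(2) proj_algebraic_hull)+
  ultimately have "C = C \<inter> - V \<or> C = C \<inter> curve_closure F'"
    using C_irr unfolding zariski_irreducible_def by blast
  then have CF: "C \<subseteq> curve_closure F'" using UV(4) by blast
  have "\<not> curve_closure F' \<subseteq> - V" using y0 CF by blast
  then have "finite (curve_closure F' \<inter> - V)" using curve_closed_subset_cases[OF F'(2) UV(2)] by blast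
  moreover have "C - range (param_map \<Phi>) \<subseteq> curve_closure F' \<inter> - V"
    using UV(5) CF unfolding \<Phi>(2) by blast
  ultimately have "finite (C - range (param_map \<Phi>))" by (rule finite_subset[rotated])
  then show ?thesis using that rp by blast
qed

section \<open>Separating the arcs of the parameter line\<close>

lemma poly_interpolation:
  fixes \<phi> :: "'a::field \<Rightarrow> 'a"
  assumes "finite R"
  shows "\<exists>p. \<forall>r\<in>R. poly p r = \<phi> r"
  using assms
proof (induction R rule: finite_induct)
  case (insert a R)
  then obtain p where p: "\<forall>r\<in>R. poly p r = \<phi> r" by blast
  define w where "w = (\<Prod>r\<in>R. [:- r, 1:])"
  have w: "poly w r = 0" if "r \<in> R" for r using that insert(1) by (auto simp: w_def poly_prod)
  have wa: "poly w a \<noteq> 0" using insert(1,2) by (auto simp: w_def poly_prod)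
  have "\<forall>r\<in>insert a R. poly (p + smult ((\<phi> a - poly p a) / poly w a) w) r = \<phi> r"
    using p w wa by auto
  then show ?case by blast
qed simp

abbreviation cpoly :: "real poly \<Rightarrow> complex poly" where
  "cpoly \<equiv> map_poly complex_of_real"

lemma cpoly_pCons: "cpoly (pCons a p) = pCons (of_real a) (cpoly p)"
  by (rule poly_eqI) (simp add: coeff_map_poly coeff_pCons split: nat.split)

lemma cpoly_add: "cpoly (p + q) = cpoly p + cpoly q"
  by (rule poly_eqI) (simp add: coeff_map_poly)

lemma cpoly_smult: "cpoly (smult c p) = smult (of_real c) (cpoly p)"
  by (rule poly_eqI) (simp add: coeff_map_poly)

lemma cpoly_mult: "cpoly (p * q) = cpoly p * cpoly q"
  by (induction p) (simp_all add: cpoly_pCons cpoly_add cpoly_smult)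

lemma cpoly_1: "cpoly 1 = 1"
  by (simp add: one_pCons cpoly_pCons)

lemma cpoly_power: "cpoly (p ^ n) = cpoly p ^ n"
  by (induction n) (simp_all add: cpoly_mult cpoly_1)

lemma cpoly_diff: "cpoly (p - q) = cpoly p - cpoly q"
  by (rule poly_eqI) (simp add: coeff_map_poly)

lemma poly_cpoly_cnj: "poly (cpoly p) (cnj z) = cnj (poly (cpoly p) z)"
  by (induction p) (simp_all add: cpoly_pCons)

lemma degree_cpoly: "degree (cpoly p) = degree p"
  by (rule degree_map_poly) simp

lemma cpoly_eq_0_iff: "cpoly p = 0 \<longleftrightarrow> p = 0"
  by (auto simp: poly_eq_iff coeff_map_poly)

text \<open>Division with remainder over the reals stays a division with remainder over the complex
  numbers, so the real remainder is 0.\<close>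

lemma cpoly_dvd_imp_dvd:
  assumes "cpoly p dvd cpoly q"
  shows "p dvd q"
proof (cases "p = 0")
  case True
  then show ?thesis using assms by (simp add: cpoly_eq_0_iff)
next
  case False
  have "cpoly q = cpoly p * cpoly (q div p) + cpoly (q mod p)"
    by (simp flip: cpoly_mult cpoly_add)
  then have "cpoly p dvd cpoly (q mod p)"
    using assms by (metis dvd_add_right_iff dvd_triv_left)
  moreover have "q mod p = 0 \<or> degree (q mod p) < degree p"
    using False by (rule degree_mod_less)
  ultimately have "q mod p = 0"
    by (metis cpoly_eq_0_iff degree_cpoly dvd_imp_degree_le not_le)
  then show ?thesis by (simp add: mod_eq_0_iff_dvd)
qed

text \<open>The values at the complex roots are chosen compatibly with conjugation, so that an
  interpolating polynomial can be made real.\<close>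

lemma fourth_root_at_roots:
  fixes \<eta> :: "real poly"
  assumes "poly \<eta> 0 \<noteq> 0"
  shows "\<exists>v. \<forall>z. poly (cpoly \<eta>) z = 0 \<longrightarrow> z\<^sup>2 * poly (cpoly v) z ^ 4 = 1"
proof -
  \<comment> \<open>At a real root of either sign, |z|^(-1/2) works because only z^2 matters. The
    values in the lower half-plane are the conjugates of those in the upper one, a symmetry that
    \<open>csqrt\<close> alone would break on the negative axis.\<close>
  define \<phi> where "\<phi> z = (if Im z = 0 then of_real (1 / sqrt \<bar>Re z\<bar>)
    else if Im z > 0 then 1 / csqrt z else cnj (1 / csqrt (cnj z)))" for z
  have cnj_\<phi>: "\<phi> (cnj z) = cnj (\<phi> z)" for z by (simp add: \<phi>_def)
  have pow4: "x ^ 4 = (x\<^sup>2)\<^sup>2" for x :: "'b::comm_ring_1"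
    unfolding power_mult[symmetric] by simp
  have \<phi>4: "z\<^sup>2 * \<phi> z ^ 4 = 1" if "z \<noteq> 0" for z
  proof -
    consider "Im z = 0" | "Im z > 0" | "Im z < 0" by linarith
    then show ?thesis
    proof cases
      case 1
      then obtain x where x: "z = of_real x" by (metis complex_is_Real_iff Reals_cases)
      have "x\<^sup>2 * (1 / sqrt \<bar>x\<bar>) ^ 4 = 1" unfolding power_divide pow4 using that x by simp
      then have "complex_of_real (x\<^sup>2 * (1 / sqrt \<bar>x\<bar>) ^ 4) = 1" by (simp only: of_real_1)
      moreover have "\<phi> z = of_real (1 / sqrt \<bar>x\<bar>)" by (simp add: \<phi>_def x)
      ultimately show ?thesis unfolding x by (simp only: of_real_mult of_real_power)
    next
      case 2
      then have "\<phi> z = 1 / csqrt z" by (simp add: \<phi>_def)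
      then show ?thesis using that by (simp only: pow4 power_divide power2_csqrt) simp
    next
      case 3
      then have "\<phi> z = 1 / cnj (csqrt (cnj z))" by (simp add: \<phi>_def)
      moreover have "(cnj (csqrt (cnj z)))\<^sup>2 = z" by (simp flip: complex_cnj_power)
      ultimately show ?thesis using that by (simp only: pow4 power_divide) simp
    qed
  qed
  have \<eta>0: "cpoly \<eta> \<noteq> 0" using assms by (auto simp: cpoly_eq_0_iff)
  then have "finite {z. poly (cpoly \<eta>) z = 0}" by (rule poly_roots_finite)
  then obtain p where p: "\<forall>z\<in>{z. poly (cpoly \<eta>) z = 0}. poly p z = \<phi> z"
    using poly_interpolation by blast
  \<comment> \<open>The real part of an interpolating polynomial is its average with the conjugate
    polynomial. Both interpolate the same values, by the symmetry of \<open>\<phi>\<close> and of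
    the set of roots.\<close>
  define v where "v = map_poly Re p"
  have cv: "cpoly v = smult (1 / 2) (p + map_poly cnj p)"
    by (rule poly_eqI) (simp add: v_def coeff_map_poly complex_eq_iff)
  have cnj_p: "poly (map_poly cnj p) z = cnj (poly p (cnj z))" for z
  proof (induction p)
    case (pCons a p)
    have "map_poly cnj (pCons a p) = pCons (cnj a) (map_poly cnj p)"
      by (rule poly_eqI) (simp add: coeff_map_poly coeff_pCons split: nat.split)
    then show ?case using pCons by simp
  qed simp
  have "z\<^sup>2 * poly (cpoly v) z ^ 4 = 1" if z: "poly (cpoly \<eta>) z = 0" for z
  proof -
    have "poly (cpoly \<eta>) (cnj z) = 0" using z by (simp add: poly_cpoly_cnj)
    then have "poly (cpoly v) z = \<phi> z" using p z by (simp add: cv cnj_p cnj_\<phi>)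
    moreover have "z \<noteq> 0"
    proof
      assume "z = 0"
      then have "coeff (cpoly \<eta>) 0 = 0" using z by (simp add: poly_0_coeff_0)
      then show False using assms by (simp add: coeff_map_poly poly_0_coeff_0)
    qed
    ultimately show ?thesis using \<phi>4 by simp
  qed
  then show ?thesis by blast
qed

text \<open>Newton's iteration doubles the precision of a fourth root of \<open>t\<^sup>-\<^sup>2\<close> modulo \<open>\<eta>\<close>.\<close>

lemma fourth_root_mod:
  fixes \<eta> :: "real poly"
  assumes "poly \<eta> 0 \<noteq> 0"
  shows "\<exists>v. \<eta> dvd 1 - [:0, 1:]\<^sup>2 * v ^ 4"
proof -
  let ?X = "[:0, 1:] :: real poly"
  obtain v0 where v0: "\<forall>z. poly (cpoly \<eta>) z = 0 \<longrightarrow> z\<^sup>2 * poly (cpoly v0) z ^ 4 = 1"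
    using fourth_root_at_roots[OF assms] by blast
  define e0 where "e0 = 1 - ?X\<^sup>2 * v0 ^ 4"
  have "cpoly ?X = [:0, 1:]" by (simp add: cpoly_pCons)
  then have ce0: "poly (cpoly e0) z = 1 - z\<^sup>2 * poly (cpoly v0) z ^ 4" for z
    by (simp only: e0_def cpoly_diff cpoly_mult cpoly_power cpoly_1 poly_diff poly_mult poly_power poly_1) simp
  have \<eta>0: "cpoly \<eta> \<noteq> 0" using assms by (auto simp: cpoly_eq_0_iff)
  \<comment> \<open>The error vanishes at every root of \<open>\<eta>\<close>, but multiplicities
    may be missing; only a power of the error is divisible by \<open>\<eta>\<close>.\<close>
  have "\<forall>z. poly (cpoly \<eta>) z = 0 \<longrightarrow> poly (cpoly e0) z = 0" unfolding ce0 using v0 by simp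
  then have "cpoly \<eta> dvd cpoly e0 ^ degree (cpoly \<eta>)"
    using nullstellensatz_univariate[of "cpoly \<eta>" "cpoly e0"] \<eta>0 by blast
  then have dvd: "\<eta> dvd e0 ^ degree \<eta>"
    unfolding cpoly_power[symmetric] degree_cpoly by (rule cpoly_dvd_imp_dvd)
  have "\<exists>v. e0 ^ (2 ^ k) dvd 1 - ?X\<^sup>2 * v ^ 4" for k :: nat
  proof (induction k)
    case 0
    show ?case by (rule exI[of _ v0]) (simp add: e0_def)
  next
    case (Suc k)
    then obtain v where v: "e0 ^ (2 ^ k) dvd 1 - ?X\<^sup>2 * v ^ 4" by blast
    define e where "e = 1 - ?X\<^sup>2 * v ^ 4"
    \<comment> \<open>The Newton correction multiplies v by 1 + e/4. In 1 - (1 - 4q) (1 + q)^4 the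
      linear terms cancel, which leaves a multiple of q^2.\<close>
    define q where "q = smult (1 / 4) e"
    have e4: "e = 4 * q" by (simp add: q_def numeral_poly)
    have "1 - ?X\<^sup>2 * (v * (1 + q)) ^ 4 = 1 - (1 - e) * (1 + q) ^ 4"
      by (simp add: e_def power_mult_distrib mult.assoc)
    also have "\<dots> = q\<^sup>2 * (10 + 20 * q + 15 * q\<^sup>2 + 4 * q ^ 3)"
      unfolding e4 by (simp add: eval_nat_numeral algebra_simps)
    finally have eq: "1 - ?X\<^sup>2 * (v * (1 + q)) ^ 4 = q\<^sup>2 * (10 + 20 * q + 15 * q\<^sup>2 + 4 * q ^ 3)" .
    have "e0 ^ (2 ^ k) dvd q" unfolding q_def using v unfolding e_def[symmetric] by (rule dvd_smult)
    then have "(e0 ^ (2 ^ k))\<^sup>2 dvd q\<^sup>2" by (rule dvd_power_same)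
    then have "e0 ^ (2 ^ Suc k) dvd q\<^sup>2" by (simp add: power_mult[symmetric] mult.commute)
    then have "e0 ^ (2 ^ Suc k) dvd 1 - ?X\<^sup>2 * (v * (1 + q)) ^ 4" unfolding eq by (rule dvd_mult2)
    then show ?case by blast
  qed
  then obtain v where "e0 ^ (2 ^ degree \<eta>) dvd 1 - ?X\<^sup>2 * v ^ 4" by blast
  moreover have "e0 ^ degree \<eta> dvd e0 ^ (2 ^ degree \<eta>)"
    by (intro le_imp_power_dvd less_imp_le less_exp)
  ultimately have "\<eta> dvd 1 - ?X\<^sup>2 * v ^ 4" using dvd_trans[OF dvd] dvd_trans by metis
  then show ?thesis by blast
qed

text \<open>The functions on \<open>S\<close> which are quotients of polynomials of the ambient space with positive
  denominator form a ring; it is considered as a ring of functions of the parameter \<open>t\<close>.\<close>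

definition descends :: "(real ^ 'm) set \<Rightarrow> real set \<Rightarrow> (real \<Rightarrow> real ^ 'm) \<Rightarrow> (real \<Rightarrow> real) \<Rightarrow> bool" where
  "descends S T X r \<longleftrightarrow> (\<exists>P D. polyfun UNIV P \<and> polyfun UNIV D \<and> (\<forall>x\<in>S. D (($) x) > 0) \<and>
     (\<forall>t\<in>T. r t * D (($) (X t)) = P (($) (X t))))"

lemma descends_cong: "descends S T X r \<Longrightarrow> (\<And>t. t \<in> T \<Longrightarrow> r t = s t) \<Longrightarrow> descends S T X s"
  unfolding descends_def by auto

lemma descends_polyfun: "polyfun UNIV P \<Longrightarrow> descends S T X (\<lambda>t. P (($) (X t)))"
  unfolding descends_def by (intro exI[of _ P] exI[of _ "\<lambda>_. 1"]) simp

lemma descends_const: "descends S T X (\<lambda>t. c)"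
  by (rule descends_polyfun[where P = "\<lambda>_. c"]) simp

lemma descends_add:
  assumes "descends S T X r" "descends S T X s"
  shows "descends S T X (\<lambda>t. r t + s t)"
proof -
  obtain P D where P: "polyfun UNIV P" "polyfun UNIV D" "\<forall>x\<in>S. D (($) x) > 0" "\<forall>t\<in>T. r t * D (($) (X t)) = P (($) (X t))"
    using assms(1) unfolding descends_def by (elim exE conjE)
  obtain Q E where Q: "polyfun UNIV Q" "polyfun UNIV E" "\<forall>x\<in>S. E (($) x) > 0" "\<forall>t\<in>T. s t * E (($) (X t)) = Q (($) (X t))"
    using assms(2) unfolding descends_def by (elim exE conjE)
  show ?thesis unfolding descends_def
  proof (rule exI[of _ "\<lambda>x. P x * E x + Q x * D x"], rule exI[of _ "\<lambda>x. D x * E x"], intro conjI ballI)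
    fix t assume "t \<in> T"
    then have eqs: "P (($) (X t)) = r t * D (($) (X t))" "Q (($) (X t)) = s t * E (($) (X t))" using P(4) Q(4) by auto
    show "(r t + s t) * (D (($) (X t)) * E (($) (X t))) = P (($) (X t)) * E (($) (X t)) + Q (($) (X t)) * D (($) (X t))"
      unfolding eqs by (simp add: algebra_simps)
  qed (use P Q in \<open>auto intro!: polyfun_add polyfun_mult\<close>)
qed

lemma descends_mult:
  assumes "descends S T X r" "descends S T X s"
  shows "descends S T X (\<lambda>t. r t * s t)"
proof -
  obtain P D where P: "polyfun UNIV P" "polyfun UNIV D" "\<forall>x\<in>S. D (($) x) > 0" "\<forall>t\<in>T. r t * D (($) (X t)) = P (($) (X t))"
    using assms(1) unfolding descends_def by (elim exE conjE)
  obtain Q E where Q: "polyfun UNIV Q" "polyfun UNIV E" "\<forall>x\<in>S. E (($) x) > 0" "\<forall>t\<in>T. s t * E (($) (X t)) = Q (($) (X t))"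
    using assms(2) unfolding descends_def by (elim exE conjE)
  show ?thesis unfolding descends_def
  proof (rule exI[of _ "\<lambda>x. P x * Q x"], rule exI[of _ "\<lambda>x. D x * E x"], intro conjI ballI)
    fix t assume "t \<in> T"
    then have "r t * D (($) (X t)) = P (($) (X t))" "s t * E (($) (X t)) = Q (($) (X t))" using P(4) Q(4) by auto
    then show "r t * s t * (D (($) (X t)) * E (($) (X t))) = P (($) (X t)) * Q (($) (X t))"
      by (metis (no_types, lifting) mult.assoc mult.commute)
  qed (use P Q in \<open>auto intro!: polyfun_mult\<close>)
qed

lemma descends_power: "descends S T X r \<Longrightarrow> descends S T X (\<lambda>t. r t ^ n)"
  by (induction n) (auto intro: descends_const descends_mult)

lemma descends_sum: "(\<And>i. i \<in> I \<Longrightarrow> descends S T X (r i)) \<Longrightarrow> descends S T X (\<lambda>t. \<Sum>i\<in>I. r i t)"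
  by (induction I rule: infinite_finite_induct) (auto intro: descends_const descends_add)

text \<open>A single denominator h^n serves all powers of r. Below n, each factor r is paired with
  one h; from n on, the integral equation lowers the exponent.\<close>

lemma descends_powers_of_integral:
  assumes int: "\<And>t. t \<in> T \<Longrightarrow> r t ^ n = (\<Sum>j<n. c j t * r t ^ j)" and c: "\<And>j. descends S T X (c j)"
    and h: "descends S T X h" "descends S T X (\<lambda>t. h t * r t)"
  shows "descends S T X (\<lambda>t. h t ^ n * r t ^ k)"
proof (induction k rule: less_induct)
  case (less k)
  show ?case
  proof (cases "k < n")
    case True
    have "descends S T X (\<lambda>t. h t ^ (n - k) * (h t * r t) ^ k)"
      by (intro descends_mult descends_power h)
    then show ?thesis
    proof (rule descends_cong)
      fix t
      have "h t ^ n = h t ^ (n - k) * h t ^ k" using True by (simp flip: power_add)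
      then show "h t ^ (n - k) * (h t * r t) ^ k = h t ^ n * r t ^ k" by (simp add: power_mult_distrib)
    qed
  next
    case False
    have "descends S T X (\<lambda>t. \<Sum>j<n. c j t * (h t ^ n * r t ^ (k - n + j)))"
      using False by (intro descends_sum descends_mult c less) auto
    then show ?thesis
    proof (rule descends_cong)
      fix t assume t: "t \<in> T"
      have "r t ^ k = r t ^ (k - n) * r t ^ n" using False by (simp flip: power_add)
      also have "\<dots> = (\<Sum>j<n. c j t * r t ^ (k - n + j))"
        unfolding int[OF t] sum_distrib_left by (intro sum.cong refl) (simp add: power_add mult_ac)
      finally show "(\<Sum>j<n. c j t * (h t ^ n * r t ^ (k - n + j))) = h t ^ n * r t ^ k"
        by (simp add: sum_distrib_left mult_ac)
    qed
  qed
qed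

lemma inner_option: "u \<bullet> w = u $ None * w $ None + (\<Sum>i\<in>UNIV. u $ Some i * w $ Some i)"
  for u w :: "real ^ 'm::finite option"
proof -
  have "(\<Sum>k\<in>(UNIV :: 'm option set). u $ k * w $ k) = u $ None * w $ None + (\<Sum>k\<in>range Some. u $ k * w $ k)"
    unfolding UNIV_option_conv by (subst sum.insert) auto
  then show ?thesis by (simp add: inner_vec_def sum.reindex)
qed

text \<open>A point \<open>[w]\<close> of the curve outside \<open>S\<close> is the only zero of the positive function
  \<open>1 - (x \<bullet> w)\<^sup>2 / (|x|\<^sup>2 |w|\<^sup>2)\<close>. Its inverse descends and has a pole at the corresponding parameter,
  so that this parameter, moved to infinity, is integral over the functions which descend.\<close>

lemma parameter_integral:
  fixes \<Psi> :: "'m::finite option \<Rightarrow> real \<Rightarrow> real \<Rightarrow> real"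
  assumes par: "hom_param d \<Psi>"
    and out: "\<And>x. x \<in> S \<Longrightarrow> affine_to_proj x \<noteq> param_point \<Psi> 0 1"
    and X: "\<And>t. t \<in> T \<Longrightarrow> X t \<in> S" "\<And>t. t \<in> T \<Longrightarrow> affine_to_proj (X t) = param_point \<Psi> 1 (r t)"
  obtains c where "\<forall>j. descends S T X (c j)" "\<forall>t\<in>T. r t ^ (2 * d) = (\<Sum>j<2 * d. c j t * r t ^ j)"
proof -
  define w where "w = (\<chi> k. \<Psi> k 0 1)"
  define V where "V a b = (\<chi> k. \<Psi> k a b)" for a b
  have w0: "w \<noteq> 0" unfolding w_def by (rule hom_param_nonzero[OF par]) simp
  \<comment> \<open>The defect in the Cauchy-Schwarz inequality: a polynomial in the coordinates
    that is positive off the line spanned by w. The identity below displays it as a squared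
    norm.\<close>
  define gap where "gap u = (u \<bullet> u) * (w \<bullet> w) - (u \<bullet> w)\<^sup>2" for u
  have gap_id: "(norm ((w \<bullet> w) *\<^sub>R u - (u \<bullet> w) *\<^sub>R w))\<^sup>2 = (w \<bullet> w) * gap u" for u
    unfolding power2_norm_eq_inner gap_def
    by (simp add: inner_diff_left inner_diff_right inner_commute algebra_simps power2_eq_square)
  have ww: "w \<bullet> w > 0" using w0 by simp
  have gap_pos: "gap (affine_vec x) > 0" if x: "x \<in> S" for x
  proof (rule ccontr)
    assume "\<not> ?thesis"
    then have "(w \<bullet> w) * gap (affine_vec x) \<le> 0" using ww by (simp add: mult_nonneg_nonpos)
    then have "norm ((w \<bullet> w) *\<^sub>R affine_vec x - (affine_vec x \<bullet> w) *\<^sub>R w) = 0"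
      unfolding gap_id[symmetric] by simp
    then have eq: "(w \<bullet> w) *\<^sub>R affine_vec x = (affine_vec x \<bullet> w) *\<^sub>R w" by simp
    have "affine_vec x \<bullet> w \<noteq> 0"
    proof
      assume "affine_vec x \<bullet> w = 0"
      then have "(w \<bullet> w) *\<^sub>R affine_vec x = 0" using eq by simp
      then show False using ww by simp
    qed
    moreover have "abs_proj ((w \<bullet> w) *\<^sub>R affine_vec x) = affine_to_proj x"
      unfolding affine_to_proj_eq using ww by (intro abs_proj_scale) auto
    ultimately have "affine_to_proj x = abs_proj w"
      unfolding eq using w0 by (simp add: abs_proj_scale)
    then show False using out[OF x] unfolding w_def param_point_def by simp
  qed
  define N where "N y = 1 + (\<Sum>i\<in>UNIV. y i * y i)" for y :: "'m \<Rightarrow> real"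
  define I where "I y = w $ None + (\<Sum>i\<in>UNIV. w $ Some i * y i)" for y :: "'m \<Rightarrow> real"
  have N: "affine_vec x \<bullet> affine_vec x = N (($) x)" for x by (simp add: inner_option N_def)
  have I: "affine_vec x \<bullet> w = I (($) x)" for x by (simp add: inner_option I_def mult.commute)
  have Np: "polyfun UNIV N" unfolding N_def[abs_def] by (intro polyfun_intros polyfun_var) simp_all
  have Ip: "polyfun UNIV I" unfolding I_def[abs_def] by (intro polyfun_intros polyfun_var) simp_all
  define y where "y t = (N (($) (X t)) * (w \<bullet> w)) / gap (affine_vec (X t))" for t
  have y: "descends S T X y"
    unfolding descends_def
  proof (rule exI[of _ "\<lambda>x. N x * (w \<bullet> w)"], rule exI[of _ "\<lambda>x. N x * (w \<bullet> w) - (I x)\<^sup>2"], intro conjI ballI)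
    show "polyfun UNIV (\<lambda>x. N x * (w \<bullet> w))" "polyfun UNIV (\<lambda>x. N x * (w \<bullet> w) - (I x)\<^sup>2)"
      by (intro polyfun_intros Np Ip)+
    have g: "N (($) x) * (w \<bullet> w) - (I (($) x))\<^sup>2 = gap (affine_vec x)" for x by (simp add: gap_def N I)
    show "0 < N (($) x) * (w \<bullet> w) - (I (($) x))\<^sup>2" if "x \<in> S" for x unfolding g by (rule gap_pos[OF that])
    show "y t * (N (($) (X t)) * (w \<bullet> w) - (I (($) (X t)))\<^sup>2) = N (($) (X t)) * (w \<bullet> w)" if "t \<in> T" for t
      unfolding g using gap_pos[OF X(1)[OF that]] by (simp add: y_def)
  qed
  have bV: "bform d (\<lambda>a b. V a b $ k)" for k unfolding V_def using par by (simp add: hom_param_def)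
  define M where "M a b = (V a b \<bullet> V a b) * (w \<bullet> w)" for a b
  define L where "L a b = gap (V a b)" for a b
  have bVV: "bform (d + d) (\<lambda>a b. V a b \<bullet> V a b)"
    unfolding inner_vec_def inner_real_def by (intro bform_sum bform_mult bV)
  have bVw: "bform d (\<lambda>a b. V a b \<bullet> w)"
  proof -
    have "bform d (\<lambda>a b. w $ k * V a b $ k)" for k by (intro bform_cmult bV)
    then show ?thesis unfolding inner_vec_def inner_real_def
      by (subst mult.commute) (intro bform_sum)
  qed
  have "bform (d + d) (\<lambda>a b. (w \<bullet> w) * (V a b \<bullet> V a b))" by (intro bform_cmult bVV)
  then have bM: "bform (2 * d) M" unfolding M_def[abs_def] mult_2 by (simp only: mult.commute)
  have bL: "bform (2 * d) L"
    unfolding L_def[abs_def] gap_def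
    using bform_diff[OF bM[unfolded M_def[abs_def]] bform_power[OF bVw, of 2]] by simp
  obtain m where m: "degree m \<le> 2 * d" "\<And>t. M 1 t = poly m t" "M 0 1 = coeff m (2 * d)"
    using bform_expand[OF bM] by metis
  obtain l where l: "degree l \<le> 2 * d" "\<And>t. L 1 t = poly l t" "L 0 1 = coeff l (2 * d)"
    using bform_expand[OF bL] by metis
  have V01: "V 0 1 = w" by (simp add: V_def w_def)
  have m_top: "coeff m (2 * d) > 0" unfolding m(3)[symmetric] M_def V01 by (intro mult_pos_pos ww)
  \<comment> \<open>The denominator vanishes at infinity, where the vector is w itself, whereas the
    numerator has the value |w|^4. So l drops in degree, m does not, and y l(r) = m(r) can be solved
    for the top power of r.\<close>
  have l_top: "coeff l (2 * d) = 0" using l(3) by (simp add: L_def V01 gap_def power2_eq_square)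
  have rel: "y t * poly l (r t) = poly m (r t)" if t: "t \<in> T" for t
  proof -
    have nz: "V 1 (r t) \<noteq> 0" unfolding V_def by (rule hom_param_nonzero[OF par]) simp
    have "abs_proj (affine_vec (X t)) = abs_proj (V 1 (r t))"
      using X(2)[OF t] unfolding affine_to_proj_eq param_point_def V_def .
    then obtain c where c: "c \<noteq> 0" "V 1 (r t) = c *\<^sub>R affine_vec (X t)"
      using abs_proj_eq_iff[OF affine_vec_nonzero nz] by blast
    have "L 1 (r t) = c\<^sup>2 * gap (affine_vec (X t))"
      unfolding L_def c(2) gap_def by (simp add: power2_eq_square algebra_simps)
    moreover have "M 1 (r t) = c\<^sup>2 * (N (($) (X t)) * (w \<bullet> w))"
      unfolding M_def c(2) N[symmetric] by (simp add: power2_eq_square algebra_simps)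
    moreover have "gap (affine_vec (X t)) \<noteq> 0" using gap_pos[OF X(1)[OF t]] by simp
    ultimately show ?thesis unfolding m(2)[symmetric] l(2)[symmetric] by (simp add: y_def)
  qed
  define c where "c j t = (1 / coeff m (2 * d)) * (y t * coeff l j + - coeff m j)" for j t
  have "descends S T X (c j)" for j
    unfolding c_def[abs_def] by (intro descends_mult descends_add descends_const y)
  moreover have "r t ^ (2 * d) = (\<Sum>j<2 * d. c j t * r t ^ j)" if t: "t \<in> T" for t
  proof -
    have expand: "poly p x = (\<Sum>j<2 * d. coeff p j * x ^ j) + coeff p (2 * d) * x ^ (2 * d)"
      if "degree p \<le> 2 * d" for p :: "real poly" and x
    proof -
      have "poly p x = (\<Sum>j\<le>2 * d. coeff p j * x ^ j)"
        unfolding poly_altdef by (rule sum.mono_neutral_left) (use that in \<open>auto simp: coeff_eq_0\<close>)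
      then show ?thesis by (simp add: lessThan_Suc_atMost[symmetric])
    qed
    have "coeff m (2 * d) * r t ^ (2 * d) = (\<Sum>j<2 * d. y t * (coeff l j * r t ^ j)) - (\<Sum>j<2 * d. coeff m j * r t ^ j)"
      using rel[OF t] unfolding expand[OF m(1)] expand[OF l(1)] l_top by (simp add: sum_distrib_left)
    also have "\<dots> = (\<Sum>j<2 * d. (y t * coeff l j + - coeff m j) * r t ^ j)"
      unfolding sum_subtractf[symmetric] by (intro sum.cong refl) (simp add: algebra_simps)
    also have "\<dots> = coeff m (2 * d) * (\<Sum>j<2 * d. c j t * r t ^ j)"
      unfolding sum_distrib_left c_def using m_top by (intro sum.cong refl) simp
    finally show ?thesis using m_top by simp
  qed
  ultimately show ?thesis using that by blast
qed

lemma poly_split_root_0: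
  fixes p :: "real poly"
  assumes "p \<noteq> 0"
  obtains m u where "p = [:0, 1:] ^ m * u" "poly u 0 \<noteq> 0"
proof -
  obtain u where u: "p = [:- 0, 1:] ^ order 0 p * u" "\<not> [:- 0, 1:] dvd u"
    using order_decomp[OF assms, of 0] by blast
  then have "poly u 0 \<noteq> 0" by (simp add: poly_eq_0_iff_dvd)
  then show ?thesis using u(1) that by simp
qed

lemma descends_poly:
  assumes "\<And>k. descends S T X (\<lambda>t. h t * t ^ k)"
  shows "descends S T X (\<lambda>t. h t * poly b t)"
proof -
  have "descends S T X (\<lambda>t. \<Sum>i\<le>degree b. coeff b i * (h t * t ^ i))"
    by (intro descends_sum descends_mult[OF descends_const] assms)
  then show ?thesis
    by (rule descends_cong) (simp add: poly_altdef sum_distrib_left mult_ac)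
qed

text \<open>If \<open>\<eta>\<close> divides \<open>1 - t\<^sup>2 v\<^sup>4\<close>, then \<open>\<psi> = t (v\<^sup>2 + \<eta>\<^sup>2)\<close> is such that \<open>\<psi>\<^sup>2 - 1\<close> is divisible by \<open>\<eta>\<close>.\<close>

lemma descending_square:
  assumes ideal: "\<And>b. descends S T X (poly (\<eta> * b))" and \<eta>0: "poly \<eta> 0 \<noteq> 0"
  obtains \<psi> where "descends S T X (\<lambda>t. (poly \<psi> t)\<^sup>2)" "\<forall>t. sgn (poly \<psi> t) = sgn t"
proof -
  let ?X = "[:0, 1:] :: real poly"
  obtain v where "\<eta> dvd 1 - ?X\<^sup>2 * v ^ 4" using fourth_root_mod[OF \<eta>0] by blast
  then obtain w where w: "1 - ?X\<^sup>2 * v ^ 4 = \<eta> * w" by (elim dvdE)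
  define \<psi> where "\<psi> = ?X * (v\<^sup>2 + \<eta>\<^sup>2)"
  define b where "b = ?X\<^sup>2 * (2 * v\<^sup>2 * \<eta> + \<eta> ^ 3) - w"
  have "(x * (v\<^sup>2 + \<eta>\<^sup>2))\<^sup>2 = x\<^sup>2 * v ^ 4 + \<eta> * (x\<^sup>2 * (2 * v\<^sup>2 * \<eta> + \<eta> ^ 3))" for x
    by (simp add: eval_nat_numeral algebra_simps)
  then have "\<psi>\<^sup>2 = ?X\<^sup>2 * v ^ 4 + \<eta> * (?X\<^sup>2 * (2 * v\<^sup>2 * \<eta> + \<eta> ^ 3))"
    unfolding \<psi>_def by this
  also have "?X\<^sup>2 * v ^ 4 = 1 - \<eta> * w" using w by (simp add: algebra_simps)
  finally have sq: "\<psi>\<^sup>2 = 1 + \<eta> * b" unfolding b_def by (simp add: right_diff_distrib)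
  have "descends S T X (\<lambda>t. 1 + poly (\<eta> * b) t)" by (intro descends_add descends_const ideal)
  then have "descends S T X (\<lambda>t. (poly \<psi> t)\<^sup>2)"
  proof (rule descends_cong)
    fix t
    have "(poly \<psi> t)\<^sup>2 = poly (\<psi>\<^sup>2) t" by (simp only: poly_power)
    then show "1 + poly (\<eta> * b) t = (poly \<psi> t)\<^sup>2" unfolding sq by simp
  qed
  moreover have "sgn (poly \<psi> t) = sgn t" for t
  proof -
    \<comment> \<open>At a common root of v and \<open>\<eta>\<close> the identity for w would read
      1 = 0.\<close>
    have "poly v t \<noteq> 0 \<or> poly \<eta> t \<noteq> 0"
    proof (rule ccontr)
      assume "\<not> ?thesis"
      then have "poly (1 - ?X\<^sup>2 * v ^ 4) t = 1" "poly (\<eta> * w) t = 0" by simp_all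
      then show False unfolding w by simp
    qed
    then have "(poly v t)\<^sup>2 + (poly \<eta> t)\<^sup>2 > 0" by (simp add: sum_power2_gt_zero_iff)
    moreover have "poly \<psi> t = t * ((poly v t)\<^sup>2 + (poly \<eta> t)\<^sup>2)" by (simp add: \<psi>_def)
    ultimately show ?thesis by (simp add: sgn_mult)
  qed
  ultimately show ?thesis using that by blast
qed

text \<open>The sign theorem is applied to numerators and denominators only, as
  \<open>\<psi>\<close> itself may have no value on S where H vanishes. The corresponding parameters
  are roots of a fixed nonzero polynomial, and they account for the finite exceptions.\<close>

lemma param_one_sided_zero:
  fixes S :: "(real ^ 'm) set"
  assumes rp: "rat_param d \<Phi> e G H" and irr: "semialgebraic_irreducible S"
    and S: "S = X ` T" and X: "\<And>t. t \<in> T \<Longrightarrow> affine_to_proj (X t) = param_point \<Phi> 1 t"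
    and out_inf: "\<And>x. x \<in> S \<Longrightarrow> affine_to_proj x \<noteq> param_point \<Phi> 0 1"
    and out_0: "\<And>x. x \<in> S \<Longrightarrow> affine_to_proj x \<noteq> param_point \<Phi> 1 0"
  shows "finite {t \<in> T. t < 0} \<or> finite {t \<in> T. t > 0}"
proof -
  have par: "hom_param d \<Phi>" and G: "form e G" and H: "form e H"
    and rel: "\<And>a b. a * G (\<lambda>k. \<Phi> k a b) = b * H (\<lambda>k. \<Phi> k a b)"
    using rp unfolding rat_param_def by auto
  have XS: "X t \<in> S" if "t \<in> T" for t using that S by blast
  have t0: "t \<noteq> 0" if "t \<in> T" for t using X[OF that] out_0[OF XS[OF that]] by auto
  \<comment> \<open>The factor between the homogeneous vector of the parametrization and the affine
    vector with coordinate 1. Its powers convert the forms G and H, evaluated along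
    \<open>\<Phi>\<close>, into functions of the affine coordinates.\<close>
  define NN where "NN t = \<Phi> None 1 t" for t
  have lam: "\<Phi> k 1 t = NN t * affine_vec (X t) $ k" "NN t \<noteq> 0" if t: "t \<in> T" for k t
  proof -
    have nz: "(\<chi> k. \<Phi> k 1 t) \<noteq> 0" by (rule hom_param_nonzero[OF par]) simp
    have "abs_proj (affine_vec (X t)) = abs_proj (\<chi> k. \<Phi> k 1 t)"
      using X[OF t] unfolding affine_to_proj_eq param_point_def .
    then obtain c where c: "c \<noteq> 0" "(\<chi> k. \<Phi> k 1 t) = c *\<^sub>R affine_vec (X t)"
      using abs_proj_eq_iff[OF affine_vec_nonzero nz] by blast
    have all: "\<Phi> k 1 t = c * affine_vec (X t) $ k" for k
      using arg_cong[OF c(2), of "\<lambda>v. v $ k"] by simp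
    have "NN t = c" using all[of None] by (simp add: NN_def)
    then show "\<Phi> k 1 t = NN t * affine_vec (X t) $ k" "NN t \<noteq> 0" using all c(1) by simp_all
  qed
  define h where "h t = H (case_option 1 (($) (X t)))" for t
  define g where "g t = G (case_option 1 (($) (X t)))" for t
  have dh: "descends S T X h" unfolding h_def[abs_def]
    by (rule descends_polyfun[OF form_dehomogenize[OF H]])
  have dg: "descends S T X g" unfolding g_def[abs_def]
    by (rule descends_polyfun[OF form_dehomogenize[OF G]])
  obtain hp where hp: "\<And>t. poly hp t = H (\<lambda>k. \<Phi> k 1 t)"
    using bform_poly[OF hom_param_form[OF par H]] by auto
  obtain np where np: "\<And>t. poly np t = NN t"
    using bform_poly[of d "\<Phi> None"] par unfolding hom_param_def NN_def by auto
  have vec: "(\<lambda>k. \<Phi> k 1 t) = (\<lambda>k. NN t * case_option 1 (($) (X t)) k)" if "t \<in> T" for t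
    using lam(1)[OF that] by (simp add: affine_vec_fun[symmetric])
  have hp_h: "poly hp t = NN t ^ e * h t" if t: "t \<in> T" for t
    unfolding hp vec[OF t] h_def by (rule form_scale[OF H])
  have g_h: "g t = t * h t" if t: "t \<in> T" for t
  proof -
    have "NN t ^ e * g t = t * (NN t ^ e * h t)"
      using rel[of 1 t] unfolding vec[OF t] form_scale[OF H] form_scale[OF G] g_def h_def by simp
    then show ?thesis using lam(2)[OF t] by simp
  qed
  have "\<exists>t. poly hp t \<noteq> 0" using rp unfolding rat_param_def hp by blast
  then have hp0: "hp \<noteq> 0" by auto
  define n where "n = 2 * d"
  obtain c1 where c1: "\<forall>j. descends S T X (c1 j)" "\<forall>t\<in>T. t ^ (2 * d) = (\<Sum>j<2 * d. c1 j t * t ^ j)"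
    by (rule parameter_integral[OF par out_inf XS X])
  have hk: "descends S T X (\<lambda>t. h t ^ n * t ^ k)" for k
  proof (rule descends_powers_of_integral[where c = c1])
    show "t ^ n = (\<Sum>j<n. c1 j t * t ^ j)" if "t \<in> T" for t unfolding n_def using c1(2) that by blast
    show "descends S T X (c1 j)" for j using c1(1) by blast
    show "descends S T X (\<lambda>t. h t * t)" using dg by (rule descends_cong) (simp add: g_h)
  qed (rule dh)
  \<comment> \<open>Exchanging the two homogeneous coordinates moves the missing parameter 0 to
    infinity and makes 1/t the parameter.\<close>
  define \<Psi> where "\<Psi> k a b = \<Phi> k b a" for k a b
  have par': "hom_param d \<Psi>"
  proof -
    have "bform d (\<lambda>a b. \<Phi> k (0 * a + 1 * b) (1 * a + 0 * b))" for k
      by (rule bform_linear) (use par in \<open>simp add: hom_param_def\<close>)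
    then have "bform d (\<Psi> k)" for k by (simp add: \<Psi>_def[abs_def])
    then show ?thesis using par unfolding hom_param_def \<Psi>_def by auto
  qed
  have out': "affine_to_proj x \<noteq> param_point \<Psi> 0 1" if "x \<in> S" for x
    using out_0[OF that] by (simp add: param_point_def \<Psi>_def)
  have X': "affine_to_proj (X t) = param_point \<Psi> 1 (1 / t)" if t: "t \<in> T" for t
  proof -
    have "abs_proj (v2 (1 / t) 1) = abs_proj (v2 1 t)"
      by (subst abs_proj_v2_eq_iff) (use t0[OF t] in auto)
    then have "param_point \<Phi> (1 / t) 1 = param_point \<Phi> 1 t"
      by (intro param_point_eq[OF par]) auto
    then show ?thesis using X[OF t] by (simp add: param_point_def \<Psi>_def)
  qed
  obtain c2 where c2: "\<forall>j. descends S T X (c2 j)" "\<forall>t\<in>T. (1 / t) ^ (2 * d) = (\<Sum>j<2 * d. c2 j t * (1 / t) ^ j)"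
    by (rule parameter_integral[OF par' out' XS X'])
  have gk: "descends S T X (\<lambda>t. g t ^ n * (1 / t) ^ k)" for k
  proof (rule descends_powers_of_integral[where c = c2])
    show "(1 / t) ^ n = (\<Sum>j<n. c2 j t * (1 / t) ^ j)" if "t \<in> T" for t unfolding n_def using c2(2) that by blast
    show "descends S T X (c2 j)" for j using c2(1) by blast
    show "descends S T X (\<lambda>t. g t * (1 / t))" using dh by (rule descends_cong) (simp add: g_h t0)
  qed (rule dg)
  obtain m u where u: "hp = [:0, 1:] ^ m * u" "poly u 0 \<noteq> 0" by (rule poly_split_root_0[OF hp0])
  \<comment> \<open>With NN^e h = t^m u and g = t h, the product of h^n NN^(2en) b(t) and g^n
    t^(-n-2nm) is u^(2n) b(t). The first factor comes from the integrality of t, the second from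
    that of 1/t.\<close>
  define \<eta> where "\<eta> = u ^ (2 * n)"
  have ideal: "descends S T X (poly (\<eta> * b))" for b
  proof -
    have "descends S T X (\<lambda>t. (h t ^ n * poly (np ^ (2 * e * n) * b) t) * (g t ^ n * (1 / t) ^ (n + 2 * n * m)))"
      by (rule descends_mult[OF descends_poly[OF hk] gk])
    then show ?thesis
    proof (rule descends_cong)
      fix t assume t: "t \<in> T"
      have hpt: "NN t ^ e * h t = t ^ m * poly u t" unfolding hp_h[OF t, symmetric] u(1) by (simp add: poly_power)
      have tt: "t ^ n * (t ^ m) ^ (2 * n) * (1 / t) ^ (n + 2 * n * m) = 1"
        using t0[OF t] by (simp add: power_add power_divide flip: power_mult) (simp add: mult_ac)
      have "(h t ^ n * poly (np ^ (2 * e * n) * b) t) * (g t ^ n * (1 / t) ^ (n + 2 * n * m))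
        = (NN t ^ e * h t) ^ (2 * n) * (t ^ n * (1 / t) ^ (n + 2 * n * m)) * poly b t"
        unfolding g_h[OF t] by (simp add: poly_power np power_mult_distrib mult_2 power_add mult_ac flip: power_mult)
          (simp add: mult_2_right power_add)
      also have "\<dots> = poly u t ^ (2 * n) * (t ^ n * (t ^ m) ^ (2 * n) * (1 / t) ^ (n + 2 * n * m)) * poly b t"
        unfolding hpt power_mult_distrib by (simp only: mult_ac)
      finally show "(h t ^ n * poly (np ^ (2 * e * n) * b) t) * (g t ^ n * (1 / t) ^ (n + 2 * n * m)) = poly (\<eta> * b) t"
        unfolding tt by (simp add: \<eta>_def poly_power)
    qed
  qed
  have \<eta>0: "poly \<eta> 0 \<noteq> 0" using u(2) by (simp add: \<eta>_def poly_power)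
  obtain \<psi> where \<psi>: "descends S T X (\<lambda>t. (poly \<psi> t)\<^sup>2)" "\<forall>t. sgn (poly \<psi> t) = sgn t"
    by (rule descending_square[OF ideal \<eta>0])
  obtain P D where P: "polyfun UNIV P" "polyfun UNIV D" "\<forall>x\<in>S. D (($) x) > 0"
    "\<forall>t\<in>T. (poly \<psi> t)\<^sup>2 * D (($) (X t)) = P (($) (X t))"
    using \<psi>(1) unfolding descends_def by (elim exE conjE)
  \<comment> \<open>On S, \<open>Q0\<close> and \<open>E\<close> are h^N \<open>\<psi>\<close> and
    h^N: the value of \<open>\<psi>\<close> at g/h with denominators cleared. Since
    \<open>\<psi>\<close>^2 = P/D, the pair Q = Q0 D and L = P D satisfies the square relation of
    the sign theorem without division.\<close>
  define N where "N = degree \<psi>"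
  define E where "E x = H (case_option 1 x) ^ N" for x :: "'m \<Rightarrow> real"
  define Q0 where "Q0 x = (\<Sum>i\<le>N. coeff \<psi> i * (G (case_option 1 x) ^ i * H (case_option 1 x) ^ (N - i)))" for x :: "'m \<Rightarrow> real"
  note hG = form_dehomogenize[OF G] and hH = form_dehomogenize[OF H]
  have E: "polyfun UNIV E" unfolding E_def[abs_def] by (intro polyfun_power hH)
  have Q0: "polyfun UNIV Q0" unfolding Q0_def[abs_def]
    by (intro polyfun_sum polyfun_mult polyfun_const polyfun_power hG hH)
  have Et: "E (($) (X t)) = h t ^ N" for t by (simp add: E_def h_def)
  have Qt: "Q0 (($) (X t)) = h t ^ N * poly \<psi> t" if t: "t \<in> T" for t
  proof -
    have "Q0 (($) (X t)) = (\<Sum>i\<le>N. coeff \<psi> i * (g t ^ i * h t ^ (N - i)))"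
      unfolding Q0_def g_def h_def ..
    also have "\<dots> = (\<Sum>i\<le>N. h t ^ N * (coeff \<psi> i * t ^ i))"
    proof (rule sum.cong[OF refl])
      fix i assume "i \<in> {..N}"
      then have "h t ^ N = h t ^ i * h t ^ (N - i)" by (simp flip: power_add)
      then show "coeff \<psi> i * (g t ^ i * h t ^ (N - i)) = h t ^ N * (coeff \<psi> i * t ^ i)"
        unfolding g_h[OF t] by (simp add: power_mult_distrib)
    qed
    finally show ?thesis by (simp add: poly_altdef N_def sum_distrib_left)
  qed
  have "(\<forall>x\<in>S. (Q0 (($) x) * D (($) x)) * E (($) x) \<ge> 0) \<or> (\<forall>x\<in>S. (Q0 (($) x) * D (($) x)) * E (($) x) \<le> 0)"
  proof (rule irreducible_sign[OF irr, where L = "\<lambda>x. P x * D x"])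
    show "polyfun UNIV (\<lambda>x. Q0 x * D x)" "polyfun UNIV E" "polyfun UNIV (\<lambda>x. P x * D x)"
      by (intro polyfun_mult P Q0 E)+
    fix x assume x: "x \<in> S"
    then obtain t where t: "t \<in> T" "x = X t" using S by blast
    have D: "D (($) x) > 0" using P(3) x by blast
    have Pt: "P (($) (X t)) = (poly \<psi> t)\<^sup>2 * D (($) (X t))" using P(4) t(1) by simp
    have "sgn (poly \<psi> t) \<noteq> 0" using \<psi>(2) t0[OF t(1)] by (simp add: sgn_eq_0_iff)
    then have "poly \<psi> t \<noteq> 0" by (simp add: sgn_eq_0_iff)
    then show "P (($) x) * D (($) x) > 0" using D unfolding t(2) Pt by simp
    show "(Q0 (($) x) * D (($) x))\<^sup>2 = (E (($) x))\<^sup>2 * (P (($) x) * D (($) x))"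
      unfolding t(2) Pt Qt[OF t(1)] Et by (simp add: power_mult_distrib power2_eq_square mult_ac)
  qed
  moreover have val: "(Q0 (($) (X t)) * D (($) (X t))) * E (($) (X t)) = (h t ^ N)\<^sup>2 * (D (($) (X t)) * poly \<psi> t)"
    if "t \<in> T" for t unfolding Qt[OF that] Et by (simp add: power2_eq_square mult_ac)
  \<comment> \<open>The product under test is (h^N)^2 D \<open>\<psi>\<close> with D positive, so
    its sign is that of t unless h^N vanishes.\<close>
  have hz: "poly hp t = 0" if t: "t \<in> T" and z: "(h t ^ N)\<^sup>2 = 0" for t
    using hp_h[OF t] z by simp
  have Dt: "D (($) (X t)) > 0" if "t \<in> T" for t using P(3) XS[OF that] by blast
  have fin: "finite {t. poly hp t = 0}" by (rule poly_roots_finite[OF hp0])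
  ultimately show ?thesis
  proof (elim disjE)
    assume ge: "\<forall>x\<in>S. (Q0 (($) x) * D (($) x)) * E (($) x) \<ge> 0"
    have "{t \<in> T. t < 0} \<subseteq> {t. poly hp t = 0}"
    proof (intro subsetI CollectI, elim CollectE conjE)
      fix t assume t: "t \<in> T" "t < 0"
      have "sgn (poly \<psi> t) = -1" using \<psi>(2) t(2) by simp
      then have "poly \<psi> t < 0" by (simp add: sgn_real_def split: if_splits)
      then have "D (($) (X t)) * poly \<psi> t < 0" by (intro mult_pos_neg Dt t)
      moreover have "(h t ^ N)\<^sup>2 * (D (($) (X t)) * poly \<psi> t) \<ge> 0" using ge XS[OF t(1)] val[OF t(1)] by metis
      ultimately have "(h t ^ N)\<^sup>2 = 0" by (metis mult_pos_neg not_le zero_less_power2 zero_eq_power2)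
      then show "poly hp t = 0" by (rule hz[OF t(1)])
    qed
    then show ?thesis using fin finite_subset by blast
  next
    assume le: "\<forall>x\<in>S. (Q0 (($) x) * D (($) x)) * E (($) x) \<le> 0"
    have "{t \<in> T. t > 0} \<subseteq> {t. poly hp t = 0}"
    proof (intro subsetI CollectI, elim CollectE conjE)
      fix t assume t: "t \<in> T" "t > 0"
      have "sgn (poly \<psi> t) = 1" using \<psi>(2) t(2) by simp
      then have "poly \<psi> t > 0" by (simp add: sgn_real_def split: if_splits)
      then have "D (($) (X t)) * poly \<psi> t > 0" using Dt[OF t(1)] by simp
      moreover have "(h t ^ N)\<^sup>2 * (D (($) (X t)) * poly \<psi> t) \<le> 0" using le XS[OF t(1)] val[OF t(1)] by metis
      ultimately have "(h t ^ N)\<^sup>2 = 0" by (metis mult_pos_pos not_le zero_less_power2 zero_eq_power2)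
      then show "poly hp t = 0" by (rule hz[OF t(1)])
    qed
    then show ?thesis using fin finite_subset by blast
  qed
qed

text \<open>The new quotient G'/H' is the inverse transformation applied to G/H. If H' vanished
  along the curve, so would G', and then H, since the determinant is nonzero.\<close>

lemma rat_param_moebius:
  assumes rp: "rat_param d \<Phi> e G H" and det: "p * s - q * r \<noteq> (0 :: real)"
  obtains G' H' where "rat_param d (\<lambda>k a b. \<Phi> k (p * a + q * b) (r * a + s * b)) e G' H'"
proof -
  have par: "hom_param d \<Phi>" and G: "form e G" and H: "form e H"
    and rel: "\<And>a b. a * G (\<lambda>k. \<Phi> k a b) = b * H (\<lambda>k. \<Phi> k a b)"
    using rp unfolding rat_param_def by auto
  define \<Psi> where "\<Psi> k a b = \<Phi> k (p * a + q * b) (r * a + s * b)" for k a b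
  have "bform d (\<Psi> k)" for k unfolding \<Psi>_def[abs_def]
    by (rule bform_linear) (use par in \<open>simp add: hom_param_def\<close>)
  moreover have "\<exists>k. \<Psi> k a b \<noteq> 0" if ab: "(a, b) \<noteq> (0, 0)" for a b
  proof -
    have "(p * a + q * b, r * a + s * b) \<noteq> (0, 0)"
    proof
      assume "(p * a + q * b, r * a + s * b) = (0, 0)"
      then have z: "p * a + q * b = 0" "r * a + s * b = 0" by auto
      have "(p * s - q * r) * a = s * (p * a + q * b) - q * (r * a + s * b)" by (simp add: algebra_simps)
      moreover have "(p * s - q * r) * b = p * (r * a + s * b) - r * (p * a + q * b)" by (simp add: algebra_simps)
      ultimately show False using z det ab by simp
    qed
    then show ?thesis using par unfolding hom_param_def \<Psi>_def by blast
  qed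
  ultimately have par': "hom_param d \<Psi>" unfolding hom_param_def by blast
  define G' H' where "G' x = p * G x - r * H x" and "H' x = s * H x - q * G x" for x
  have forms: "form e G'" "form e H'" unfolding G'_def[abs_def] H'_def[abs_def]
    by (intro form_diff form_cmult G H)+
  have rel': "a * G' (\<lambda>k. \<Psi> k a b) = b * H' (\<lambda>k. \<Psi> k a b)" for a b
    using rel[of "p * a + q * b" "r * a + s * b"] unfolding G'_def H'_def \<Psi>_def by (simp add: algebra_simps)
  have "\<exists>t. H' (\<lambda>k. \<Psi> k 1 t) \<noteq> 0"
  proof (rule ccontr)
    assume "\<not> ?thesis"
    then have H'0: "H' (\<lambda>k. \<Psi> k 1 t) = 0" for t by blast
    have H0: "H (\<lambda>k. \<Psi> k 1 t) = 0" for t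
    proof -
      have "G' (\<lambda>k. \<Psi> k 1 t) = 0" using rel'[of 1 t] H'0 by simp
      moreover have "(p * s - q * r) * H x = q * G' x + p * H' x" for x
        by (simp add: G'_def H'_def algebra_simps)
      ultimately show ?thesis using H'0 det by (metis add.right_neutral mult_eq_0_iff mult_zero_right)
    qed
    obtain t0 where t0: "H (\<lambda>k. \<Phi> k 1 t0) \<noteq> 0" using rp unfolding rat_param_def by blast
    \<comment> \<open>The solution of p a + q b = 1 and r a + s b = t0.\<close>
    define a b where "a = (s - q * t0) / (p * s - q * r)" and "b = (p * t0 - r) / (p * s - q * r)"
    have "p * a + q * b = (p * s - q * r) / (p * s - q * r)"
      unfolding a_def b_def by (simp add: add_divide_distrib[symmetric] algebra_simps)
    moreover have "r * a + s * b = ((p * s - q * r) * t0) / (p * s - q * r)"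
      unfolding a_def b_def by (simp add: add_divide_distrib[symmetric] algebra_simps)
    ultimately have "H (\<lambda>k. \<Psi> k a b) = H (\<lambda>k. \<Phi> k 1 t0)" using det by (simp add: \<Psi>_def)
    moreover have "H (\<lambda>k. \<Psi> k a b) = 0"
      by (rule bform_eq_0[OF hom_param_form[OF par' H]]) (simp add: H0 infinite_UNIV_char_0)
    ultimately show False using t0 by simp
  qed
  then have "rat_param d \<Psi> e G' H'" unfolding rat_param_def using par' forms rel' by blast
  then show ?thesis using that unfolding \<Psi>_def[abs_def] by blast
qed

lemma param_one_sided:
  fixes S :: "(real ^ 'm) set"
  assumes rp: "rat_param d \<Phi> e G H" and irr: "semialgebraic_irreducible S"
    and S: "S = X ` T" and X: "\<And>t. t \<in> T \<Longrightarrow> affine_to_proj (X t) = param_point \<Phi> 1 t"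
    and out_inf: "\<And>x. x \<in> S \<Longrightarrow> affine_to_proj x \<noteq> param_point \<Phi> 0 1"
    and out: "\<And>x. x \<in> S \<Longrightarrow> affine_to_proj x \<noteq> param_point \<Phi> 1 \<beta>"
  shows "finite {t \<in> T. t < \<beta>} \<or> finite {t \<in> T. t > \<beta>}"
proof -
  obtain G' H' where "rat_param d (\<lambda>k a b. \<Phi> k (1 * a + 0 * b) (\<beta> * a + 1 * b)) e G' H'"
    by (rule rat_param_moebius[OF rp, of 1 1 0 \<beta>]) auto
  then have rp': "rat_param d (\<lambda>k a b. \<Phi> k a (\<beta> * a + b)) e G' H'" by simp
  define U where "U = (\<lambda>t. t - \<beta>) ` T"
  have "finite {t \<in> U. t < 0} \<or> finite {t \<in> U. t > 0}"
  proof (rule param_one_sided_zero[OF rp' irr, where X = "\<lambda>t. X (\<beta> + t)"])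
    show "S = (\<lambda>t. X (\<beta> + t)) ` U" unfolding U_def image_image S by simp
    show "affine_to_proj (X (\<beta> + t)) = param_point (\<lambda>k a b. \<Phi> k a (\<beta> * a + b)) 1 t" if "t \<in> U" for t
    proof -
      have "\<beta> + t \<in> T" using that unfolding U_def by auto
      then show ?thesis using X by (simp add: param_point_def)
    qed
  qed (use out_inf out in \<open>simp_all add: param_point_def\<close>)
  then have "finite ((\<lambda>t. t + \<beta>) ` {t \<in> U. t < 0}) \<or> finite ((\<lambda>t. t + \<beta>) ` {t \<in> U. t > 0})" by blast
  moreover have "(\<lambda>t. t + \<beta>) ` {t \<in> U. t < 0} = {t \<in> T. t < \<beta>}" unfolding U_def by force
  moreover have "(\<lambda>t. t + \<beta>) ` {t \<in> U. t > 0} = {t \<in> T. t > \<beta>}" unfolding U_def by force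
  ultimately show ?thesis by simp
qed

section \<open>The parameter set of a curve arc\<close>

text \<open>A point of S outside K has a neighbourhood avoiding K and the finitely many other points
  of S - K, so it would be isolated. This removes all finite exceptions in the sequel.\<close>

lemma irreducible_subset_closed:
  fixes S :: "(real ^ 'm) set"
  assumes irr: "semialgebraic_irreducible S" and inf: "infinite S"
    and K: "closed K" "finite (S - K)"
  shows "S \<subseteq> K"
proof (rule ccontr)
  assume "\<not> S \<subseteq> K"
  then obtain x0 where x0: "x0 \<in> S" "x0 \<notin> K" by blast
  have "closed (K \<union> (S - K - {x0}))" 
    by (intro closed_Un K(1) finite_imp_closed finite_subset[OF _ K(2)]) blast
  then have "open (- (K \<union> (S - K - {x0})))" by (rule open_Compl)
  then obtain \<epsilon> where \<epsilon>: "\<epsilon> > 0" "ball x0 \<epsilon> \<subseteq> - (K \<union> (S - K - {x0}))"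
    using x0 open_contains_ball[of "- (K \<union> (S - K - {x0}))"] by auto
  have "S = {x0}"
  proof (rule irreducible_no_isolated[OF irr x0(1) \<epsilon>(1)])
    fix x assume x: "x \<in> S" "x \<noteq> x0"
    then have "x \<notin> ball x0 \<epsilon>" using \<epsilon>(2) by blast
    then show "dist x x0 \<ge> \<epsilon>" by (simp add: dist_commute not_less)
  qed
  then show False using inf by simp
qed

lemma closed_affine_param_image:
  fixes \<Phi> :: "'m::finite option \<Rightarrow> real \<Rightarrow> real \<Rightarrow> real" and A :: "(real ^ 2) set"
  assumes par: "hom_param d \<Phi>" and A: "compact A" "0 \<notin> A"
  shows "closed {x. \<exists>w\<in>A. affine_to_proj x = param_point \<Phi> (w $ 1) (w $ 2)}"
proof -
  define K where "K = {v :: real ^ 'm option. \<exists>w\<in>A. \<forall>i j. v $ i * \<Phi> j (w $ 1) (w $ 2) = v $ j * \<Phi> i (w $ 1) (w $ 2)}"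
  have K: "closed K" unfolding K_def by (rule closed_param_image[OF par A])
  have cont: "continuous_on UNIV (affine_vec :: real ^ 'm \<Rightarrow> _)"
    unfolding affine_vec_def
  proof (rule continuous_on_vec_lambda)
    fix k :: "'m option"
    show "continuous_on UNIV (\<lambda>x :: real ^ 'm. case_option 1 (($) x) k)"
      by (cases k) (auto intro: continuous_intros)
  qed
  have "affine_to_proj x = param_point \<Phi> (w $ 1) (w $ 2) \<longleftrightarrow>
      (\<forall>i j. affine_vec x $ i * \<Phi> j (w $ 1) (w $ 2) = affine_vec x $ j * \<Phi> i (w $ 1) (w $ 2))" if "w \<in> A" for x w
  proof -
    have "w \<noteq> 0" using that A(2) by blast
    then have "(w $ 1, w $ 2) \<noteq> (0, 0)" by (metis Pair_inject v2_eta v2_eq_0_iff)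
    then have "(\<chi> k. \<Phi> k (w $ 1) (w $ 2)) \<noteq> 0" by (rule hom_param_nonzero[OF par])
    then show ?thesis unfolding affine_to_proj_eq param_point_def
      by (subst abs_proj_eq_iff_cross[OF affine_vec_nonzero]) simp_all
  qed
  then have "{x. \<exists>w\<in>A. affine_to_proj x = param_point \<Phi> (w $ 1) (w $ 2)} = affine_vec -` K"
    unfolding K_def by auto
  moreover have "closed (affine_vec -` K)" by (rule closed_vimage[OF K cont])
  ultimately show ?thesis by simp
qed

text \<open>The finite unions of points and intervals: membership can change only at a point of
  \<open>B\<close>. In this form complements and unions are immediate.\<close>

definition tame :: "real set \<Rightarrow> bool" where
  "tame A \<longleftrightarrow> (\<exists>B. finite B \<and> (\<forall>s t. s \<le> t \<longrightarrow> {s..t} \<inter> B = {} \<longrightarrow> (s \<in> A \<longleftrightarrow> t \<in> A)))"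

lemma tame_Compl: "tame A \<Longrightarrow> tame (- A)"
  unfolding tame_def by auto

lemma tame_Un:
  assumes "tame A" "tame A'"
  shows "tame (A \<union> A')"
proof -
  obtain B where B: "finite B" "\<forall>s t. s \<le> t \<longrightarrow> {s..t} \<inter> B = {} \<longrightarrow> (s \<in> A \<longleftrightarrow> t \<in> A)"
    using assms(1) unfolding tame_def by (elim exE conjE)
  obtain B' where B': "finite B'" "\<forall>s t. s \<le> t \<longrightarrow> {s..t} \<inter> B' = {} \<longrightarrow> (s \<in> A' \<longleftrightarrow> t \<in> A')"
    using assms(2) unfolding tame_def by (elim exE conjE)
  show ?thesis unfolding tame_def
  proof (intro exI[of _ "B \<union> B'"] conjI allI impI)
    fix s t :: real assume st: "s \<le> t" "{s..t} \<inter> (B \<union> B') = {}"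
    then have "{s..t} \<inter> B = {}" "{s..t} \<inter> B' = {}" by auto
    then show "(s \<in> A \<union> A') = (t \<in> A \<union> A')" using B(2) B'(2) st(1) by simp
  qed (use B B' in simp)
qed

lemma tame_Int: "tame A \<Longrightarrow> tame A' \<Longrightarrow> tame (A \<inter> A')"
  using tame_Compl[OF tame_Un[OF tame_Compl tame_Compl]] by simp

lemma
  shows tame_poly_eq: "tame {t. poly q t = 0}" and tame_poly_pos: "tame {t. poly q t > 0}"
proof -
  have "\<exists>B. finite B \<and> (\<forall>s t. s \<le> t \<longrightarrow> {s..t} \<inter> B = {} \<longrightarrow>
    (poly q s = 0 \<longleftrightarrow> poly q t = 0) \<and> (poly q s > 0 \<longleftrightarrow> poly q t > 0))"
  proof (cases "q = 0")
    case False
    show ?thesis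
    proof (intro exI[of _ "{t. poly q t = 0}"] conjI allI impI)
      show "finite {t. poly q t = 0}" by (rule poly_roots_finite[OF False])
      fix s t :: real assume st: "s \<le> t" "{s..t} \<inter> {t. poly q t = 0} = {}"
      then have nz: "poly q x \<noteq> 0" if "s \<le> x" "x \<le> t" for x using that by auto
      show "poly q s = 0 \<longleftrightarrow> poly q t = 0" using nz[of s] nz[of t] st(1) by simp
      show "poly q s > 0 \<longleftrightarrow> poly q t > 0"
      proof (rule ccontr)
        assume ne: "\<not> ?thesis"
        then have "s \<noteq> t" by auto
        then have lt: "s < t" using st(1) by simp
        have "poly q s \<noteq> 0" "poly q t \<noteq> 0" using nz st(1) by auto
        then have "(poly q s < 0 \<and> poly q t > 0) \<or> (poly q s > 0 \<and> poly q t < 0)" using ne by linarith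
        then obtain x where "s < x" "x < t" "poly q x = 0"
          using poly_IVT_pos[OF lt, of q] poly_IVT_neg[OF lt, of q] by blast
        then show False using nz[of x] by simp
      qed
    qed
  qed (use finite.emptyI in fastforce)
  then obtain B where "finite B"
    and B: "\<And>s t. s \<le> t \<Longrightarrow> {s..t} \<inter> B = {} \<Longrightarrow> (poly q s = 0 \<longleftrightarrow> poly q t = 0) \<and> (poly q s > 0 \<longleftrightarrow> poly q t > 0)"
    by (elim exE conjE) simp
  show "tame {t. poly q t = 0}" unfolding tame_def mem_Collect_eq
    by (rule exI[of _ B], intro conjI allI impI \<open>finite B\<close>) (rule B[THEN conjunct1])
  show "tame {t. poly q t > 0}" unfolding tame_def mem_Collect_eq
    by (rule exI[of _ B], intro conjI allI impI \<open>finite B\<close>) (rule B[THEN conjunct2])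
qed

text \<open>A polynomial divided by a power of N, away from the zeros of N. Polynomial conditions on
  the quotients F/N thus become sign conditions on polynomials in t.\<close>

definition denom_power :: "real poly \<Rightarrow> (real \<Rightarrow> real) \<Rightarrow> bool" where
  "denom_power N f \<longleftrightarrow> (\<exists>k q. \<forall>t. poly N t \<noteq> 0 \<longrightarrow> poly q t = poly N t ^ k * f t)"

lemma denom_powerI: "(\<And>t. poly N t \<noteq> 0 \<Longrightarrow> poly q t = poly N t ^ k * f t) \<Longrightarrow> denom_power N f"
  unfolding denom_power_def by (rule exI[of _ k], rule exI[of _ q]) simp

lemma denom_powerE:
  assumes "denom_power N f"
  obtains k q where "\<forall>t. poly N t \<noteq> 0 \<longrightarrow> poly q t = poly N t ^ k * f t"
  using assms unfolding denom_power_def by (elim exE)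

lemma denom_power_const: "denom_power N (\<lambda>t. c)"
  by (rule denom_powerI[where q = "[:c:]" and k = 0]) simp

lemma denom_power_add:
  assumes "denom_power N f" "denom_power N g"
  shows "denom_power N (\<lambda>t. f t + g t)"
proof -
  obtain k q where q: "\<forall>t. poly N t \<noteq> 0 \<longrightarrow> poly q t = poly N t ^ k * f t"
    using assms(1) by (rule denom_powerE)
  obtain l r where r: "\<forall>t. poly N t \<noteq> 0 \<longrightarrow> poly r t = poly N t ^ l * g t"
    using assms(2) by (rule denom_powerE)
  show ?thesis
    by (rule denom_powerI[where q = "N ^ l * q + N ^ k * r" and k = "k + l"])
      (simp add: q r power_add algebra_simps)
qed

lemma denom_power_mult:
  assumes "denom_power N f" "denom_power N g"
  shows "denom_power N (\<lambda>t. f t * g t)"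
proof -
  obtain k q where q: "\<forall>t. poly N t \<noteq> 0 \<longrightarrow> poly q t = poly N t ^ k * f t"
    using assms(1) by (rule denom_powerE)
  obtain l r where r: "\<forall>t. poly N t \<noteq> 0 \<longrightarrow> poly r t = poly N t ^ l * g t"
    using assms(2) by (rule denom_powerE)
  show ?thesis
    by (rule denom_powerI[where q = "q * r" and k = "k + l"]) (simp add: q r power_add)
qed

lemma denom_power_poly_eval:
  assumes "\<And>v. denom_power N (\<lambda>t. \<gamma> t v)"
  shows "denom_power N (\<lambda>t. poly_eval p (\<gamma> t))"
proof -
  have pow: "denom_power N (\<lambda>t. \<gamma> t v ^ n)" for v n
    by (induction n) (auto intro: denom_power_const denom_power_mult assms)
  have prod: "denom_power N (\<lambda>t. \<Prod>v\<in>A. \<gamma> t v ^ n v)" for A n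
    by (induction A rule: infinite_finite_induct) (auto intro: denom_power_const denom_power_mult pow)
  have sum: "denom_power N (\<lambda>t. \<Sum>\<alpha>\<in>A. f \<alpha> t)" if "\<And>\<alpha>. denom_power N (f \<alpha>)" for A and f :: "('a \<Rightarrow>\<^sub>0 nat) \<Rightarrow> real \<Rightarrow> real"
    by (induction A rule: infinite_finite_induct) (auto intro: denom_power_const denom_power_add that)
  show ?thesis unfolding poly_eval_def monom_eval_def
    by (intro sum denom_power_mult denom_power_const prod)
qed

lemma tame_semialgebraic_preimage:
  fixes F :: "'m::finite \<Rightarrow> real poly" and A :: "(real ^ 'm) set"
  assumes "semialgebraic A"
  shows "tame {t. poly N t \<noteq> 0 \<and> (\<chi> i. poly (F i) t / poly N t) \<in> A}"
proof -
  have N: "tame {t. poly N t \<noteq> 0}" using tame_Compl[OF tame_poly_eq[of N]] by (simp add: Compl_eq)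
  have dp: "\<exists>k q. \<forall>t. poly N t \<noteq> 0 \<longrightarrow> poly q t = poly N t ^ k * poly_eval p (($) (\<chi> i. poly (F i) t / poly N t))"
    for p :: "'m rpoly"
  proof -
    have "denom_power N (\<lambda>t. (\<chi> i. poly (F i) t / poly N t) $ i)" for i
      by (rule denom_powerI[where q = "F i" and k = 1]) simp
    then have "denom_power N (\<lambda>t. poly_eval p (($) (\<chi> i. poly (F i) t / poly N t)))"
      by (rule denom_power_poly_eval)
    then show ?thesis unfolding denom_power_def .
  qed
  show ?thesis using assms
  proof (induction rule: semialgebraic.induct)
    case (eq p)
    obtain k q where q: "\<forall>t. poly N t \<noteq> 0 \<longrightarrow> poly q t = poly N t ^ k * poly_eval p (($) (\<chi> i. poly (F i) t / poly N t))"
      using dp[of p] by (elim exE)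
    have "{t. poly N t \<noteq> 0 \<and> (\<chi> i. poly (F i) t / poly N t) \<in> {x. poly_eval p (($) x) = 0}}
      = {t. poly N t \<noteq> 0} \<inter> {t. poly q t = 0}" using q by auto
    then show ?case using tame_Int[OF N tame_poly_eq[of q]] by simp
  next
    case (gt p)
    obtain k q where q: "\<forall>t. poly N t \<noteq> 0 \<longrightarrow> poly q t = poly N t ^ k * poly_eval p (($) (\<chi> i. poly (F i) t / poly N t))"
      using dp[of p] by (elim exE)
    \<comment> \<open>A further factor N^k makes the exponent even, so that clearing the denominator
      preserves the sign.\<close>
    have "poly (N ^ k * q) t > 0 \<longleftrightarrow> poly_eval p (($) (\<chi> i. poly (F i) t / poly N t)) > 0" if t: "poly N t \<noteq> 0" for t
    proof -
      have "poly (N ^ k * q) t = (poly N t ^ k)\<^sup>2 * poly_eval p (($) (\<chi> i. poly (F i) t / poly N t))"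
        using q t by (simp add: power2_eq_square)
      moreover have "(poly N t ^ k)\<^sup>2 > 0" using t by simp
      ultimately show ?thesis by (simp add: zero_less_mult_iff)
    qed
    then have "{t. poly N t \<noteq> 0 \<and> (\<chi> i. poly (F i) t / poly N t) \<in> {x. poly_eval p (($) x) > 0}}
      = {t. poly N t \<noteq> 0} \<inter> {t. poly (N ^ k * q) t > 0}" by auto
    then show ?case using tame_Int[OF N tame_poly_pos[of "N ^ k * q"]] by simp
  next
    case (compl A)
    have "{t. poly N t \<noteq> 0 \<and> (\<chi> i. poly (F i) t / poly N t) \<in> - A}
      = {t. poly N t \<noteq> 0} \<inter> - {t. poly N t \<noteq> 0 \<and> (\<chi> i. poly (F i) t / poly N t) \<in> A}" by auto
    then show ?case using tame_Int[OF N tame_Compl[OF compl.IH]] by simp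
  next
    case (union A B)
    have "{t. poly N t \<noteq> 0 \<and> (\<chi> i. poly (F i) t / poly N t) \<in> A \<union> B}
      = {t. poly N t \<noteq> 0 \<and> (\<chi> i. poly (F i) t / poly N t) \<in> A} \<union>
        {t. poly N t \<noteq> 0 \<and> (\<chi> i. poly (F i) t / poly N t) \<in> B}" by auto
    then show ?case using tame_Un[OF union.IH] by simp
  qed
qed

text \<open>The points with infinitely many elements of T on both sides form a convex set
  \<open>T'\<close>, contained in T by the hypothesis on missing points. Any other point of T
  belongs to the finite exceptional set, because elsewhere a whole neighbourhood lies in T.\<close>

lemma tame_one_sided_interval:
  fixes T :: "real set"
  assumes tame: "tame T" and inf: "infinite T"
    and side: "\<And>\<beta>. \<beta> \<notin> T \<Longrightarrow> finite {t \<in> T. t < \<beta>} \<or> finite {t \<in> T. t > \<beta>}"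
  obtains I where "I \<subseteq> T" "finite (T - I)" "connected I" "infinite I" "closure I \<inter> T \<subseteq> I"
proof -
  define T' where "T' = {\<beta>. infinite {t \<in> T. t < \<beta>} \<and> infinite {t \<in> T. t > \<beta>}}"
  have T'T: "T' \<subseteq> T" unfolding T'_def using side by auto
  have "connected T'"
  proof (rule connectedI_interval)
    fix x y z assume "x \<in> T'" "y \<in> T'" and xz: "x \<le> z" "z \<le> y"
    then have "infinite {t \<in> T. t < x}" "infinite {t \<in> T. t > y}" unfolding T'_def by auto
    moreover have "{t \<in> T. t < x} \<subseteq> {t \<in> T. t < z}" "{t \<in> T. t > y} \<subseteq> {t \<in> T. t > z}" using xz by auto
    ultimately show "z \<in> T'" unfolding T'_def using finite_subset by blast
  qed
  \<comment> \<open>Endpoints that belong to T are added, so that I is closed relative to T.\<close>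
  define I where "I = T \<inter> closure T'"
  have T'I: "T' \<subseteq> I" using T'T closure_subset[of T'] unfolding I_def by blast
  have "connected I"
    by (rule connected_intermediate_closure[OF \<open>connected T'\<close> T'I]) (simp add: I_def)
  obtain B where B: "finite B" "\<forall>s t. s \<le> t \<longrightarrow> {s..t} \<inter> B = {} \<longrightarrow> (s \<in> T \<longleftrightarrow> t \<in> T)"
    using tame unfolding tame_def by (elim exE conjE)
  have "T - T' \<subseteq> B"
  proof
    fix t assume t: "t \<in> T - T'"
    show "t \<in> B"
    proof (rule ccontr)
      assume "t \<notin> B"
      moreover have "open (- B)" using B(1) by (simp add: finite_imp_closed open_Compl)
      ultimately obtain \<delta> where \<delta>: "\<delta> > 0" "ball t \<delta> \<subseteq> - B" using open_contains_ball[of "- B"] by auto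
      have mem: "s \<in> T" if "\<bar>s - t\<bar> < \<delta>" for s
      proof (cases "s \<le> t")
        case True
        then have "{s..t} \<subseteq> ball t \<delta>" using that by (auto simp: dist_real_def)
        then have "{s..t} \<inter> B = {}" using \<delta>(2) by blast
        then show ?thesis using B(2) True t by blast
      next
        case False
        then have "{t..s} \<subseteq> ball t \<delta>" using that by (auto simp: dist_real_def)
        then have "{t..s} \<inter> B = {}" using \<delta>(2) by blast
        then show ?thesis using B(2) False t by (meson DiffD1 linear)
      qed
      have "{t - \<delta><..<t} \<subseteq> {s \<in> T. s < t}" "{t<..<t + \<delta>} \<subseteq> {s \<in> T. s > t}" using mem by auto
      moreover have "infinite {t - \<delta><..<t}" "infinite {t<..<t + \<delta>}" using \<delta>(1) by (simp_all add: infinite_Ioo)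
      ultimately have "t \<in> T'" unfolding T'_def using finite_subset by blast
      then show False using t by blast
    qed
  qed
  then have fin: "finite (T - T')" using B(1) finite_subset by blast
  then have "finite (T - I)" by (rule rev_finite_subset) (use T'I in blast)
  moreover have "infinite I"
  proof
    assume "finite I"
    then have "finite (T' \<union> (T - T'))" using fin T'I finite_subset by blast
    then show False using inf T'T by (simp add: Un_absorb1)
  qed
  moreover have "closure I \<inter> T \<subseteq> I"
  proof -
    have "closure I \<subseteq> closure T'" by (rule closure_minimal) (auto simp: I_def)
    then show ?thesis unfolding I_def by blast
  qed
  ultimately show ?thesis using that[of I] \<open>connected I\<close> unfolding I_def by blast
qed

definition affine_param :: "('m::finite option \<Rightarrow> real \<Rightarrow> real \<Rightarrow> real) \<Rightarrow> real \<Rightarrow> real \<Rightarrow> real ^ 'm" where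
  "affine_param \<Phi> a b = (\<chi> i. \<Phi> (Some i) a b / \<Phi> None a b)"

lemma affine_to_proj_eq_param_iff:
  assumes par: "hom_param d \<Phi>" and ab: "(a, b) \<noteq> (0, 0)"
  shows "affine_to_proj x = param_point \<Phi> a b \<longleftrightarrow> \<Phi> None a b \<noteq> 0 \<and> x = affine_param \<Phi> a b"
proof
  assume eq: "affine_to_proj x = param_point \<Phi> a b"
  have nz: "(\<chi> k. \<Phi> k a b) \<noteq> 0" by (rule hom_param_nonzero[OF par ab])
  have "abs_proj (affine_vec x) = abs_proj (\<chi> k. \<Phi> k a b)"
    using eq unfolding affine_to_proj_eq param_point_def .
  then obtain c where c: "c \<noteq> 0" "(\<chi> k. \<Phi> k a b) = c *\<^sub>R affine_vec x"
    using abs_proj_eq_iff[OF affine_vec_nonzero nz] by blast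
  have all: "\<Phi> k a b = c * affine_vec x $ k" for k
    using arg_cong[OF c(2), of "\<lambda>v. v $ k"] by simp
  show "\<Phi> None a b \<noteq> 0 \<and> x = affine_param \<Phi> a b"
    using c(1) all by (simp add: affine_param_def Finite_Cartesian_Product.vec_eq_iff)
next
  assume r: "\<Phi> None a b \<noteq> 0 \<and> x = affine_param \<Phi> a b"
  have "(\<chi> k. \<Phi> k a b) $ k = (\<Phi> None a b *\<^sub>R affine_vec x) $ k" for k
    using r by (cases k) (simp_all add: affine_param_def)
  then have "(\<chi> k. \<Phi> k a b) = \<Phi> None a b *\<^sub>R affine_vec x"
    unfolding Finite_Cartesian_Product.vec_eq_iff by blast
  then show "affine_to_proj x = param_point \<Phi> a b"
    unfolding affine_to_proj_eq param_point_def using r by (simp add: abs_proj_scale)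
qed

text \<open>All but finitely many parameters lie in an interval I. The points of S with a parameter
  in the closure of I, or at infinity, lie in a closed set, so irreducibility puts all of S into
  it.\<close>

lemma param_interval:
  fixes S :: "(real ^ 'm) set"
  assumes rp: "rat_param d \<Phi> e G H" and sa: "semialgebraic S"
    and irr: "semialgebraic_irreducible S" and inf: "infinite S"
    and onto: "\<And>x. x \<in> S \<Longrightarrow> \<exists>a b. (a, b) \<noteq> (0, 0) \<and> affine_to_proj x = param_point \<Phi> a b"
    and out_inf: "\<And>x. x \<in> S \<Longrightarrow> affine_to_proj x \<noteq> param_point \<Phi> 0 1"
  obtains I where "connected I" "infinite I" "\<forall>t\<in>I. \<Phi> None 1 t \<noteq> 0" "S = affine_param \<Phi> 1 ` I"
proof -
  have par: "hom_param d \<Phi>" using rp unfolding rat_param_def by blast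
  define X where "X = affine_param \<Phi> 1"
  define T where "T = {t. \<Phi> None 1 t \<noteq> 0 \<and> X t \<in> S}"
  have XT: "affine_to_proj (X t) = param_point \<Phi> 1 t" if "t \<in> T" for t
    by (subst affine_to_proj_eq_param_iff[OF par]) (use that in \<open>simp_all add: T_def X_def\<close>)
  have at: "\<exists>t. t \<in> T \<and> x = X t \<and> a \<noteq> 0 \<and> t = b / a"
    if x: "x \<in> S" and ab: "(a, b) \<noteq> (0, 0)" and eq: "affine_to_proj x = param_point \<Phi> a b" for x a b
  proof -
    have "a \<noteq> 0"
    proof
      assume "a = 0"
      then have "param_point \<Phi> a b = param_point \<Phi> 0 1"
        using ab by (intro param_point_eq[OF par ab]) (subst abs_proj_v2_eq_iff, auto)
      then show False using out_inf[OF x] eq by simp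
    qed
    then have "param_point \<Phi> a b = param_point \<Phi> 1 (b / a)"
      using ab by (intro param_point_eq[OF par ab]) (subst abs_proj_v2_eq_iff, auto)
    then have "affine_to_proj x = param_point \<Phi> 1 (b / a)" using eq by simp
    then have "\<Phi> None 1 (b / a) \<noteq> 0 \<and> x = affine_param \<Phi> 1 (b / a)"
      by (subst (asm) affine_to_proj_eq_param_iff[OF par]) simp_all
    then show ?thesis using \<open>a \<noteq> 0\<close> x unfolding T_def X_def by auto
  qed
  have SX: "S = X ` T"
  proof (intro equalityI subsetI)
    fix x assume x: "x \<in> S"
    obtain a b where "(a, b) \<noteq> (0, 0)" "affine_to_proj x = param_point \<Phi> a b" using onto[OF x] by (elim exE conjE)
    then show "x \<in> X ` T" using at[OF x] by blast
  qed (auto simp: T_def)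
  have side: "finite {t \<in> T. t < \<beta>} \<or> finite {t \<in> T. t > \<beta>}" if \<beta>: "\<beta> \<notin> T" for \<beta>
  proof (rule param_one_sided[OF rp irr SX XT out_inf])
    fix x assume x: "x \<in> S"
    show "affine_to_proj x \<noteq> param_point \<Phi> 1 \<beta>"
    proof
      assume "affine_to_proj x = param_point \<Phi> 1 \<beta>"
      then have "\<Phi> None 1 \<beta> \<noteq> 0 \<and> x = X \<beta>" unfolding X_def
        by (subst (asm) affine_to_proj_eq_param_iff[OF par]) simp_all
      then show False using \<beta> x unfolding T_def by blast
    qed
  qed
  obtain F where F: "\<And>k t. poly (F k) t = \<Phi> k 1 t" using polys_of_hom_param[OF par] by metis
  have tame: "tame T"
    using tame_semialgebraic_preimage[OF sa, where N = "F None" and F = "\<lambda>i. F (Some i)"]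
    unfolding F T_def X_def affine_param_def .
  have infT: "infinite T" using inf SX by auto
  obtain I where I: "I \<subseteq> T" "finite (T - I)" "connected I" "infinite I" "closure I \<inter> T \<subseteq> I"
    by (rule tame_one_sided_interval[OF tame infT side])
  \<comment> \<open>The directions whose parameter is outside the closure of I. The direction of
    infinity is not removed, which leaves a compact part of the circle; no point of S has that
    parameter.\<close>
  define U where "U = {w \<in> {w :: real ^ 2. w $ 1 \<noteq> 0}. w $ 2 / w $ 1 \<in> - closure I}"
  have op: "open {w :: real ^ 2. w $ 1 \<noteq> 0}"
    by (intro open_Collect_neq continuous_intros)
  have "open U" unfolding U_def
  proof -
    have "continuous_on {w :: real ^ 2. w $ 1 \<noteq> 0} (\<lambda>w. w $ 2 / w $ 1)"
      by (intro continuous_intros) auto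
    then have "open ({w :: real ^ 2. w $ 1 \<noteq> 0} \<inter> (\<lambda>w. w $ 2 / w $ 1) -` (- closure I))"
      by (rule continuous_open_preimage[OF _ op]) (simp add: open_Compl)
    then show "open {w \<in> {w :: real ^ 2. w $ 1 \<noteq> 0}. w $ 2 / w $ 1 \<in> - closure I}"
      by (simp add: Int_def)
  qed
  define A where "A = sphere (0 :: real ^ 2) 1 - U"
  have A: "compact A" "0 \<notin> A" unfolding A_def using \<open>open U\<close> by (auto intro: compact_diff)
  define K where "K = {x. \<exists>w\<in>A. affine_to_proj x = param_point \<Phi> (w $ 1) (w $ 2)}"
  have "closed K" unfolding K_def by (rule closed_affine_param_image[OF par A])
  have IK: "X t \<in> K" if t: "t \<in> I" for t
  proof -
    define w where "w = (1 / norm (v2 1 t)) *\<^sub>R v2 1 t"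
    have nz: "norm (v2 1 t) \<noteq> 0" by simp
    have w: "w $ 1 \<noteq> 0" "w $ 2 / w $ 1 = t" "norm w = 1" using nz by (simp_all add: w_def)
    have "w \<in> A" using w t closure_subset[of I] unfolding A_def U_def by auto
    moreover have "param_point \<Phi> (w $ 1) (w $ 2) = param_point \<Phi> 1 t"
      using w by (intro param_point_eq[OF par]) (simp, subst abs_proj_v2_eq_iff, auto)
    moreover have "affine_to_proj (X t) = param_point \<Phi> 1 t" using XT t I(1) by blast
    ultimately show ?thesis unfolding K_def by (intro CollectI bexI[of _ w]) simp_all
  qed
  have "S - K \<subseteq> X ` (T - I)" using IK SX by blast
  then have "finite (S - K)" using I(2) finite_surj by blast
  then have SK: "S \<subseteq> K" by (rule irreducible_subset_closed[OF irr inf \<open>closed K\<close>])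
  have "S \<subseteq> X ` I"
  proof
    fix x assume x: "x \<in> S"
    then obtain w where w: "w \<in> A" "affine_to_proj x = param_point \<Phi> (w $ 1) (w $ 2)" using SK unfolding K_def by blast
    have "(w $ 1, w $ 2) \<noteq> (0, 0)" using w(1) unfolding A_def by (intro circle_nonzero) auto
    from at[OF x this w(2)] obtain t where t: "t \<in> T" "x = X t" "w $ 1 \<noteq> 0" "t = w $ 2 / w $ 1" by (elim exE conjE)
    then have "t \<in> closure I" using w(1) unfolding A_def U_def by auto
    then have "t \<in> I" using I(5) t(1) by blast
    then show "x \<in> X ` I" using t(2) by blast
  qed
  moreover have "X ` I \<subseteq> S" using I(1) SX by blast
  ultimately have "S = affine_param \<Phi> 1 ` I" unfolding X_def by blast
  moreover have "\<forall>t\<in>I. \<Phi> None 1 t \<noteq> 0" using I(1) unfolding T_def by blast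
  ultimately show ?thesis using that[OF I(3,4)] by blast
qed

section \<open>Intervals and arcs as regular images of the plane\<close>

text \<open>The quotient is kept as a pair, because (\<open>\<alpha>\<close>,
  \<open>\<beta>\<close>) is substituted directly into binary forms as homogeneous coordinates of
  the parameter.\<close>

definition plane_image :: "real set \<Rightarrow> bool" where
  "plane_image I \<longleftrightarrow> (\<exists>\<alpha> \<beta>. polyfun {..<2} \<alpha> \<and> polyfun {..<2} \<beta> \<and> (\<forall>x\<in>Rn 2. \<alpha> x \<noteq> 0) \<and>
     I = (\<lambda>x. \<beta> x / \<alpha> x) ` Rn 2)"

lemma plane_imageI:
  assumes "polyfun {..<2} \<alpha>" "polyfun {..<2} \<beta>" "\<And>x. x \<in> Rn 2 \<Longrightarrow> \<alpha> x \<noteq> 0"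
    "\<And>x. x \<in> Rn 2 \<Longrightarrow> \<beta> x / \<alpha> x \<in> I" "\<And>t. t \<in> I \<Longrightarrow> \<exists>x\<in>Rn 2. \<beta> x / \<alpha> x = t"
  shows "plane_image I"
proof -
  have "I = (\<lambda>x. \<beta> x / \<alpha> x) ` Rn 2"
  proof (intro equalityI subsetI)
    fix t assume "t \<in> I"
    from assms(5)[OF this] obtain x where "x \<in> Rn 2" "\<beta> x / \<alpha> x = t" by (elim bexE)
    then show "t \<in> (\<lambda>x. \<beta> x / \<alpha> x) ` Rn 2" by blast
  next
    fix t assume "t \<in> (\<lambda>x. \<beta> x / \<alpha> x) ` Rn 2"
    then show "t \<in> I" using assms(4) by (elim imageE) simp
  qed
  with assms(1-3) show ?thesis unfolding plane_image_def
    by - (rule exI[of _ \<alpha>], rule exI[of _ \<beta>], intro conjI ballI)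
qed

lemma plane_imageE:
  assumes "plane_image I"
  obtains \<alpha> \<beta> where "polyfun {..<2} \<alpha>" "polyfun {..<2} \<beta>" "\<forall>x\<in>Rn 2. \<alpha> x \<noteq> 0" "I = (\<lambda>x. \<beta> x / \<alpha> x) ` Rn 2"
  using assms unfolding plane_image_def by (elim exE conjE)

lemma Rn2_point: "(\<lambda>i. if i = 0 then a else if i = 1 then b else 0) \<in> Rn 2"
  by (simp add: Rn_def)

lemma polyfun_plane: "polyfun {..<2} (\<lambda>x :: nat \<Rightarrow> real. x 0)" "polyfun {..<2} (\<lambda>x :: nat \<Rightarrow> real. x 1)"
  by (rule polyfun_var, simp)+

lemma plane_image_map:
  assumes "polyfun {..<2} \<alpha>" "polyfun {..<2} \<beta>" "\<And>x. x \<in> Rn 2 \<Longrightarrow> \<alpha> x \<noteq> 0"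
    "I = r ` Rn 2" "\<And>x. x \<in> Rn 2 \<Longrightarrow> \<beta> x / \<alpha> x = f (r x)"
  shows "plane_image (f ` I)"
proof -
  have "f ` I = (\<lambda>x. \<beta> x / \<alpha> x) ` Rn 2"
    unfolding assms(4) image_image by (intro image_cong refl assms(5)[symmetric])
  with assms(1-3) show ?thesis unfolding plane_image_def
    by - (rule exI[of _ \<alpha>], rule exI[of _ \<beta>], intro conjI ballI)
qed

lemma plane_image_affine:
  assumes "plane_image I"
  shows "plane_image ((\<lambda>t. c + m * t) ` I)"
proof -
  obtain \<alpha> \<beta> where ab: "polyfun {..<2} \<alpha>" "polyfun {..<2} \<beta>" "\<forall>x\<in>Rn 2. \<alpha> x \<noteq> 0" "I = (\<lambda>x. \<beta> x / \<alpha> x) ` Rn 2"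
    using assms by (rule plane_imageE)
  show ?thesis
  proof (rule plane_image_map[OF ab(1) _ _ ab(4)])
    show "polyfun {..<2} (\<lambda>x. c * \<alpha> x + m * \<beta> x)" by (intro polyfun_add polyfun_mult polyfun_const ab)
    show "\<alpha> x \<noteq> 0" "(c * \<alpha> x + m * \<beta> x) / \<alpha> x = c + m * (\<beta> x / \<alpha> x)" if "x \<in> Rn 2" for x
      using ab(3) that by (simp_all add: add_divide_distrib)
  qed
qed

lemma plane_image_squash:
  assumes "plane_image I" "I \<subseteq> {0..}"
  shows "plane_image ((\<lambda>t. t / (1 + t)) ` I)"
proof -
  obtain \<alpha> \<beta> where ab: "polyfun {..<2} \<alpha>" "polyfun {..<2} \<beta>" "\<forall>x\<in>Rn 2. \<alpha> x \<noteq> 0" "I = (\<lambda>x. \<beta> x / \<alpha> x) ` Rn 2"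
    using assms(1) by (rule plane_imageE)
  show ?thesis
  proof (rule plane_image_map[OF _ ab(2) _ ab(4)])
    show "polyfun {..<2} (\<lambda>x. \<alpha> x + \<beta> x)" by (intro polyfun_add ab)
    fix x :: "nat \<Rightarrow> real" assume x: "x \<in> Rn 2"
    have nz: "\<alpha> x \<noteq> 0" using ab(3) x by blast
    then have sum: "\<alpha> x + \<beta> x = \<alpha> x * (1 + \<beta> x / \<alpha> x)" by (simp add: distrib_left)
    have "\<beta> x / \<alpha> x \<in> I" using ab(4) x by blast
    then have "1 + \<beta> x / \<alpha> x > 0" using assms(2) by auto
    then show "\<alpha> x + \<beta> x \<noteq> 0" unfolding sum using nz by simp
    show "\<beta> x / (\<alpha> x + \<beta> x) = (\<beta> x / \<alpha> x) / (1 + \<beta> x / \<alpha> x)"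
      unfolding sum using nz by simp
  qed
qed

lemma plane_image_UNIV: "plane_image UNIV"
proof (rule plane_imageI[where \<alpha> = "\<lambda>_. 1" and \<beta> = "\<lambda>x. x 0"])
  show "\<exists>x\<in>Rn 2. x 0 / 1 = t" for t :: real by (rule bexI[OF _ Rn2_point[of t 0]]) simp
qed (use polyfun_plane in auto)

lemma plane_image_Ici: "plane_image {0..}"
proof (rule plane_imageI[where \<alpha> = "\<lambda>_. 1" and \<beta> = "\<lambda>x. x 0 ^ 2"])
  show "\<exists>x\<in>Rn 2. (x 0)\<^sup>2 / 1 = t" if "t \<in> {0..}" for t :: real
    by (rule bexI[OF _ Rn2_point[of "sqrt t" 0]]) (use that in simp)
qed (use polyfun_plane in \<open>auto intro: polyfun_power\<close>)

text \<open>The sum of squares never vanishes, since x = 0 makes the first square 1; along the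
  hyperbola x y = 1 it equals x^2 and comes arbitrarily close to 0.\<close>

lemma plane_image_Ioi: "plane_image {0<..}"
proof (rule plane_imageI[where \<alpha> = "\<lambda>_. 1" and \<beta> = "\<lambda>x. (x 0 * x 1 - 1)\<^sup>2 + x 0 ^ 2"])
  show "\<exists>x\<in>Rn 2. ((x 0 * x 1 - 1)\<^sup>2 + (x 0)\<^sup>2) / 1 = t" if "t \<in> {0<..}" for t :: real
    by (rule bexI[OF _ Rn2_point[of "sqrt t" "1 / sqrt t"]]) (use that in simp)
  show "((x 0 * x 1 - 1)\<^sup>2 + (x 0)\<^sup>2) / 1 \<in> {0<..}" for x :: "nat \<Rightarrow> real"
    by (cases "x 0 = 0") (simp_all add: add_nonneg_pos)
  show "polyfun {..<2} (\<lambda>x :: nat \<Rightarrow> real. (x 0 * x 1 - 1)\<^sup>2 + (x 0)\<^sup>2)"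
    by (intro polyfun_add polyfun_power polyfun_diff polyfun_mult polyfun_const polyfun_plane)
qed auto

lemma plane_image_Icc: "plane_image {- 1 / 2..1 / 2}"
proof (rule plane_imageI[where \<alpha> = "\<lambda>x. 1 + x 0 ^ 2" and \<beta> = "\<lambda>x. x 0"])
  have pos: "1 + (x 0)\<^sup>2 > 0" for x :: "nat \<Rightarrow> real" by (simp add: add_pos_nonneg)
  then show "1 + (x 0)\<^sup>2 \<noteq> 0" for x :: "nat \<Rightarrow> real" by (metis less_irrefl)
  show "x 0 / (1 + (x 0)\<^sup>2) \<in> {- 1 / 2..1 / 2}" for x :: "nat \<Rightarrow> real"
  proof -
    have "(x 0 - 1)\<^sup>2 \<ge> 0" "(x 0 + 1)\<^sup>2 \<ge> 0" by simp_all
    then have "2 * x 0 \<le> 1 + (x 0)\<^sup>2" "- (1 + (x 0)\<^sup>2) \<le> 2 * x 0" by (simp_all add: power2_eq_square algebra_simps)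
    then have "- 1 / 2 * (1 + (x 0)\<^sup>2) \<le> x 0" "x 0 \<le> 1 / 2 * (1 + (x 0)\<^sup>2)" by (simp_all add: field_simps)
    then show ?thesis unfolding atLeastAtMost_iff pos_divide_le_eq[OF pos] pos_le_divide_eq[OF pos] by (rule conjI)
  qed
  show "\<exists>x\<in>Rn 2. x 0 / (1 + (x 0)\<^sup>2) = y" if y: "y \<in> {- 1 / 2..1 / 2}" for y :: real
  proof -
    define s where "s = sqrt (1 - 4 * y\<^sup>2)"
    \<comment> \<open>The smaller root (1 - s) / (2 y) of y u^2 - u + y = 0, rewritten so that it
      also makes sense at y = 0.\<close>
    define u where "u = 2 * y / (1 + s)"
    have "\<bar>y\<bar> \<le> 1 / 2" using y by auto
    then have "y\<^sup>2 \<le> (1 / 2)\<^sup>2" by (metis abs_le_square_iff abs_of_nonneg zero_le_divide_1_iff zero_le_numeral)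
    then have s: "s \<ge> 0" "s\<^sup>2 = 1 - 4 * y\<^sup>2" by (simp_all add: s_def power_divide)
    have "1 + u\<^sup>2 = ((1 + s)\<^sup>2 + 4 * y\<^sup>2) / (1 + s)\<^sup>2"
      using s(1) by (simp add: u_def power_divide power_mult_distrib add_divide_distrib)
    also have "(1 + s)\<^sup>2 + 4 * y\<^sup>2 = 2 * (1 + s)" using s(2) by (simp add: power2_eq_square algebra_simps)
    also have "2 * (1 + s) / (1 + s)\<^sup>2 = 2 / (1 + s)"
      unfolding power2_eq_square by (rule nonzero_mult_divide_mult_cancel_right) (use s(1) in simp)
    finally have "u / (1 + u\<^sup>2) = y" using s(1) by (simp add: u_def)
    then show ?thesis by (intro bexI[OF _ Rn2_point[of u 0]]) simp
  qed
qed (intro polyfun_add polyfun_const polyfun_power polyfun_plane)+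

lemma affine_image:
  fixes m :: real
  assumes "m \<noteq> 0"
  shows "(\<lambda>t. c + m * t) ` I = {x. (x - c) / m \<in> I}"
proof (intro equalityI subsetI)
  fix x assume "x \<in> {x. (x - c) / m \<in> I}"
  moreover have "x = c + m * ((x - c) / m)" using assms by simp
  ultimately show "x \<in> (\<lambda>t. c + m * t) ` I" by blast
qed (use assms in auto)

lemma squash_image:
  fixes I :: "real set"
  assumes "I \<subseteq> {0..}"
  shows "(\<lambda>t. t / (1 + t)) ` I = {y. y < 1 \<and> y / (1 - y) \<in> I}"
proof (intro equalityI subsetI)
  fix y assume "y \<in> (\<lambda>t. t / (1 + t)) ` I"
  then obtain t where t: "t \<in> I" "y = t / (1 + t)" by blast
  then have "t \<ge> 0" using assms by auto
  then have "1 - y = 1 / (1 + t)" unfolding t(2) by (simp add: field_simps)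
  then have "y / (1 - y) = t" "1 - y > 0" unfolding t(2) using \<open>t \<ge> 0\<close> by simp_all
  then show "y \<in> {y. y < 1 \<and> y / (1 - y) \<in> I}" using t(1) by simp
next
  fix y assume "y \<in> {y. y < 1 \<and> y / (1 - y) \<in> I}"
  then have y: "y < 1" "y / (1 - y) \<in> I" by auto
  have "1 + y / (1 - y) = 1 / (1 - y)" using y(1) by (simp add: field_simps)
  then have "y = (y / (1 - y)) / (1 + y / (1 - y))" using y(1) by simp
  then show "y \<in> (\<lambda>t. t / (1 + t)) ` I" using y(2) by blast
qed

text \<open>Up to affine maps there are six infinite intervals: the line, the open and the closed
  half-line, and the open, half-open and closed bounded interval. The bounded ones that are not
  closed come from half-lines under t/(1 + t).\<close>

lemma plane_image_interval:
  fixes I :: "real set"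
  assumes con: "connected I" and inf: "infinite I"
  shows "plane_image I"
proof -
  have io: "plane_image {0<..<1}"
  proof -
    have "(\<lambda>t. t / (1 + t)) ` {0<..} = {0<..<1::real}"
      by (subst squash_image) (auto simp: zero_less_divide_iff)
    moreover have "{0<..} \<subseteq> {0 :: real..}" by auto
    ultimately show ?thesis using plane_image_squash[OF plane_image_Ioi] by metis
  qed
  have ico: "plane_image {0..<1}"
  proof -
    have "(\<lambda>t. t / (1 + t)) ` {0..} = {0..<1::real}"
      by (subst squash_image) (auto simp: zero_le_divide_iff)
    then show ?thesis using plane_image_squash[OF plane_image_Ici order.refl] by metis
  qed
  note aff = plane_image_affine
  have lt: "a < b" if "I \<subseteq> {a..b}" for a b
  proof (rule ccontr)
    assume "\<not> a < b"
    then have "{a..b} \<subseteq> {a}" by auto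
    then show False using inf that by (metis finite.emptyI finite_insert finite_subset)
  qed
  have "\<exists>a b. I = {} \<or> I = UNIV \<or> I = {..<b} \<or> I = {..b} \<or> I = {a<..} \<or> I = {a..} \<or>
    I = {a<..<b} \<or> I = {a<..b} \<or> I = {a..<b} \<or> I = {a..b}"
    by (rule interval_cases) (use connectedD_interval[OF con] in blast)
  then obtain a b where "I = {} \<or> I = UNIV \<or> I = {..<b} \<or> I = {..b} \<or> I = {a<..} \<or> I = {a..} \<or>
    I = {a<..<b} \<or> I = {a<..b} \<or> I = {a..<b} \<or> I = {a..b}" by (elim exE)
  then show ?thesis
  proof (elim disjE)
    assume "I = {}" then show ?thesis using inf by simp
  next
    assume "I = UNIV" then show ?thesis by (simp add: plane_image_UNIV)
  next
    assume "I = {..<b}"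
    then have "I = (\<lambda>t. b + -1 * t) ` {0<..}" by (subst affine_image) auto
    then show ?thesis by (simp only: aff[OF plane_image_Ioi])
  next
    assume "I = {..b}"
    then have "I = (\<lambda>t. b + -1 * t) ` {0..}" by (subst affine_image) auto
    then show ?thesis by (simp only: aff[OF plane_image_Ici])
  next
    assume "I = {a<..}"
    then have "I = (\<lambda>t. a + 1 * t) ` {0<..}" by (subst affine_image) auto
    then show ?thesis by (simp only: aff[OF plane_image_Ioi])
  next
    assume "I = {a..}"
    then have "I = (\<lambda>t. a + 1 * t) ` {0..}" by (subst affine_image) auto
    then show ?thesis by (simp only: aff[OF plane_image_Ici])
  next
    assume I: "I = {a<..<b}"
    then have "a < b" by (intro lt) auto
    then have "I = (\<lambda>t. a + (b - a) * t) ` {0<..<1}"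
      unfolding I by (subst affine_image) (auto simp: zero_less_divide_iff divide_less_eq)
    then show ?thesis by (simp only: aff[OF io])
  next
    assume I: "I = {a<..b}"
    then have "a < b" by (intro lt) auto
    \<comment> \<open>The slope a - b is negative, so the closed end 0 goes to b.\<close>
    then have "I = (\<lambda>t. b + (a - b) * t) ` {0..<1}"
      unfolding I by (subst affine_image) (auto simp: zero_le_divide_iff divide_less_eq)
    then show ?thesis by (simp only: aff[OF ico])
  next
    assume I: "I = {a..<b}"
    then have "a < b" by (intro lt) auto
    then have "I = (\<lambda>t. a + (b - a) * t) ` {0..<1}"
      unfolding I by (subst affine_image) (auto simp: zero_le_divide_iff divide_less_eq)
    then show ?thesis by (simp only: aff[OF ico])
  next
    assume I: "I = {a..b}"
    then have ab: "a < b" by (intro lt) auto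
    have "I = (\<lambda>t. (a + b) / 2 + (b - a) * t) ` {- 1 / 2..1 / 2}"
      unfolding I using ab by (subst affine_image) (auto simp: field_simps)
    then show ?thesis by (simp only: aff[OF plane_image_Icc])
  qed
qed

lemma regular_map_affine_param:
  fixes \<Phi> :: "'m::finite option \<Rightarrow> real \<Rightarrow> real \<Rightarrow> real"
  assumes par: "hom_param d \<Phi>" and ab: "polyfun {..<n} \<alpha>" "polyfun {..<n} \<beta>"
    and nz: "\<And>x. x \<in> Rn n \<Longrightarrow> \<Phi> None (\<alpha> x) (\<beta> x) \<noteq> 0"
  shows "regular_map n (\<lambda>x. affine_param \<Phi> (\<alpha> x) (\<beta> x))"
proof -
  have pf: "polyfun {..<n} (\<lambda>x. \<Phi> k (\<alpha> x) (\<beta> x))" for k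
  proof -
    have "polyfun UNIV (\<lambda>x :: 2 \<Rightarrow> real. \<Phi> k (x 1) (x 2))"
      using par unfolding hom_param_def bform_def by (intro form_imp_polyfun) blast
    moreover have "polyfun {..<n} (\<lambda>x. if v = (1 :: 2) then \<alpha> x else \<beta> x)" for v
      using ab by (cases "v = 1") simp_all
    ultimately have "polyfun {..<n} (\<lambda>x. \<Phi> k (if (1 :: 2) = 1 then \<alpha> x else \<beta> x) (if (2 :: 2) = 1 then \<alpha> x else \<beta> x))"
      by (rule polyfun_compose[where g = "\<lambda>x v. if v = (1 :: 2) then \<alpha> x else \<beta> x"])
    then show ?thesis by simp
  qed
  obtain h where h: "poly_vars h \<subseteq> {..<n}" "\<forall>x. \<Phi> None (\<alpha> x) (\<beta> x) = poly_eval h x"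
    using pf[of None] unfolding polyfun_def by (elim exE conjE)
  show ?thesis unfolding regular_map_def
  proof
    fix i
    obtain g where g: "poly_vars g \<subseteq> {..<n}" "\<forall>x. \<Phi> (Some i) (\<alpha> x) (\<beta> x) = poly_eval g x"
      using pf[of "Some i"] unfolding polyfun_def by (elim exE conjE)
    show "\<exists>g h. poly_vars g \<subseteq> {..<n} \<and> poly_vars h \<subseteq> {..<n} \<and> (\<forall>x\<in>Rn n. poly_eval h x \<noteq> 0) \<and>
      (\<forall>x\<in>Rn n. affine_param \<Phi> (\<alpha> x) (\<beta> x) $ i = poly_eval g x / poly_eval h x)"
    proof (rule exI[of _ g], rule exI[of _ h], intro conjI ballI g(1) h(1))
      fix x assume x: "x \<in> Rn n"
      show "poly_eval h x \<noteq> 0" using nz[OF x] unfolding h(2)[rule_format] .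
      show "affine_param \<Phi> (\<alpha> x) (\<beta> x) $ i = poly_eval g x / poly_eval h x"
        unfolding g(2)[rule_format, symmetric] h(2)[rule_format, symmetric] by (simp add: affine_param_def)
    qed
  qed
qed

lemma affine_param_scale:
  assumes par: "hom_param d \<Phi>" and "a \<noteq> 0"
  shows "\<Phi> None a b \<noteq> 0 \<longleftrightarrow> \<Phi> None 1 (b / a) \<noteq> 0" "affine_param \<Phi> a b = affine_param \<Phi> 1 (b / a)"
proof -
  have "\<Phi> k a b = a ^ d * \<Phi> k 1 (b / a)" for k
    using bform_scale[of d "\<Phi> k" a 1 "b / a"] par assms(2) unfolding hom_param_def by simp
  then show "\<Phi> None a b \<noteq> 0 \<longleftrightarrow> \<Phi> None 1 (b / a) \<noteq> 0" "affine_param \<Phi> a b = affine_param \<Phi> 1 (b / a)"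
    using assms(2) by (simp_all add: affine_param_def)
qed

lemma regular_image_arc:
  fixes S :: "(real ^ 'm) set"
  assumes par: "hom_param d \<Phi>" and I: "connected I" "infinite I" "\<forall>t\<in>I. \<Phi> None 1 t \<noteq> 0"
    and S: "S = affine_param \<Phi> 1 ` I"
  shows "regular_image 2 S"
proof -
  obtain \<alpha> \<beta> where ab: "polyfun {..<2} \<alpha>" "polyfun {..<2} \<beta>" "\<forall>x\<in>Rn 2. \<alpha> x \<noteq> 0" "I = (\<lambda>x. \<beta> x / \<alpha> x) ` Rn 2"
    using plane_image_interval[OF I(1,2)] by (rule plane_imageE)
  have "regular_map 2 (\<lambda>x. affine_param \<Phi> (\<alpha> x) (\<beta> x))"
  proof (rule regular_map_affine_param[OF par ab(1,2)])
    show "\<Phi> None (\<alpha> x) (\<beta> x) \<noteq> 0" if "x \<in> Rn 2" for x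
      using affine_param_scale(1)[OF par, of "\<alpha> x" "\<beta> x"] ab(3,4) I(3) that by blast
  qed
  moreover have "S = (\<lambda>x. affine_param \<Phi> (\<alpha> x) (\<beta> x)) ` Rn 2"
    unfolding S ab(4) image_image
  proof (rule image_cong[OF refl])
    fix x assume "x \<in> Rn 2"
    then have "\<alpha> x \<noteq> 0" using ab(3) by blast
    then show "affine_param \<Phi> 1 (\<beta> x / \<alpha> x) = affine_param \<Phi> (\<alpha> x) (\<beta> x)"
      by (rule affine_param_scale(2)[OF par, symmetric])
  qed
  ultimately show ?thesis unfolding regular_image_def by blast
qed

text \<open>If no parameter is missing, the circle \<open>(1 - s\<^sup>2, 2s)\<close> covers the whole projective line.\<close>

lemma regular_image_full_curve:
  fixes S :: "(real ^ 'm) set"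
  assumes par: "hom_param d \<Phi>"
    and onto: "\<And>x. x \<in> S \<Longrightarrow> \<exists>a b. (a, b) \<noteq> (0, 0) \<and> affine_to_proj x = param_point \<Phi> a b"
    and full: "\<And>a b. (a, b) \<noteq> (0, 0) \<Longrightarrow> \<exists>x\<in>S. affine_to_proj x = param_point \<Phi> a b"
  shows "regular_image 2 S"
proof -
  define \<alpha> \<beta> where "\<alpha> x = 1 - (x 0)\<^sup>2" and "\<beta> x = 2 * x 0" for x :: "nat \<Rightarrow> real"
  have nz: "(\<alpha> x, \<beta> x) \<noteq> (0, 0)" for x by (auto simp: \<alpha>_def \<beta>_def)
  have val: "\<Phi> None (\<alpha> x) (\<beta> x) \<noteq> 0 \<and> affine_param \<Phi> (\<alpha> x) (\<beta> x) \<in> S" for x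
  proof -
    obtain s where s: "s \<in> S" "affine_to_proj s = param_point \<Phi> (\<alpha> x) (\<beta> x)" using full[OF nz[of x]] by blast
    then have "\<Phi> None (\<alpha> x) (\<beta> x) \<noteq> 0 \<and> s = affine_param \<Phi> (\<alpha> x) (\<beta> x)"
      using affine_to_proj_eq_param_iff[OF par nz[of x], of s] by simp
    then show ?thesis using s(1) by simp
  qed
  have "regular_map 2 (\<lambda>x. affine_param \<Phi> (\<alpha> x) (\<beta> x))"
  proof (rule regular_map_affine_param[OF par])
    show "polyfun {..<2} \<alpha>" "polyfun {..<2} \<beta>" unfolding \<alpha>_def[abs_def] \<beta>_def[abs_def]
      by (intro polyfun_diff polyfun_const polyfun_power polyfun_mult polyfun_plane)+
  qed (use val in blast)
  moreover have "S = (\<lambda>x. affine_param \<Phi> (\<alpha> x) (\<beta> x)) ` Rn 2"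
  proof (intro equalityI subsetI)
    fix s assume "s \<in> S"
    from onto[OF this] obtain a b where ab: "(a, b) \<noteq> (0, 0)" "affine_to_proj s = param_point \<Phi> a b" by (elim exE conjE)
    have "\<exists>u. (1 - u\<^sup>2) * b = 2 * u * a"
    proof (cases "b = 0")
      case True
      then show ?thesis by (intro exI[of _ 0]) simp
    next
      case False
      \<comment> \<open>The half-angle substitution: for the angle of (a, b), the number (r - a)/b
        is the tangent of half of it.\<close>
      define r where "r = sqrt (a\<^sup>2 + b\<^sup>2)"
      have r: "r\<^sup>2 = a\<^sup>2 + b\<^sup>2" by (simp add: r_def)
      have "(1 - ((r - a) / b)\<^sup>2) * b = 2 * ((r - a) / b) * a"
      proof -
        have "(b\<^sup>2 - (r - a)\<^sup>2) / b = 2 * (r - a) * a / b"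
          using r by (simp add: power2_eq_square algebra_simps)
        moreover have "(1 - ((r - a) / b)\<^sup>2) * b = (b\<^sup>2 - (r - a)\<^sup>2) / b"
          using False by (simp add: power_divide field_simps power2_eq_square)
        ultimately show ?thesis by simp
      qed
      then show ?thesis by blast
    qed
    then obtain u where u: "(1 - u\<^sup>2) * b = 2 * u * a" by blast
    define x where "x = (\<lambda>i::nat. if i = 0 then u else if i = 1 then 0 else 0 :: real)"
    have x: "x \<in> Rn 2" unfolding x_def by (rule Rn2_point)
    have "abs_proj (v2 a b) = abs_proj (v2 (\<alpha> x) (\<beta> x))"
      by (subst abs_proj_v2_eq_iff[OF ab(1) nz]) (use u in \<open>simp add: \<alpha>_def \<beta>_def x_def mult.commute\<close>)
    then have "param_point \<Phi> a b = param_point \<Phi> (\<alpha> x) (\<beta> x)" by (rule param_point_eq[OF par ab(1) _ nz])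
    then have "s = affine_param \<Phi> (\<alpha> x) (\<beta> x)"
      using ab(2) affine_to_proj_eq_param_iff[OF par nz] by metis
    then show "s \<in> (\<lambda>x. affine_param \<Phi> (\<alpha> x) (\<beta> x)) ` Rn 2" using x by blast
  qed (use val in blast)
  ultimately show ?thesis unfolding regular_image_def by blast
qed

text \<open>Only finitely many points of the closure of S are outside the image, and the affine
  points of the image form a closed set.\<close>

lemma subset_of_param:
  fixes S :: "(real ^ 'm) set"
  assumes par: "hom_param d \<Phi>" and irr: "semialgebraic_irreducible S" and inf: "infinite S"
    and fin: "finite (Cl_zar_proj S - range (param_map \<Phi>))" and x: "x \<in> S"
  shows "\<exists>a b. (a, b) \<noteq> (0, 0) \<and> affine_to_proj x = param_point \<Phi> a b"
proof -
  define K where "K = {x. \<exists>w\<in>sphere (0 :: real ^ 2) 1. affine_to_proj x = param_point \<Phi> (w $ 1) (w $ 2)}"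
  have "closed K" unfolding K_def by (rule closed_affine_param_image[OF par]) auto
  moreover have "finite (S - K)"
  proof (rule finite_imageD)
    show "inj_on affine_to_proj (S - K)" by (rule inj_onI) (simp add: affine_to_proj_inj)
    have "affine_to_proj y \<in> Cl_zar_proj S - range (param_map \<Phi>)" if y: "y \<in> S - K" for y
    proof
      show "affine_to_proj y \<in> Cl_zar_proj S"
        unfolding Cl_zar_proj_def by (rule hull_inc) (use y in blast)
      show "affine_to_proj y \<notin> range (param_map \<Phi>)"
      proof
        assume "affine_to_proj y \<in> range (param_map \<Phi>)"
        then obtain z where z: "affine_to_proj y = param_map \<Phi> z" by blast
        obtain w where w: "norm w = 1" "z = abs_proj w" by (rule norm_one_rep)
        have "param_map \<Phi> (abs_proj (v2 (w $ 1) (w $ 2))) = param_point \<Phi> (w $ 1) (w $ 2)"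
          by (rule param_map_abs_proj[OF par circle_nonzero[OF w(1)]])
        then have "affine_to_proj y = param_point \<Phi> (w $ 1) (w $ 2)" using z w(2) by simp
        then have "y \<in> K" unfolding K_def using w(1) by (intro CollectI bexI[of _ w]) simp_all
        then show False using y by blast
      qed
    qed
    then have "affine_to_proj ` (S - K) \<subseteq> Cl_zar_proj S - range (param_map \<Phi>)" by (rule image_subsetI)
    then show "finite (affine_to_proj ` (S - K))" using fin by (rule finite_subset)
  qed
  ultimately have "x \<in> K" using irreducible_subset_closed[OF irr inf] x by blast
  then obtain w where w: "w \<in> sphere (0 :: real ^ 2) 1" "affine_to_proj x = param_point \<Phi> (w $ 1) (w $ 2)"
    unfolding K_def by blast
  have "(w $ 1, w $ 2) \<noteq> (0, 0)" using w(1) by (intro circle_nonzero) simp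
  then show ?thesis using w(2) by blast
qed

theorem rational_arc_regular_image:
  fixes S :: "(real ^ 'm) set"
  assumes sa: "semialgebraic S" and irr: "semialgebraic_irreducible S" and inf: "infinite S"
    and rat: "rational_curve (Cl_zar_proj S)"
  shows "regular_image 2 S"
proof -
  obtain d \<Phi> e G H where rp: "rat_param d \<Phi> e G H" and fin: "finite (Cl_zar_proj S - range (param_map \<Phi>))"
    using rat by (rule rational_curve_param)
  have par: "hom_param d \<Phi>" using rp unfolding rat_param_def by blast
  note onto = subset_of_param[OF par irr inf fin]
  show ?thesis
  proof (cases "\<forall>a b. (a, b) \<noteq> (0, 0) \<longrightarrow> (\<exists>x\<in>S. affine_to_proj x = param_point \<Phi> a b)")
    case True
    then show ?thesis using regular_image_full_curve[OF par onto] by blast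
  next
    case False
    then obtain p q where pq: "(p, q) \<noteq> (0, 0)" "\<And>x. x \<in> S \<Longrightarrow> affine_to_proj x \<noteq> param_point \<Phi> p q" by blast
    \<comment> \<open>The linear map sends (0, 1) to the missing parameter (p, q), and its
      determinant p^2 + q^2 is nonzero.\<close>
    have det: "q * q - p * (- p) \<noteq> 0" using pq(1) by (simp add: sum_squares_eq_zero_iff) blast
    obtain G' H' where rp': "rat_param d (\<lambda>k a b. \<Phi> k (q * a + p * b) (- p * a + q * b)) e G' H'"
      by (rule rat_param_moebius[OF rp det])
    define \<Psi> where "\<Psi> k a b = \<Phi> k (q * a + p * b) (- p * a + q * b)" for k a b
    have rp'': "rat_param d \<Psi> e G' H'" using rp' unfolding \<Psi>_def[abs_def] .
    have onto': "\<exists>a b. (a, b) \<noteq> (0, 0) \<and> affine_to_proj x = param_point \<Psi> a b" if "x \<in> S" for x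
    proof -
      from onto[OF that] obtain a b where ab: "(a, b) \<noteq> (0, 0)" "affine_to_proj x = param_point \<Phi> a b" by (elim exE conjE)
      define D where "D = q * q + p * p"
      have D: "D \<noteq> 0" using det by (simp add: D_def)
      define a' b' where "a' = (q * a - p * b) / D" and "b' = (p * a + q * b) / D"
      have "q * a' + p * b' = D * a / D" "- p * a' + q * b' = D * b / D"
        unfolding a'_def b'_def by (simp_all add: add_divide_distrib[symmetric] diff_divide_distrib[symmetric] D_def algebra_simps)
      then have eqs: "q * a' + p * b' = a" "- p * a' + q * b' = b" using D by simp_all
      then have "param_point \<Psi> a' b' = param_point \<Phi> a b" unfolding param_point_def \<Psi>_def by simp
      moreover have "(a', b') \<noteq> (0, 0)" using eqs ab(1) by auto
      ultimately show ?thesis using ab(2) by metis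
    qed
    have out: "affine_to_proj x \<noteq> param_point \<Psi> 0 1" if "x \<in> S" for x
      using pq(2)[OF that] by (simp add: param_point_def \<Psi>_def)
    obtain I where I: "connected I" "infinite I" "\<forall>t\<in>I. \<Psi> None 1 t \<noteq> 0" "S = affine_param \<Psi> 1 ` I"
      by (rule param_interval[OF rp'' sa irr inf onto' out])
    have "hom_param d \<Psi>" using rp'' unfolding rat_param_def by blast
    then show ?thesis by (rule regular_image_arc[OF _ I])
  qed
qed

theorem theorem1p3:
  fixes S :: "(real ^ 'm) set"
  assumes "semialgebraic S" and "dim_affine S = 1"
  shows "((\<exists>n\<ge>1. regular_image n S) \<longleftrightarrow>
            semialgebraic_irreducible S \<and> rational_curve (Cl_zar_proj S)) \<and>
         ((\<exists>n\<ge>1. regular_image n S) \<longrightarrow> r_inv S \<le> 2)"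
proof -
  have inf: "infinite S" by (rule dim_affine_infinite[OF assms(2)])
  have fwd: "semialgebraic_irreducible S \<and> rational_curve (Cl_zar_proj S)" if "\<exists>n\<ge>1. regular_image n S"
    using that regular_image_irreducible regular_image_rational_curve[OF _ assms(2)] by blast
  have bwd: "regular_image 2 S" if "semialgebraic_irreducible S \<and> rational_curve (Cl_zar_proj S)"
    using that rational_arc_regular_image[OF assms(1) _ inf] by blast
  have "r_inv S \<le> 2" if "\<exists>n\<ge>1. regular_image n S"
  proof -
    have "regular_image 2 S" using bwd[OF fwd[OF that]] .
    then have "enat 2 \<in> {enat r | r. 1 \<le> r \<and> regular_image r S}" by auto
    then have "r_inv S \<le> enat 2" unfolding r_inv_def by (rule Inf_lower)
    then show ?thesis by (simp add: numeral_eq_enat)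
  qed
  moreover have "\<exists>n\<ge>1. regular_image n S" if "semialgebraic_irreducible S \<and> rational_curve (Cl_zar_proj S)"
    using bwd[OF that] by (intro exI[of _ 2]) simp
  ultimately show ?thesis using fwd by blast
qed

end
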